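(* Fix $\delta\in(0,1)$. Assume (A1)–(A4) below, $2k\le\min\{d,T\}$, $n_1\gg\rho^4\big(d+\log\frac{T}{\delta}\big)$, $n_2\gg\rho^4\big(k+\log\frac1\delta\big)$ and $c\,n_1\ge n_2$, where $c$ is the constant of (A2). Let $\kappa=\frac{\max_{t\in[T]}\lambda_{\max}(\Sigma_t)}{\min_{t\in[T]}\lambda_{\min}(\Sigma_t)}$. Then with probability at least $1-\delta$ over the samples, $$\mathbb{E}_{{\bm w}^*_{T+1}\sim\nu}\big[\mathrm{ER}(\hat B,\hat{\bm w}_{T+1})\big]\lesssim \sigma^2\left(\frac{kd\log(\kappa n_1)}{c\,n_1T}+\frac{k+\log\frac1\delta}{n_2}\right).$$
   Context: Setting. Let $d,k,T,n_1,n_2$ be positive integers. For $t\in[T+1]$, $p_t$ is a distribution on $\mathbb{R}^d$ with mean $0$ and covariance $\Sigma_t=\mathbb{E}_{{\bm x}\sim p_t}[{\bm x}{\bm x}^\top]$, positive definite for $t\in[T]$. A sample ${\bm x}\sim p_t$ can be written ${\bm x}=\Sigma_t^{1/2}\bar{\bm x}$ with $\bar{\bm x}\sim\bar p_t$, where $\bar p_t$ has mean $0$ and covariance $I$. There are a ground-truth $B^*\in\mathbb{R}^{d\times k}$ and vectors ${\bm w}^*_t\in\mathbb{R}^k$ with $\|{\bm w}^*_t\|$ between two fixed positive absolute constants. A sample of task $t$ is $({\bm x},y)$ with ${\bm x}\sim p_t$, $y=({\bm w}_t^* )^\top (B^* )^\top{\bm x}+z$, and $z\sim\mathcal N(0,\sigma^2)$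 independent of ${\bm x}$. For each source task $t\in[T]$ there are $n_1$ i.i.d. samples, stacked as $X_t\in\mathbb{R}^{n_1\times d}$ and ${\bm y}_t\in\mathbb{R}^{n_1}$. The target task $T+1$ has $n_2$ i.i.d. samples $X_{T+1}\in\mathbb{R}^{n_2\times d}$ and ${\bm y}_{T+1}\in\mathbb{R}^{n_2}$. All samples are independent. Write $W^*=[{\bm w}_1^*,\dots,{\bm w}_T^*]\in\mathbb{R}^{k\times T}$. Estimators. Let $$(\hat B,\hat W)\in\arg\min_{B\in\mathbb{R}^{d\times k},\,W=[{\bm w}_1,\dots,{\bm w}_T]\in\mathbb{R}^{k\times T}}\frac{1}{2n_1T}\sum_{t=1}^T\|{\bm y}_t-X_tB{\bm w}_t\|^2,$$ $$\hat{\bm w}_{T+1}\in\arg\min_{{\bm w}\in\mathbb{R}^k}\frac1{2n_2}\|{\bm y}_{T+1}-X_{T+1}\hat B{\bm w}\|^2.$$ The excess risk is $\mathrm{ER}(\hat B,\hat{\bm w}_{T+1})=\frac12\mathbb{E}_{{\bm x}\sim p_{T+1}}\big[({\bm x}^\top(\hat B\hat{\bm w}_{T+1}-B^*{\bm w}^*_{T+1}))^2\big]$. Assumptions. - (A1) There is $\rho>0$ such that for every $t\in[T+1]$, $\bar{\bm x}\sim\bar p_t$ is $\rho^2$-subgaussian. A random vector ${\bm x}$ is $\rho^2$-subgaussian if for every unit vector ${\bm v}$ and every $s\in\mathbb{R}$, $\mathbb{E}[e^{s{\bm v}^\top({\bm x}-\mathbb{E}{\bm x})}]\le e^{s^2\rho^2/2}$.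 - (A2) There is $c>0$ with $\Sigma_t\succeq c\,\Sigma_{T+1}$ for all $t\in[T]$. - (A3) $\sigma_k^2(W^* )\ge c_0T/k$ for an absolute constant $c_0>0$, where $\sigma_i(\cdot)$ is the $i$-th largest singular value. - (A4) ${\bm w}^*_{T+1}\sim\nu$, and $\|\mathbb{E}_{{\bm w}\sim\nu}[{\bm w}{\bm w}^\top]\|_2\le C_0/k$ for an absolute constant $C_0$. Notation. $a\lesssim b$ means $a\le Cb$ for a constant $C$ depending only on the absolute constants above. $a\gg b$ means $a\ge Cb$ for a sufficiently large such constant $C$. *)

theory Defs
  imports "HOL-Probability.Probability" "Jordan_Normal_Form.Char_Poly"
begin

text \<open>Vectors in R^n are functions nat => real (only indices < n matter);
  an m x n matrix is a function nat => nat => real (only i < m, j < n matter).\<close>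

definition mv :: "nat \<Rightarrow> (nat \<Rightarrow> nat \<Rightarrow> real) \<Rightarrow> (nat \<Rightarrow> real) \<Rightarrow> nat \<Rightarrow> real" where
  "mv n A v = (\<lambda>i. \<Sum>j<n. A i j * v j)"

definition symm :: "nat \<Rightarrow> (nat \<Rightarrow> nat \<Rightarrow> real) \<Rightarrow> bool" where
  "symm n A \<longleftrightarrow> (\<forall>i<n. \<forall>j<n. A i j = A j i)"

definition psd :: "nat \<Rightarrow> (nat \<Rightarrow> nat \<Rightarrow> real) \<Rightarrow> bool" where
  "psd n A \<longleftrightarrow> symm n A \<and> (\<forall>v. 0 \<le> (\<Sum>i<n. \<Sum>j<n. v i * A i j * v j))"

definition pd :: "nat \<Rightarrow> (nat \<Rightarrow> nat \<Rightarrow> real) \<Rightarrow> bool" where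
  "pd n A \<longleftrightarrow> symm n A \<and>
     (\<forall>v. (\<exists>i<n. v i \<noteq> 0) \<longrightarrow> 0 < (\<Sum>i<n. \<Sum>j<n. v i * A i j * v j))"

definition loewner_ge :: "nat \<Rightarrow> (nat \<Rightarrow> nat \<Rightarrow> real) \<Rightarrow> (nat \<Rightarrow> nat \<Rightarrow> real) \<Rightarrow> bool" where
  "loewner_ge n A B \<longleftrightarrow> psd n (\<lambda>i j. A i j - B i j)"

definition msqrt :: "nat \<Rightarrow> (nat \<Rightarrow> nat \<Rightarrow> real) \<Rightarrow> (nat \<Rightarrow> nat \<Rightarrow> real)" where
  "msqrt n S = (THE R. psd n R \<and> (\<forall>i<n. \<forall>j<n. (\<Sum>l<n. R i l * R l j) = S i j)
                      \<and> (\<forall>i j. n \<le> i \<or> n \<le> j \<longrightarrow> R i j = 0))"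

definition eig_list :: "nat \<Rightarrow> (nat \<Rightarrow> nat \<Rightarrow> real) \<Rightarrow> real list" where
  "eig_list n A = (let p = char_poly (mat n n (\<lambda>(i, j). A i j)) in
     rev (sort (concat (map (\<lambda>r. replicate (order r p) r)
                              (sorted_list_of_set {r. poly p r = 0})))))"

definition lam_max :: "nat \<Rightarrow> (nat \<Rightarrow> nat \<Rightarrow> real) \<Rightarrow> real" where
  "lam_max n A = eig_list n A ! 0"

definition lam_min :: "nat \<Rightarrow> (nat \<Rightarrow> nat \<Rightarrow> real) \<Rightarrow> real" where
  "lam_min n A = eig_list n A ! (n - 1)"

definition sing_val :: "nat \<Rightarrow> nat \<Rightarrow> (nat \<Rightarrow> nat \<Rightarrow> real) \<Rightarrow> nat \<Rightarrow> real" where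
  "sing_val m n W i = sqrt (eig_list m (\<lambda>a b. \<Sum>l<n. W a l * W b l) ! (i - 1))"

definition spec_norm :: "nat \<Rightarrow> nat \<Rightarrow> (nat \<Rightarrow> nat \<Rightarrow> real) \<Rightarrow> real" where
  "spec_norm m n W = sing_val m n W 1"

definition vnorm :: "nat \<Rightarrow> (nat \<Rightarrow> real) \<Rightarrow> real" where
  "vnorm n v = sqrt (\<Sum>i<n. (v i)\<^sup>2)"

definition vec_space :: "nat \<Rightarrow> (nat \<Rightarrow> real) measure" where
  "vec_space n = (\<Pi>\<^sub>M i\<in>{..<n}. (borel :: real measure))"

definition mean_zero :: "nat \<Rightarrow> (nat \<Rightarrow> real) measure \<Rightarrow> bool" where
  "mean_zero n M \<longleftrightarrow> (\<forall>i<n. integrable M (\<lambda>x. x i) \<and> (\<integral>x. x i \<partial>M) = 0)"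

definition second_moment :: "(nat \<Rightarrow> real) measure \<Rightarrow> (nat \<Rightarrow> nat \<Rightarrow> real)" where
  "second_moment M = (\<lambda>i j. \<integral>x. x i * x j \<partial>M)"

definition has_cov :: "nat \<Rightarrow> (nat \<Rightarrow> real) measure \<Rightarrow> (nat \<Rightarrow> nat \<Rightarrow> real) \<Rightarrow> bool" where
  "has_cov n M S \<longleftrightarrow> (\<forall>i<n. \<forall>j<n. integrable M (\<lambda>x. x i * x j) \<and> second_moment M i j = S i j)"

definition subgaussian :: "nat \<Rightarrow> (nat \<Rightarrow> real) measure \<Rightarrow> real \<Rightarrow> bool" where
  "subgaussian n M r2 \<longleftrightarrow>
     (\<forall>v. vnorm n v = 1 \<longrightarrow> (\<forall>s::real.
        (\<integral>\<^sup>+x. ennreal (exp (s * (\<Sum>i<n. v i * (x i - (\<integral>y. y i \<partial>M))))) \<partial>M)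
          \<le> ennreal (exp (s\<^sup>2 * r2 / 2))))"

text \<open>Tasks are indexed 0..T-1 (sources) and T (target). A sample point \<omega> assigns to
  (t,i) the pair (x, z) of the i-th covariate of task t and its noise.\<close>

definition sample_idx :: "nat \<Rightarrow> nat \<Rightarrow> nat \<Rightarrow> (nat \<times> nat) set" where
  "sample_idx T n1 n2 = {(t, i). t < T \<and> i < n1} \<union> {(t, i). t = T \<and> i < n2}"

definition sample_space ::
  "nat \<Rightarrow> nat \<Rightarrow> nat \<Rightarrow> (nat \<Rightarrow> (nat \<Rightarrow> real) measure) \<Rightarrow> real
     \<Rightarrow> ((nat \<times> nat) \<Rightarrow> ((nat \<Rightarrow> real) \<times> real)) measure" where
  "sample_space T n1 n2 p \<sigma> =
     (\<Pi>\<^sub>M ti\<in>sample_idx T n1 n2. (p (fst ti) \<Otimes>\<^sub>M density lborel (normal_density 0 \<sigma>)))"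

definition lin :: "nat \<Rightarrow> nat \<Rightarrow> (nat \<Rightarrow> real) \<Rightarrow> (nat \<Rightarrow> nat \<Rightarrow> real) \<Rightarrow> (nat \<Rightarrow> real) \<Rightarrow> real" where
  "lin d k x B w = (\<Sum>l<d. x l * mv k B w l)"

definition resp :: "nat \<Rightarrow> nat \<Rightarrow> (nat \<Rightarrow> nat \<Rightarrow> real) \<Rightarrow> (nat \<Rightarrow> real)
    \<Rightarrow> ((nat \<times> nat) \<Rightarrow> ((nat \<Rightarrow> real) \<times> real)) \<Rightarrow> nat \<Rightarrow> nat \<Rightarrow> real" where
  "resp d k Bs ws \<omega> t i = lin d k (fst (\<omega> (t, i))) Bs ws + snd (\<omega> (t, i))"

definition source_loss :: "nat \<Rightarrow> nat \<Rightarrow> nat \<Rightarrow> nat \<Rightarrow> (nat \<Rightarrow> nat \<Rightarrow> real) \<Rightarrow> (nat \<Rightarrow> nat \<Rightarrow> real)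
    \<Rightarrow> ((nat \<times> nat) \<Rightarrow> ((nat \<Rightarrow> real) \<times> real)) \<Rightarrow> (nat \<Rightarrow> nat \<Rightarrow> real) \<Rightarrow> (nat \<Rightarrow> nat \<Rightarrow> real) \<Rightarrow> real" where
  "source_loss d k T n1 Bs Ws \<omega> B W =
     1 / (2 * real n1 * real T) *
       (\<Sum>t<T. \<Sum>i<n1. (resp d k Bs (\<lambda>j. Ws j t) \<omega> t i - lin d k (fst (\<omega> (t, i))) B (\<lambda>j. W j t))\<^sup>2)"

definition target_loss :: "nat \<Rightarrow> nat \<Rightarrow> nat \<Rightarrow> nat \<Rightarrow> (nat \<Rightarrow> nat \<Rightarrow> real) \<Rightarrow> (nat \<Rightarrow> real)
    \<Rightarrow> ((nat \<times> nat) \<Rightarrow> ((nat \<Rightarrow> real) \<times> real)) \<Rightarrow> (nat \<Rightarrow> nat \<Rightarrow> real) \<Rightarrow> (nat \<Rightarrow> real) \<Rightarrow> real" where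
  "target_loss d k T n2 Bs wT \<omega> Bh w =
     1 / (2 * real n2) * (\<Sum>i<n2. (resp d k Bs wT \<omega> T i - lin d k (fst (\<omega> (T, i))) Bh w)\<^sup>2)"

text \<open>ER = 1/2 E_{x ~ P} (x^T u)^2 with u = Bhat what - B* w*.\<close>
definition excess_risk :: "nat \<Rightarrow> (nat \<Rightarrow> real) measure \<Rightarrow> (nat \<Rightarrow> real) \<Rightarrow> real" where
  "excess_risk d P u = 1 / 2 * (\<integral>x. (\<Sum>i<d. x i * u i)\<^sup>2 \<partial>P)"

end

theory Submission imports Defs "Jordan_Normal_Form.Spectral_Radius" begin

text \<open>
Comparing \<open>(Bh, Wh)\<close> with the truth in the source loss bounds the in-sample prediction error by a linear
functional of the noise, evaluated at a difference of rank at most \<open>2k\<close>. The column space of that difference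
lies within a small distance of one of \<open>exp (O (k d log (\<kappa> n1)))\<close> points of a net, and for each of them the
noise energy in the corresponding \<open>2k\<close>-dimensional spaces has exponential moments. Since \<open>n1\<close> exceeds
\<open>d\<close>, the empirical covariances are comparable to the population ones, which turns this into a bound on
the sum of the source risks. By (A2) the part of \<open>Bs w\<close> not reached by the columns of \<open>Bh\<close>, measured in
the target covariance, is controlled in mean square over the columns \<open>w\<close> of \<open>Ws\<close>, hence by (A3) in all
directions \<open>w\<close> and by (A4) on average over \<open>\<nu>\<close>. On the target side, least squares in the fixed
\<open>2k\<close>-dimensional range of \<open>Bh\<close> and \<open>Bs\<close> adds a multiple of that residual and the noise term
\<open>\<sigma>\<^sup>2 (k + log (1 / \<delta>)) / n2\<close>.

The estimator is an arbitrary minimiser, so the target event cannot be conditioned on it directly. The fitted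
values of near-minimisers converge almost surely to those of every minimiser (the optimal gain over a
countable family is a convex function of each noise variable, hence differentiable almost everywhere), and
almost surely every minimiser \<open>Wh\<close> has full row rank, so that its fitted values determine the range of
\<open>Bh\<close>. Near-minimisers can be chosen measurably from a countable set, to which the independence of the
target sample applies.
\<close>

section \<open>Orthonormal systems and spectra of symmetric matrices\<close>

text \<open>Where the terms of the bound come from. The net resolution \<open>h\<close> satisfies
  \<open>h^2 * 2 k d \<kappa> n1 = 1\<close>. Rounding an orthonormal basis to the net then costs at
  most a fraction of order \<open>1 / n1\<close> of the prediction energy, so that even the crude
  comparison with the total noise energy, of order \<open>\<sigma>^2 T n1\<close>, contributes only
  order \<open>\<sigma>^2 T\<close>. The net has log-cardinality of order
  \<open>k d ln (\<kappa> n1)\<close>, which is the numerator of the first term. For a fixed net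
  point every source task still has \<open>2 k\<close> free coefficients, together
  \<open>2 k T\<close> degrees of freedom; divided by \<open>c n1 T\<close> they give order
  \<open>k / (c n1)\<close>, and \<open>c n1 \<ge> n2\<close> absorbs this into
  \<open>k / n2\<close>. The target event is uniform in the target parameter: it concerns the span
  of \<open>Bh\<close> and \<open>Bs\<close> for the design and the range of \<open>Bh\<close> for
  the noise, never one particular \<open>w\<close>. Hence one event serves the whole average over
  \<open>\<nu>\<close>, for an arbitrary choice of target minimisers \<open>wh\<close>.\<close>

definition ip :: "'i set \<Rightarrow> ('i \<Rightarrow> real) \<Rightarrow> ('i \<Rightarrow> real) \<Rightarrow> real" where
  "ip I u v = (\<Sum>i\<in>I. u i * v i)"

lemma ip_commute: "ip I u v = ip I v u"
  by (simp add: ip_def mult.commute)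

lemma ip_cong: "(\<And>i. i \<in> I \<Longrightarrow> u i = u' i) \<Longrightarrow> (\<And>i. i \<in> I \<Longrightarrow> v i = v' i) \<Longrightarrow> ip I u v = ip I u' v'"
  by (simp add: ip_def)

lemma ip_diff_right: "ip I u (\<lambda>i. v i - w i) = ip I u v - ip I u w"
  by (simp add: ip_def algebra_simps sum_subtractf)

lemma ip_cmul_right: "ip I u (\<lambda>i. c * v i) = c * ip I u v"
  by (simp add: ip_def algebra_simps sum_distrib_left)

lemma ip_sum_right: "ip I u (\<lambda>i. \<Sum>a\<in>A. c a * w a i) = (\<Sum>a\<in>A. c a * ip I u (w a))"
  unfolding ip_def sum_distrib_left by (subst sum.swap) (simp add: algebra_simps)

lemma ip_sum_left: "ip I (\<lambda>i. \<Sum>a\<in>A. c a * w a i) u = (\<Sum>a\<in>A. c a * ip I (w a) u)"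
  using ip_sum_right[of I u c w A] by (subst (1 2) ip_commute)

lemma ip_self_nonneg: "0 \<le> ip I u u"
  by (simp add: ip_def sum_nonneg)

lemma ip_self_eq_0: "finite I \<Longrightarrow> ip I u u = 0 \<Longrightarrow> i \<in> I \<Longrightarrow> u i = 0"
  unfolding ip_def by (subst (asm) sum_nonneg_eq_0_iff) auto

lemma ip_delta_expand:
  fixes r :: nat
  assumes on: "\<And>a b. a < r \<Longrightarrow> b < r \<Longrightarrow> ip I (u a) (u b) = (if a = b then 1 else 0)"
    and b: "b < r"
  shows "ip I (u b) (\<lambda>i. \<Sum>a<r. c a * u a i) = c b"
proof -
  have "ip I (u b) (\<lambda>i. \<Sum>a<r. c a * u a i) = (\<Sum>a<r. c a * ip I (u b) (u a))"
    by (rule ip_sum_right)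
  also have "\<dots> = (\<Sum>a<r. if a = b then c a else 0)"
    using on b by (intro sum.cong) auto
  finally show ?thesis using b by simp
qed

lemma ip_orthonormal_norm:
  fixes r :: nat
  assumes on: "\<And>a b. a < r \<Longrightarrow> b < r \<Longrightarrow> ip I (u a) (u b) = (if a = b then 1 else 0)"
  shows "ip I (\<lambda>i. \<Sum>a<r. c a * u a i) (\<lambda>i. \<Sum>a<r. c a * u a i) = (\<Sum>a<r. (c a)\<^sup>2)"
  by (subst ip_sum_left) (simp add: ip_delta_expand[OF on] power2_eq_square)

text \<open>Gram-Schmidt by induction on \<open>A\<close>. A vector already in the span adds no new
  basis element, which is why \<open>r\<close> may be smaller than \<open>card A\<close>. Both
  inclusions of the spans are recorded, because coefficients are later transported in both
  directions.\<close>

lemma orthonormalize: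
  fixes v :: "'a \<Rightarrow> 'i \<Rightarrow> real"
  assumes I: "finite I" and A: "finite A"
  shows "\<exists>(r::nat) u. r \<le> card A
     \<and> (\<forall>a<r. \<forall>b<r. ip I (u a) (u b) = (if a = b then 1 else 0))
     \<and> (\<forall>j\<in>A. \<exists>c. \<forall>i\<in>I. v j i = (\<Sum>a<r. c a * u a i))
     \<and> (\<forall>a<r. \<exists>e. \<forall>i\<in>I. u a i = (\<Sum>j\<in>A. e j * v j i))"
  using A
proof (induction A rule: finite_induct)
  case empty
  show ?case by (intro exI[of _ 0]) auto
next
  case (insert j A)
  then obtain r :: nat and u where r: "r \<le> card A"
    and on: "\<And>a b. a < r \<Longrightarrow> b < r \<Longrightarrow> ip I (u a) (u b) = (if a = b then 1 else 0)"
    and vu: "\<And>j. j \<in> A \<Longrightarrow> \<exists>c. \<forall>i\<in>I. v j i = (\<Sum>a<r. c a * u a i)"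
    and uv: "\<And>a. a < r \<Longrightarrow> \<exists>e. \<forall>i\<in>I. u a i = (\<Sum>j\<in>A. e j * v j i)" by blast
  have uv': "\<exists>e. \<forall>i\<in>I. u a i = (\<Sum>j\<in>insert j A. e j * v j i)" if "a < r" for a
  proof -
    obtain e where e: "\<forall>i\<in>I. u a i = (\<Sum>j\<in>A. e j * v j i)" using uv \<open>a < r\<close> by blast
    show ?thesis
      apply (rule exI[of _ "e(j := 0)"])
      using e insert.hyps by (auto intro!: sum.cong)
  qed
  define w where "w i = v j i - (\<Sum>a<r. ip I (u a) (v j) * u a i)" for i
  have wu: "ip I (u b) w = 0" if "b < r" for b
    unfolding w_def ip_diff_right by (subst ip_delta_expand[OF on that]) auto
  show ?case
  proof (cases "ip I w w = 0")
    case True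
    have w0: "w i = 0" if "i \<in> I" for i using ip_self_eq_0[OF I True that] .
    have "\<exists>c. \<forall>i\<in>I. v j i = (\<Sum>a<r. c a * u a i)"
      by (rule exI[of _ "\<lambda>a. ip I (u a) (v j)"]) (use w0 w_def in force)
    with vu have "\<forall>l\<in>insert j A. \<exists>c. \<forall>i\<in>I. v l i = (\<Sum>a<r. c a * u a i)" by blast
    moreover have "r \<le> card (insert j A)" using r insert.hyps by simp
    ultimately show ?thesis
      using on uv' by (intro exI[of _ r] exI[of _ u] conjI) blast+
  next
    case False
    define s where "s = sqrt (ip I w w)"
    have s: "s > 0" "s * s = ip I w w" using False ip_self_nonneg[of I w] by (auto simp: s_def)
    define \<tau> where "\<tau> = 1 / s"
    have \<tau>: "\<tau> * (\<tau> * ip I w w) = 1" "\<tau> * s = 1"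
      using s(1) unfolding s(2)[symmetric] \<tau>_def by simp_all
    define u' where "u' = u(r := (\<lambda>i. \<tau> * w i))"
    have on': "ip I (u' a) (u' b) = (if a = b then 1 else 0)" if "a < Suc r" "b < Suc r" for a b
    proof -
      have 1: "ip I (\<lambda>i. \<tau> * w i) (\<lambda>i. \<tau> * w i) = 1"
        unfolding ip_cmul_right by (subst ip_commute) (simp add: ip_cmul_right \<tau>)
      have 2: "ip I (u b) (\<lambda>i. \<tau> * w i) = 0" if "b < r" for b
        unfolding ip_cmul_right using wu[OF that] by simp
      have 3: "ip I (\<lambda>i. \<tau> * w i) (u b) = 0" if "b < r" for b
        using 2[OF that] by (subst ip_commute)
      consider "a < r" "b < r" | "a = r" "b < r" | "a < r" "b = r" | "a = r" "b = r"
        using \<open>a < Suc r\<close> \<open>b < Suc r\<close> by linarith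
      then show ?thesis
        by cases (simp_all add: u'_def on 1 2 3)
    qed
    have extend: "\<exists>c. \<forall>i\<in>I. f i = (\<Sum>a<Suc r. c a * u' a i)" if "\<forall>i\<in>I. f i = (\<Sum>a<r. c a * u a i) + t * w i" for f c t
      apply (rule exI[of _ "c(r := t * s)"])
      using that \<tau>(2) by (auto simp: u'_def mult.commute mult.left_commute)
    have vj: "\<exists>c. \<forall>i\<in>I. v j i = (\<Sum>a<Suc r. c a * u' a i)"
      by (rule extend[of _ "\<lambda>a. ip I (u a) (v j)" 1]) (simp add: w_def)
    have vA: "\<exists>c. \<forall>i\<in>I. v l i = (\<Sum>a<Suc r. c a * u' a i)" if "l \<in> A" for l
    proof -
      obtain c where "\<forall>i\<in>I. v l i = (\<Sum>a<r. c a * u a i)" using vu \<open>l \<in> A\<close> by blast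
      then show ?thesis by (intro extend[of _ c 0]) simp
    qed
    have u'r: "\<exists>e. \<forall>i\<in>I. u' r i = (\<Sum>l\<in>insert j A. e l * v l i)"
    proof -
      obtain E where E: "\<And>a i. a < r \<Longrightarrow> i \<in> I \<Longrightarrow> u a i = (\<Sum>l\<in>A. E a l * v l i)"
        using uv by metis
      define e where "e l = (if l = j then \<tau> else - \<tau> * (\<Sum>a<r. ip I (u a) (v j) * E a l))" for l
      have "u' r i = (\<Sum>l\<in>insert j A. e l * v l i)" if i: "i \<in> I" for i
      proof -
        have "(\<Sum>a<r. ip I (u a) (v j) * u a i) = (\<Sum>a<r. \<Sum>l\<in>A. ip I (u a) (v j) * (E a l * v l i))"
          using E i by (simp add: sum_distrib_left)
        also have "\<dots> = (\<Sum>l\<in>A. (\<Sum>a<r. ip I (u a) (v j) * E a l) * v l i)"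
          by (subst sum.swap) (simp add: sum_distrib_right mult.assoc)
        finally have 4: "(\<Sum>a<r. ip I (u a) (v j) * u a i) = (\<Sum>l\<in>A. (\<Sum>a<r. ip I (u a) (v j) * E a l) * v l i)" .
        have "(\<Sum>l\<in>A. e l * v l i) = (\<Sum>l\<in>A. - \<tau> * ((\<Sum>a<r. ip I (u a) (v j) * E a l) * v l i))"
          by (rule sum.cong) (use insert.hyps in \<open>auto simp: e_def\<close>)
        also have "\<dots> = - \<tau> * (\<Sum>a<r. ip I (u a) (v j) * u a i)"
          unfolding 4 by (simp add: sum_distrib_left)
        finally have "(\<Sum>l\<in>insert j A. e l * v l i) = \<tau> * v j i - \<tau> * (\<Sum>a<r. ip I (u a) (v j) * u a i)"
          using insert.hyps by (simp add: e_def)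
        then show ?thesis by (simp add: u'_def w_def right_diff_distrib)
      qed
      then show ?thesis by blast
    qed
    have u'e: "\<exists>e. \<forall>i\<in>I. u' a i = (\<Sum>l\<in>insert j A. e l * v l i)" if "a < Suc r" for a
      using uv'[of a] u'r that by (cases "a = r") (auto simp: u'_def)
    have "Suc r \<le> card (insert j A)" using r insert.hyps by simp
    moreover have "\<forall>l\<in>insert j A. \<exists>c. \<forall>i\<in>I. v l i = (\<Sum>a<Suc r. c a * u' a i)"
      using vj vA by blast
    ultimately show ?thesis
      using on' u'e by (intro exI[of _ "Suc r"] exI[of _ u'] conjI) blast+
  qed
qed

text \<open>Solves the normal equations for a possibly dependent family: the projection is computed
  in an orthonormal basis of the span, and its coefficients are pulled back through the expansion of
  that basis in the \<open>v j\<close>.\<close>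

lemma orthogonal_projection:
  fixes v :: "'a \<Rightarrow> 'i \<Rightarrow> real"
  assumes I: "finite I" and A: "finite A"
  shows "\<exists>q. \<forall>a\<in>A. ip I (v a) (\<lambda>i. b i - (\<Sum>j\<in>A. q j * v j i)) = 0"
proof -
  obtain r :: nat and u where
        on: "\<And>a b. a < r \<Longrightarrow> b < r \<Longrightarrow> ip I (u a) (u b) = (if a = b then 1 else 0)"
    and vu: "\<And>j. j \<in> A \<Longrightarrow> \<exists>c. \<forall>i\<in>I. v j i = (\<Sum>a<r. c a * u a i)"
    and uv: "\<And>a. a < r \<Longrightarrow> \<exists>e. \<forall>i\<in>I. u a i = (\<Sum>j\<in>A. e j * v j i)"
    using orthonormalize[OF I A, of v] by blast
  obtain E where E: "\<And>a i. a < r \<Longrightarrow> i \<in> I \<Longrightarrow> u a i = (\<Sum>l\<in>A. E a l * v l i)"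
    using uv by metis
  define q where "q l = (\<Sum>a<r. ip I (u a) b * E a l)" for l
  have q: "(\<Sum>l\<in>A. q l * v l i) = (\<Sum>a<r. ip I (u a) b * u a i)" if "i \<in> I" for i
  proof -
    have "(\<Sum>a<r. ip I (u a) b * u a i) = (\<Sum>a<r. \<Sum>l\<in>A. ip I (u a) b * (E a l * v l i))"
      using E that by (simp add: sum_distrib_left)
    also have "\<dots> = (\<Sum>l\<in>A. (\<Sum>a<r. ip I (u a) b * E a l) * v l i)"
      by (subst sum.swap) (simp add: sum_distrib_right mult.assoc)
    finally show ?thesis by (simp add: q_def)
  qed
  have uz: "ip I (u a) (\<lambda>i. b i - (\<Sum>j\<in>A. q j * v j i)) = 0" if "a < r" for a
  proof -
    have "ip I (u a) (\<lambda>i. b i - (\<Sum>j\<in>A. q j * v j i)) = ip I (u a) (\<lambda>i. b i - (\<Sum>a<r. ip I (u a) b * u a i))"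
      by (rule ip_cong) (auto simp: q)
    also have "\<dots> = 0"
      unfolding ip_diff_right by (subst ip_delta_expand[OF on that]) auto
    finally show ?thesis .
  qed
  have "ip I (v l) (\<lambda>i. b i - (\<Sum>j\<in>A. q j * v j i)) = 0" if "l \<in> A" for l
  proof -
    obtain c where "\<forall>i\<in>I. v l i = (\<Sum>a<r. c a * u a i)" using vu[OF \<open>l \<in> A\<close>] by blast
    then have "ip I (v l) (\<lambda>i. b i - (\<Sum>j\<in>A. q j * v j i))
        = ip I (\<lambda>i. \<Sum>a<r. c a * u a i) (\<lambda>i. b i - (\<Sum>j\<in>A. q j * v j i))"
      by (intro ip_cong) auto
    also have "\<dots> = 0" unfolding ip_sum_left using uz by simp
    finally show ?thesis .
  qed
  then show ?thesis by blast
qed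

section \<open>Spectral bounds for real symmetric matrices\<close>

definition qform :: "nat \<Rightarrow> (nat \<Rightarrow> nat \<Rightarrow> real) \<Rightarrow> (nat \<Rightarrow> real) \<Rightarrow> real" where
  "qform n A v = (\<Sum>i<n. \<Sum>j<n. v i * A i j * v j)"

definition eigvec :: "nat \<Rightarrow> (nat \<Rightarrow> nat \<Rightarrow> real) \<Rightarrow> real \<Rightarrow> (nat \<Rightarrow> real) \<Rightarrow> bool" where
  "eigvec n A r x \<longleftrightarrow> (\<exists>i<n. x i \<noteq> 0) \<and> (\<forall>i<n. (\<Sum>j<n. A i j * x j) = r * x i)"

text \<open>Kept over a general field because it is applied twice: to the real matrix itself and to
  its complexification.\<close>

lemma eigenvalue_mat_iff:
  fixes A :: "nat \<Rightarrow> nat \<Rightarrow> 'a::field"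
  shows "eigenvalue (mat n n (\<lambda>(i, j). A i j)) r \<longleftrightarrow>
    (\<exists>x. (\<exists>i<n. x i \<noteq> 0) \<and> (\<forall>i<n. (\<Sum>j<n. A i j * x j) = r * x i))" (is "?L \<longleftrightarrow> ?R")
proof
  assume ?L
  then obtain v where v: "v \<in> carrier_vec n" "v \<noteq> 0\<^sub>v n" "mat n n (\<lambda>(i, j). A i j) *\<^sub>v v = r \<cdot>\<^sub>v v"
    by (auto simp: eigenvalue_def eigenvector_def)
  have "\<exists>i<n. v $ i \<noteq> 0" using v(1,2) by (metis carrier_vecD eq_vecI index_zero_vec)
  moreover have "(\<Sum>j<n. A i j * v $ j) = r * v $ i" if "i < n" for i
    using arg_cong[OF v(3), of "\<lambda>w. w $ i"] that v(1)
    by (simp add: scalar_prod_def atLeast0LessThan)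
  ultimately show ?R by (intro exI[of _ "\<lambda>i. v $ i"]) auto
next
  assume ?R
  then obtain x where x: "\<exists>i<n. x i \<noteq> 0" "\<forall>i<n. (\<Sum>j<n. A i j * x j) = r * x i" by blast
  have "eigenvector (mat n n (\<lambda>(i, j). A i j)) (vec n x) r"
    unfolding eigenvector_def
  proof (intro conjI)
    show "vec n x \<noteq> 0\<^sub>v (dim_row (mat n n (\<lambda>(i, j). A i j)))"
      using x(1) by (auto simp: vec_eq_iff)
    show "mat n n (\<lambda>(i, j). A i j) *\<^sub>v vec n x = r \<cdot>\<^sub>v vec n x"
      using x(2) by (intro eq_vecI) (auto simp: scalar_prod_def atLeast0LessThan)
  qed auto
  then show ?L by (auto simp: eigenvalue_def)
qed

text \<open>The number \<open>x^* A x\<close> equals its own conjugate by symmetry, and it also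
  equals \<open>r\<close> times the positive number \<open>|x|^2\<close>.\<close>

lemma symm_complex_eigenvalue_real:
  fixes x :: "nat \<Rightarrow> complex"
  assumes A: "symm n A" and x: "i0 < n" "x i0 \<noteq> 0"
    and e: "\<And>i. i < n \<Longrightarrow> (\<Sum>j<n. of_real (A i j) * x j) = r * x i"
  shows "Im r = 0"
proof -
  define S where "S = (\<Sum>i<n. \<Sum>j<n. cnj (x i) * of_real (A i j) * x j)"
  have "S = (\<Sum>i<n. cnj (x i) * (\<Sum>j<n. of_real (A i j) * x j))"
    unfolding S_def by (simp add: sum_distrib_left mult.assoc)
  also have "\<dots> = r * (\<Sum>i<n. cnj (x i) * x i)"
    using e by (simp add: sum_distrib_left mult_ac)
  also have "(\<Sum>i<n. cnj (x i) * x i) = of_real (\<Sum>i<n. (cmod (x i))\<^sup>2)"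
    unfolding of_real_sum complex_norm_square by (simp add: mult.commute)
  finally have 1: "S = r * of_real (\<Sum>i<n. (cmod (x i))\<^sup>2)" .
  have "cnj S = (\<Sum>i<n. \<Sum>j<n. cnj (x j) * of_real (A i j) * x i)"
    by (simp add: S_def mult_ac)
  also have "\<dots> = (\<Sum>j<n. \<Sum>i<n. cnj (x j) * of_real (A i j) * x i)" by (rule sum.swap)
  also have "\<dots> = S" unfolding S_def
    using A by (intro sum.cong refl) (auto simp: symm_def)
  finally have "Im S = 0" by (metis complex_cnj_cancel_iff cnj.sel(2) equal_neg_zero)
  moreover have "0 < (\<Sum>i<n. (cmod (x i))\<^sup>2)"
    using x by (intro sum_pos2[of _ i0]) auto
  ultimately show ?thesis by (simp add: 1)
qed

lemma order_prod_list_linear: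
  fixes rs :: "real list"
  shows "order r (\<Prod>a\<leftarrow>rs. [:- a, 1:]) = count (mset rs) r"
proof (induction rs)
  case (Cons a rs)
  have nz: "(\<Prod>a\<leftarrow>rs. [:- a, 1:]) \<noteq> (0::real poly)" by (auto simp: prod_list_zero_iff)
  have "order r ([:- a, 1:] * (\<Prod>a\<leftarrow>rs. [:- a, 1:])) = order r [:- a, 1:] + order r (\<Prod>a\<leftarrow>rs. [:- a, 1:])"
    using nz by (intro order_mult) (metis mult_eq_0_iff pCons_eq_0_iff zero_neq_one)
  moreover have "order r [:- a, 1:] = (if a = r then 1 else 0)"
    using order_power_n_n[of r 1] by (auto intro: order_0I)
  ultimately show ?case using Cons by simp
qed simp

text \<open>The characteristic polynomial is factored over the complex numbers, where all its roots
  turn out to be real; injectivity of the embedding of polynomials brings the factorisation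
  back.\<close>

lemma char_poly_symm_splits:
  assumes A: "symm n A"
  shows "\<exists>rs :: real list. length rs = n \<and> char_poly (mat n n (\<lambda>(i, j). A i j)) = (\<Prod>a\<leftarrow>rs. [:- a, 1:])"
proof -
  let ?A = "mat n n (\<lambda>(i, j). A i j)"
  define C :: "complex mat" where "C = mat n n (\<lambda>(i, j). of_real (A i j))"
  have C: "C \<in> carrier_mat n n" by (simp add: C_def)
  have hC: "C = map_mat of_real ?A" by (intro eq_matI) (auto simp: C_def)
  have cp: "char_poly C = map_poly of_real (char_poly ?A)"
    unfolding hC by (rule of_real_hom.char_poly_hom[of _ n]) simp
  obtain as where as: "char_poly C = (\<Prod>a\<leftarrow>as. [:- a, 1:])" "length as = n"
    using char_poly_factorized[OF C] by blast
  have real: "Im a = 0" if "a \<in> set as" for a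
  proof -
    have "poly (char_poly C) a = 0" unfolding as(1) poly_prod_list using that
      by (auto simp: prod_list_zero_iff o_def image_iff intro!: bexI[of _ a])
    then have "eigenvalue C a" using eigenvalue_root_char_poly[OF C] by simp
    then show ?thesis unfolding C_def eigenvalue_mat_iff
      using symm_complex_eigenvalue_real[OF A] by blast
  qed
  define rs where "rs = map Re as"
  have asr: "as = map of_real rs"
    unfolding rs_def using real by (auto intro!: nth_equalityI simp: complex_eq_iff)
  have "map_poly of_real (\<Prod>a\<leftarrow>rs. [:- a, 1:]) = (\<Prod>a\<leftarrow>as. [:- a, 1::complex:])"
  proof -
    interpret h: map_poly_inj_idom_hom "of_real :: real \<Rightarrow> complex" ..
    show ?thesis unfolding h.hom_prod_list asr by (simp add: o_def)
  qed
  then have "map_poly (of_real :: real \<Rightarrow> complex) (char_poly ?A) = map_poly of_real (\<Prod>a\<leftarrow>rs. [:- a, 1:])"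
    using as(1) cp by simp
  then have "char_poly ?A = (\<Prod>a\<leftarrow>rs. [:- a, 1:])"
  proof -
    interpret h: map_poly_inj_idom_hom "of_real :: real \<Rightarrow> complex" ..
    assume "map_poly (of_real :: real \<Rightarrow> complex) (char_poly ?A) = map_poly of_real (\<Prod>a\<leftarrow>rs. [:- a, 1:])"
    then show ?thesis by simp
  qed
  then show ?thesis using as(2) by (intro exI[of _ rs]) (auto simp: rs_def)
qed

text \<open>Listing every root with its order rearranges the list of linear factors. So the list has
  exactly \<open>n\<close> entries, and the positions \<open>0\<close> and \<open>n - 1\<close> in
  the definitions of \<open>lam_max\<close>, \<open>lam_min\<close> and the singular values denote
  actual eigenvalues.\<close>

lemma eig_list_symm:
  assumes A: "symm n A"
  shows "length (eig_list n A) = n"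
    and "r \<in> set (eig_list n A) \<longleftrightarrow> (\<exists>x. eigvec n A r x)"
    and "sorted (rev (eig_list n A))"
proof -
  let ?A = "mat n n (\<lambda>(i, j). A i j)"
  let ?p = "char_poly ?A"
  obtain rs where rs: "length rs = n" "?p = (\<Prod>a\<leftarrow>rs. [:- a, 1:])"
    using char_poly_symm_splits[OF A] by blast
  have roots: "{r. poly ?p r = 0} = set rs"
    unfolding rs(2) poly_prod_list by (auto simp: prod_list_zero_iff)
  define ys where "ys = concat (map (\<lambda>r. replicate (order r ?p) r) (sorted_list_of_set {r. poly ?p r = 0}))"
  have eig: "eig_list n A = rev (sort ys)" by (simp add: eig_list_def ys_def Let_def)
  have cnt: "count (mset (concat (map (\<lambda>r. replicate (f r) r) xs))) r = (if r \<in> set xs then f r else 0)"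
    if "distinct xs" for f :: "real \<Rightarrow> nat" and xs r
    using that by (induction xs) auto
  have "mset ys = mset rs"
  proof (rule multiset_eqI)
    fix r
    have "count (mset ys) r = (if r \<in> set rs then order r ?p else 0)"
      unfolding ys_def by (subst cnt) (auto simp: roots)
    also have "\<dots> = count (mset rs) r"
      unfolding rs(2) order_prod_list_linear by (auto simp: count_mset_0_iff[symmetric] simp del: count_mset_0_iff)
    finally show "count (mset ys) r = count (mset rs) r" .
  qed
  then have m: "mset (eig_list n A) = mset rs" by (simp add: eig)
  show "length (eig_list n A) = n" using arg_cong[OF m, of size] rs(1) by simp
  show "sorted (rev (eig_list n A))" by (simp add: eig)
  have "set (eig_list n A) = set rs" using m by (metis set_mset_mset)
  then have "r \<in> set (eig_list n A) \<longleftrightarrow> eigenvalue ?A r"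
    using roots eigenvalue_root_char_poly[of ?A n r] by auto
  then show "r \<in> set (eig_list n A) \<longleftrightarrow> (\<exists>x. eigvec n A r x)"
    unfolding eigenvalue_mat_iff eigvec_def .
qed

text \<open>First-order optimality condition, tested at
  \<open>s = - g / (\<bar>H\<bar> + 1)\<close>. It serves both the maximum of the Rayleigh quotient
  and the normal equations of least squares.\<close>

lemma linear_coeff_zero:
  fixes g H :: real
  assumes "\<And>s. 0 \<le> 2 * s * g + s\<^sup>2 * H"
  shows "g = 0"
proof (rule ccontr)
  assume g: "g \<noteq> 0"
  define s where "s = - g / (\<bar>H\<bar> + 1)"
  have sH: "s * (\<bar>H\<bar> + 1) = - g" by (simp add: s_def add_nonneg_pos less_imp_neq[symmetric])
  have "s\<^sup>2 * H \<le> s\<^sup>2 * (\<bar>H\<bar> + 1)" by (intro mult_left_mono) auto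
  also have "\<dots> = - s * g" unfolding power2_eq_square mult.assoc sH by simp
  finally have "0 \<le> s * g" using assms[of s] by simp
  moreover have "s * g = - (g * g) / (\<bar>H\<bar> + 1)" by (simp add: s_def)
  moreover have "- (g * g) / (\<bar>H\<bar> + 1) < 0"
    using g by (intro divide_neg_pos) (auto simp: zero_less_mult_iff)
  ultimately show False by simp
qed

text \<open>The Rayleigh quotient attains its maximum on the unit sphere, and stationarity in each
  coordinate direction is the eigenvalue equation.\<close>

lemma exists_max_eigvec:
  assumes A: "symm n A" and n: "0 < n"
  shows "\<exists>m x. eigvec n A m x \<and> (\<forall>v. qform n A v \<le> m * (\<Sum>i<n. (v i)\<^sup>2))"
proof -
  define nr where "nr x = (\<Sum>a<n. (x a)\<^sup>2)" for x :: "nat \<Rightarrow> real"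
  \<comment> \<open>Vectors are functions on all naturals, so compactness comes from Tychonoff:
    coordinates below \<open>n\<close> range over an interval, all others are pinned to
    \<open>0\<close>.\<close>
  define Q where "Q = PiE UNIV (\<lambda>i. if i < n then {-1..1::real} else {0})"
  have "compactin (product_topology (\<lambda>i. euclidean) UNIV) Q"
    unfolding Q_def compactin_PiE by auto
  then have cQ: "compact Q" by (simp add: euclidean_product_topology)
  have cont: "continuous_on UNIV (\<lambda>x :: nat \<Rightarrow> real. x i)" for i by simp
  have cn: "continuous_on UNIV nr" unfolding nr_def by (intro continuous_intros cont)
  have cq: "continuous_on UNIV (qform n A)" unfolding qform_def by (intro continuous_intros cont)
  have "closed (nr -` {1})" using continuous_closed_vimage[of "{1}" nr] cn
    by (simp add: continuous_on_eq_continuous_within)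
  then have cK: "compact (Q \<inter> nr -` {1})" using cQ by (rule compact_Int_closed[rotated])
  have "(\<lambda>i. if i = 0 then 1 else 0) \<in> Q \<inter> nr -` {1}"
    using n by (auto simp: Q_def nr_def if_distrib[of "\<lambda>x. x\<^sup>2"] sum.delta cong: if_cong)
  then have "Q \<inter> nr -` {1} \<noteq> {}" by blast
  then obtain x where x: "x \<in> Q" "nr x = 1" "\<And>y. y \<in> Q \<Longrightarrow> nr y = 1 \<Longrightarrow> qform n A y \<le> qform n A x"
    using continuous_attains_sup[OF cK, of "qform n A"] continuous_on_subset[OF cq] by auto
  define m where "m = qform n A x"
  have le: "qform n A v \<le> m * nr v" for v
  proof (cases "nr v = 0")
    case True
    then have "v i = 0" if "i < n" for i
      using that unfolding nr_def by (subst (asm) sum_nonneg_eq_0_iff) auto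
    then have "qform n A v = 0" by (simp add: qform_def)
    then show ?thesis using True by simp
  next
    case False
    then have p: "nr v > 0" by (simp add: nr_def sum_nonneg less_le)
    define c where "c = 1 / sqrt (nr v)"
    have c2: "c\<^sup>2 * nr v = 1" using p by (simp add: c_def power_divide)
    define y where "y i = (if i < n then c * v i else 0)" for i
    have ny: "nr y = 1"
      unfolding c2[symmetric] by (simp add: nr_def y_def power_mult_distrib sum_distrib_left)
    have "\<bar>y i\<bar> \<le> 1" if "i < n" for i
    proof -
      have "(y i)\<^sup>2 \<le> nr y" unfolding nr_def using that by (intro member_le_sum) auto
      with ny show ?thesis using abs_square_le_1 by auto
    qed
    then have "y \<in> Q" by (force simp: Q_def y_def abs_le_iff)
    then have "qform n A y \<le> m" using x(3) ny by (simp add: m_def)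
    moreover have "qform n A y = c\<^sup>2 * qform n A v"
      by (simp add: qform_def y_def sum_distrib_left power2_eq_square mult_ac)
    ultimately have le: "nr v * (c\<^sup>2 * qform n A v) \<le> nr v * m" using p by (intro mult_left_mono) auto
    have "qform n A v = (c\<^sup>2 * nr v) * qform n A v" using c2 by simp
    also have "\<dots> = nr v * (c\<^sup>2 * qform n A v)" by (simp only: mult_ac)
    also note le
    finally show ?thesis by (simp only: mult.commute)
  qed
  have eq: "(\<Sum>j<n. A i j * x j) = m * x i" if i: "i < n" for i
  proof -
    define g where "g = m * x i - (\<Sum>j<n. A i j * x j)"
    define H where "H = m - A i i"
    \<comment> \<open>The maximality inequality for the vector \<open>x + s e_i\<close>, written as
      a polynomial in \<open>s\<close>; its linear coefficient is twice the defect \<open>g\<close>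
      in the eigenvalue equation.\<close>
    have key: "0 \<le> 2 * s * g + s\<^sup>2 * H" for s
    proof -
      define v where "v j = x j + (if j = i then s else 0)" for j
      define y where "y a = (\<Sum>b<n. A a b * x b)" for a
      have "nr v = (\<Sum>j<n. (x j)\<^sup>2 + (if j = i then 2 * s * x j + s\<^sup>2 else 0))"
        unfolding nr_def v_def by (intro sum.cong) (auto simp: power2_eq_square algebra_simps)
      also have "\<dots> = nr x + 2 * s * x i + s\<^sup>2"
        using i by (simp add: sum.distrib nr_def)
      finally have nv: "nr v = 1 + 2 * s * x i + s\<^sup>2" using x(2) by simp
      have inner: "(\<Sum>b<n. A a b * v b) = y a + s * A a i" for a
        using i by (simp add: v_def y_def distrib_left sum.distrib mult_delta_right)
      have xA: "(\<Sum>a<n. x a * A a i) = y i"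
        unfolding y_def using A i by (intro sum.cong) (auto simp: symm_def)
      have xy: "(\<Sum>a<n. x a * y a) = m"
        unfolding y_def m_def qform_def by (simp add: sum_distrib_left mult.assoc)
      have "qform n A v = (\<Sum>a<n. v a * (y a + s * A a i))"
        unfolding qform_def inner[symmetric] by (simp add: sum_distrib_left mult.assoc)
      also have "\<dots> = (\<Sum>a<n. x a * (y a + s * A a i)) + s * (y i + s * A i i)"
        using i by (simp add: v_def distrib_right sum.distrib mult_delta_left)
      also have "(\<Sum>a<n. x a * (y a + s * A a i)) = (\<Sum>a<n. x a * y a) + s * (\<Sum>a<n. x a * A a i)"
        by (simp add: distrib_left sum.distrib sum_distrib_left mult_ac)
      finally have "qform n A v = m + 2 * s * (\<Sum>b<n. A i b * x b) + s\<^sup>2 * A i i"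
        unfolding xA xy by (simp add: y_def power2_eq_square algebra_simps)
      with le[of v] nv show ?thesis by (simp add: g_def H_def algebra_simps)
    qed
    have "g = 0" using key by (rule linear_coeff_zero)
    then show ?thesis by (simp add: g_def)
  qed
  have "\<exists>i<n. x i \<noteq> 0"
  proof (rule ccontr)
    assume "\<not> ?thesis"
    then have "nr x = 0" by (simp add: nr_def)
    with x(2) show False by simp
  qed
  then have "eigvec n A m x" using eq by (auto simp: eigvec_def)
  then show ?thesis using le by (auto simp: nr_def)
qed

text \<open>The maximal Rayleigh quotient is an eigenvalue, hence at most the first list entry; the
  lower bound is the same fact for \<open>- A\<close>.\<close>

lemma eig_list_Rayleigh:
  assumes A: "symm n A" and n: "0 < n"
  shows "qform n A v \<le> eig_list n A ! 0 * (\<Sum>i<n. (v i)\<^sup>2)"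
    and "eig_list n A ! (n - 1) * (\<Sum>i<n. (v i)\<^sup>2) \<le> qform n A v"
    and "\<exists>x. eigvec n A (eig_list n A ! (n - 1)) x"
proof -
  note E = eig_list_symm[OF A]
  have rng: "eig_list n A ! (n - 1) \<le> r \<and> r \<le> eig_list n A ! 0" if r: "r \<in> set (eig_list n A)" for r
  proof -
    obtain i where i: "i < n" "eig_list n A ! i = r" using r E(1) by (metis in_set_conv_nth)
    have "sorted_wrt (\<ge>) (eig_list n A)" using E(3) by (simp add: sorted_wrt_rev)
    then have mono: "eig_list n A ! b \<le> eig_list n A ! a" if "a \<le> b" "b < n" for a b
      using that E(1) by (cases "a = b") (auto simp: sorted_wrt_iff_nth_less)
    show ?thesis using mono[of i "n - 1"] mono[of 0 i] i n by auto
  qed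
  have nn: "0 \<le> (\<Sum>i<n. (v i)\<^sup>2)" by (intro sum_nonneg) auto
  obtain m x where m: "eigvec n A m x" "\<And>v. qform n A v \<le> m * (\<Sum>i<n. (v i)\<^sup>2)"
    using exists_max_eigvec[OF A n] by blast
  have "m \<le> eig_list n A ! 0" using m(1) E(2) rng by blast
  then have "m * (\<Sum>i<n. (v i)\<^sup>2) \<le> eig_list n A ! 0 * (\<Sum>i<n. (v i)\<^sup>2)" using nn by (intro mult_right_mono)
  with m(2)[of v] show "qform n A v \<le> eig_list n A ! 0 * (\<Sum>i<n. (v i)\<^sup>2)" by linarith
  have A': "symm n (\<lambda>i j. - A i j)" using A by (simp add: symm_def)
  obtain m x where m: "eigvec n (\<lambda>i j. - A i j) m x" "\<And>v. qform n (\<lambda>i j. - A i j) v \<le> m * (\<Sum>i<n. (v i)\<^sup>2)"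
    using exists_max_eigvec[OF A' n] by blast
  have "eigvec n A (- m) x" using m(1) by (auto simp: eigvec_def sum_negf)
  then have "eig_list n A ! (n - 1) \<le> - m" using E(2) rng by blast
  then have "eig_list n A ! (n - 1) * (\<Sum>i<n. (v i)\<^sup>2) \<le> - m * (\<Sum>i<n. (v i)\<^sup>2)" using nn by (intro mult_right_mono)
  moreover have "qform n (\<lambda>i j. - A i j) v = - qform n A v" by (simp add: qform_def sum_negf)
  ultimately show "eig_list n A ! (n - 1) * (\<Sum>i<n. (v i)\<^sup>2) \<le> qform n A v" using m(2)[of v] by simp
  have "eig_list n A ! (n - 1) \<in> set (eig_list n A)" using E(1) n by (intro nth_mem) auto
  then show "\<exists>x. eigvec n A (eig_list n A ! (n - 1)) x" using E(2) by blast
qed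

lemma qform_eigvec: "eigvec n A r x \<Longrightarrow> qform n A x = r * (\<Sum>i<n. (x i)\<^sup>2)"
  by (simp add: eigvec_def qform_def mult.assoc sum_distrib_left[symmetric])
     (simp add: sum_distrib_left power2_eq_square mult_ac)

lemma lam_min_pos:
  assumes A: "pd n A" and n: "0 < n"
  shows "0 < lam_min n A"
proof -
  have s: "symm n A" using A by (simp add: pd_def)
  obtain x where x: "eigvec n A (lam_min n A) x"
    using eig_list_Rayleigh(3)[OF s n] by (auto simp: lam_min_def)
  then have "0 < qform n A x" using A by (auto simp: eigvec_def pd_def qform_def)
  then have "0 < lam_min n A * (\<Sum>i<n. (x i)\<^sup>2)" using qform_eigvec[OF x] by simp
  moreover have "0 \<le> (\<Sum>i<n. (x i)\<^sup>2)" by (intro sum_nonneg) auto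
  ultimately show ?thesis by (metis linorder_not_less mult_nonpos_nonneg)
qed

section \<open>Nets\<close>

text \<open>The subtracted term makes the induction close: each step adds
  \<open>2 exp (- (L + 1)^2)\<close>, at most \<open>2 / 2 ^ (L + 1)\<close>, and these increments
  telescope.\<close>

lemma sum_exp_neg_square_le: "(\<Sum>y\<in>{-int L..int L}. exp (- (real_of_int y)\<^sup>2)) \<le> 3 - 2 / 2 ^ L"
proof (induction L)
  case 0
  then show ?case by simp
next
  case (Suc L)
  have e: "exp (- (real (Suc L))\<^sup>2) \<le> 1 / 2 ^ Suc L"
  proof -
    have "real (Suc L) * ln 2 \<le> (real (Suc L))\<^sup>2"
    proof -
      have "ln 2 \<le> (1::real)" using ln_le_minus_one[of "2::real"] by simp
      then have "real (Suc L) * ln 2 \<le> real (Suc L) * 1" by (intro mult_left_mono) auto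
      also have "\<dots> \<le> real (Suc L) * real (Suc L)" by (intro mult_left_mono) auto
      finally show ?thesis by (simp add: power2_eq_square)
    qed
    then have "exp (real (Suc L) * ln 2) \<le> exp ((real (Suc L))\<^sup>2)" by (simp only: exp_le_cancel_iff)
    also have "exp (real (Suc L) * ln 2) = (2::real) ^ Suc L"
      by (subst exp_of_nat_mult) simp
    finally have "(2::real) ^ Suc L \<le> exp ((real (Suc L))\<^sup>2)" .
    then show ?thesis by (simp only: exp_minus) (simp add: divide_simps)
  qed
  have "{-int (Suc L)..int (Suc L)} = insert (-int (Suc L)) (insert (int (Suc L)) {-int L..int L})" by auto
  then have "(\<Sum>y\<in>{-int (Suc L)..int (Suc L)}. exp (- (real_of_int y)\<^sup>2))
     = 2 * exp (- (real (Suc L))\<^sup>2) + (\<Sum>y\<in>{-int L..int L}. exp (- (real_of_int y)\<^sup>2))"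
    by (simp add: power2_commute power2_minus[of "1 + real L", symmetric])
  also have "\<dots> \<le> 2 * (1 / 2 ^ Suc L) + (3 - 2 / 2 ^ L)"
    using e Suc by linarith
  also have "\<dots> = 3 - 2 / 2 ^ Suc L" by (simp add: field_simps)
  finally show ?case .
qed

text \<open>Rounding towards zero never increases the absolute value, so rounded points stay inside
  the ball or cube that is being covered.\<close>

lemma round_to_zero:
  fixes x h :: real
  assumes "0 < h"
  shows "\<exists>z::int. \<bar>h * z\<bar> \<le> \<bar>x\<bar> \<and> \<bar>x - h * z\<bar> \<le> h"
proof -
  define n where "n = \<lfloor>\<bar>x\<bar> / h\<rfloor>"
  have n: "real_of_int n \<le> \<bar>x\<bar> / h" "\<bar>x\<bar> / h < real_of_int n + 1" "0 \<le> n"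
    using assms by (auto simp: n_def)
  then have n': "h * n \<le> \<bar>x\<bar>" "\<bar>x\<bar> \<le> h * n + h"
    using assms by (auto simp: field_simps)
  have p: "0 \<le> h * n" using n assms by simp
  show ?thesis
  proof (cases "0 \<le> x")
    case True
    then show ?thesis using n' p by (intro exI[of _ n]) auto
  next
    case False
    then show ?thesis using n' p by (intro exI[of _ "-n"]) auto
  qed
qed

text \<open>The net is a lattice of step \<open>h\<close> with \<open>h^2 m = 1 / 25\<close>, cut to
  the ball, where \<open>\<Sum> z^2 \<le> 25 m\<close>. To count it, each point gets the weight
  \<open>exp (25 m - \<Sum> z^2) \<ge> 1\<close>; the sum over the box factorises into
  \<open>m\<close> one-dimensional sums, each at most \<open>3 \<le> exp 2\<close>. This gives
  \<open>27 = 25 + 2\<close>.\<close>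

lemma unit_ball_net:
  "\<exists>N :: (nat \<Rightarrow> real) set. finite N \<and> real (card N) \<le> exp (27 * real m)
     \<and> (\<forall>b\<in>N. (\<Sum>a<m. (b a)\<^sup>2) \<le> 1)
     \<and> (\<forall>b. (\<Sum>a<m. (b a)\<^sup>2) \<le> 1 \<longrightarrow> (\<exists>b'\<in>N. (\<Sum>a<m. (b a - b' a)\<^sup>2) \<le> 1 / 25))"
proof (cases "m = 0")
  case True
  then show ?thesis by (intro exI[of _ "{\<lambda>_. 0}"]) auto
next
  case False
  define h where "h = 1 / (5 * sqrt (real m))"
  have h: "0 < h" "h\<^sup>2 * m = 1 / 25"
    using False by (auto simp: h_def power_divide power_mult_distrib)
  define L where "L = 25 * m"
  define P where "P = PiE {..<m} (\<lambda>_. {-int L..int L})"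
  define Z where "Z = {z\<in>P. (\<Sum>a<m. (real_of_int (z a))\<^sup>2) \<le> real L}"
  have finP: "finite P" unfolding P_def by (intro finite_PiE) auto
  have finZ: "finite Z" using finP by (auto simp: Z_def)
  define N where "N = (\<lambda>z a. h * real_of_int (z a)) ` Z"
  have "real (card N) \<le> real (card Z)" unfolding N_def using card_image_le[OF finZ] by simp
  also have "\<dots> = (\<Sum>z\<in>Z. 1)" by simp
  also have "\<dots> \<le> (\<Sum>z\<in>Z. exp (real L - (\<Sum>a<m. (real_of_int (z a))\<^sup>2)))"
    by (intro sum_mono) (auto simp: Z_def)
  also have "\<dots> \<le> (\<Sum>z\<in>P. exp (real L - (\<Sum>a<m. (real_of_int (z a))\<^sup>2)))"
    using finP by (intro sum_mono2) (auto simp: Z_def)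
  also have "\<dots> = exp (real L) * (\<Sum>z\<in>P. \<Prod>a<m. exp (- (real_of_int (z a))\<^sup>2))"
    by (simp add: sum_distrib_left exp_diff exp_minus exp_sum divide_inverse prod_inversef[symmetric])
  also have "(\<Sum>z\<in>P. \<Prod>a<m. exp (- (real_of_int (z a))\<^sup>2))
      = (\<Prod>a<m. \<Sum>y\<in>{-int L..int L}. exp (- (real_of_int y)\<^sup>2))"
    unfolding P_def by (subst prod_sum_PiE) auto
  also have "\<dots> \<le> (\<Prod>a<m. exp 2)"
  proof (intro prod_mono conjI)
    have "(\<Sum>y\<in>{-int L..int L}. exp (- (real_of_int y)\<^sup>2)) \<le> 3"
      using sum_exp_neg_square_le[of L] by (smt (verit) divide_nonneg_nonneg zero_le_power)
    also have "3 \<le> exp (2::real)" using exp_ge_add_one_self[of "2::real"] by simp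
    finally show "(\<Sum>y\<in>{-int L..int L}. exp (- (real_of_int y)\<^sup>2)) \<le> exp 2" .
  qed (auto intro: sum_nonneg)
  also have "(\<Prod>a<m. exp 2) = exp (2 * real m)"
    by (simp add: mult.commute[of 2] exp_of_nat_mult)
  also have "exp (real L) * exp (2 * real m) = exp (27 * real m)"
    by (simp add: L_def flip: exp_add)
  finally have card: "real (card N) \<le> exp (27 * real m)" by simp
  have ball: "(\<Sum>a<m. (b a)\<^sup>2) \<le> 1" if bN: "b \<in> N" for b
  proof -
    obtain z where z: "z \<in> Z" "b = (\<lambda>a. h * real_of_int (z a))" using bN by (auto simp: N_def)
    have "(\<Sum>a<m. (b a)\<^sup>2) = h\<^sup>2 * (\<Sum>a<m. (real_of_int (z a))\<^sup>2)"
      by (simp add: z power_mult_distrib sum_distrib_left)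
    also have "\<dots> \<le> h\<^sup>2 * real L" using z by (intro mult_left_mono) (auto simp: Z_def)
    also have "\<dots> = 1" using h(2) by (simp add: L_def)
    finally show ?thesis .
  qed
  have net: "\<exists>b'\<in>N. (\<Sum>a<m. (b a - b' a)\<^sup>2) \<le> 1 / 25" if b: "(\<Sum>a<m. (b a)\<^sup>2) \<le> 1" for b
  proof -
    have "\<forall>a. \<exists>z::int. \<bar>h * z\<bar> \<le> \<bar>b a\<bar> \<and> \<bar>b a - h * z\<bar> \<le> h"
      using round_to_zero[OF h(1)] by blast
    from choice[OF this] obtain z0 :: "nat \<Rightarrow> int"
      where z0: "\<And>a. \<bar>h * z0 a\<bar> \<le> \<bar>b a\<bar>" "\<And>a. \<bar>b a - h * z0 a\<bar> \<le> h" by blast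
    define z where "z = restrict z0 {..<m}"
    have "h\<^sup>2 * (\<Sum>a<m. (real_of_int (z a))\<^sup>2) = (\<Sum>a<m. (h * real_of_int (z0 a))\<^sup>2)"
      by (simp add: z_def power_mult_distrib sum_distrib_left)
    also have "\<dots> \<le> (\<Sum>a<m. (b a)\<^sup>2)" by (intro sum_mono) (use z0(1) abs_le_square_iff in blast)
    also have "\<dots> \<le> h\<^sup>2 * real L" using b h(2) by (simp add: L_def)
    finally have s: "(\<Sum>a<m. (real_of_int (z a))\<^sup>2) \<le> real L" using h(1) by simp
    have "z \<in> P"
      unfolding P_def
    proof (rule PiE_I)
      fix a assume a: "a \<in> {..<m}"
      have "(real_of_int (z a))\<^sup>2 \<le> (\<Sum>a<m. (real_of_int (z a))\<^sup>2)"
        using a by (intro member_le_sum) auto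
      with s have "(real_of_int (z a))\<^sup>2 \<le> real L" by simp
      then have "real_of_int ((z a)\<^sup>2) \<le> real_of_int (int L)" by simp
      then have 1: "(z a)\<^sup>2 \<le> int L" by (simp only: of_int_le_iff)
      have "\<bar>z a\<bar> \<le> \<bar>z a\<bar> * \<bar>z a\<bar>"
        using mult_right_mono[of 1 "\<bar>z a\<bar>" "\<bar>z a\<bar>"] by (cases "z a = 0") auto
      then have "\<bar>z a\<bar> \<le> (z a)\<^sup>2" by (simp add: power2_eq_square flip: abs_mult)
      with 1 have "\<bar>z a\<bar> \<le> int L" by simp
      then show "z a \<in> {-int L..int L}" by auto
    qed (auto simp: z_def)
    with s have "z \<in> Z" by (auto simp: Z_def)
    then have "(\<lambda>a. h * real_of_int (z a)) \<in> N" by (auto simp: N_def)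
    moreover have "(\<Sum>a<m. (b a - h * real_of_int (z a))\<^sup>2) \<le> 1 / 25"
    proof -
      have "(\<Sum>a<m. (b a - h * real_of_int (z a))\<^sup>2) \<le> (\<Sum>a<m. h\<^sup>2)"
        using z0(2) h(1) by (intro sum_mono) (auto simp: z_def abs_le_square_iff[symmetric])
      then show ?thesis using h(2) by (simp add: mult.commute)
    qed
    ultimately show ?thesis by (intro bexI[of _ "\<lambda>a. h * real_of_int (z a)"])
  qed
  have "finite N" unfolding N_def using finZ by simp
  with card ball net show ?thesis by (intro exI[of _ N]) auto
qed

text \<open>A coordinatewise grid. Each coordinate takes
  \<open>2 \<lfloor>1 / h\<rfloor> + 1\<close> values, which is at most \<open>3 / h\<close> because
  \<open>h \<le> 1\<close>.\<close>

lemma cube_net: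
  fixes h :: real and K :: "'k set"
  assumes h: "0 < h" "h \<le> 1" and K: "finite K"
  shows "\<exists>N :: ('k \<Rightarrow> real) set. finite N \<and> real (card N) \<le> (3 / h) ^ card K
     \<and> (\<forall>V. (\<forall>i\<in>K. \<bar>V i\<bar> \<le> 1) \<longrightarrow> (\<exists>V'\<in>N. \<forall>i\<in>K. \<bar>V i - V' i\<bar> \<le> h))"
proof -
  define n where "n = \<lfloor>1 / h\<rfloor>"
  have n: "real_of_int n \<le> 1 / h" "1 / h < real_of_int n + 1" "0 \<le> n"
    using h by (auto simp: n_def)
  define G where "G = (\<lambda>z. h * real_of_int z) ` {-n..n}"
  define N where "N = PiE K (\<lambda>_. G)"
  have finG: "finite G" by (simp add: G_def)
  have "real (card G) \<le> real (card {-n..n})" unfolding G_def using card_image_le[of "{-n..n}"] by simp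
  also have "\<dots> = 2 * real_of_int n + 1" using n by simp
  also have "\<dots> \<le> 2 * (1 / h) + 1 / h" using n h by (intro add_mono) (auto simp: field_simps)
  finally have cG: "real (card G) \<le> 3 / h" by simp
  have "real (card N) = real (card G) ^ card K"
    unfolding N_def by (simp add: card_PiE[OF K])
  also have "\<dots> \<le> (3 / h) ^ card K" by (intro power_mono cG) auto
  finally have card: "real (card N) \<le> (3 / h) ^ card K" .
  have "\<exists>V'\<in>N. \<forall>i\<in>K. \<bar>V i - V' i\<bar> \<le> h" if V: "\<forall>i\<in>K. \<bar>V i\<bar> \<le> 1" for V
  proof -
    have "\<forall>a. \<exists>z::int. \<bar>h * z\<bar> \<le> \<bar>V a\<bar> \<and> \<bar>V a - h * z\<bar> \<le> h"
      using round_to_zero[OF h(1)] by blast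
    from choice[OF this] obtain z :: "'k \<Rightarrow> int"
      where z: "\<And>a. \<bar>h * z a\<bar> \<le> \<bar>V a\<bar>" "\<And>a. \<bar>V a - h * z a\<bar> \<le> h" by blast
    have "h * z a \<in> G" if "a \<in> K" for a
    proof -
      have "h * \<bar>real_of_int (z a)\<bar> \<le> 1" using z(1)[of a] V that h(1) by (fastforce simp: abs_mult)
      then have "real_of_int \<bar>z a\<bar> \<le> 1 / h" using h(1) by (simp add: field_simps)
      then have "\<bar>z a\<bar> \<le> n" unfolding n_def by (simp only: le_floor_iff)
      then have "z a \<in> {-n..n}" by auto
      then show ?thesis by (auto simp: G_def)
    qed
    then have "restrict (\<lambda>a. h * z a) K \<in> N" by (auto simp: N_def)
    then show ?thesis using z(2) by (intro bexI[of _ "restrict (\<lambda>a. h * z a) K"]) auto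
  qed
  moreover have "finite N" unfolding N_def using K finG by (intro finite_PiE)
  ultimately show ?thesis using card by blast
qed

text \<open>With \<open>s\<close> the supremum of the form over the unit ball, polarisation bounds
  the bilinear form by \<open>s\<close>. Moving from \<open>x\<close> to a net point changes the
  value by at most \<open>2 / 5 * s\<close>, hence \<open>s \<le> \<eta> + 2 / 5 * s\<close> and
  \<open>s \<le> 2 * \<eta>\<close>.\<close>

lemma quadratic_form_on_net:
  fixes q :: "nat \<Rightarrow> nat \<Rightarrow> real"
  assumes sym: "\<And>a b. q a b = q b a"
    and net: "\<And>b. (\<Sum>a<m. (b a)\<^sup>2) \<le> 1 \<Longrightarrow> \<exists>b'\<in>N. (\<Sum>a<m. (b a - b' a)\<^sup>2) \<le> 1 / 25"
    and ball: "\<And>b. b \<in> N \<Longrightarrow> (\<Sum>a<m. (b a)\<^sup>2) \<le> 1"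
    and le: "\<And>b. b \<in> N \<Longrightarrow> \<bar>\<Sum>i<m. \<Sum>j<m. b i * q i j * b j\<bar> \<le> \<eta>"
  shows "\<bar>\<Sum>i<m. \<Sum>j<m. b i * q i j * b j\<bar> \<le> 2 * \<eta> * (\<Sum>a<m. (b a)\<^sup>2)"
proof -
  define B where "B x y = (\<Sum>i<m. \<Sum>j<m. x i * q i j * y j)" for x y :: "nat \<Rightarrow> real"
  define nr where "nr x = (\<Sum>a<m. (x a)\<^sup>2)" for x :: "nat \<Rightarrow> real"
  have Bsym: "B x y = B y x" for x y
  proof -
    have "B x y = (\<Sum>j<m. \<Sum>i<m. x i * q i j * y j)" unfolding B_def by (rule sum.swap)
    also have "\<dots> = (\<Sum>j<m. \<Sum>i<m. y j * q j i * x i)"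
      by (intro sum.cong refl) (metis mult.commute mult.left_commute sym)
    finally show ?thesis by (simp add: B_def)
  qed
  have Badd: "B (\<lambda>i. x i + y i) z = B x z + B y z" "B (\<lambda>i. x i - y i) z = B x z - B y z"
    "B (\<lambda>i. c * x i) z = c * B x z" for x y z c
    by (simp_all add: B_def algebra_simps sum.distrib sum_subtractf sum_distrib_left)
  have Badd': "B z (\<lambda>i. x i + y i) = B z x + B z y" "B z (\<lambda>i. x i - y i) = B z x - B z y"
    "B z (\<lambda>i. c * x i) = c * B z x" for x y z c
    using Badd(1,2)[of x y z] Badd(3)[of c x z] by (simp_all add: Bsym[of z])
  have nr0: "0 \<le> nr x" for x by (simp add: nr_def sum_nonneg)
  have nrc: "nr (\<lambda>i. c * x i) = c\<^sup>2 * nr x" for c x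
    by (simp add: nr_def power_mult_distrib sum_distrib_left)
  have par: "nr (\<lambda>i. x i + y i) + nr (\<lambda>i. x i - y i) = 2 * nr x + 2 * nr y" for x y
    unfolding nr_def sum_distrib_left sum.distrib[symmetric]
    by (intro sum.cong refl) (simp add: power2_sum power2_diff)
  have coord: "\<bar>x i\<bar> \<le> 1" if "nr x \<le> 1" "i < m" for x i
  proof -
    have "(x i)\<^sup>2 \<le> nr x" unfolding nr_def using that by (intro member_le_sum) auto
    with that have "(x i)\<^sup>2 \<le> 1" by simp
    then show ?thesis using abs_square_le_1 by blast
  qed
  define S where "S = (\<lambda>x. \<bar>B x x\<bar>) ` {x. nr x \<le> 1}"
  have "\<bar>B x x\<bar> \<le> (\<Sum>i<m. \<Sum>j<m. \<bar>q i j\<bar>)" if "nr x \<le> 1" for x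
  proof -
    have "\<bar>B x x\<bar> \<le> (\<Sum>i<m. \<Sum>j<m. \<bar>x i * q i j * x j\<bar>)"
      unfolding B_def by (rule order_trans[OF sum_abs]) (intro sum_mono sum_abs)
    also have "\<dots> \<le> (\<Sum>i<m. \<Sum>j<m. \<bar>q i j\<bar>)"
    proof (intro sum_mono)
      fix i j assume "i \<in> {..<m}" "j \<in> {..<m}"
      then have "\<bar>x i\<bar> \<le> 1" "\<bar>x j\<bar> \<le> 1" using coord[OF that] by auto
      then have "\<bar>x i\<bar> * \<bar>x j\<bar> \<le> 1" by (simp add: mult_le_one)
      then have "(\<bar>x i\<bar> * \<bar>x j\<bar>) * \<bar>q i j\<bar> \<le> 1 * \<bar>q i j\<bar>" by (intro mult_right_mono) auto
      then show "\<bar>x i * q i j * x j\<bar> \<le> \<bar>q i j\<bar>" by (simp add: abs_mult mult_ac)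
    qed
    finally show ?thesis .
  qed
  then have bdd: "bdd_above S" unfolding S_def by (auto intro!: bdd_aboveI2)
  define s where "s = Sup S"
  have s: "\<bar>B x x\<bar> \<le> s" if "nr x \<le> 1" for x
    unfolding s_def using bdd that by (intro cSup_upper) (auto simp: S_def)
  have S0: "S \<noteq> {}" unfolding S_def by (auto simp: nr_def intro!: exI[of _ "\<lambda>_. 0"])
  have s0: "0 \<le> s" using s[of "\<lambda>_. 0"] by (simp add: nr_def B_def)
  have sc: "\<bar>B x x\<bar> \<le> t * nr x" if t: "\<And>x. nr x \<le> 1 \<Longrightarrow> \<bar>B x x\<bar> \<le> t" for t x
  proof (cases "nr x = 0")
    case True
    then have "x i = 0" if "i < m" for i
      using that unfolding nr_def by (subst (asm) sum_nonneg_eq_0_iff) auto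
    then have "B x x = 0" by (simp add: B_def)
    then show ?thesis using True by simp
  next
    case False
    then have p: "nr x > 0" using nr0[of x] by simp
    define c where "c = 1 / sqrt (nr x)"
    have c2: "c\<^sup>2 * nr x = 1" using p by (simp add: c_def power_divide)
    have "\<bar>B (\<lambda>i. c * x i) (\<lambda>i. c * x i)\<bar> \<le> t" by (rule t) (simp add: nrc c2)
    then have "c\<^sup>2 * \<bar>B x x\<bar> \<le> t" by (simp add: Badd Badd' abs_mult power2_eq_square mult_ac)
    then have le: "nr x * (c\<^sup>2 * \<bar>B x x\<bar>) \<le> nr x * t" using p by (intro mult_left_mono) auto
    have "\<bar>B x x\<bar> = (c\<^sup>2 * nr x) * \<bar>B x x\<bar>" using c2 by simp
    also have "\<dots> = nr x * (c\<^sup>2 * \<bar>B x x\<bar>)" by (simp only: mult_ac)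
    also note le
    finally show ?thesis by (simp only: mult.commute)
  qed
  have bil: "\<bar>B x y\<bar> \<le> s / 2 * (nr x + nr y)" for x y
  proof -
    have "4 * B x y = B (\<lambda>i. x i + y i) (\<lambda>i. x i + y i) - B (\<lambda>i. x i - y i) (\<lambda>i. x i - y i)"
      by (simp add: Badd Badd' Bsym[of y x])
    then have "4 * \<bar>B x y\<bar> \<le> s * nr (\<lambda>i. x i + y i) + s * nr (\<lambda>i. x i - y i)"
      using sc[OF s, of "\<lambda>i. x i + y i"] sc[OF s, of "\<lambda>i. x i - y i"] by linarith
    also have "\<dots> = s * (2 * nr x + 2 * nr y)" by (simp only: par distrib_left[symmetric])
    finally show ?thesis by (simp add: algebra_simps)
  qed
  have "\<bar>B x x\<bar> \<le> \<eta> + 2 / 5 * s" if x: "nr x \<le> 1" for x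
  proof -
    obtain b' where b': "b' \<in> N" "nr (\<lambda>i. x i - b' i) \<le> 1 / 25" using net[of x] x by (auto simp: nr_def)
    have n': "nr b' \<le> 1" using ball[OF b'(1)] by (simp add: nr_def)
    have le': "\<bar>B b' b'\<bar> \<le> \<eta>" using le[OF b'(1)] by (simp add: B_def)
    have "B x x - B b' b' = B (\<lambda>i. x i - b' i) (\<lambda>i. x i + b' i)"
      by (simp add: Badd Badd' Bsym[of b' x])
    \<comment> \<open>The factor \<open>10\<close> balances the two arguments of the bilinear bound:
      the squared distance \<open>1 / 25\<close> grows to \<open>4\<close>, which is also the bound
      for the squared norm of \<open>x + b'\<close>.\<close>
    then have 1: "10 * (B x x - B b' b') = B (\<lambda>i. 10 * (x i - b' i)) (\<lambda>i. x i + b' i)"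
      using Badd(3)[of 10 "\<lambda>i. x i - b' i"] by simp
    have "10 * \<bar>B x x - B b' b'\<bar> \<le> s / 2 * (nr (\<lambda>i. 10 * (x i - b' i)) + nr (\<lambda>i. x i + b' i))"
      using bil[of "\<lambda>i. 10 * (x i - b' i)" "\<lambda>i. x i + b' i"] unfolding 1[symmetric] abs_mult by simp
    also have "\<dots> \<le> s / 2 * (4 + 4)"
    proof (intro mult_left_mono add_mono)
      show "nr (\<lambda>i. 10 * (x i - b' i)) \<le> 4" using b'(2) nrc[of 10 "\<lambda>i. x i - b' i"] by simp
      show "nr (\<lambda>i. x i + b' i) \<le> 4" using par[of x b'] nr0[of "\<lambda>i. x i - b' i"] x n' by linarith
    qed (use s0 in auto)
    finally have "10 * \<bar>B x x - B b' b'\<bar> \<le> 4 * s" by simp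
    then show ?thesis using le' abs_triangle_ineq[of "B x x - B b' b'" "B b' b'"] by simp
  qed
  then have "s \<le> \<eta> + 2 / 5 * s"
    unfolding s_def using S0 by (intro cSup_least) (auto simp: S_def s_def)
  moreover from this have "0 \<le> \<eta>" using s0 by linarith
  ultimately have "s \<le> 2 * \<eta>" by linarith
  then have "\<bar>B x x\<bar> \<le> 2 * \<eta>" if "nr x \<le> 1" for x using s[OF that] by linarith
  from sc[OF this, of b] show ?thesis by (simp add: B_def nr_def)
qed

abbreviation gauss :: "real \<Rightarrow> real measure" where
  "gauss \<sigma> \<equiv> density lborel (normal_density 0 \<sigma>)"

section \<open>Exponential moments and concentration\<close>

lemma nn_integral_normal_density:
  assumes "0 < \<sigma>"
  shows "(\<integral>\<^sup>+x. ennreal (normal_density \<mu> \<sigma> x) \<partial>lborel) = 1"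
  using integral_normal_density[OF assms, of \<mu>] integrable_normal_density[OF assms, of \<mu>]
  by (subst nn_integral_eq_integral) (auto simp: normal_density_nonneg)

lemma emeasure_gauss_singleton: "emeasure (gauss \<sigma>) {x} = 0"
proof -
  have "emeasure (gauss \<sigma>) {x} = (\<integral>\<^sup>+y. ennreal (normal_density 0 \<sigma> y) * indicator {x} y \<partial>lborel)"
    by (subst emeasure_density) auto
  also have "\<dots> = 0"
    by (subst nn_integral_0_iff_AE) (use AE_lborel_singleton[of x] in \<open>auto simp: indicator_def elim!: AE_mp\<close>)
  finally show ?thesis .
qed

lemma gauss_exp_linear:
  assumes "0 < \<sigma>"
  shows "(\<integral>\<^sup>+x. ennreal (exp (s * x)) \<partial>gauss \<sigma>) = ennreal (exp (s\<^sup>2 * \<sigma>\<^sup>2 / 2))"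
proof -
  have pt: "normal_density 0 \<sigma> x * exp (s * x) = exp (s\<^sup>2 * \<sigma>\<^sup>2 / 2) * normal_density (s * \<sigma>\<^sup>2) \<sigma> x" for x
  proof -
    have "- x\<^sup>2 / (2 * \<sigma>\<^sup>2) + s * x = s\<^sup>2 * \<sigma>\<^sup>2 / 2 + - (x - s * \<sigma>\<^sup>2)\<^sup>2 / (2 * \<sigma>\<^sup>2)"
      using assms by (simp add: field_simps power2_eq_square)
    then have "exp (- x\<^sup>2 / (2 * \<sigma>\<^sup>2)) * exp (s * x) = exp (s\<^sup>2 * \<sigma>\<^sup>2 / 2) * exp (- (x - s * \<sigma>\<^sup>2)\<^sup>2 / (2 * \<sigma>\<^sup>2))"
      by (simp only: exp_add[symmetric])
    then show ?thesis by (simp add: normal_density_def)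
  qed
  have "(\<integral>\<^sup>+x. ennreal (exp (s * x)) \<partial>gauss \<sigma>)
      = (\<integral>\<^sup>+x. ennreal (normal_density 0 \<sigma> x) * ennreal (exp (s * x)) \<partial>lborel)"
    by (subst nn_integral_density) auto
  also have "\<dots> = (\<integral>\<^sup>+x. ennreal (exp (s\<^sup>2 * \<sigma>\<^sup>2 / 2)) * ennreal (normal_density (s * \<sigma>\<^sup>2) \<sigma> x) \<partial>lborel)"
    by (intro nn_integral_cong) (simp add: ennreal_mult[symmetric] normal_density_nonneg pt)
  also have "\<dots> = ennreal (exp (s\<^sup>2 * \<sigma>\<^sup>2 / 2))"
    by (subst nn_integral_cmult) (auto simp: nn_integral_normal_density[OF assms])
  finally show ?thesis .
qed

lemma gauss_exp_square: "(\<integral>\<^sup>+x. ennreal (exp (x\<^sup>2 / 4)) \<partial>gauss 1) = ennreal (sqrt 2)"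
proof -
  have pt: "normal_density 0 1 x * exp (x\<^sup>2 / 4) = sqrt 2 * normal_density 0 (sqrt 2) x" for x :: real
  proof -
    have "- x\<^sup>2 / 2 + x\<^sup>2 / 4 = - x\<^sup>2 / 4" by simp
    then have "exp (- x\<^sup>2 / 2) * exp (x\<^sup>2 / 4) = exp (- x\<^sup>2 / 4)"
      by (simp only: exp_add[symmetric])
    then show ?thesis by (simp add: normal_density_def real_sqrt_mult field_simps)
  qed
  have "(\<integral>\<^sup>+x. ennreal (exp (x\<^sup>2 / 4)) \<partial>gauss 1)
      = (\<integral>\<^sup>+x. ennreal (normal_density 0 1 x) * ennreal (exp (x\<^sup>2 / 4)) \<partial>lborel)"
    by (subst nn_integral_density) auto
  also have "\<dots> = (\<integral>\<^sup>+x. ennreal (sqrt 2) * ennreal (normal_density 0 (sqrt 2) x) \<partial>lborel)"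
    by (intro nn_integral_cong) (simp add: ennreal_mult[symmetric] normal_density_nonneg pt)
  also have "\<dots> = ennreal (sqrt 2)"
    by (subst nn_integral_cmult) (auto simp: nn_integral_normal_density)
  finally show ?thesis .
qed

text \<open>The square in the exponent is linearised by \<open>exp (y\<^sup>2 / 2) = E exp (g y)\<close> for a standard
  Gaussian \<open>g\<close>; after Fubini only the assumed bound on the joint Laplace transform is needed.\<close>

lemma exp_sum_squares_le:
  fixes r :: nat and Y :: "nat \<Rightarrow> 'a \<Rightarrow> real"
  assumes M: "prob_space M" and \<rho>: "0 < \<rho>"
    and meas [measurable]: "\<And>a. a < r \<Longrightarrow> Y a \<in> borel_measurable M"
    and mgf: "\<And>s. (\<integral>\<^sup>+x. ennreal (exp (\<Sum>a<r. s a * Y a x)) \<partial>M) \<le> ennreal (exp ((\<Sum>a<r. (s a)\<^sup>2) * \<rho>\<^sup>2 / 2))"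
  shows "(\<integral>\<^sup>+x. ennreal (exp ((\<Sum>a<r. (Y a x)\<^sup>2) / (4 * \<rho>\<^sup>2))) \<partial>M) \<le> ennreal (sqrt 2 ^ r)"
proof -
  interpret M: prob_space M by fact
  define N where "N = gauss 1"
  have pN: "prob_space N" unfolding N_def by (rule prob_space_normal_density) simp
  have sN [measurable_cong]: "sets N = sets borel" by (simp add: N_def)
  have mN: "borel_measurable N = (borel_measurable borel :: (real \<Rightarrow> real) set)"
    by (rule measurable_cong_sets[OF sN refl])
  interpret N: product_prob_space "\<lambda>_::nat. N" by (simp add: product_prob_space_def product_prob_space_axioms_def product_sigma_finite_def pN prob_space_imp_sigma_finite)
  define G where "G = PiM {..<r} (\<lambda>_::nat. N)"
  interpret G: prob_space G unfolding G_def by (intro prob_space_PiM pN)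
  interpret P: pair_sigma_finite M G ..
  \<comment> \<open>This scale linearises \<open>Y^2 / (4 \<rho>^2)\<close>. After the Laplace bound
    it leaves the exponent \<open>g^2 / 4\<close> per coordinate, whose Gaussian expectation is
    \<open>sqrt 2\<close>.\<close>
  define t where "t = 1 / (sqrt 2 * \<rho>)"
  have t2: "t\<^sup>2 / 2 = 1 / (4 * \<rho>\<^sup>2)" "t\<^sup>2 * \<rho>\<^sup>2 = 1 / 2"
    using \<rho> by (auto simp: t_def power_divide power_mult_distrib)
  have lin: "ennreal (exp (\<Sum>a<r. c a)) = (\<Prod>a<r. ennreal (exp (c a)))" for c :: "nat \<Rightarrow> real"
    by (simp add: exp_sum prod_ennreal)
  have comp [measurable]: "(\<lambda>g. g a) \<in> borel_measurable G" if "a < r" for a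
    using measurable_component_singleton[of a "{..<r}" "\<lambda>_. N"] that
    by (simp add: G_def cong: measurable_cong_sets[OF refl sN])
  have pt: "ennreal (exp ((\<Sum>a<r. (Y a x)\<^sup>2) / (4 * \<rho>\<^sup>2)))
      = (\<integral>\<^sup>+g. ennreal (exp (\<Sum>a<r. (t * g a) * Y a x)) \<partial>G)" for x
  proof -
    have "ennreal (exp ((\<Sum>a<r. (Y a x)\<^sup>2) / (4 * \<rho>\<^sup>2))) = (\<Prod>a<r. ennreal (exp ((t * Y a x)\<^sup>2 * 1\<^sup>2 / 2)))"
      unfolding lin[symmetric] using t2(1) by (simp add: sum_divide_distrib power_mult_distrib)
    also have "\<dots> = (\<Prod>a<r. \<integral>\<^sup>+y. ennreal (exp (t * Y a x * y)) \<partial>N)"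
      unfolding N_def by (subst gauss_exp_linear) auto
    also have "\<dots> = (\<integral>\<^sup>+g. (\<Prod>a<r. ennreal (exp (t * Y a x * g a))) \<partial>G)"
      unfolding G_def by (subst N.product_nn_integral_prod) (auto simp: mN)
    also have "\<dots> = (\<integral>\<^sup>+g. ennreal (exp (\<Sum>a<r. (t * g a) * Y a x)) \<partial>G)"
      unfolding lin[symmetric] by (simp add: mult_ac)
    finally show ?thesis .
  qed
  have "(\<integral>\<^sup>+x. ennreal (exp ((\<Sum>a<r. (Y a x)\<^sup>2) / (4 * \<rho>\<^sup>2))) \<partial>M)
      = (\<integral>\<^sup>+x. \<integral>\<^sup>+g. ennreal (exp (\<Sum>a<r. (t * g a) * Y a x)) \<partial>G \<partial>M)"
    by (simp add: pt)
  also have "\<dots> = (\<integral>\<^sup>+g. \<integral>\<^sup>+x. ennreal (exp (\<Sum>a<r. (t * g a) * Y a x)) \<partial>M \<partial>G)"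
    by (subst P.Fubini') auto
  also have "\<dots> \<le> (\<integral>\<^sup>+g. ennreal (exp ((\<Sum>a<r. (t * g a)\<^sup>2) * \<rho>\<^sup>2 / 2)) \<partial>G)"
    by (intro nn_integral_mono mgf)
  also have "\<dots> = (\<integral>\<^sup>+g. (\<Prod>a<r. ennreal (exp ((g a)\<^sup>2 / 4))) \<partial>G)"
  proof (intro nn_integral_cong)
    fix g :: "nat \<Rightarrow> real"
    have "(\<Sum>a<r. (t * g a)\<^sup>2) * \<rho>\<^sup>2 / 2 = (\<Sum>a<r. (g a)\<^sup>2) * (t\<^sup>2 * \<rho>\<^sup>2) / 2"
      by (simp add: power_mult_distrib sum_distrib_left mult_ac)
    also have "\<dots> = (\<Sum>a<r. (g a)\<^sup>2 / 4)" unfolding t2 by (simp add: sum_divide_distrib)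
    finally show "ennreal (exp ((\<Sum>a<r. (t * g a)\<^sup>2) * \<rho>\<^sup>2 / 2)) = (\<Prod>a<r. ennreal (exp ((g a)\<^sup>2 / 4)))"
      by (simp add: lin)
  qed
  also have "\<dots> = (\<Prod>a<r. \<integral>\<^sup>+y. ennreal (exp (y\<^sup>2 / 4)) \<partial>N)"
    unfolding G_def by (subst N.product_nn_integral_prod) (auto simp: mN)
  also have "\<dots> = ennreal (sqrt 2 ^ r)"
    unfolding N_def by (simp add: gauss_exp_square ennreal_power)
  finally show ?thesis .
qed

lemma exp_le_quadratic: "exp x \<le> 1 + x + x\<^sup>2 / 2 * exp \<bar>x\<bar>" for x :: real
proof (cases "x = 0")
  case False
  then obtain t where t: "\<bar>t\<bar> < \<bar>x\<bar>" "exp x = (\<Sum>m<2. x ^ m / fact m) + exp t / fact 2 * x ^ 2"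
    using Maclaurin_exp_lt[of x 2] by auto
  have "exp t \<le> exp \<bar>x\<bar>" using t(1) by simp
  then have "exp t * x\<^sup>2 \<le> exp \<bar>x\<bar> * x\<^sup>2" by (intro mult_right_mono) auto
  then show ?thesis using t(2) by (simp add: lessThan_Suc numeral_2_eq_2 algebra_simps)
qed simp

text \<open>The linear term of the expansion integrates to zero because \<open>Y\<close> has second
  moment \<open>1\<close>, and the quadratic remainder is dominated by \<open>exp (a Y^2)\<close>.
  The first conclusion follows from \<open>1 + a \<le> E exp (a Y^2) \<le> sqrt 2\<close>; it makes
  \<open>exp a \<le> 2\<close>, and \<open>12 = 4 * 2 * (3 / 2)\<close>. It also says that unit
  variance keeps \<open>\<rho>\<close> away from zero.\<close>

lemma exp_centered_square_le:
  fixes Y :: "'a \<Rightarrow> real"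
  assumes M: "prob_space M" and \<rho>: "0 < \<rho>"
    and meas [measurable]: "Y \<in> borel_measurable M"
    and mgf: "\<And>s. (\<integral>\<^sup>+x. ennreal (exp (s * Y x)) \<partial>M) \<le> ennreal (exp (s\<^sup>2 * \<rho>\<^sup>2 / 2))"
    and int: "integrable M (\<lambda>x. (Y x)\<^sup>2)" and var: "(\<integral>x. (Y x)\<^sup>2 \<partial>M) = 1"
    and a_def: "a = 1 / (4 * \<rho>\<^sup>2)"
  shows "a \<le> 1 / 2"
    and "\<bar>l\<bar> \<le> a / 2 \<Longrightarrow> (\<integral>\<^sup>+x. ennreal (exp (l * ((Y x)\<^sup>2 - 1))) \<partial>M) \<le> ennreal (exp (12 * l\<^sup>2 / a\<^sup>2))"
proof -
  interpret M: prob_space M by fact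
  have a0: "0 < a" using \<rho> by (simp add: a_def)
  have "(\<integral>\<^sup>+x. ennreal (exp ((\<Sum>i<(1::nat). (Y x)\<^sup>2) / (4 * \<rho>\<^sup>2))) \<partial>M) \<le> ennreal (sqrt 2 ^ 1)"
    by (rule exp_sum_squares_le[OF M \<rho>]) (use mgf in \<open>auto\<close>)
  then have E: "(\<integral>\<^sup>+x. ennreal (exp (a * (Y x)\<^sup>2)) \<partial>M) \<le> ennreal (sqrt 2)"
    by (simp add: a_def)
  have iE: "integrable M (\<lambda>x. exp (a * (Y x)\<^sup>2))"
    using E by (intro integrableI_bounded) (auto simp: top.not_eq_extremum intro: le_less_trans)
  have E': "(\<integral>x. exp (a * (Y x)\<^sup>2) \<partial>M) \<le> sqrt 2"
    using E by (subst (asm) nn_integral_eq_integral[OF iE]) auto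
  have s2: "sqrt 2 \<le> 3 / 2" by (rule real_le_lsqrt) (auto simp: power2_eq_square)
  have "1 + a = (\<integral>x. 1 + a * (Y x)\<^sup>2 \<partial>M)" using int var by (simp add: M.prob_space)
  also have "\<dots> \<le> (\<integral>x. exp (a * (Y x)\<^sup>2) \<partial>M)"
    using int by (intro integral_mono iE) (auto simp: exp_ge_add_one_self)
  finally show a2: "a \<le> 1 / 2" using E' s2 by simp
  assume l: "\<bar>l\<bar> \<le> a / 2"
  define K where "K = l\<^sup>2 * (4 / a\<^sup>2) * exp a"
  have K0: "0 \<le> K" by (simp add: K_def)
  have pt: "exp (l * (y\<^sup>2 - 1)) \<le> 1 + l * (y\<^sup>2 - 1) + K * exp (a * y\<^sup>2)" for y
  proof -
    define u where "u = y\<^sup>2 - 1"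
    have u: "\<bar>u\<bar> \<le> y\<^sup>2 + 1" by (simp add: u_def abs_le_iff)
    \<comment> \<open>The factor \<open>u^2\<close> is traded for one half of the available exponent
      and \<open>exp \<bar>l * u\<bar>\<close> uses the other half. Together they give
      \<open>exp (a * \<bar>u\<bar>)\<close>, which is integrable since
      \<open>\<bar>u\<bar> \<le> y^2 + 1\<close>.\<close>
    have "(a / 2 * \<bar>u\<bar>)\<^sup>2 / 2 \<le> exp (a / 2 * \<bar>u\<bar>)"
    proof -
      have "0 \<le> a / 2 * \<bar>u\<bar>" using a0 by simp
      from exp_lower_Taylor_quadratic[OF this] this show ?thesis by linarith
    qed
    then have u2: "u\<^sup>2 \<le> 8 / a\<^sup>2 * exp (a / 2 * \<bar>u\<bar>)"
      using a0 by (simp add: power_mult_distrib power_divide field_simps)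
    have lu: "\<bar>l * u\<bar> \<le> a / 2 * \<bar>u\<bar>" unfolding abs_mult using l by (intro mult_right_mono) auto
    have "(l * u)\<^sup>2 / 2 * exp \<bar>l * u\<bar> = l\<^sup>2 / 2 * (u\<^sup>2 * exp \<bar>l * u\<bar>)" by (simp add: power_mult_distrib)
    also have "\<dots> \<le> l\<^sup>2 / 2 * ((8 / a\<^sup>2 * exp (a / 2 * \<bar>u\<bar>)) * exp (a / 2 * \<bar>u\<bar>))"
      using u2 lu by (intro mult_left_mono mult_mono) auto
    also have "\<dots> = l\<^sup>2 * (4 / a\<^sup>2) * exp (a * \<bar>u\<bar>)"
      by (simp add: exp_add[symmetric] mult.assoc)
    also have "\<dots> \<le> l\<^sup>2 * (4 / a\<^sup>2) * exp (a * (y\<^sup>2 + 1))"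
      using u a0 by (intro mult_left_mono) auto
    also have "\<dots> = K * exp (a * y\<^sup>2)" by (simp add: K_def distrib_left exp_add mult_ac)
    finally show ?thesis using exp_le_quadratic[of "l * u"] by (simp add: u_def)
  qed
  have "(\<integral>\<^sup>+x. ennreal (exp (l * ((Y x)\<^sup>2 - 1))) \<partial>M)
      \<le> (\<integral>\<^sup>+x. ennreal (1 + l * ((Y x)\<^sup>2 - 1) + K * exp (a * (Y x)\<^sup>2)) \<partial>M)"
    by (intro nn_integral_mono ennreal_leI pt)
  also have "\<dots> = ennreal (\<integral>x. 1 + l * ((Y x)\<^sup>2 - 1) + K * exp (a * (Y x)\<^sup>2) \<partial>M)"
    using int iE by (intro nn_integral_eq_integral) (auto intro!: order_trans[OF _ pt])
  also have "(\<integral>x. 1 + l * ((Y x)\<^sup>2 - 1) + K * exp (a * (Y x)\<^sup>2) \<partial>M) = 1 + K * (\<integral>x. exp (a * (Y x)\<^sup>2) \<partial>M)"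
    using int iE var by (simp add: M.prob_space)
  also have "\<dots> \<le> 1 + K * sqrt 2" using E' K0 by (intro add_left_mono mult_left_mono)
  also have "\<dots> \<le> 1 + (l\<^sup>2 * (4 / a\<^sup>2) * 2) * (3 / 2)"
  proof -
    have "exp a \<le> exp (1 / 2)" using a2 by simp
    also have "\<dots> \<le> 2" by (rule exp_half_le2)
    finally have "K \<le> l\<^sup>2 * (4 / a\<^sup>2) * 2" unfolding K_def by (intro mult_left_mono) auto
    then show ?thesis using s2 by (intro add_left_mono mult_mono) auto
  qed
  also have "\<dots> = 1 + 12 * l\<^sup>2 / a\<^sup>2" by simp
  also have "\<dots> \<le> exp (12 * l\<^sup>2 / a\<^sup>2)" by (rule exp_ge_add_one_self)
  finally show "(\<integral>\<^sup>+x. ennreal (exp (l * ((Y x)\<^sup>2 - 1))) \<partial>M) \<le> ennreal (exp (12 * l\<^sup>2 / a\<^sup>2))"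
    by (simp add: ennreal_leI)
qed

lemma nn_integral_PiM_prod_le:
  assumes M: "\<And>i. prob_space (M i)" and I: "finite I" and J: "J \<subseteq> I"
    and meas: "\<And>j. j \<in> J \<Longrightarrow> f j \<in> borel_measurable (M j)"
    and le: "\<And>j. j \<in> J \<Longrightarrow> (\<integral>\<^sup>+x. f j x \<partial>M j) \<le> C"
  shows "(\<integral>\<^sup>+\<omega>. (\<Prod>j\<in>J. f j (\<omega> j)) \<partial>PiM I M) \<le> C ^ card J"
proof -
  interpret product_prob_space M I
    by (simp add: product_prob_space_def product_prob_space_axioms_def product_sigma_finite_def M prob_space_imp_sigma_finite)
  define g where "g i = (if i \<in> J then f i else (\<lambda>_. 1))" for i
  have "(\<integral>\<^sup>+\<omega>. (\<Prod>j\<in>J. f j (\<omega> j)) \<partial>PiM I M) = (\<integral>\<^sup>+\<omega>. (\<Prod>i\<in>I. g i (\<omega> i)) \<partial>PiM I M)"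
  proof (intro nn_integral_cong)
    fix \<omega>
    show "(\<Prod>j\<in>J. f j (\<omega> j)) = (\<Prod>i\<in>I. g i (\<omega> i))"
      using I J by (intro prod.mono_neutral_cong_left) (auto simp: g_def)
  qed
  also have "\<dots> = (\<Prod>i\<in>I. \<integral>\<^sup>+x. g i x \<partial>M i)"
    using meas by (intro product_nn_integral_prod I) (auto simp: g_def)
  also have "\<dots> = (\<Prod>j\<in>J. \<integral>\<^sup>+x. f j x \<partial>M j)"
    using I J M by (intro prod.mono_neutral_cong_right) (auto simp: g_def prob_space.emeasure_space_1)
  also have "\<dots> \<le> C ^ card J"
    using finite_subset[OF J I] le by (induction J rule: finite_induct) (auto intro!: mult_mono)
  finally show ?thesis .
qed

lemma emeasure_Chernoff:
  assumes [measurable]: "g \<in> borel_measurable M" and le: "(\<integral>\<^sup>+x. ennreal (exp (g x)) \<partial>M) \<le> ennreal C" and C: "0 \<le> C"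
  shows "emeasure M {x\<in>space M. t \<le> g x} \<le> ennreal (C * exp (- t))"
proof -
  have "{x\<in>space M. t \<le> g x} = {x\<in>space M. 1 \<le> ennreal (exp (- t)) * ennreal (exp (g x))}"
    by (auto simp: ennreal_mult[symmetric] exp_add[symmetric])
  also have "emeasure M \<dots> \<le> ennreal (exp (- t)) * (\<integral>\<^sup>+x. ennreal (exp (g x)) * indicator (space M) x \<partial>M)"
    by (rule order_trans[OF nn_integral_Markov_inequality]) auto
  also have "\<dots> \<le> ennreal (exp (- t)) * ennreal C"
    using le by (intro mult_left_mono) (auto simp: nn_integral_indicator_singleton cong: nn_integral_cong_simp)
  finally show ?thesis using C by (simp add: ennreal_mult[symmetric] mult.commute)
qed

lemma sum_squares_concentration:
  fixes Y :: "'i \<Rightarrow> 'b \<Rightarrow> real"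
  assumes M: "\<And>i. prob_space (M i)" and I: "finite I" and J: "J \<subseteq> I" and \<rho>: "0 < \<rho>"
    and meas: "\<And>j. j \<in> J \<Longrightarrow> Y j \<in> borel_measurable (M j)"
    and mgf: "\<And>j s. j \<in> J \<Longrightarrow> (\<integral>\<^sup>+x. ennreal (exp (s * Y j x)) \<partial>M j) \<le> ennreal (exp (s\<^sup>2 * \<rho>\<^sup>2 / 2))"
    and int: "\<And>j. j \<in> J \<Longrightarrow> integrable (M j) (\<lambda>x. (Y j x)\<^sup>2)"
    and var: "\<And>j. j \<in> J \<Longrightarrow> (\<integral>x. (Y j x)\<^sup>2 \<partial>M j) = 1"
    and J0: "J \<noteq> {}"
  shows "emeasure (PiM I M) {\<omega> \<in> space (PiM I M). real (card J) / 20 \<le> \<bar>(\<Sum>j\<in>J. (Y j (\<omega> j))\<^sup>2) - real (card J)\<bar>}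
      \<le> ennreal (2 * exp (- (real (card J) / (307200 * \<rho> ^ 4))))"
proof -
  let ?n = "real (card J)"
  define a where "a = 1 / (4 * \<rho>\<^sup>2)"
  have a0: "0 < a" using \<rho> by (simp add: a_def)
  obtain j0 where j0: "j0 \<in> J" using J0 by blast
  note Q = exp_centered_square_le[OF M \<rho> meas mgf int var a_def]
  have a2: "a \<le> 1 / 2" using Q(1)[OF j0 j0 j0 j0] .
  \<comment> \<open>Minimiser of the exponent \<open>12 l^2 / a^2 - l / 20\<close>. The minimum is
    \<open>- a^2 / 19200\<close>, and \<open>a^2 = 1 / (16 \<rho>^4)\<close> turns this into the
    rate \<open>1 / (307200 \<rho>^4)\<close>.\<close>
  define l where "l = a\<^sup>2 / 480"
  have "a * a \<le> a * 1" using a2 a0 by (intro mult_left_mono) auto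
  then have l: "0 \<le> l" "l \<le> a / 2" using a0 by (simp_all add: l_def power2_eq_square)
  have [measurable]: "(\<lambda>\<omega>. Y j (\<omega> j)) \<in> borel_measurable (PiM I M)" if "j \<in> J" for j
    using measurable_compose[OF measurable_component_singleton[of j I M] meas] that J by auto
  have tail: "emeasure (PiM I M) {\<omega> \<in> space (PiM I M). l * (?n / 20) \<le> (\<Sum>j\<in>J. e * l * ((Y j (\<omega> j))\<^sup>2 - 1))}
      \<le> ennreal (exp (- (?n / (307200 * \<rho> ^ 4))))" if e: "e = 1 \<or> e = -1" for e
  proof -
    define C where "C = exp (12 * l\<^sup>2 / a\<^sup>2)"
    have "(\<integral>\<^sup>+\<omega>. ennreal (exp (\<Sum>j\<in>J. e * l * ((Y j (\<omega> j))\<^sup>2 - 1))) \<partial>PiM I M)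
        = (\<integral>\<^sup>+\<omega>. (\<Prod>j\<in>J. ennreal (exp (e * l * ((Y j (\<omega> j))\<^sup>2 - 1)))) \<partial>PiM I M)"
      using finite_subset[OF J I] by (simp add: exp_sum prod_ennreal)
    also have "\<dots> \<le> ennreal C ^ card J"
    proof (rule nn_integral_PiM_prod_le[OF M I J])
      fix j assume j: "j \<in> J"
      show "(\<lambda>x. ennreal (exp (e * l * ((Y j x)\<^sup>2 - 1)))) \<in> borel_measurable (M j)" using meas[OF j] by simp
      show "(\<integral>\<^sup>+x. ennreal (exp (e * l * ((Y j x)\<^sup>2 - 1))) \<partial>M j) \<le> ennreal C"
        using Q(2)[OF j j j j, of "e * l"] l e by (auto simp: C_def)
    qed
    also have "\<dots> = ennreal (C ^ card J)" by (simp add: C_def ennreal_power)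
    finally have "emeasure (PiM I M) {\<omega> \<in> space (PiM I M). l * (?n / 20) \<le> (\<Sum>j\<in>J. e * l * ((Y j (\<omega> j))\<^sup>2 - 1))}
        \<le> ennreal (C ^ card J * exp (- (l * (?n / 20))))"
      by (intro emeasure_Chernoff) (auto simp: C_def)
    also have "C ^ card J * exp (- (l * (?n / 20))) = exp (- (?n / (307200 * \<rho> ^ 4)))"
    proof -
      have "?n * (12 * l\<^sup>2 / a\<^sup>2) + - (l * (?n / 20)) = - (?n * (a\<^sup>2 / 19200))"
        using a0 by (simp add: l_def power2_eq_square field_simps)
      also have "\<dots> = - (?n * ((1 / (16 * \<rho> ^ 4)) / 19200))"
        by (simp add: a_def power_divide power_mult_distrib flip: power_mult)
      finally have "?n * (12 * l\<^sup>2 / a\<^sup>2) + - (l * (?n / 20)) = - (?n / (307200 * \<rho> ^ 4))" by simp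
      then show ?thesis unfolding C_def exp_of_nat_mult[symmetric] exp_add[symmetric] by simp
    qed
    finally show ?thesis .
  qed
  let ?A = "\<lambda>e. {\<omega> \<in> space (PiM I M). l * (?n / 20) \<le> (\<Sum>j\<in>J. e * l * ((Y j (\<omega> j))\<^sup>2 - 1))}"
  have "{\<omega> \<in> space (PiM I M). ?n / 20 \<le> \<bar>(\<Sum>j\<in>J. (Y j (\<omega> j))\<^sup>2) - ?n\<bar>} \<subseteq> ?A 1 \<union> ?A (-1)"
  proof
    fix \<omega> assume \<omega>: "\<omega> \<in> {\<omega> \<in> space (PiM I M). ?n / 20 \<le> \<bar>(\<Sum>j\<in>J. (Y j (\<omega> j))\<^sup>2) - ?n\<bar>}"
    define s where "s = (\<Sum>j\<in>J. (Y j (\<omega> j))\<^sup>2) - ?n"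
    have s: "(\<Sum>j\<in>J. e * l * ((Y j (\<omega> j))\<^sup>2 - 1)) = l * (e * s)" for e
      by (simp add: s_def sum_distrib_left[symmetric] sum_subtractf)
    have "?n / 20 \<le> \<bar>s\<bar>" using \<omega> by (simp add: s_def)
    then have "?n / 20 \<le> 1 * s \<or> ?n / 20 \<le> -1 * s" by linarith
    then have "l * (?n / 20) \<le> l * (1 * s) \<or> l * (?n / 20) \<le> l * (-1 * s)"
      using l(1) mult_left_mono by blast
    then show "\<omega> \<in> ?A 1 \<union> ?A (-1)" using \<omega> s[of 1] s[of "-1"] by auto
  qed
  then have "emeasure (PiM I M) {\<omega> \<in> space (PiM I M). ?n / 20 \<le> \<bar>(\<Sum>j\<in>J. (Y j (\<omega> j))\<^sup>2) - ?n\<bar>}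
      \<le> emeasure (PiM I M) (?A 1 \<union> ?A (-1))" by (intro emeasure_mono) auto
  also have "\<dots> \<le> emeasure (PiM I M) (?A 1) + emeasure (PiM I M) (?A (-1))"
    by (intro emeasure_subadditive) auto
  also have "\<dots> \<le> ennreal (exp (- (?n / (307200 * \<rho> ^ 4)))) + ennreal (exp (- (?n / (307200 * \<rho> ^ 4))))"
    by (intro add_mono tail) auto
  also have "\<dots> = ennreal (2 * exp (- (?n / (307200 * \<rho> ^ 4))))" by (simp add: ennreal_plus[symmetric] del: ennreal_plus)
  finally show ?thesis .
qed

section \<open>Product measures: regrouping of coordinates and null sets\<close>

lemma product_prob_spaceI: "(\<And>i. prob_space (M i)) \<Longrightarrow> product_prob_space M"
  by (simp add: product_prob_space_def product_prob_space_axioms_def product_sigma_finite_def prob_space_imp_sigma_finite)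

text \<open>Joins separately drawn covariates and noise into the pairs that form the coordinates of
  \<open>sample_space\<close>.\<close>

definition zip_fun :: "'i set \<Rightarrow> ('i \<Rightarrow> 'a) \<times> ('i \<Rightarrow> 'b) \<Rightarrow> 'i \<Rightarrow> 'a \<times> 'b" where
  "zip_fun I xz = (\<lambda>i\<in>I. (fst xz i, snd xz i))"

lemma zip_fun_apply [simp]: "i \<in> I \<Longrightarrow> zip_fun I (x, z) i = (x i, z i)"
  by (simp add: zip_fun_def)

lemma measurable_zip_fun [measurable]:
  "zip_fun I \<in> measurable (PiM I p \<Otimes>\<^sub>M PiM I q) (PiM I (\<lambda>i. p i \<Otimes>\<^sub>M q i))"
  unfolding zip_fun_def by measurable

text \<open>A section of a rectangle of pairs is a rectangle of sections, so Fubini over the first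
  block factorises. This separates all covariates from all noise, and conditioning on the covariates
  becomes taking sections.\<close>

lemma distr_zip_fun:
  assumes p: "\<And>i. prob_space (p i)" and q: "\<And>i. prob_space (q i)" and I: "finite I"
  shows "distr (PiM I p \<Otimes>\<^sub>M PiM I q) (PiM I (\<lambda>i. p i \<Otimes>\<^sub>M q i)) (zip_fun I) = PiM I (\<lambda>i. p i \<Otimes>\<^sub>M q i)"
proof -
  interpret p: product_prob_space p I by (rule product_prob_spaceI[OF p])
  interpret q: product_prob_space q I by (rule product_prob_spaceI[OF q])
  have pq: "prob_space (p i \<Otimes>\<^sub>M q i)" for i using prob_space_pair[OF p q] .
  interpret pq: product_prob_space "\<lambda>i. p i \<Otimes>\<^sub>M q i" I by (rule product_prob_spaceI[OF pq])
  have Q: "prob_space (PiM I q)" by (intro prob_space_PiM q)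
  show ?thesis
  proof (rule pq.PiM_eqI[OF I])
    fix A assume A: "\<And>i. i \<in> I \<Longrightarrow> A i \<in> sets (p i \<Otimes>\<^sub>M q i)"
    let ?S = "zip_fun I -` (PiE I A) \<inter> space (PiM I p \<Otimes>\<^sub>M PiM I q)"
    have PA: "PiE I A \<in> sets (PiM I (\<lambda>i. p i \<Otimes>\<^sub>M q i))" using A I by (intro sets_PiM_I_finite) auto
    have S: "?S \<in> sets (PiM I p \<Otimes>\<^sub>M PiM I q)" using measurable_sets[OF measurable_zip_fun PA] .
    have "emeasure (distr (PiM I p \<Otimes>\<^sub>M PiM I q) (PiM I (\<lambda>i. p i \<Otimes>\<^sub>M q i)) (zip_fun I)) (PiE I A)
        = emeasure (PiM I p \<Otimes>\<^sub>M PiM I q) ?S" by (rule emeasure_distr[OF measurable_zip_fun PA])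
    also have "\<dots> = (\<integral>\<^sup>+x. emeasure (PiM I q) (Pair x -` ?S) \<partial>PiM I p)"
      by (rule sigma_finite_measure.emeasure_pair_measure_alt[OF prob_space_imp_sigma_finite[OF Q] S])
    also have "\<dots> = (\<integral>\<^sup>+x. (\<Prod>i\<in>I. emeasure (q i) (Pair (x i) -` A i)) \<partial>PiM I p)"
    proof (intro nn_integral_cong)
      fix x assume x: "x \<in> space (PiM I p)"
      have "Pair x -` ?S = PiE I (\<lambda>i. Pair (x i) -` A i)"
      proof (intro equalityI subsetI)
        fix z assume "z \<in> Pair x -` ?S"
        then show "z \<in> PiE I (\<lambda>i. Pair (x i) -` A i)"
          by (auto simp: space_pair_measure space_PiM PiE_iff zip_fun_def split: if_splits)
      next
        fix z assume z: "z \<in> PiE I (\<lambda>i. Pair (x i) -` A i)"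
        have "z i \<in> space (q i)" if "i \<in> I" for i
          using z that sets.sets_into_space[OF A[OF that]] by (auto simp: PiE_iff space_pair_measure)
        then show "z \<in> Pair x -` ?S" using x z
          by (auto simp: space_pair_measure space_PiM PiE_iff zip_fun_def)
      qed
      then show "emeasure (PiM I q) (Pair x -` ?S) = (\<Prod>i\<in>I. emeasure (q i) (Pair (x i) -` A i))"
        using A I by (simp add: q.emeasure_PiM sets_Pair1)
    qed
    also have "\<dots> = (\<Prod>i\<in>I. \<integral>\<^sup>+x. emeasure (q i) (Pair x -` A i) \<partial>p i)"
    proof (rule p.product_nn_integral_prod[OF I])
      fix i assume "i \<in> I"
      show "(\<lambda>x. emeasure (q i) (Pair x -` A i)) \<in> borel_measurable (p i)"
        using sigma_finite_measure.measurable_emeasure_Pair[OF prob_space_imp_sigma_finite[OF q] A[OF \<open>i \<in> I\<close>]] .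
    qed
    also have "\<dots> = (\<Prod>i\<in>I. emeasure (p i \<Otimes>\<^sub>M q i) (A i))"
    proof (intro prod.cong refl)
      fix i assume "i \<in> I"
      show "(\<integral>\<^sup>+x. emeasure (q i) (Pair x -` A i) \<partial>p i) = emeasure (p i \<Otimes>\<^sub>M q i) (A i)"
        using sigma_finite_measure.emeasure_pair_measure_alt[OF prob_space_imp_sigma_finite[OF q] A[OF \<open>i \<in> I\<close>]] by simp
    qed
    finally show "emeasure (distr (PiM I p \<Otimes>\<^sub>M PiM I q) (PiM I (\<lambda>i. p i \<Otimes>\<^sub>M q i)) (zip_fun I)) (PiE I A)
        = (\<Prod>i\<in>I. emeasure (p i \<Otimes>\<^sub>M q i) (A i))" .
  qed simp
qed

text \<open>Fubini with coordinate \<open>j\<close> innermost: each line parallel to axis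
  \<open>j\<close> meets \<open>B\<close> in at most one point, and \<open>N\<close> has no
  atoms.\<close>

lemma null_set_PiM_one_point:
  fixes N :: "real measure"
  assumes N: "prob_space N" and sN: "sets N = sets borel" and atom: "\<And>x. emeasure N {x} = 0"
    and J: "finite J" "j \<in> J" and B: "B \<in> sets (PiM J (\<lambda>_. N))"
    and one: "\<And>z s. z \<in> B \<Longrightarrow> s \<noteq> z j \<Longrightarrow> z(j := s) \<notin> B"
  shows "emeasure (PiM J (\<lambda>_. N)) B = 0"
proof -
  define J' where "J' = J - {j}"
  have J': "J = insert j J'" "j \<notin> J'" "finite J'" using J by (auto simp: J'_def)
  interpret N: product_prob_space "\<lambda>_. N" by (rule product_prob_spaceI[OF N])
  have "emeasure (PiM J (\<lambda>_. N)) B = (\<integral>\<^sup>+x. indicator B x \<partial>PiM (insert j J') (\<lambda>_. N))"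
    using B by (simp add: J'(1))
  also have "\<dots> = (\<integral>\<^sup>+x. \<integral>\<^sup>+y. indicator B (x(j := y)) \<partial>N \<partial>PiM J' (\<lambda>_. N))"
    using B J' by (intro N.product_nn_integral_insert) auto
  also have "\<dots> = (\<integral>\<^sup>+x. 0 \<partial>PiM J' (\<lambda>_. N))"
  proof (intro nn_integral_cong)
    fix x
    have "\<exists>c. {y. x(j := y) \<in> B} \<subseteq> {c}"
      using one[of "x(j := _)" ] by (metis (mono_tags, lifting) fun_upd_same fun_upd_upd mem_Collect_eq singletonI subsetI)
    then obtain c where c: "{y. x(j := y) \<in> B} \<subseteq> {c}" by blast
    have "(\<integral>\<^sup>+y. indicator B (x(j := y)) \<partial>N) \<le> (\<integral>\<^sup>+y. indicator {c} y \<partial>N)"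
      using c by (intro nn_integral_mono) (auto simp: indicator_def)
    also have "\<dots> = 0" using atom[of c] by (simp add: sN)
    finally show "(\<integral>\<^sup>+y. indicator B (x(j := y)) \<partial>N) = 0" by simp
  qed
  finally show ?thesis by simp
qed

text \<open>Induction on the coordinates. With coordinate \<open>j\<close> frozen at
  \<open>z0 j\<close> the function is almost surely nonzero in the remaining ones; at such a point
  the affine function of coordinate \<open>j\<close> is not identically zero and so has at most one
  root. The application is a determinant as a function of the noise.\<close>

lemma AE_multiaffine_nonzero:
  fixes N :: "real measure" and F :: "('j \<Rightarrow> real) \<Rightarrow> real"
  assumes N: "prob_space N" and sN: "sets N = sets borel" and atom: "\<And>x. emeasure N {x} = 0"
    and J: "finite J"
    and "F \<in> borel_measurable (PiM J (\<lambda>_. N))"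
    and "\<And>j z. j \<in> J \<Longrightarrow> \<exists>\<alpha> \<beta>. \<forall>s. F (z(j := s)) = \<alpha> + \<beta> * s"
    and "z0 \<in> extensional J" "F z0 \<noteq> 0"
  shows "AE z in PiM J (\<lambda>_. N). F z \<noteq> 0"
  using J assms(5-)
proof (induction J arbitrary: F z0 rule: finite_induct)
  case empty
  then show ?case by (intro AE_I2) (auto simp: space_PiM)
next
  case (insert j J)
  interpret N: product_prob_space "\<lambda>_. N" by (rule product_prob_spaceI[OF N])
  interpret NN: prob_space N by (rule N)
  note F [measurable] = insert.prems(1)
  have upd: "(\<lambda>(z, y). z(j := y)) \<in> measurable (PiM J (\<lambda>_. N) \<Otimes>\<^sub>M N) (PiM (insert j J) (\<lambda>_. N))"
    by (rule measurable_add_dim)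
  have spN: "space N = UNIV" using sets_eq_imp_space_eq[OF sN] by simp
  have meas2: "(\<lambda>p. F ((fst p)(j := snd p))) \<in> borel_measurable (PiM J (\<lambda>_. N) \<Otimes>\<^sub>M N)"
    using measurable_compose[OF upd F] by (simp add: split_beta)
  define G where "G z = F (z(j := z0 j))" for z
  have "AE z in PiM J (\<lambda>_. N). G z \<noteq> 0"
  proof (rule insert.IH[of G "restrict z0 J"])
    have "(\<lambda>z. (z, z0 j)) \<in> measurable (PiM J (\<lambda>_. N)) (PiM J (\<lambda>_. N) \<Otimes>\<^sub>M N)"
      by (intro measurable_Pair) (auto simp: spN)
    from measurable_compose[OF this meas2] show "G \<in> borel_measurable (PiM J (\<lambda>_. N))"
      by (simp add: G_def[abs_def])
    show "\<exists>\<alpha> \<beta>. \<forall>s. G (z(i := s)) = \<alpha> + \<beta> * s" if "i \<in> J" for i z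
    proof -
      have "i \<noteq> j" using that insert.hyps by blast
      then have "G (z(i := s)) = F ((z(j := z0 j))(i := s))" for s
        by (simp add: G_def fun_upd_twist)
      then show ?thesis using insert.prems(2)[of i "z(j := z0 j)"] that by (simp only: insert_iff simp_thms)
    qed
    have "(restrict z0 J)(j := z0 j) = z0"
      using insert.prems(3) insert.hyps by (auto simp: fun_eq_iff extensional_def restrict_def)
    then show "G (restrict z0 J) \<noteq> 0" using insert.prems(4) by (simp add: G_def)
  qed (rule restrict_extensional)
  moreover have "(\<integral>\<^sup>+y. indicator {0} (F (z(j := y))) \<partial>N) = 0" if "G z \<noteq> 0" for z
  proof -
    obtain \<alpha> \<beta> where ab: "\<And>s. F (z(j := s)) = \<alpha> + \<beta> * s" using insert.prems(2)[of j z] by blast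
    have "\<exists>c. {y. F (z(j := y)) = 0} \<subseteq> {c}"
    proof (rule exI[of _ "- \<alpha> / \<beta>"], intro subsetI)
      fix y assume "y \<in> {y. F (z(j := y)) = 0}"
      then have y: "\<alpha> + \<beta> * y = 0" by (simp add: ab)
      have "\<beta> \<noteq> 0" using y \<open>G z \<noteq> 0\<close> by (auto simp: G_def ab)
      with y show "y \<in> {- \<alpha> / \<beta>}" by (simp add: field_simps)
    qed
    then obtain c where c: "{y. F (z(j := y)) = 0} \<subseteq> {c}" by blast
    have "(\<integral>\<^sup>+y. indicator {0} (F (z(j := y))) \<partial>N) \<le> (\<integral>\<^sup>+y. indicator {c} y \<partial>N)"
      using c by (intro nn_integral_mono) (auto simp: indicator_def)
    also have "\<dots> = 0" using atom[of c] by (simp add: sN)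
    finally show ?thesis by simp
  qed
  ultimately have AE: "AE z in PiM J (\<lambda>_. N). (\<integral>\<^sup>+y. indicator {0} (F (z(j := y))) \<partial>N) = 0" by auto
  have "(\<integral>\<^sup>+z. indicator {0} (F z) \<partial>PiM (insert j J) (\<lambda>_. N))
      = (\<integral>\<^sup>+z. \<integral>\<^sup>+y. indicator {0} (F (z(j := y))) \<partial>N \<partial>PiM J (\<lambda>_. N))"
    using insert.hyps by (intro N.product_nn_integral_insert) auto
  also have "\<dots> = 0"
  proof (subst nn_integral_0_iff_AE)
    have "(\<lambda>p. indicator {0} (F ((fst p)(j := snd p))) :: ennreal) \<in> borel_measurable (PiM J (\<lambda>_. N) \<Otimes>\<^sub>M N)"
      using measurable_compose[OF meas2, of "indicator {0}" borel] by simp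
    from sigma_finite_measure.borel_measurable_nn_integral[OF prob_space_imp_sigma_finite[OF N], of "\<lambda>z y. indicator {0} (F (z(j := y)))", unfolded split_beta, OF this]
    show "(\<lambda>z. \<integral>\<^sup>+y. indicator {0} (F (z(j := y))) \<partial>N) \<in> borel_measurable (PiM J (\<lambda>_. N))" .
  qed (use AE in auto)
  finally have "AE z in PiM (insert j J) (\<lambda>_. N). (indicator {0} (F z) :: ennreal) = 0"
    by (subst (asm) nn_integral_0_iff_AE) auto
  then show ?case by (auto simp: indicator_def elim!: AE_mp split: if_splits)
qed

lemma emeasure_finite_union_le:
  assumes "finite A" and "\<And>a. a \<in> A \<Longrightarrow> F a \<in> sets M"
    and "\<And>a. a \<in> A \<Longrightarrow> emeasure M (F a) \<le> ennreal C" and "real (card A) \<le> D" "0 \<le> C"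
  shows "emeasure M (\<Union>a\<in>A. F a) \<le> ennreal (D * C)"
proof -
  have "emeasure M (\<Union>a\<in>A. F a) \<le> (\<Sum>a\<in>A. emeasure M (F a))"
    using assms by (intro emeasure_subadditive_finite) auto
  also have "\<dots> \<le> (\<Sum>a\<in>A. ennreal C)" by (intro sum_mono assms)
  also have "\<dots> = ennreal (real (card A) * C)"
    using assms by (simp add: ennreal_of_nat_eq_real_of_nat ennreal_mult)
  also have "\<dots> \<le> ennreal (D * C)" using assms by (intro ennreal_leI mult_right_mono) auto
  finally show ?thesis .
qed

section \<open>Uniform bounds for noise and for empirical covariances\<close>

lemma rational_approximation:
  fixes r :: "'a \<Rightarrow> real"
  shows "\<exists>R :: nat \<Rightarrow> 'a \<Rightarrow> real. (\<forall>n. R n \<in> PiE A (\<lambda>_. \<rat>)) \<and> (\<forall>a\<in>A. (\<lambda>n. R n a) \<longlonglongrightarrow> r a)"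
proof -
  have "\<forall>n a. \<exists>q. q \<in> \<rat> \<and> r a < q \<and> q < r a + 1 / real (Suc n)"
    using Rats_dense_in_real by (metis add.commute less_add_same_cancel2 of_nat_0_less_iff zero_less_Suc zero_less_divide_1_iff)
  then obtain q where q: "\<And>n a. q n a \<in> \<rat>" "\<And>n a. r a < q n a" "\<And>n a. q n a < r a + 1 / real (Suc n)"
    by metis
  have lim: "(\<lambda>n. q n a) \<longlonglongrightarrow> r a" for a
  proof (rule real_tendsto_sandwich)
    show "(\<lambda>n. r a) \<longlonglongrightarrow> r a" by simp
    show "(\<lambda>n. r a + 1 / real (Suc n)) \<longlonglongrightarrow> r a"
      using tendsto_add[OF tendsto_const[of "r a"] LIMSEQ_inverse_real_of_nat] by (simp add: inverse_eq_divide)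
  qed (use q in \<open>auto intro!: always_eventually less_imp_le\<close>)
  show ?thesis
    using q lim by (intro exI[of _ "\<lambda>n. restrict (q n) A"]) auto
qed

text \<open>For fixed \<open>x\<close> the vectors \<open>\<phi> a x\<close> span a space of
  dimension \<open>r \<le> card A\<close>. By Cauchy-Schwarz the inequality holds for all
  coefficients as soon as the squared projection of the noise onto that space is at most
  \<open>K\<close>, and this projection has the exponential moment \<open>sqrt 2 ^ r\<close>.
  Integrating the section bound over \<open>x\<close> finishes, since it does not depend on
  \<open>x\<close>.\<close>

lemma noise_concentration:
  fixes \<phi> :: "'a \<Rightarrow> 'x \<Rightarrow> 'j \<Rightarrow> real"
  assumes MX: "prob_space MX" and A: "finite A" and J: "finite J" and \<sigma>: "0 < \<sigma>" and K: "0 \<le> K"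
    and meas [measurable]: "\<And>a j. a \<in> A \<Longrightarrow> j \<in> J \<Longrightarrow> (\<lambda>x. \<phi> a x j) \<in> borel_measurable MX"
  shows "\<exists>E\<in>sets (MX \<Otimes>\<^sub>M PiM J (\<lambda>_. gauss \<sigma>)).
     emeasure (MX \<Otimes>\<^sub>M PiM J (\<lambda>_. gauss \<sigma>)) (space (MX \<Otimes>\<^sub>M PiM J (\<lambda>_. gauss \<sigma>)) - E)
       \<le> ennreal (sqrt 2 ^ card A * exp (- (K / (4 * \<sigma>\<^sup>2))))
     \<and> (\<forall>(x, z)\<in>E. \<forall>r. (\<Sum>j\<in>J. z j * (\<Sum>a\<in>A. r a * \<phi> a x j))\<^sup>2 \<le> K * (\<Sum>j\<in>J. (\<Sum>a\<in>A. r a * \<phi> a x j)\<^sup>2))"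
proof -
  define N where "N = gauss \<sigma>"
  have pN: "prob_space N" unfolding N_def by (rule prob_space_normal_density[OF \<sigma>])
  have sN [measurable_cong]: "sets N = sets borel" by (simp add: N_def)
  interpret N: product_prob_space "\<lambda>_. N" by (rule product_prob_spaceI[OF pN])
  define Z where "Z = PiM J (\<lambda>_. N)"
  have pZ: "prob_space Z" unfolding Z_def by (intro prob_space_PiM pN)
  have comp [measurable]: "(\<lambda>z. z j) \<in> borel_measurable Z" if "j \<in> J" for j
    using measurable_component_singleton[of j J "\<lambda>_. N"] that
    by (simp add: Z_def cong: measurable_cong_sets[OF refl sN])
  define lhs where "lhs r x z = (\<Sum>j\<in>J. z j * (\<Sum>a\<in>A. r a * \<phi> a x j))\<^sup>2" for r x z
  define rhs where "rhs r x = K * (\<Sum>j\<in>J. (\<Sum>a\<in>A. r a * \<phi> a x j)\<^sup>2)" for r x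
  \<comment> \<open>Rational coefficients make \<open>E\<close> a countable intersection and hence
    measurable; both sides are continuous in the coefficients, so \<open>all\<close> recovers the
    real ones.\<close>
  define Q where "Q = PiE A (\<lambda>_. \<rat> :: real set)"
  have cQ: "countable Q" unfolding Q_def by (intro countable_PiE A countable_rat)
  define E where "E = {p\<in>space (MX \<Otimes>\<^sub>M Z). \<forall>r\<in>Q. lhs r (fst p) (snd p) \<le> rhs r (fst p)}"
  have E: "E \<in> sets (MX \<Otimes>\<^sub>M Z)"
  proof -
    have "E = space (MX \<Otimes>\<^sub>M Z) - (\<Union>r\<in>Q. {p\<in>space (MX \<Otimes>\<^sub>M Z). rhs r (fst p) < lhs r (fst p) (snd p)})"
      by (auto simp: E_def)
    also have "\<dots> \<in> sets (MX \<Otimes>\<^sub>M Z)"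
      using cQ by (intro sets.Diff sets.top sets.countable_UN') (auto simp: lhs_def rhs_def)
    finally show ?thesis .
  qed
  have all: "lhs r x z \<le> rhs r x" if xz: "(x, z) \<in> E" for r x z
  proof -
    obtain R where R: "\<And>n. R n \<in> Q" "\<And>a. a \<in> A \<Longrightarrow> (\<lambda>n. R n a) \<longlonglongrightarrow> r a"
      using rational_approximation[of A r] unfolding Q_def by blast
    show ?thesis
    proof (rule LIMSEQ_le)
      show "(\<lambda>n. lhs (R n) x z) \<longlonglongrightarrow> lhs r x z"
        unfolding lhs_def using R(2) by (intro tendsto_intros) auto
      show "(\<lambda>n. rhs (R n) x) \<longlonglongrightarrow> rhs r x"
        unfolding rhs_def using R(2) by (intro tendsto_intros) auto
      show "\<exists>N. \<forall>n\<ge>N. lhs (R n) x z \<le> rhs (R n) x" using xz R(1) by (auto simp: E_def)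
    qed
  qed
  have sect: "emeasure Z (Pair x -` (space (MX \<Otimes>\<^sub>M Z) - E)) \<le> ennreal (sqrt 2 ^ card A * exp (- (K / (4 * \<sigma>\<^sup>2))))" for x
  proof -
    obtain r :: nat and u where r: "r \<le> card A"
      and on: "\<And>a b. a < r \<Longrightarrow> b < r \<Longrightarrow> ip J (u a) (u b) = (if a = b then 1 else 0)"
      and span: "\<And>a. a \<in> A \<Longrightarrow> \<exists>c. \<forall>j\<in>J. \<phi> a x j = (\<Sum>b<r. c b * u b j)"
      using orthonormalize[OF J A, of "\<lambda>a. \<phi> a x"] by blast
    from span have "\<forall>a. \<exists>c. a \<in> A \<longrightarrow> (\<forall>j\<in>J. \<phi> a x j = (\<Sum>b<r. c b * u b j))" by blast
    from choice[OF this] obtain c where c: "\<And>a j. a \<in> A \<Longrightarrow> j \<in> J \<Longrightarrow> \<phi> a x j = (\<Sum>b<r. c a b * u b j)" by blast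
    define g where "g z = (\<Sum>b<r. (ip J (u b) z)\<^sup>2) / (4 * \<sigma>\<^sup>2)" for z
    have mip [measurable]: "ip J (u b) \<in> borel_measurable Z" for b
      unfolding ip_def[abs_def] by measurable
    have key: "lhs q x z \<le> (\<Sum>b<r. (ip J (u b) z)\<^sup>2) * (\<Sum>j\<in>J. (\<Sum>a\<in>A. q a * \<phi> a x j)\<^sup>2)" for q z
    proof -
      define \<beta> where "\<beta> b = (\<Sum>a\<in>A. q a * c a b)" for b
      have w: "(\<Sum>a\<in>A. q a * \<phi> a x j) = (\<Sum>b<r. \<beta> b * u b j)" if "j \<in> J" for j
      proof -
        have "(\<Sum>a\<in>A. q a * \<phi> a x j) = (\<Sum>a\<in>A. \<Sum>b<r. q a * (c a b * u b j))"
          using c that by (simp add: sum_distrib_left)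
        also have "\<dots> = (\<Sum>b<r. \<beta> b * u b j)"
          by (subst sum.swap) (simp add: \<beta>_def sum_distrib_right mult.assoc)
        finally show ?thesis .
      qed
      have "(\<Sum>j\<in>J. z j * (\<Sum>a\<in>A. q a * \<phi> a x j)) = ip J (\<lambda>j. \<Sum>b<r. \<beta> b * u b j) z"
        unfolding ip_def by (intro sum.cong) (auto simp: w)
      also have "\<dots> = (\<Sum>b<r. \<beta> b * ip J (u b) z)" by (rule ip_sum_left)
      finally have "lhs q x z = (\<Sum>b<r. \<beta> b * ip J (u b) z)\<^sup>2" by (simp add: lhs_def)
      also have "\<dots> \<le> (\<Sum>b<r. (\<beta> b)\<^sup>2) * (\<Sum>b<r. (ip J (u b) z)\<^sup>2)" by (rule Cauchy_Schwarz_ineq_sum)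
      also have "(\<Sum>b<r. (\<beta> b)\<^sup>2) = (\<Sum>j\<in>J. (\<Sum>a\<in>A. q a * \<phi> a x j)\<^sup>2)"
      proof -
        have "(\<Sum>b<r. (\<beta> b)\<^sup>2) = ip J (\<lambda>j. \<Sum>b<r. \<beta> b * u b j) (\<lambda>j. \<Sum>b<r. \<beta> b * u b j)"
          by (rule ip_orthonormal_norm[OF on, symmetric])
        also have "\<dots> = (\<Sum>j\<in>J. (\<Sum>a\<in>A. q a * \<phi> a x j)\<^sup>2)"
          unfolding ip_def by (intro sum.cong) (auto simp: w power2_eq_square)
        finally show ?thesis .
      qed
      finally show ?thesis by (simp add: mult.commute)
    qed
    have "Pair x -` (space (MX \<Otimes>\<^sub>M Z) - E) \<subseteq> {z\<in>space Z. K / (4 * \<sigma>\<^sup>2) \<le> g z}"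
    proof
      fix z assume "z \<in> Pair x -` (space (MX \<Otimes>\<^sub>M Z) - E)"
      then obtain q where z: "z \<in> space Z" and q: "rhs q x < lhs q x z"
        by (auto simp: E_def space_pair_measure not_le)
      have "K \<le> (\<Sum>b<r. (ip J (u b) z)\<^sup>2)"
      proof (rule ccontr)
        assume "\<not> ?thesis"
        then have "(\<Sum>b<r. (ip J (u b) z)\<^sup>2) * (\<Sum>j\<in>J. (\<Sum>a\<in>A. q a * \<phi> a x j)\<^sup>2) \<le> rhs q x"
          unfolding rhs_def by (intro mult_right_mono sum_nonneg) auto
        with key[of q z] q show False by linarith
      qed
      then show "z \<in> {z\<in>space Z. K / (4 * \<sigma>\<^sup>2) \<le> g z}" using z by (simp add: g_def divide_right_mono)
    qed
    then have "emeasure Z (Pair x -` (space (MX \<Otimes>\<^sub>M Z) - E)) \<le> emeasure Z {z\<in>space Z. K / (4 * \<sigma>\<^sup>2) \<le> g z}"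
      by (intro emeasure_mono) (auto simp: g_def)
    also have "\<dots> \<le> ennreal (sqrt 2 ^ r * exp (- (K / (4 * \<sigma>\<^sup>2))))"
    proof (rule emeasure_Chernoff)
      show "(\<integral>\<^sup>+z. ennreal (exp (g z)) \<partial>Z) \<le> ennreal (sqrt 2 ^ r)"
        unfolding g_def
      proof (rule exp_sum_squares_le[OF pZ \<sigma>])
        fix s :: "nat \<Rightarrow> real"
        define w where "w j = (\<Sum>b<r. s b * u b j)" for j
        have "(\<integral>\<^sup>+z. ennreal (exp (\<Sum>b<r. s b * ip J (u b) z)) \<partial>Z) = (\<integral>\<^sup>+z. (\<Prod>j\<in>J. ennreal (exp (w j * z j))) \<partial>Z)"
          using J by (simp add: ip_sum_left[symmetric] prod_ennreal exp_sum[symmetric]) (simp add: ip_def w_def)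
        also have "\<dots> = (\<Prod>j\<in>J. \<integral>\<^sup>+y. ennreal (exp (w j * y)) \<partial>N)"
          unfolding Z_def by (intro N.product_nn_integral_prod J) (auto simp: measurable_cong_sets[OF sN refl])
        also have "\<dots> = (\<Prod>j\<in>J. ennreal (exp ((w j)\<^sup>2 * \<sigma>\<^sup>2 / 2)))"
          by (simp add: N_def gauss_exp_linear[OF \<sigma>])
        also have "\<dots> = ennreal (exp (ip J w w * \<sigma>\<^sup>2 / 2))"
          using J by (simp add: prod_ennreal exp_sum[symmetric] ip_def sum_distrib_right sum_divide_distrib power2_eq_square)
        also have "ip J w w = (\<Sum>b<r. (s b)\<^sup>2)" unfolding w_def by (rule ip_orthonormal_norm[OF on])
        finally show "(\<integral>\<^sup>+z. ennreal (exp (\<Sum>b<r. s b * ip J (u b) z)) \<partial>Z) \<le> ennreal (exp ((\<Sum>b<r. (s b)\<^sup>2) * \<sigma>\<^sup>2 / 2))"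
          by simp
      qed auto
    qed (auto simp: g_def)
    also have "\<dots> \<le> ennreal (sqrt 2 ^ card A * exp (- (K / (4 * \<sigma>\<^sup>2))))"
      using r by (intro ennreal_leI mult_right_mono power_increasing) auto
    finally show ?thesis .
  qed
  have "emeasure (MX \<Otimes>\<^sub>M Z) (space (MX \<Otimes>\<^sub>M Z) - E) = (\<integral>\<^sup>+x. emeasure Z (Pair x -` (space (MX \<Otimes>\<^sub>M Z) - E)) \<partial>MX)"
    using E by (intro sigma_finite_measure.emeasure_pair_measure_alt prob_space_imp_sigma_finite[OF pZ]) auto
  also have "\<dots> \<le> (\<integral>\<^sup>+x. ennreal (sqrt 2 ^ card A * exp (- (K / (4 * \<sigma>\<^sup>2)))) \<partial>MX)"
    by (intro nn_integral_mono sect)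
  also have "\<dots> = ennreal (sqrt 2 ^ card A * exp (- (K / (4 * \<sigma>\<^sup>2))))"
    using prob_space.emeasure_space_1[OF MX] by simp
  finally show ?thesis
    using E all unfolding Z_def N_def lhs_def rhs_def by (intro bexI[of _ E]) (auto simp: Z_def N_def)
qed

text \<open>The price is the dimension \<open>m\<close> of the relevant span, not \<open>d\<close>:
  the \<open>B a\<close> are orthonormalised in the geometry of \<open>S\<close> through its factor
  \<open>R\<close>, and a net of the resulting \<open>r\<close>-dimensional ball suffices. The
  deviation \<open>1 / 20\<close> on the net becomes \<open>1 / 10\<close> on the whole span.
  \<open>S\<close> may be singular, so directions of variance zero need a separate null
  event.\<close>

lemma covariance_concentration:
  fixes X :: "'i \<Rightarrow> 'b \<Rightarrow> nat \<Rightarrow> real"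
  assumes M: "\<And>i. prob_space (M i)" and I: "finite I" and J: "J \<subseteq> I" "J \<noteq> {}" and \<rho>: "0 < \<rho>"
    and S: "\<And>i j. i < d \<Longrightarrow> j < d \<Longrightarrow> S i j = (\<Sum>l<d. R i l * R j l)"
    and meas: "\<And>j l. j \<in> J \<Longrightarrow> l < d \<Longrightarrow> (\<lambda>x. X j x l) \<in> borel_measurable (M j)"
    and mgf: "\<And>j v. j \<in> J \<Longrightarrow> (\<integral>\<^sup>+x. ennreal (exp (\<Sum>l<d. v l * X j x l)) \<partial>M j) \<le> ennreal (exp (qform d S v * \<rho>\<^sup>2 / 2))"
    and int: "\<And>j v. j \<in> J \<Longrightarrow> integrable (M j) (\<lambda>x. (\<Sum>l<d. v l * X j x l)\<^sup>2)"
    and var: "\<And>j v. j \<in> J \<Longrightarrow> (\<integral>x. (\<Sum>l<d. v l * X j x l)\<^sup>2 \<partial>M j) = qform d S v"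
  shows "\<exists>E\<in>sets (PiM I M).
     emeasure (PiM I M) (space (PiM I M) - E)
       \<le> ennreal (exp (27 * real m) * (2 * exp (- (real (card J) / (307200 * \<rho> ^ 4)))))
     \<and> (\<forall>\<omega>\<in>E. \<forall>b v. (\<forall>l<d. v l = (\<Sum>a<m. b a * B a l)) \<longrightarrow>
          \<bar>(\<Sum>j\<in>J. (\<Sum>l<d. v l * X j (\<omega> j) l)\<^sup>2) - real (card J) * qform d S v\<bar> \<le> real (card J) / 10 * qform d S v)"
proof -
  let ?n = "real (card J)"
  have finJ: "finite J" using J(1) I finite_subset by blast
  then have n: "0 < ?n" using J(2) by (simp add: card_gt_0_iff)
  define D where "D = {..<d}"
  define Rt where "Rt v l = (\<Sum>i<d. v i * R i l)" for v :: "nat \<Rightarrow> real" and l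
  define dt where "dt v x = ip D v x" for v x :: "nat \<Rightarrow> real"
  have dtsum: "(\<Sum>l<d. v l * x l) = dt v x" for v x by (simp add: dt_def ip_def D_def)
  have qf: "qform d S v = ip D (Rt v) (Rt v)" for v
  proof -
    have "qform d S v = (\<Sum>i<d. \<Sum>j<d. \<Sum>l<d. (v i * R i l) * (v j * R j l))"
      unfolding qform_def by (intro sum.cong) (auto simp: S sum_distrib_left sum_distrib_right mult_ac)
    also have "\<dots> = (\<Sum>i<d. \<Sum>l<d. \<Sum>j<d. (v i * R i l) * (v j * R j l))" by (intro sum.cong refl sum.swap)
    also have "\<dots> = (\<Sum>l<d. \<Sum>i<d. \<Sum>j<d. (v i * R i l) * (v j * R j l))" by (rule sum.swap)
    also have "\<dots> = ip D (Rt v) (Rt v)" by (simp add: ip_def D_def Rt_def sum_product)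
    finally show ?thesis .
  qed
  have Rts: "Rt v l = (\<Sum>a\<in>A. c a * Rt (w a) l)" if "\<And>i. i < d \<Longrightarrow> v i = (\<Sum>a\<in>A. c a * w a i)" for v l c and A :: "nat set" and w
  proof -
    have "Rt v l = (\<Sum>i<d. \<Sum>a\<in>A. c a * (w a i * R i l))"
      unfolding Rt_def by (intro sum.cong) (auto simp: that sum_distrib_right sum_distrib_left mult_ac)
    also have "\<dots> = (\<Sum>a\<in>A. c a * Rt (w a) l)" by (subst sum.swap) (simp add: Rt_def sum_distrib_left)
    finally show ?thesis .
  qed
  obtain r :: nat and u where r: "r \<le> card {..<m}"
    and on: "\<And>a b. a < r \<Longrightarrow> b < r \<Longrightarrow> ip D (u a) (u b) = (if a = b then 1 else 0)"
    and span: "\<And>a. a \<in> {..<m} \<Longrightarrow> \<exists>c. \<forall>l\<in>D. Rt (B a) l = (\<Sum>b<r. c b * u b l)"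
    and span': "\<And>b. b < r \<Longrightarrow> \<exists>e. \<forall>l\<in>D. u b l = (\<Sum>a<m. e a * Rt (B a) l)"
    using orthonormalize[of D "{..<m}" "\<lambda>a. Rt (B a)"] unfolding D_def by blast
  from span have "\<forall>a. \<exists>c. a < m \<longrightarrow> (\<forall>l\<in>D. Rt (B a) l = (\<Sum>b<r. c b * u b l))" by blast
  from choice[OF this] obtain c where c: "\<And>a l. a < m \<Longrightarrow> l \<in> D \<Longrightarrow> Rt (B a) l = (\<Sum>b<r. c a b * u b l)" by blast
  from span' have "\<forall>b. \<exists>e. b < r \<longrightarrow> (\<forall>l\<in>D. u b l = (\<Sum>a<m. e a * Rt (B a) l))" by blast
  from choice[OF this] obtain e where e: "\<And>b l. b < r \<Longrightarrow> l \<in> D \<Longrightarrow> u b l = (\<Sum>a<m. e b a * Rt (B a) l)" by blast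
  define V where "V b l = (\<Sum>a<m. e b a * B a l)" for b l
  have RV: "Rt (V b) l = u b l" if "b < r" "l \<in> D" for b l
    using e[OF that] Rts[where v = "V b" and A = "{..<m}" and c = "e b" and w = B and l = l] by (simp add: V_def)
  \<comment> \<open>The part of \<open>B a\<close> that the orthonormalisation loses. Its form
    vanishes, so almost surely every sample is orthogonal to it.\<close>
  define W where "W a l = B a l - (\<Sum>b<r. c a b * V b l)" for a l
  have qW: "qform d S (W a) = 0" if "a < m" for a
  proof -
    have "Rt (W a) l = 0" if l: "l \<in> D" for l
    proof -
      have "Rt (W a) l = Rt (B a) l - Rt (\<lambda>l. \<Sum>b<r. c a b * V b l) l"
        by (simp add: Rt_def W_def left_diff_distrib sum_subtractf)
      also have "Rt (\<lambda>l. \<Sum>b<r. c a b * V b l) l = (\<Sum>b<r. c a b * Rt (V b) l)" by (rule Rts) simp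
      also have "\<dots> = Rt (B a) l" using c[OF \<open>a < m\<close> l] RV l by simp
      finally show ?thesis by simp
    qed
    then show ?thesis by (simp add: qf ip_def)
  qed
  obtain N :: "(nat \<Rightarrow> real) set" where N: "finite N" "real (card N) \<le> exp (27 * real r)"
     "\<And>b. b \<in> N \<Longrightarrow> (\<Sum>a<r. (b a)\<^sup>2) \<le> 1"
     "\<And>b. (\<Sum>a<r. (b a)\<^sup>2) \<le> 1 \<Longrightarrow> \<exists>b'\<in>N. (\<Sum>a<r. (b a - b' a)\<^sup>2) \<le> 1 / 25"
    using unit_ball_net[of r] by blast
  define vv where "vv b l = (\<Sum>a<r. b a * V a l)" for b l
  have qvv: "qform d S (vv b) = (\<Sum>a<r. (b a)\<^sup>2)" for b
  proof -
    have "qform d S (vv b) = ip D (\<lambda>l. \<Sum>a<r. b a * u a l) (\<lambda>l. \<Sum>a<r. b a * u a l)"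
      unfolding qf by (intro ip_cong) (auto simp: Rts[where v = "vv b" and A = "{..<r}" and c = b and w = V] vv_def RV)
    also have "\<dots> = (\<Sum>a<r. (b a)\<^sup>2)" by (rule ip_orthonormal_norm[OF on])
    finally show ?thesis .
  qed
  have mdt [measurable]: "(\<lambda>\<omega>. dt v (X j (\<omega> j))) \<in> borel_measurable (PiM I M)" if "j \<in> J" for v j
  proof -
    have "(\<lambda>x. dt v (X j x)) \<in> borel_measurable (M j)"
      unfolding dt_def ip_def D_def using meas[OF that] by (intro borel_measurable_sum borel_measurable_times) auto
    from measurable_compose[OF measurable_component_singleton[of j I M] this] show ?thesis using that J by auto
  qed
  define q where "q b \<omega> = (\<Sum>j\<in>J. (dt (vv b) (X j (\<omega> j)))\<^sup>2) - ?n * (\<Sum>a<r. (b a)\<^sup>2)" for b \<omega>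
  \<comment> \<open>Net points have form value at most \<open>1\<close>, so the deviation for
    \<open>vv b\<close> is at most the deviation for the normalised direction, to which the
    concentration bound applies.\<close>
  define F where "F b = {\<omega>\<in>space (PiM I M). ?n / 20 < \<bar>q b \<omega>\<bar>}" for b
  have FE: "F b \<in> sets (PiM I M)" for b unfolding F_def q_def by measurable
  have Fle: "emeasure (PiM I M) (F b) \<le> ennreal (2 * exp (- (?n / (307200 * \<rho> ^ 4))))" if b: "b \<in> N" for b
  proof (cases "(\<Sum>a<r. (b a)\<^sup>2) = 0")
    case True
    then have b0: "b a = 0" if "a < r" for a
      using that by (subst (asm) sum_nonneg_eq_0_iff) auto
    have "vv b = (\<lambda>_. 0)" by (auto simp: vv_def b0)
    then have "q b \<omega> = 0" for \<omega> using True by (simp add: q_def dt_def ip_def)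
    then have "F b = {}" using n by (auto simp: F_def)
    then show ?thesis by simp
  next
    case False
    define s where "s = (\<Sum>a<r. (b a)\<^sup>2)"
    have s: "0 < s" "s \<le> 1" using False N(3)[OF b] by (auto simp: s_def sum_nonneg less_le)
    define t where "t = 1 / sqrt s"
    have t: "t\<^sup>2 * s = 1" using s by (simp add: t_def power_divide)
    define y where "y l = t * vv b l" for l
    have qy: "qform d S y = 1"
    proof -
      have "y = vv (\<lambda>a. t * b a)" by (auto simp: y_def vv_def sum_distrib_left mult.assoc)
      then have "qform d S y = t\<^sup>2 * s" by (simp add: qvv power_mult_distrib sum_distrib_left s_def)
      then show ?thesis using t by simp
    qed
    have dty: "(dt y x)\<^sup>2 * s = (dt (vv b) x)\<^sup>2" for x
    proof -
      have "dt y x = t * dt (vv b) x" unfolding dt_def y_def by (simp add: ip_def sum_distrib_left mult.assoc)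
      then have "(dt y x)\<^sup>2 * s = (t\<^sup>2 * s) * (dt (vv b) x)\<^sup>2" by (simp add: power_mult_distrib mult_ac)
      then show ?thesis using t by simp
    qed
    have "emeasure (PiM I M) {\<omega> \<in> space (PiM I M). ?n / 20 \<le> \<bar>(\<Sum>j\<in>J. (dt y (X j (\<omega> j)))\<^sup>2) - ?n\<bar>}
      \<le> ennreal (2 * exp (- (?n / (307200 * \<rho> ^ 4))))"
    proof (rule sum_squares_concentration[OF M I J(1) \<rho> _ _ _ _ J(2)])
      fix j assume j: "j \<in> J"
      show "(\<lambda>x. dt y (X j x)) \<in> borel_measurable (M j)"
        unfolding dt_def ip_def D_def using meas[OF j] by (intro borel_measurable_sum borel_measurable_times) auto
      show "integrable (M j) (\<lambda>x. (dt y (X j x))\<^sup>2)" using int[OF j, of y] by (simp add: dtsum)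
      show "(\<integral>x. (dt y (X j x))\<^sup>2 \<partial>M j) = 1" using var[OF j, of y] by (simp add: dtsum qy)
      fix h :: real
      have "qform d S (\<lambda>l. h * y l) = h\<^sup>2 * qform d S y"
        by (simp add: qform_def sum_distrib_left power2_eq_square mult_ac)
      moreover have "dt (\<lambda>l. h * y l) x = h * dt y x" for x by (simp add: dt_def ip_def sum_distrib_left mult.assoc)
      ultimately show "(\<integral>\<^sup>+x. ennreal (exp (h * dt y (X j x))) \<partial>M j) \<le> ennreal (exp (h\<^sup>2 * \<rho>\<^sup>2 / 2))"
        using mgf[OF j, of "\<lambda>l. h * y l"] by (simp only: dtsum) (simp add: qy)
    qed
    moreover have "F b \<subseteq> {\<omega> \<in> space (PiM I M). ?n / 20 \<le> \<bar>(\<Sum>j\<in>J. (dt y (X j (\<omega> j)))\<^sup>2) - ?n\<bar>}"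
    proof
      fix \<omega> assume \<omega>: "\<omega> \<in> F b"
      define h where "h = (\<Sum>j\<in>J. (dt y (X j (\<omega> j)))\<^sup>2) - ?n"
      have "q b \<omega> = s * h" unfolding q_def h_def s_def[symmetric] dty[symmetric]
        by (simp add: sum_distrib_left algebra_simps)
      then have "\<bar>q b \<omega>\<bar> = s * \<bar>h\<bar>" using s by (simp add: abs_mult)
      also have "\<dots> \<le> 1 * \<bar>h\<bar>" using s by (intro mult_right_mono) auto
      finally show "\<omega> \<in> {\<omega> \<in> space (PiM I M). ?n / 20 \<le> \<bar>(\<Sum>j\<in>J. (dt y (X j (\<omega> j)))\<^sup>2) - ?n\<bar>}"
        using \<omega> by (auto simp: F_def h_def)
    qed
    moreover have "{\<omega> \<in> space (PiM I M). ?n / 20 \<le> \<bar>(\<Sum>j\<in>J. (dt y (X j (\<omega> j)))\<^sup>2) - ?n\<bar>} \<in> sets (PiM I M)"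
      by measurable
    ultimately show ?thesis using emeasure_mono order_trans by blast
  qed
  define G where "G = {\<omega>\<in>space (PiM I M). \<exists>a<m. \<exists>j\<in>J. dt (W a) (X j (\<omega> j)) \<noteq> 0}"
  have GE: "G \<in> sets (PiM I M)"
  proof -
    have "G = (\<Union>a\<in>{..<m}. \<Union>j\<in>J. {\<omega>\<in>space (PiM I M). dt (W a) (X j (\<omega> j)) \<noteq> 0})" by (auto simp: G_def)
    also have "\<dots> \<in> sets (PiM I M)" using finJ by (intro sets.finite_UN) auto
    finally show ?thesis .
  qed
  have "AE \<omega> in PiM I M. \<forall>a\<in>{..<m}. \<forall>j\<in>J. dt (W a) (X j (\<omega> j)) = 0"
  proof (intro AE_finite_allI finJ)
    fix a j assume a: "a \<in> {..<m}" and j: "j \<in> J"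
    have "AE x in M j. (dt (W a) (X j x))\<^sup>2 = 0"
      using int[OF j, of "W a"] var[OF j, of "W a"] qW[of a] a
      by (subst integral_nonneg_eq_0_iff_AE[symmetric]) (auto simp: dtsum)
    then have AEj: "AE x in M j. dt (W a) (X j x) = 0" by simp
    have dj: "distr (PiM I M) (M j) (\<lambda>\<omega>. \<omega> j) = M j" using M I J j by (intro distr_PiM_component) auto
    have "AE x in distr (PiM I M) (M j) (\<lambda>\<omega>. \<omega> j). dt (W a) (X j x) = 0" unfolding dj by (rule AEj)
    then show "AE \<omega> in PiM I M. dt (W a) (X j (\<omega> j)) = 0"
      using j J by (intro AE_distrD[of "\<lambda>\<omega>. \<omega> j" _ "M j"]) auto
  qed simp
  then have "AE \<omega> in PiM I M. \<omega> \<notin> G" by eventually_elim (auto simp: G_def)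
  then have G0: "emeasure (PiM I M) G = 0" using AE_iff_null_sets[OF GE] by auto
  define E where "E = space (PiM I M) - ((\<Union>b\<in>N. F b) \<union> G)"
  have FN: "(\<Union>b\<in>N. F b) \<in> sets (PiM I M)" using N(1) FE by (intro sets.finite_UN) auto
  have E: "E \<in> sets (PiM I M)" unfolding E_def using FN GE by auto
  have sub: "space (PiM I M) - E \<subseteq> (\<Union>b\<in>N. F b) \<union> G" by (auto simp: E_def)
  have "emeasure (PiM I M) (space (PiM I M) - E) \<le> emeasure (PiM I M) ((\<Union>b\<in>N. F b) \<union> G)"
    using FN GE by (intro emeasure_mono sub) auto
  also have "\<dots> \<le> emeasure (PiM I M) (\<Union>b\<in>N. F b) + emeasure (PiM I M) G"
    using FN GE by (intro emeasure_subadditive)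
  also have "\<dots> \<le> ennreal (exp (27 * real r) * (2 * exp (- (?n / (307200 * \<rho> ^ 4))))) + 0"
    unfolding G0 using N FE Fle by (intro add_mono emeasure_finite_union_le) auto
  also have "\<dots> \<le> ennreal (exp (27 * real m) * (2 * exp (- (?n / (307200 * \<rho> ^ 4)))))"
    using r by (auto intro!: ennreal_leI mult_right_mono)
  finally have prob: "emeasure (PiM I M) (space (PiM I M) - E) \<le> ennreal (exp (27 * real m) * (2 * exp (- (?n / (307200 * \<rho> ^ 4)))))" .
  have main: "\<bar>(\<Sum>j\<in>J. (dt v (X j (\<omega> j)))\<^sup>2) - ?n * qform d S v\<bar> \<le> ?n / 10 * qform d S v"
    if \<omega>: "\<omega> \<in> E" and v: "\<forall>l<d. v l = (\<Sum>a<m. b a * B a l)" for \<omega> b v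
  proof -
    define \<beta> where "\<beta> x = (\<Sum>a<m. b a * c a x)" for x
    define p where "p x y = (\<Sum>j\<in>J. dt (V x) (X j (\<omega> j)) * dt (V y) (X j (\<omega> j))) - ?n * (if x = y then 1 else 0)" for x y
    have dtvv: "dt (vv g) x = (\<Sum>a<r. g a * dt (V a) x)" for g x
      unfolding dt_def vv_def[abs_def] by (rule ip_sum_left)
    have pq: "(\<Sum>x<r. \<Sum>y<r. g x * p x y * g y) = q g \<omega>" for g
    proof -
      have "(\<Sum>x<r. \<Sum>y<r. g x * p x y * g y)
         = (\<Sum>x<r. \<Sum>y<r. \<Sum>j\<in>J. (g x * dt (V x) (X j (\<omega> j))) * (g y * dt (V y) (X j (\<omega> j))))
           - (\<Sum>x<r. \<Sum>y<r. if x = y then ?n * (g x * g y) else 0)"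
        unfolding p_def sum_subtractf[symmetric]
        by (intro sum.cong refl) (auto simp: sum_distrib_left sum_distrib_right algebra_simps)
      also have "(\<Sum>x<r. \<Sum>y<r. if x = y then ?n * (g x * g y) else 0) = ?n * (\<Sum>a<r. (g a)\<^sup>2)"
        by (simp add: sum_distrib_left power2_eq_square)
      also have "(\<Sum>x<r. \<Sum>y<r. \<Sum>j\<in>J. (g x * dt (V x) (X j (\<omega> j))) * (g y * dt (V y) (X j (\<omega> j))))
         = (\<Sum>x<r. \<Sum>j\<in>J. \<Sum>y<r. (g x * dt (V x) (X j (\<omega> j))) * (g y * dt (V y) (X j (\<omega> j))))"
        by (intro sum.cong refl sum.swap)
      also have "\<dots> = (\<Sum>j\<in>J. \<Sum>x<r. \<Sum>y<r. (g x * dt (V x) (X j (\<omega> j))) * (g y * dt (V y) (X j (\<omega> j))))"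
        by (rule sum.swap)
      also have "\<dots> = (\<Sum>j\<in>J. (dt (vv g) (X j (\<omega> j)))\<^sup>2)"
        by (simp add: dtvv power2_eq_square sum_product)
      finally show ?thesis by (simp add: q_def)
    qed
    have "\<bar>\<Sum>x<r. \<Sum>y<r. \<beta> x * p x y * \<beta> y\<bar> \<le> 2 * (?n / 20) * (\<Sum>a<r. (\<beta> a)\<^sup>2)"
    proof (rule quadratic_form_on_net[where N = N])
      show "p x y = p y x" for x y by (auto simp: p_def mult.commute)
      show "\<bar>\<Sum>x<r. \<Sum>y<r. g x * p x y * g y\<bar> \<le> ?n / 20" if "g \<in> N" for g
        unfolding pq using \<omega> that by (auto simp: E_def F_def not_less)
    qed (use N in auto)
    then have 1: "\<bar>q \<beta> \<omega>\<bar> \<le> ?n / 10 * (\<Sum>a<r. (\<beta> a)\<^sup>2)" by (simp add: pq)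
    have W0: "dt (W a) (X j (\<omega> j)) = 0" if "a < m" "j \<in> J" for a j
      using \<omega> that by (auto simp: E_def G_def)
    have dv: "dt v (X j (\<omega> j)) = dt (vv \<beta>) (X j (\<omega> j))" if j: "j \<in> J" for j
    proof -
      have "dt v (X j (\<omega> j)) = ip D (\<lambda>l. \<Sum>a<m. b a * (W a l + (\<Sum>x<r. c a x * V x l))) (X j (\<omega> j))"
        unfolding dt_def using v by (intro ip_cong) (auto simp: D_def W_def)
      also have "\<dots> = (\<Sum>a<m. b a * ip D (\<lambda>l. W a l + (\<Sum>x<r. c a x * V x l)) (X j (\<omega> j)))"
        by (rule ip_sum_left)
      also have "\<dots> = (\<Sum>a<m. b a * (\<Sum>x<r. c a x * dt (V x) (X j (\<omega> j))))"
      proof (intro sum.cong refl arg_cong2[where f = "(*)"])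
        fix a assume a: "a \<in> {..<m}"
        have "ip D (\<lambda>l. W a l + (\<Sum>x<r. c a x * V x l)) (X j (\<omega> j))
            = dt (W a) (X j (\<omega> j)) + (\<Sum>x<r. c a x * dt (V x) (X j (\<omega> j)))"
          unfolding dt_def ip_sum_left[symmetric] by (simp add: ip_def distrib_right sum.distrib)
        then show "ip D (\<lambda>l. W a l + (\<Sum>x<r. c a x * V x l)) (X j (\<omega> j)) = (\<Sum>x<r. c a x * dt (V x) (X j (\<omega> j)))"
          using W0[of a j] a j by simp
      qed
      also have "\<dots> = (\<Sum>a<m. \<Sum>x<r. b a * c a x * dt (V x) (X j (\<omega> j)))"
        by (simp add: sum_distrib_left mult.assoc)
      also have "\<dots> = dt (vv \<beta>) (X j (\<omega> j))"
        unfolding dtvv \<beta>_def sum_distrib_right by (rule sum.swap)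
      finally show ?thesis .
    qed
    have qv: "qform d S v = (\<Sum>a<r. (\<beta> a)\<^sup>2)"
    proof -
      have "qform d S v = ip D (\<lambda>l. \<Sum>x<r. \<beta> x * u x l) (\<lambda>l. \<Sum>x<r. \<beta> x * u x l)"
      proof -
        have "Rt v l = (\<Sum>x<r. \<beta> x * u x l)" if l: "l \<in> D" for l
        proof -
          have "Rt v l = (\<Sum>a<m. b a * Rt (B a) l)" using v by (intro Rts) auto
          also have "\<dots> = (\<Sum>a<m. \<Sum>x<r. b a * c a x * u x l)" using c l by (simp add: sum_distrib_left mult.assoc)
          also have "\<dots> = (\<Sum>x<r. \<beta> x * u x l)" unfolding \<beta>_def sum_distrib_right by (rule sum.swap)
          finally show ?thesis .
        qed
        then show ?thesis unfolding qf by (intro ip_cong) auto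
      qed
      also have "\<dots> = (\<Sum>a<r. (\<beta> a)\<^sup>2)" by (rule ip_orthonormal_norm[OF on])
      finally show ?thesis .
    qed
    show ?thesis using 1 dv by (simp add: q_def qv)
  qed
  show ?thesis
    unfolding dtsum using E prob main by (intro bexI[of _ E] conjI ballI allI impI) blast+
qed

section \<open>Convergence of near-maximizers\<close>

text \<open>Half the decrease of the squared error that the fit \<open>u\<close> achieves over the
  zero fit. Minimising the squared error is maximising \<open>gain\<close>; for fixed
  \<open>u\<close> it is affine in \<open>y\<close>, so a supremum over fits is convex in
  \<open>y\<close>, with the fitted values as slopes.\<close>

definition gain :: "'j set \<Rightarrow> ('j \<Rightarrow> real) \<Rightarrow> ('j \<Rightarrow> real) \<Rightarrow> real" where
  "gain J y u = (\<Sum>j\<in>J. y j * u j - (u j)\<^sup>2 / 2)"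

lemma gain_shift:
  assumes "finite J" "j \<in> J"
  shows "gain J (\<lambda>i. m i + (z(j := s)) i) u = gain J (\<lambda>i. m i + z i) u + (s - z j) * u j"
proof -
  have "gain J (\<lambda>i. m i + (z(j := s)) i) u
      = (\<Sum>i\<in>J. ((m i + z i) * u i - (u i)\<^sup>2 / 2) + (if i = j then (s - z j) * u j else 0))"
    unfolding gain_def by (intro sum.cong) (auto simp: algebra_simps)
  then show ?thesis using assms by (simp add: sum.distrib gain_def)
qed

text \<open>For a countable family of candidate fits, the best attainable gain is a convex function of each
  noise coordinate \<open>z j\<close>, and \<open>c\<^sub>1 < c\<^sub>2\<close> can both be approximate slopes only at a single value of
  \<open>z j\<close>. Hence almost surely all near-maximisers have asymptotically the same fit.\<close>

lemma near_maximizers_converge: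
  fixes fit :: "'q \<Rightarrow> 'x \<Rightarrow> 'j \<Rightarrow> real" and \<mu> :: "'x \<Rightarrow> 'j \<Rightarrow> real"
  assumes MX: "prob_space MX" and J: "finite J" and \<sigma>: "0 < \<sigma>" and Q: "countable Q"
    and mfit [measurable]: "\<And>q j. q \<in> Q \<Longrightarrow> j \<in> J \<Longrightarrow> (\<lambda>x. fit q x j) \<in> borel_measurable MX"
    and mmu [measurable]: "\<And>j. j \<in> J \<Longrightarrow> (\<lambda>x. \<mu> x j) \<in> borel_measurable MX"
  shows "\<exists>B\<in>null_sets (MX \<Otimes>\<^sub>M PiM J (\<lambda>_. gauss \<sigma>)).
     \<forall>x z u r q. (x, z) \<in> space (MX \<Otimes>\<^sub>M PiM J (\<lambda>_. gauss \<sigma>)) - B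
       \<longrightarrow> (\<forall>m. r m \<in> Q) \<longrightarrow> (\<forall>j\<in>J. (\<lambda>m. fit (r m) x j) \<longlonglongrightarrow> u j)
       \<longrightarrow> (\<forall>p\<in>Q. gain J (\<lambda>j. \<mu> x j + z j) (fit p x) \<le> gain J (\<lambda>j. \<mu> x j + z j) u)
       \<longrightarrow> (\<forall>n. q n \<in> Q \<and> (\<forall>p\<in>Q. gain J (\<lambda>j. \<mu> x j + z j) (fit p x)
                                     \<le> gain J (\<lambda>j. \<mu> x j + z j) (fit (q n) x) + 1 / real (Suc n)))
       \<longrightarrow> (\<forall>j\<in>J. (\<lambda>n. fit (q n) x j) \<longlonglongrightarrow> u j)"
proof -
  define N where "N = gauss \<sigma>"
  have pN: "prob_space N" unfolding N_def by (rule prob_space_normal_density[OF \<sigma>])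
  have sN [measurable_cong]: "sets N = sets borel" by (simp add: N_def)
  have atom: "emeasure N {x} = 0" for x
    unfolding N_def by (rule emeasure_gauss_singleton)
  define Z where "Z = PiM J (\<lambda>_. N)"
  have pZ: "prob_space Z" unfolding Z_def by (intro prob_space_PiM pN)
  have comp [measurable]: "(\<lambda>z. z j) \<in> borel_measurable Z" if "j \<in> J" for j
    using measurable_component_singleton[of j J "\<lambda>_. N"] that
    by (simp add: Z_def cong: measurable_cong_sets[OF refl sN])
  define G where "G q p = gain J (\<lambda>j. \<mu> (fst p) j + snd p j) (fit q (fst p))" for q and p :: "'x \<times> ('j \<Rightarrow> real)"
  have mG [measurable]: "G q \<in> borel_measurable (MX \<Otimes>\<^sub>M Z)" if "q \<in> Q" for q
    unfolding G_def[abs_def] gain_def using that by measurable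
  define opt where "opt n q p \<longleftrightarrow> (\<forall>q'\<in>Q. G q' p \<le> G q p + 1 / real (Suc n))" for n q p
  have mopt: "{p\<in>space (MX \<Otimes>\<^sub>M Z). opt n q p} \<in> sets (MX \<Otimes>\<^sub>M Z)" if "q \<in> Q" for n q
    unfolding opt_def using that Q by (intro sets.sets_Collect_countable_All') auto
  \<comment> \<open>\<open>lo\<close> and \<open>hi\<close> express that \<open>c\<close> bounds,
    from above or from below, the \<open>j\<close>-th fitted values of some near-maximisers of every
    precision. Both at once for \<open>c1 < c2\<close> amounts to a kink of the optimal gain in
    direction \<open>j\<close>.\<close>
  define lo where "lo j c p \<longleftrightarrow> (\<forall>n. \<exists>q\<in>Q. opt n q p \<and> fit q (fst p) j \<le> c)" for j c p
  define hi where "hi j c p \<longleftrightarrow> (\<forall>n. \<exists>q\<in>Q. opt n q p \<and> c \<le> fit q (fst p) j)" for j c p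
  define bad where "bad j c1 c2 = {p\<in>space (MX \<Otimes>\<^sub>M Z). lo j c1 p \<and> hi j c2 p}" for j c1 c2
  have mbad: "bad j c1 c2 \<in> sets (MX \<Otimes>\<^sub>M Z)" if j: "j \<in> J" for j c1 c2
    unfolding bad_def lo_def hi_def
    by (intro sets.sets_Collect_conj sets.sets_Collect_countable_All sets.sets_Collect_countable_Ex' Q mopt) (use j in measurable)
  have null: "bad j c1 c2 \<in> null_sets (MX \<Otimes>\<^sub>M Z)" if j: "j \<in> J" and c: "c1 < c2" for j c1 c2
  proof -
    \<comment> \<open>Monotonicity of slopes of a convex function: adding the near-optimality
      inequalities at the two noise vectors cancels the gains and leaves
      \<open>s * (c2 - c1)\<close> below twice the tolerance, for every tolerance.\<close>
    have key: False if s0: "0 < s" and l: "lo j c1 (x, z')" and h: "hi j c2 (x, z)"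
      and sh: "\<And>q. G q (x, z') = G q (x, z) + s * fit q x j" for x z z' s
    proof -
      have le: "s * (c2 - c1) \<le> 2 * (1 / real (Suc n))" for n
      proof -
        obtain q where q: "q \<in> Q" "opt n q (x, z)" "c2 \<le> fit q x j" using h unfolding hi_def by auto
        obtain q' where q': "q' \<in> Q" "opt n q' (x, z')" "fit q' x j \<le> c1" using l unfolding lo_def by auto
        have "G q (x, z') \<le> G q' (x, z') + 1 / real (Suc n)" using q'(2) q(1) by (simp add: opt_def)
        moreover have "G q' (x, z) \<le> G q (x, z) + 1 / real (Suc n)" using q(2) q'(1) by (simp add: opt_def)
        moreover have "s * c2 \<le> s * fit q x j" "s * fit q' x j \<le> s * c1" using s0 q(3) q'(3) by auto
        ultimately show ?thesis using sh[of q] sh[of q'] by (simp add: algebra_simps)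
      qed
      have "0 < s * (c2 - c1) / 2" using s0 c by simp
      then obtain n where "1 / real (Suc n) < s * (c2 - c1) / 2" using nat_approx_posE by blast
      with le[of n] show False by linarith
    qed
    have "emeasure Z (Pair x -` bad j c1 c2) = 0" for x
      unfolding Z_def
    proof (rule null_set_PiM_one_point[OF pN sN atom J j])
      show "Pair x -` bad j c1 c2 \<in> sets (PiM J (\<lambda>_. N))"
        using sets_Pair1[OF mbad[OF j]] by (simp add: Z_def)
      fix z s assume z: "z \<in> Pair x -` bad j c1 c2" and s: "s \<noteq> z j"
      show "z(j := s) \<notin> Pair x -` bad j c1 c2"
      proof
        assume z': "z(j := s) \<in> Pair x -` bad j c1 c2"
        have sh: "G q (x, z(j := s)) = G q (x, z) + (s - z j) * fit q x j" for q
          unfolding G_def fst_conv snd_conv by (rule gain_shift[OF J j])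
        show False
        proof (cases "z j < s")
          case True
          then show ?thesis using key[of "s - z j" x "z(j := s)" z] z z' sh by (auto simp: bad_def)
        next
          case False
          then show ?thesis using key[of "z j - s" x z "z(j := s)"] z z' sh s by (auto simp: bad_def algebra_simps)
        qed
      qed
    qed
    then have "emeasure (MX \<Otimes>\<^sub>M Z) (bad j c1 c2) = 0"
      by (simp add: sigma_finite_measure.emeasure_pair_measure_alt[OF prob_space_imp_sigma_finite[OF pZ] mbad[OF j]])
    then show ?thesis using mbad[OF j] by auto
  qed
  define B where "B = (\<Union>j\<in>J. \<Union>c1\<in>\<rat>. \<Union>c2\<in>\<rat> \<inter> {c1<..}. bad j c1 c2)"
  have "B \<in> null_sets (MX \<Otimes>\<^sub>M Z)"
    unfolding B_def by (intro null_sets_UN' countable_finite J countable_rat countable_Int1 null) auto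
  moreover have "(\<lambda>n. fit (q n) x j) \<longlonglongrightarrow> u j"
    if xz: "(x, z) \<in> space (MX \<Otimes>\<^sub>M Z) - B" and r: "\<forall>m. r m \<in> Q" "\<forall>j\<in>J. (\<lambda>m. fit (r m) x j) \<longlonglongrightarrow> u j"
      and u: "\<forall>p\<in>Q. G p (x, z) \<le> gain J (\<lambda>j. \<mu> x j + z j) u"
      and q: "\<forall>n. q n \<in> Q \<and> opt n (q n) (x, z)" and j: "j \<in> J" for x z u r q j
  proof (rule ccontr)
    assume "\<not> ?thesis"
    then obtain \<epsilon> where \<epsilon>: "0 < \<epsilon>" "\<And>m. \<exists>n\<ge>m. \<epsilon> \<le> \<bar>fit (q n) x j - u j\<bar>"
      unfolding LIMSEQ_def dist_real_def by (metis linorder_not_less)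
    \<comment> \<open>The value \<open>u j\<close> is itself a slope: the candidates approximating
      \<open>u\<close> have gains converging to that of \<open>u\<close>, which no candidate
      exceeds, so eventually they are near-maximisers.\<close>
    have near: "\<exists>p\<in>Q. opt n p (x, z) \<and> \<bar>fit p x j - u j\<bar> < \<eta>" if \<eta>: "0 < \<eta>" for n \<eta>
    proof -
      have "(\<lambda>m. G (r m) (x, z)) \<longlonglongrightarrow> gain J (\<lambda>j. \<mu> x j + z j) u"
        unfolding G_def gain_def fst_conv snd_conv using r(2) by (intro tendsto_intros) auto
      then have "eventually (\<lambda>m. gain J (\<lambda>j. \<mu> x j + z j) u - 1 / real (Suc n) < G (r m) (x, z)) sequentially"
        by (rule order_tendstoD) simp
      moreover have "eventually (\<lambda>m. \<bar>fit (r m) x j - u j\<bar> < \<eta>) sequentially"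
        using r(2) j \<eta> by (auto simp: tendsto_iff dist_real_def)
      ultimately have "eventually (\<lambda>m. gain J (\<lambda>j. \<mu> x j + z j) u - 1 / real (Suc n) < G (r m) (x, z)
          \<and> \<bar>fit (r m) x j - u j\<bar> < \<eta>) sequentially" by eventually_elim simp
      then obtain m where m: "gain J (\<lambda>j. \<mu> x j + z j) u - 1 / real (Suc n) < G (r m) (x, z)"
          "\<bar>fit (r m) x j - u j\<bar> < \<eta>" using eventually_happens' sequentially_bot by blast
      have "opt n (r m) (x, z)" unfolding opt_def using u m(1) by (smt (verit) ballI)
      then show ?thesis using r(1) m(2) by blast
    qed
    have mono: "opt n p y" if "opt m p y" "n \<le> m" for n m p y
    proof -
      have "1 / real (Suc m) \<le> 1 / real (Suc n)" using that(2) by (simp add: frac_le)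
      then show ?thesis using that(1) unfolding opt_def by (smt (verit))
    qed
    have notbad: "\<not> (lo j c1 (x, z) \<and> hi j c2 (x, z))" if "c1 \<in> \<rat>" "c2 \<in> \<rat>" "c1 < c2" for c1 c2
    proof
      assume "lo j c1 (x, z) \<and> hi j c2 (x, z)"
      then have "(x, z) \<in> bad j c1 c2" using xz by (simp add: bad_def)
      then have "(x, z) \<in> B" unfolding B_def using that j by blast
      then show False using xz by blast
    qed
    show False
    \<comment> \<open>Fits that keep a distance \<open>\<epsilon>\<close> from \<open>u j\<close> do
      so infinitely often on one side; two rationals between that side and \<open>u j\<close> then
      witness a bad pair.\<close>
    proof (cases "\<forall>m. \<exists>n\<ge>m. u j + \<epsilon> \<le> fit (q n) x j")
      case True
      obtain c1 where c1: "c1 \<in> \<rat>" "u j < c1" "c1 < u j + \<epsilon>" using Rats_dense_in_real[of "u j" "u j + \<epsilon>"] \<epsilon>(1) by auto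
      obtain c2 where c2: "c2 \<in> \<rat>" "c1 < c2" "c2 < u j + \<epsilon>" using Rats_dense_in_real[of c1 "u j + \<epsilon>"] c1(3) by auto
      have "lo j c1 (x, z)" unfolding lo_def
      proof
        fix n
        from near[of "c1 - u j" n] c1(2) obtain p where "p \<in> Q" "opt n p (x, z)" "\<bar>fit p x j - u j\<bar> < c1 - u j" by auto
        then show "\<exists>p\<in>Q. opt n p (x, z) \<and> fit p (fst (x, z)) j \<le> c1" by (intro bexI[of _ p]) auto
      qed
      moreover have "hi j c2 (x, z)" unfolding hi_def
      proof
        fix n
        from True obtain m where m: "m \<ge> n" "u j + \<epsilon> \<le> fit (q m) x j" by blast
        have "opt n (q m) (x, z)" using mono[OF _ m(1)] q by blast
        with m show "\<exists>p\<in>Q. opt n p (x, z) \<and> c2 \<le> fit p (fst (x, z)) j"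
          using q c2(3) by (intro bexI[of _ "q m"]) auto
      qed
      ultimately show False using notbad c1 c2 by blast
    next
      case False
      then obtain m0 where m0: "\<And>n. n \<ge> m0 \<Longrightarrow> fit (q n) x j < u j + \<epsilon>" by (meson not_le)
      have low: "\<exists>n\<ge>m. fit (q n) x j \<le> u j - \<epsilon>" for m
      proof -
        obtain n where "n \<ge> max m m0" "\<epsilon> \<le> \<bar>fit (q n) x j - u j\<bar>" using \<epsilon>(2) by blast
        moreover from this have "fit (q n) x j < u j + \<epsilon>" using m0 by simp
        ultimately have "n \<ge> m" "fit (q n) x j \<le> u j - \<epsilon>" by auto
        then show ?thesis by blast
      qed
      obtain c1 where c1: "c1 \<in> \<rat>" "u j - \<epsilon> < c1" "c1 < u j" using Rats_dense_in_real[of "u j - \<epsilon>" "u j"] \<epsilon>(1) by auto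
      obtain c2 where c2: "c2 \<in> \<rat>" "c1 < c2" "c2 < u j" using Rats_dense_in_real[of c1 "u j"] c1(3) by auto
      have "hi j c2 (x, z)" unfolding hi_def
      proof
        fix n
        from near[of "u j - c2" n] c2(3) obtain p where "p \<in> Q" "opt n p (x, z)" "\<bar>fit p x j - u j\<bar> < u j - c2" by auto
        then show "\<exists>p\<in>Q. opt n p (x, z) \<and> c2 \<le> fit p (fst (x, z)) j" by (intro bexI[of _ p]) auto
      qed
      moreover have "lo j c1 (x, z)" unfolding lo_def
      proof
        fix n
        from low[of n] obtain m where m: "m \<ge> n" "fit (q m) x j \<le> u j - \<epsilon>" by blast
        have "opt n (q m) (x, z)" using mono[OF _ m(1)] q by blast
        with m show "\<exists>p\<in>Q. opt n p (x, z) \<and> fit p (fst (x, z)) j \<le> c1"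
          using q c1(2) by (intro bexI[of _ "q m"]) auto
      qed
      ultimately show False using notbad c1 c2 by blast
    qed
  qed
  ultimately show ?thesis
    unfolding Z_def N_def opt_def G_def fst_conv snd_conv by (intro bexI[of _ B]) blast+
qed

section \<open>Almost sure independence of the least squares columns\<close>

lemma sum_blocks:
  fixes f :: "nat \<Rightarrow> nat \<Rightarrow> real"
  shows "(\<Sum>c<k * d. f (c div d) (c mod d)) = (\<Sum>t<k. \<Sum>l<d. f t l)"
proof (cases "d = 0")
  case False
  have "(\<Sum>c<k * d. f (c div d) (c mod d)) = (\<Sum>t<k. \<Sum>c\<in>{t * d..<t * d + d}. f (c div d) (c mod d))"
    by (rule sum.nat_group[symmetric])
  also have "\<dots> = (\<Sum>t<k. \<Sum>l<d. f t l)"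
  proof (rule sum.cong[OF refl])
    fix t
    have "(\<Sum>c\<in>{t * d..<t * d + d}. f (c div d) (c mod d)) = (\<Sum>l\<in>{0..<d}. f ((l + t * d) div d) ((l + t * d) mod d))"
      using sum.shift_bounds_nat_ivl[of "\<lambda>c. f (c div d) (c mod d)" 0 "t * d" d] by (simp add: add.commute)
    also have "\<dots> = (\<Sum>l<d. f t l)" using False by (intro sum.cong) auto
    finally show "(\<Sum>c\<in>{t * d..<t * d + d}. f (c div d) (c mod d)) = (\<Sum>l<d. f t l)" .
  qed
  finally show ?thesis .
qed simp

lemma sum_split_blocks:
  fixes f :: "nat \<Rightarrow> real" and g :: "nat \<Rightarrow> nat \<Rightarrow> real"
  shows "(\<Sum>c<k + k * d. if c < k then f c else g ((c - k) div d) ((c - k) mod d)) = (\<Sum>c<k. f c) + (\<Sum>t<k. \<Sum>l<d. g t l)"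
proof -
  have "(\<Sum>c<k + k * d. if c < k then f c else g ((c - k) div d) ((c - k) mod d))
      = (\<Sum>c<k. f c) + (\<Sum>c\<in>{k..<k + k * d}. g ((c - k) div d) ((c - k) mod d))"
  proof -
    have "{..<k + k * d} = {..<k} \<union> {k..<k + k * d}" "{..<k} \<inter> {k..<k + k * d} = {}" by auto
    then show ?thesis by (simp add: sum.union_disjoint)
  qed
  also have "(\<Sum>c\<in>{k..<k + k * d}. g ((c - k) div d) ((c - k) mod d)) = (\<Sum>c<k * d. g (c div d) (c mod d))"
    using sum.shift_bounds_nat_ivl[of "\<lambda>c. g ((c - k) div d) ((c - k) mod d)" 0 k "k * d"]
    by (simp add: atLeast0LessThan add.commute)
  finally show ?thesis by (simp add: sum_blocks)
qed

lemma mat_delete_cong_column: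
  assumes "A \<in> carrier_mat n n" "A' \<in> carrier_mat n n" "c < n"
    and "\<And>r c'. r < n \<Longrightarrow> c' < n \<Longrightarrow> c' \<noteq> c \<Longrightarrow> A $$ (r, c') = A' $$ (r, c')"
  shows "mat_delete A r c = mat_delete A' r c"
  using assms by (intro eq_matI) (auto simp: mat_delete_def)

text \<open>Laplace expansion along column \<open>c\<close>: the cofactors do not see that column
  and are therefore constant in \<open>s\<close>.\<close>

lemma det_affine_in_column:
  fixes A :: "real \<Rightarrow> real mat"
  assumes A: "\<And>s. A s \<in> carrier_mat n n" and c: "c < n"
    and col: "\<And>r. r < n \<Longrightarrow> \<exists>a b. \<forall>s. A s $$ (r, c) = a + b * s"
    and other: "\<And>r c' s. r < n \<Longrightarrow> c' < n \<Longrightarrow> c' \<noteq> c \<Longrightarrow> A s $$ (r, c') = A 0 $$ (r, c')"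
  shows "\<exists>a b. \<forall>s. det (A s) = a + b * s"
proof -
  from col have "\<forall>r. \<exists>ab. r < n \<longrightarrow> (\<forall>s. A s $$ (r, c) = fst ab + snd ab * s)" by (metis fst_conv snd_conv)
  from choice[OF this] obtain ab where ab: "\<And>r s. r < n \<Longrightarrow> A s $$ (r, c) = fst (ab r) + snd (ab r) * s" by blast
  define C where "C r = cofactor (A 0) r c" for r
  have cof: "cofactor (A s) r c = C r" if "r < n" for r s
  proof -
    have "mat_delete (A s) r c = mat_delete (A 0) r c" by (rule mat_delete_cong_column[OF A A c other])
    then show ?thesis by (simp add: C_def cofactor_def)
  qed
  have "det (A s) = (\<Sum>r<n. fst (ab r) * C r) + (\<Sum>r<n. snd (ab r) * C r) * s" for s
    unfolding laplace_expansion_column[OF A c] sum_distrib_right sum.distrib[symmetric]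
    by (intro sum.cong refl) (auto simp: ab cof algebra_simps)
  then show ?thesis by blast
qed

lemma measurable_det:
  fixes A :: "'x \<Rightarrow> real mat"
  assumes A: "\<And>x. A x \<in> carrier_mat n n"
    and [measurable]: "\<And>r c. r < n \<Longrightarrow> c < n \<Longrightarrow> (\<lambda>x. A x $$ (r, c)) \<in> borel_measurable M"
  shows "(\<lambda>x. det (A x)) \<in> borel_measurable M"
proof -
  have "(\<lambda>x. det (A x)) = (\<lambda>x. \<Sum>p \<in> {p. p permutes {0..<n}}. signof p * (\<Prod>i = 0..<n. A x $$ (i, p i)))"
    by (intro ext det_def' A)
  also have "\<dots> \<in> borel_measurable M"
    by (intro borel_measurable_sum borel_measurable_times borel_measurable_prod borel_measurable_const)
       (use permutes_in_image in \<open>fastforce intro!: assms(2)\<close>)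
  finally show ?thesis .
qed

lemma measurable_nested_if:
  fixes f g :: "'x \<Rightarrow> real"
  assumes "\<not> b1 \<Longrightarrow> b2 \<Longrightarrow> f \<in> borel_measurable M" "\<not> b1 \<Longrightarrow> \<not> b2 \<Longrightarrow> g \<in> borel_measurable M"
  shows "(\<lambda>p. if b1 then if b2 then 0 else if b3 then 1 else 0 else if b2 then if b4 then - f p else 0
     else if b5 then g p else 0) \<in> borel_measurable M"
  using assms by (cases b1; cases b2; cases b3; cases b4; cases b5) simp_all

lemma vec_sum_eq: "v \<in> carrier_vec n \<Longrightarrow> A \<in> carrier_mat n n \<Longrightarrow> r < n \<Longrightarrow> (A *\<^sub>v v) $ r = (\<Sum>c<n. A $$ (r, c) * v $ c)"
  by (auto simp: scalar_prod_def atLeast0LessThan)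

definition lsmat :: "nat \<Rightarrow> nat \<Rightarrow> (nat \<Rightarrow> nat \<Rightarrow> nat \<Rightarrow> real) \<Rightarrow> (nat \<Rightarrow> nat \<Rightarrow> real) \<Rightarrow> real mat" where
  "lsmat k d G h = mat (k + k * d) (k + k * d) (\<lambda>(r, c).
     if r < k then if c < k then 0 else if (c - k) mod d = r then 1 else 0
     else if c < k then if c = (r - k) div d then - h c ((r - k) mod d) else 0
     else if (c - k) div d = (r - k) div d then G ((r - k) div d) ((r - k) mod d) ((c - k) mod d) else 0)"

text \<open>The unknowns of \<open>lsmat\<close> are coefficients \<open>\<alpha> t\<close> followed by vectors \<open>\<theta>' t = \<alpha> t * \<theta> t\<close>; its rows
  express that the \<open>\<theta>' t\<close> sum to zero in the first \<open>k\<close> coordinates and that \<open>G t \<theta>' t = \<alpha> t h t\<close>.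
  So a linear dependence between least squares solutions \<open>\<theta> t\<close> makes it singular.\<close>

lemma lsmat_mult:
  assumes r: "r < k + k * d"
  shows "(\<Sum>c<k + k * d. lsmat k d G h $$ (r, c) * (if c < k then \<alpha> c else \<theta> ((c - k) div d) ((c - k) mod d)))
    = (if r < k then \<Sum>t<k. \<Sum>l<d. if l = r then \<theta> t l else 0
       else (\<Sum>l<d. G ((r - k) div d) ((r - k) mod d) l * \<theta> ((r - k) div d) l) - \<alpha> ((r - k) div d) * h ((r - k) div d) ((r - k) mod d))"
proof (cases "r < k")
  case True
  have "(\<Sum>c<k + k * d. lsmat k d G h $$ (r, c) * (if c < k then \<alpha> c else \<theta> ((c - k) div d) ((c - k) mod d)))
     = (\<Sum>c<k + k * d. if c < k then 0 else if (c - k) mod d = r then \<theta> ((c - k) div d) ((c - k) mod d) else 0)"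
    using True r by (intro sum.cong) (auto simp: lsmat_def)
  also have "\<dots> = (\<Sum>t<k. \<Sum>l<d. if l = r then \<theta> t l else 0)"
    using sum_split_blocks[where f = "\<lambda>_. 0" and g = "\<lambda>t l. if l = r then \<theta> t l else 0"] by simp
  finally show ?thesis using True by simp
next
  case False
  define t where "t = (r - k) div d"
  define l where "l = (r - k) mod d"
  have t: "t < k" using False r unfolding t_def by (metis add_diff_inverse_nat less_mult_imp_div_less nat_add_left_cancel_less)
  have "(\<Sum>c<k + k * d. lsmat k d G h $$ (r, c) * (if c < k then \<alpha> c else \<theta> ((c - k) div d) ((c - k) mod d)))
     = (\<Sum>c<k + k * d. if c < k then (if c = t then - (\<alpha> t * h t l) else 0)
          else if (c - k) div d = t then G t l ((c - k) mod d) * \<theta> t ((c - k) mod d) else 0)"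
    using False r by (intro sum.cong) (auto simp: lsmat_def t_def l_def)
  also have "\<dots> = - (\<alpha> t * h t l) + (\<Sum>t'<k. \<Sum>l'<d. if t' = t then G t l l' * \<theta> t l' else 0)"
    using sum_split_blocks[where f = "\<lambda>c. if c = t then - (\<alpha> t * h t l) else 0"
      and g = "\<lambda>t' l'. if t' = t then G t l l' * \<theta> t l' else 0" and k = k and d = d] t by simp
  also have "(\<Sum>t'<k. \<Sum>l'<d. if t' = t then G t l l' * \<theta> t l' else 0) = (\<Sum>l'<d. G t l l' * \<theta> t l')"
    using t by (subst sum.swap) simp
  finally show ?thesis using False by (simp add: t_def l_def)
qed

text \<open>The kernel vector consists of the coefficients \<open>\<alpha>\<close> followed by the
  vectors \<open>\<alpha> t * \<theta> t\<close>; its first block alone shows that it is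
  nonzero.\<close>

lemma lsmat_singular:
  assumes a: "a < k" "\<alpha> a \<noteq> 0" and dep: "\<And>l. l < d \<Longrightarrow> (\<Sum>t<k. \<alpha> t * \<theta> t l) = 0"
    and sol: "\<And>t l. t < k \<Longrightarrow> l < d \<Longrightarrow> (\<Sum>l'<d. G t l l' * \<theta> t l') = h t l"
  shows "det (lsmat k d G h) = 0"
proof -
  let ?n = "k + k * d" and ?A = "lsmat k d G h"
  have A: "?A \<in> carrier_mat ?n ?n" by (simp add: lsmat_def)
  define w where "w = vec ?n (\<lambda>c. if c < k then \<alpha> c else \<alpha> ((c - k) div d) * \<theta> ((c - k) div d) ((c - k) mod d))"
  have w: "w \<in> carrier_vec ?n" by (simp add: w_def)
  have "w $ a = \<alpha> a" using a by (simp add: w_def)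
  then have w0: "w \<noteq> 0\<^sub>v ?n" using a by auto
  have "?A *\<^sub>v w = 0\<^sub>v ?n"
  proof (rule eq_vecI)
    fix r assume "r < dim_vec (0\<^sub>v ?n :: real vec)"
    then have r: "r < ?n" by simp
    note mult = lsmat_mult[OF r, where G = G and h = h and \<alpha> = \<alpha> and \<theta> = "\<lambda>t l. \<alpha> t * \<theta> t l"]
    have "(?A *\<^sub>v w) $ r = (\<Sum>c<?n. ?A $$ (r, c) * w $ c)" by (rule vec_sum_eq[OF w A r])
    also have "\<dots> = (\<Sum>c<?n. ?A $$ (r, c) * (if c < k then \<alpha> c else \<alpha> ((c - k) div d) * \<theta> ((c - k) div d) ((c - k) mod d)))"
      by (intro sum.cong) (auto simp: w_def)
    also have "\<dots> = 0"
    proof (cases "r < k")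
      case True
      have "(\<Sum>t<k. \<Sum>l<d. if l = r then \<alpha> t * \<theta> t l else 0) = (if r < d then \<Sum>t<k. \<alpha> t * \<theta> t r else 0)" by auto
      also have "\<dots> = 0" using dep by auto
      finally show ?thesis unfolding mult using True by simp
    next
      case False
      then have "0 < d" using r by (cases d) auto
      then have tl: "(r - k) div d < k" "(r - k) mod d < d" using False r
        by (auto simp: less_mult_imp_div_less)
      have "(\<Sum>l'<d. G ((r - k) div d) ((r - k) mod d) l' * (\<alpha> ((r - k) div d) * \<theta> ((r - k) div d) l'))
          = \<alpha> ((r - k) div d) * (\<Sum>l'<d. G ((r - k) div d) ((r - k) mod d) l' * \<theta> ((r - k) div d) l')"
        by (simp add: sum_distrib_left mult_ac)
      then show ?thesis unfolding mult using False sol[OF tl] by simp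
    qed
    finally show "(?A *\<^sub>v w) $ r = 0\<^sub>v ?n $ r" using r by simp
  qed (simp add: lsmat_def)
  then show ?thesis using det_0_iff_vec_prod_zero[OF A] w w0 by blast
qed

text \<open>For \<open>h t = G t e_t\<close>, injectivity forces the \<open>t\<close>-th vector of a
  kernel element to be \<open>\<alpha> t * e_t\<close>. The first \<open>k\<close> coordinates of
  the sum of these vectors are \<open>\<alpha>\<close> itself, here with \<open>k \<le> d\<close>,
  so the kernel is trivial.\<close>

lemma lsmat_regular:
  assumes kd: "k \<le> d"
    and inj: "\<And>t v. t < k \<Longrightarrow> (\<And>l. l < d \<Longrightarrow> (\<Sum>l'<d. G t l l' * v l') = 0) \<Longrightarrow> \<forall>l<d. v l = 0"
    and h: "\<And>t l. t < k \<Longrightarrow> l < d \<Longrightarrow> h t l = G t l t"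
  shows "det (lsmat k d G h) \<noteq> 0"
proof
  let ?n = "k + k * d" and ?A = "lsmat k d G h"
  have A: "?A \<in> carrier_mat ?n ?n" by (simp add: lsmat_def)
  assume "det ?A = 0"
  then obtain w where w: "w \<in> carrier_vec ?n" "w \<noteq> 0\<^sub>v ?n" "?A *\<^sub>v w = 0\<^sub>v ?n"
    using det_0_iff_vec_prod_zero[OF A] by blast
  define \<alpha> where "\<alpha> c = w $ c" for c
  define \<theta> where "\<theta> t l = w $ (k + (t * d + l))" for t l
  have wc: "w $ c = (if c < k then \<alpha> c else \<theta> ((c - k) div d) ((c - k) mod d))" if "c < ?n" for c
    using that by (auto simp: \<alpha>_def \<theta>_def)
  have row: "(\<Sum>c<?n. ?A $$ (r, c) * (if c < k then \<alpha> c else \<theta> ((c - k) div d) ((c - k) mod d))) = 0" if r: "r < ?n" for r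
  proof -
    have "(\<Sum>c<?n. ?A $$ (r, c) * (if c < k then \<alpha> c else \<theta> ((c - k) div d) ((c - k) mod d))) = (\<Sum>c<?n. ?A $$ (r, c) * w $ c)"
      by (intro sum.cong) (auto simp: wc)
    also have "\<dots> = (?A *\<^sub>v w) $ r" by (rule vec_sum_eq[OF w(1) A r, symmetric])
    finally show ?thesis using w(3) r by simp
  qed
  have eq: "\<theta> t l = \<alpha> t * (if l = t then 1 else 0)" if t: "t < k" and l: "l < d" for t l
  proof -
    have "\<forall>l<d. \<theta> t l - \<alpha> t * (if l = t then 1 else 0) = 0"
    proof (rule inj[OF t])
      fix l assume l: "l < d"
      define r where "r = k + (t * d + l)"
      have r: "r < ?n"
      proof -
        have "t * d + l < (t + 1) * d" using l by simp
        also have "\<dots> \<le> k * d" using t by (intro mult_le_mono1) simp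
        finally show ?thesis by (simp add: r_def)
      qed
      have tl: "(r - k) div d = t" "(r - k) mod d = l" "\<not> r < k" using l by (auto simp: r_def)
      have "(\<Sum>l'<d. G t l l' * \<theta> t l') = \<alpha> t * G t l t"
      proof -
        have "0 = (if r < k then \<Sum>t<k. \<Sum>l<d. if l = r then \<theta> t l else 0
           else (\<Sum>l<d. G ((r - k) div d) ((r - k) mod d) l * \<theta> ((r - k) div d) l) - \<alpha> ((r - k) div d) * h ((r - k) div d) ((r - k) mod d))"
          using row[OF r] lsmat_mult[OF r, of G h \<alpha> \<theta>] by simp
        then show ?thesis using tl h[OF t l] by simp
      qed
      moreover have "(\<Sum>l'<d. G t l l' * (\<alpha> t * (if l' = t then 1 else 0))) = \<alpha> t * G t l t"
        using t kd by (simp add: mult_delta_right)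
      ultimately show "(\<Sum>l'<d. G t l l' * (\<theta> t l' - \<alpha> t * (if l' = t then 1 else 0))) = 0"
        unfolding right_diff_distrib sum_subtractf by simp
    qed
    then show ?thesis using l by simp
  qed
  have \<alpha>0: "\<alpha> a = 0" if a: "a < k" for a
  proof -
    have an: "a < ?n" using a by simp
    have "0 = (\<Sum>t<k. \<Sum>l<d. if l = a then \<theta> t l else 0)"
      using row[OF an] a unfolding lsmat_mult[OF an] by simp
    also have "\<dots> = (\<Sum>t<k. \<theta> t a)" using a kd by simp
    also have "\<dots> = (\<Sum>t<k. if t = a then \<alpha> t else 0)" using a kd eq by (intro sum.cong) auto
    also have "\<dots> = \<alpha> a" using a by simp
    finally show ?thesis by simp
  qed
  have "w $ c = 0" if c: "c < ?n" for c
  proof (cases "c < k")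
    case True
    then show ?thesis using \<alpha>0 by (simp add: \<alpha>_def)
  next
    case False
    then have "0 < d" using c by (cases d) auto
    then have "(c - k) div d < k" "(c - k) mod d < d" using False c by (auto simp: less_mult_imp_div_less)
    then show ?thesis using False wc[OF c] eq \<alpha>0 by simp
  qed
  then have "w = 0\<^sub>v ?n" using w(1) by (intro eq_vecI) auto
  with w(2) show False by blast
qed

text \<open>A dependence among the first \<open>k\<close> single-task least squares solutions makes
  the determinant of \<open>lsmat\<close> vanish. A noise variable of a task \<open>t < k\<close>
  occurs only in column \<open>t\<close>, so the determinant is affine in each noise variable; being
  nonzero at one noise vector, it is nonzero almost surely.\<close>

lemma least_squares_columns_independent:
  fixes x :: "'x \<Rightarrow> nat \<times> nat \<Rightarrow> nat \<Rightarrow> real" and \<mu> :: "'x \<Rightarrow> nat \<times> nat \<Rightarrow> real"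
  assumes MX: "prob_space MX" and \<sigma>: "0 < \<sigma>" and J: "J = {..<T} \<times> {..<n}" and kT: "k \<le> T" and kd: "k \<le> d"
    and mx [measurable]: "\<And>j l. j \<in> J \<Longrightarrow> l < d \<Longrightarrow> (\<lambda>a. x a j l) \<in> borel_measurable MX"
    and mmu [measurable]: "\<And>j. j \<in> J \<Longrightarrow> (\<lambda>a. \<mu> a j) \<in> borel_measurable MX"
  shows "\<exists>B\<in>null_sets (MX \<Otimes>\<^sub>M PiM J (\<lambda>_. gauss \<sigma>)).
     \<forall>a z. (a, z) \<in> space (MX \<Otimes>\<^sub>M PiM J (\<lambda>_. gauss \<sigma>)) - B
       \<longrightarrow> (\<forall>t<T. \<forall>v. (\<Sum>i<n. (\<Sum>l<d. v l * x a (t, i) l)\<^sup>2) = 0 \<longrightarrow> (\<forall>l<d. v l = 0))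
       \<longrightarrow> \<not> (\<exists>\<theta> \<alpha>. (\<exists>t<k. \<alpha> t \<noteq> 0) \<and> (\<forall>l<d. (\<Sum>t<k. \<alpha> t * \<theta> t l) = 0)
            \<and> (\<forall>t<k. \<forall>l<d. (\<Sum>i<n. x a (t, i) l * (\<mu> a (t, i) + z (t, i) - (\<Sum>l'<d. \<theta> t l' * x a (t, i) l'))) = 0))"
proof -
  define N where "N = gauss \<sigma>"
  have pN: "prob_space N" unfolding N_def by (rule prob_space_normal_density[OF \<sigma>])
  have sN [measurable_cong]: "sets N = sets borel" by (simp add: N_def)
  have atom: "emeasure N {x} = 0" for x
    unfolding N_def by (rule emeasure_gauss_singleton)
  have finJ: "finite J" by (simp add: J)
  define Z where "Z = PiM J (\<lambda>_. N)"
  have pZ: "prob_space Z" unfolding Z_def by (intro prob_space_PiM pN)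
  have comp [measurable]: "(\<lambda>z. z j) \<in> borel_measurable Z" if "j \<in> J" for j
    using measurable_component_singleton[of j J "\<lambda>_. N"] that
    by (simp add: Z_def cong: measurable_cong_sets[OF refl sN])
  have tJ: "(t, i) \<in> J" if "t < k" "i < n" for t i using that kT by (auto simp: J)
  define G where "G a t l l' = (\<Sum>i<n. x a (t, i) l * x a (t, i) l')" for a t l l'
  define h where "h a z t l = (\<Sum>i<n. x a (t, i) l * (\<mu> a (t, i) + z (t, i)))" for a z t l
  define D where "D a z = det (lsmat k d (G a) (h a z))" for a z
  have mD [measurable]: "(\<lambda>p. D (fst p) (snd p)) \<in> borel_measurable (MX \<Otimes>\<^sub>M Z)"
    unfolding D_def
  proof (rule measurable_det[where n = "k + k * d"])
    fix r c assume r: "r < k + k * d" and c: "c < k + k * d"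
    have mG: "(\<lambda>p. G (fst p) t l l') \<in> borel_measurable (MX \<Otimes>\<^sub>M Z)" if "t < k" "l < d" "l' < d" for t l l'
      unfolding G_def using tJ that by measurable
    have mh: "(\<lambda>p. h (fst p) (snd p) t l) \<in> borel_measurable (MX \<Otimes>\<^sub>M Z)" if "t < k" "l < d" for t l
      unfolding h_def using tJ that by measurable
    have idx: "(r - k) div d < k \<and> (r - k) mod d < d" if "\<not> r < k" "r < k + k * d" for r
    proof -
      have "0 < d" using that by (cases d) auto
      then show ?thesis using that by (auto simp: less_mult_imp_div_less)
    qed
    have "(\<lambda>p. lsmat k d (G (fst p)) (h (fst p) (snd p)) $$ (r, c)) = (\<lambda>p.
        if r < k then if c < k then 0 else if (c - k) mod d = r then 1 else 0
        else if c < k then if c = (r - k) div d then - h (fst p) (snd p) c ((r - k) mod d) else 0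
        else if (c - k) div d = (r - k) div d then G (fst p) ((r - k) div d) ((r - k) mod d) ((c - k) mod d) else 0)"
      using r c by (intro ext) (simp add: lsmat_def)
    also have "\<dots> \<in> borel_measurable (MX \<Otimes>\<^sub>M Z)"
      by (rule measurable_nested_if) (use idx[of r] idx[of c] r c mG mh in blast)+
    finally show "(\<lambda>p. lsmat k d (G (fst p)) (h (fst p) (snd p)) $$ (r, c)) \<in> borel_measurable (MX \<Otimes>\<^sub>M Z)" .
  qed (simp add: lsmat_def)
  define inj where "inj a \<longleftrightarrow> (\<forall>t<T. \<forall>v. (\<Sum>i<n. (\<Sum>l<d. v l * x a (t, i) l)\<^sup>2) = 0 \<longrightarrow> (\<forall>l<d. v l = 0))" for a
  have Gv: "(\<Sum>l'<d. G a t l l' * v l') = (\<Sum>i<n. x a (t, i) l * (\<Sum>l'<d. v l' * x a (t, i) l'))" for a t l v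
  proof -
    have "(\<Sum>l'<d. G a t l l' * v l') = (\<Sum>l'<d. \<Sum>i<n. x a (t, i) l * (v l' * x a (t, i) l'))"
      unfolding G_def sum_distrib_right by (simp add: mult_ac)
    also have "\<dots> = (\<Sum>i<n. \<Sum>l'<d. x a (t, i) l * (v l' * x a (t, i) l'))" by (rule sum.swap)
    finally show ?thesis by (simp add: sum_distrib_left)
  qed
  have AE: "AE z in Z. D a z \<noteq> 0" if inj: "inj a" and a: "a \<in> space MX" for a
    unfolding Z_def
  proof (rule AE_multiaffine_nonzero[OF pN sN atom finJ])
    \<comment> \<open>This noise turns the response of task \<open>t\<close> into its own
      \<open>t\<close>-th covariate, so that for \<open>t < k\<close> the least squares solution is
      the unit vector \<open>e_t\<close>.\<close>
    define z0 where "z0 = (\<lambda>j\<in>J. x a j (fst j) - \<mu> a j)"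
    show "z0 \<in> extensional J" by (simp add: z0_def)
    show "D a z0 \<noteq> 0" unfolding D_def
    proof (rule lsmat_regular[OF kd])
      fix t l assume t: "t < k" and "l < d"
      show "h a z0 t l = G a t l t"
        unfolding h_def G_def using tJ t by (intro sum.cong) (auto simp: z0_def)
    next
      fix t v assume t: "t < k" and v: "\<And>l. l < d \<Longrightarrow> (\<Sum>l'<d. G a t l l' * v l') = 0"
      have "(\<Sum>i<n. (\<Sum>l<d. v l * x a (t, i) l)\<^sup>2) = (\<Sum>i<n. \<Sum>l<d. v l * (x a (t, i) l * (\<Sum>l'<d. v l' * x a (t, i) l')))"
        by (simp add: power2_eq_square sum_distrib_right mult.assoc)
      also have "\<dots> = (\<Sum>l<d. \<Sum>i<n. v l * (x a (t, i) l * (\<Sum>l'<d. v l' * x a (t, i) l')))" by (rule sum.swap)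
      also have "\<dots> = (\<Sum>l<d. v l * (\<Sum>l'<d. G a t l l' * v l'))" unfolding Gv by (simp add: sum_distrib_left)
      also have "\<dots> = 0" using v by simp
      finally have "(\<Sum>i<n. (\<Sum>l<d. v l * x a (t, i) l)\<^sup>2) = 0" .
      moreover have "t < T" using t kT by simp
      ultimately show "\<forall>l<d. v l = 0" using inj unfolding inj_def by blast
    qed
    have "(\<lambda>z. (a, z)) \<in> measurable Z (MX \<Otimes>\<^sub>M Z)" using a by simp
    from measurable_compose[OF this mD] show "D a \<in> borel_measurable (PiM J (\<lambda>_. N))"
      by (simp add: Z_def)
  next
    fix j z assume j: "j \<in> J"
    obtain t i where ti: "j = (t, i)" "t < T" "i < n" using j by (auto simp: J)
    show "\<exists>\<alpha> \<beta>. \<forall>s. D a (z(j := s)) = \<alpha> + \<beta> * s"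
    proof (cases "t < k")
      case True
      define h0 where "h0 t' l = h a (z(j := 0)) t' l" for t' l
      have hh: "h a (z(j := s)) t' l = h0 t' l + (if t' = t then x a j l * s else 0)" if "t' < k" for t' l s
      proof -
        have "h a (z(j := s)) t' l = (\<Sum>i'<n. x a (t', i') l * (\<mu> a (t', i') + (z(j := 0)) (t', i'))
            + (if i' = i then if t' = t then x a j l * s else 0 else 0))"
          unfolding h_def by (intro sum.cong) (auto simp: ti algebra_simps)
        then show ?thesis using ti(3) by (simp add: sum.distrib h_def h0_def)
      qed
      show ?thesis unfolding D_def
      proof (rule det_affine_in_column[where c = t and n = "k + k * d" and A = "\<lambda>s. lsmat k d (G a) (h a (z(j := s)))"])
        fix r assume r: "r < k + k * d"
        have "\<exists>p q. \<forall>s. - h a (z(j := s)) t ((r - k) mod d) = p + q * s"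
          by (rule exI[of _ "- h0 t ((r - k) mod d)"], rule exI[of _ "- x a j ((r - k) mod d)"])
             (simp only: hh[OF True], simp)
        moreover have "\<exists>p q. \<forall>s::real. (0::real) = p + q * s" by (rule exI[of _ 0], rule exI[of _ 0]) simp
        ultimately show "\<exists>p q. \<forall>s. lsmat k d (G a) (h a (z(j := s))) $$ (r, t) = p + q * s"
          using r True by (cases "r < k"; cases "t = (r - k) div d") (simp_all add: lsmat_def)
      next
        fix r c' s assume "r < k + k * d" "c' < k + k * d" "c' \<noteq> t"
        then show "lsmat k d (G a) (h a (z(j := s))) $$ (r, c') = lsmat k d (G a) (h a (z(j := 0))) $$ (r, c')"
          by (auto simp: lsmat_def hh simp del: fun_upd_apply)
      qed (use True in \<open>auto simp: lsmat_def\<close>)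
    next
      case False
      have hh: "h a (z(j := s)) t' l = h a z t' l" if "t' < k" for t' l s
        unfolding h_def using that False by (intro sum.cong) (auto simp: ti)
      have "lsmat k d (G a) (h a (z(j := s))) = lsmat k d (G a) (h a z)" for s
        unfolding lsmat_def by (intro eq_matI) (auto simp: hh simp del: fun_upd_apply)
      then show ?thesis unfolding D_def by (intro exI[of _ "det (lsmat k d (G a) (h a z))"] exI[of _ 0]) simp
    qed
  qed
  define B where "B = {p\<in>space (MX \<Otimes>\<^sub>M Z). D (fst p) (snd p) = 0}"
  have mB: "B \<in> sets (MX \<Otimes>\<^sub>M Z)" unfolding B_def by measurable
  text \<open>Injectivity of the design is not known to be a measurable condition; it is replaced by the
    measurable condition that almost no noise vector makes the determinant vanish.\<close>
  define H where "H = {a\<in>space MX. emeasure Z (Pair a -` B) = 0}"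
  have mH: "H \<in> sets MX" unfolding H_def
    using sigma_finite_measure.measurable_emeasure_Pair[OF prob_space_imp_sigma_finite[OF pZ] mB] by measurable
  have injH: "a \<in> H" if "inj a" "a \<in> space MX" for a
  proof -
    have s: "Pair a -` B = {z\<in>space Z. \<not> D a z \<noteq> 0}" using that(2) by (auto simp: B_def space_pair_measure)
    have "Pair a -` B \<in> sets Z" by (rule sets_Pair1[OF mB])
    then show ?thesis using AE[OF that] that(2) unfolding H_def by (simp add: AE_iff_measurable[OF _ s[symmetric]])
  qed
  define B' where "B' = B \<inter> (H \<times> space Z)"
  have mB': "B' \<in> sets (MX \<Otimes>\<^sub>M Z)" unfolding B'_def by (intro sets.Int pair_measureI mB mH sets.top)
  have "emeasure Z (Pair a -` B') = 0" for a
  proof (cases "a \<in> H")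
    case True
    then have "emeasure Z (Pair a -` B) = 0" by (simp add: H_def)
    moreover have "emeasure Z (Pair a -` B') \<le> emeasure Z (Pair a -` B)"
      by (intro emeasure_mono sets_Pair1[OF mB]) (auto simp: B'_def)
    ultimately show ?thesis by simp
  next
    case False
    then have "Pair a -` B' = {}" by (auto simp: B'_def)
    then show ?thesis by simp
  qed
  then have "emeasure (MX \<Otimes>\<^sub>M Z) B' = 0"
    by (simp add: sigma_finite_measure.emeasure_pair_measure_alt[OF prob_space_imp_sigma_finite[OF pZ] mB'])
  then have B'0: "B' \<in> null_sets (MX \<Otimes>\<^sub>M Z)" using mB' by auto
  define dep where "dep a z \<longleftrightarrow> (\<exists>\<theta> \<alpha>. (\<exists>t<k. \<alpha> t \<noteq> 0) \<and> (\<forall>l<d. (\<Sum>t<k. \<alpha> t * \<theta> t l) = 0)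
            \<and> (\<forall>t<k. \<forall>l<d. (\<Sum>i<n. x a (t, i) l * (\<mu> a (t, i) + z (t, i) - (\<Sum>l'<d. \<theta> t l' * x a (t, i) l'))) = 0))" for a z
  have nodep: "\<not> dep a z" if az: "(a, z) \<in> space (MX \<Otimes>\<^sub>M Z) - B'" and inj: "inj a" for a z
  proof
    assume "dep a z"
    then obtain \<theta> \<alpha> t0 where t0: "t0 < k" "\<alpha> t0 \<noteq> 0" and dep: "\<And>l. l < d \<Longrightarrow> (\<Sum>t<k. \<alpha> t * \<theta> t l) = 0"
      and sol: "\<And>t l. t < k \<Longrightarrow> l < d \<Longrightarrow> (\<Sum>i<n. x a (t, i) l * (\<mu> a (t, i) + z (t, i) - (\<Sum>l'<d. \<theta> t l' * x a (t, i) l'))) = 0"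
      unfolding dep_def by blast
    have "(\<Sum>l'<d. G a t l l' * \<theta> t l') = h a z t l" if "t < k" "l < d" for t l
      using sol[OF that] unfolding Gv h_def by (simp add: right_diff_distrib sum_subtractf)
    then have "D a z = 0" unfolding D_def by (intro lsmat_singular[OF t0 dep])
    moreover have "a \<in> H" using injH[OF inj] az by (auto simp: space_pair_measure)
    ultimately have "(a, z) \<in> B'" using az by (auto simp: B'_def B_def space_pair_measure)
    then show False using az by blast
  qed
  then have nd: "\<forall>a z. (a, z) \<in> space (MX \<Otimes>\<^sub>M Z) - B' \<longrightarrow> inj a \<longrightarrow> \<not> dep a z" by blast
  show ?thesis
  proof (rule bexI[where x = B'])
    show "B' \<in> null_sets (MX \<Otimes>\<^sub>M PiM J (\<lambda>_. gauss \<sigma>))" using B'0 unfolding Z_def N_def .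
  qed (rule nd[unfolded inj_def dep_def Z_def N_def])
qed

section \<open>Full row rank of optimal coefficient matrices\<close>

lemma lin_ip: "lin d k x B w = ip {..<d} x (mv k B w)"
  by (simp add: lin_def ip_def)

text \<open>A square matrix and its transpose are singular together: a row relation among the first
  \<open>k\<close> columns yields a column relation.\<close>

lemma singular_kernel:
  fixes W :: "nat \<Rightarrow> nat \<Rightarrow> real"
  assumes q: "m0 < k" "q m0 \<noteq> 0" and z: "\<And>t. t < k \<Longrightarrow> (\<Sum>m<k. q m * W m t) = 0"
  shows "\<exists>\<alpha>. (\<exists>t<k. \<alpha> t \<noteq> 0) \<and> (\<forall>m<k. (\<Sum>t<k. W m t * \<alpha> t) = 0)"
proof -
  define A where "A = mat k k (\<lambda>(m, t). W m t)"
  have A: "A \<in> carrier_mat k k" "transpose_mat A \<in> carrier_mat k k" by (auto simp: A_def)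
  have "vec k q \<noteq> 0\<^sub>v k"
  proof
    assume "vec k q = 0\<^sub>v k"
    then have "vec k q $ m0 = 0\<^sub>v k $ m0" by simp
    then show False using q by simp
  qed
  moreover have "transpose_mat A *\<^sub>v vec k q = 0\<^sub>v k"
  proof (rule eq_vecI)
    fix t assume "t < dim_vec (0\<^sub>v k :: real vec)"
    then have t: "t < k" by simp
    have "(transpose_mat A *\<^sub>v vec k q) $ t = (\<Sum>c<k. transpose_mat A $$ (t, c) * vec k q $ c)"
      by (rule vec_sum_eq[OF _ A(2) t]) simp
    also have "\<dots> = (\<Sum>m<k. q m * W m t)" using t by (intro sum.cong) (auto simp: A_def)
    finally show "(transpose_mat A *\<^sub>v vec k q) $ t = 0\<^sub>v k $ t" using z[OF t] t by simp
  qed (simp add: A_def)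
  moreover have "vec k q \<in> carrier_vec k" by simp
  ultimately have "det (transpose_mat A) = 0" using det_0_iff_vec_prod_zero[OF A(2)] by blast
  then have "det A = 0" by (simp add: det_transpose[OF A(1)])
  then obtain w where w: "w \<in> carrier_vec k" "w \<noteq> 0\<^sub>v k" "A *\<^sub>v w = 0\<^sub>v k"
    using det_0_iff_vec_prod_zero[OF A(1)] by blast
  have "\<exists>t<k. w $ t \<noteq> 0"
  proof (rule ccontr)
    assume "\<not> ?thesis"
    then have "w = 0\<^sub>v k" using w(1) by (intro eq_vecI) auto
    then show False using w(2) by simp
  qed
  moreover have "(\<Sum>t<k. W m t * w $ t) = 0" if m: "m < k" for m
  proof -
    have "(\<Sum>t<k. W m t * w $ t) = (\<Sum>t<k. A $$ (m, t) * w $ t)" using m by (intro sum.cong) (auto simp: A_def)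
    also have "\<dots> = (A *\<^sub>v w) $ m" by (rule vec_sum_eq[OF w(1) A(1) m, symmetric])
    finally show ?thesis using w(3) m by simp
  qed
  ultimately show ?thesis by blast
qed

lemma orthonormal_span:
  fixes v :: "'a \<Rightarrow> 'i \<Rightarrow> real"
  assumes I: "finite I" and A: "finite A"
  obtains r :: nat and u c where "r \<le> card A"
    and "\<And>a b. a < r \<Longrightarrow> b < r \<Longrightarrow> ip I (u a) (u b) = (if a = b then 1 else 0)"
    and "\<And>j i. j \<in> A \<Longrightarrow> i \<in> I \<Longrightarrow> v j i = (\<Sum>a<r. c j a * u a i)"
proof -
  from orthonormalize[OF I A, of v] obtain r :: nat and u where *: "r \<le> card A"
     "\<forall>a<r. \<forall>b<r. ip I (u a) (u b) = (if a = b then 1 else 0)"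
     "\<forall>j\<in>A. \<exists>c. \<forall>i\<in>I. v j i = (\<Sum>a<r. c a * u a i)" by (elim exE conjE)
  from bchoice[OF *(3)] obtain c where "\<forall>j\<in>A. \<forall>i\<in>I. v j i = (\<Sum>a<r. c j a * u a i)" by (elim exE)
  with * show thesis by (intro that[of r u c]) auto
qed

lemma gain_le_iff:
  assumes "finite J"
  shows "gain J y u \<le> gain J y v \<longleftrightarrow> (\<Sum>j\<in>J. (y j - v j)\<^sup>2) \<le> (\<Sum>j\<in>J. (y j - u j)\<^sup>2)"
proof -
  have "(\<Sum>j\<in>J. (y j - u j)\<^sup>2) = (\<Sum>j\<in>J. (y j)\<^sup>2) - 2 * gain J y u" for u
    unfolding gain_def sum_distrib_left sum_subtractf[symmetric]
    by (intro sum.cong) (auto simp: power2_eq_square algebra_simps)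
  then show ?thesis by auto
qed

text \<open>If \<open>W\<close> is rank deficient then \<open>B\<close> can be changed freely along the kernel of its transpose, so the
  product \<open>B W\<close> can be perturbed in every direction and solves the unconstrained least squares problem.\<close>

lemma maximizer_surjective:
  fixes x :: "nat \<times> nat \<Rightarrow> nat \<Rightarrow> real"
  assumes J: "J = {..<T} \<times> {..<n}" and kT: "k \<le> T"
    and opt: "\<And>B W. gain J y (\<lambda>j. lin d k (x j) B (\<lambda>m. W m (fst j))) \<le> gain J y (\<lambda>j. lin d k (x j) Bh (\<lambda>m. Wh m (fst j)))"
    and indep: "\<not> (\<exists>\<theta> \<alpha>. (\<exists>t<k. \<alpha> t \<noteq> 0) \<and> (\<forall>l<d. (\<Sum>t<k. \<alpha> t * \<theta> t l) = 0)
            \<and> (\<forall>t<k. \<forall>l<d. (\<Sum>i<n. x (t, i) l * (y (t, i) - (\<Sum>l'<d. \<theta> t l' * x (t, i) l'))) = 0))"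
  shows "\<exists>a. \<forall>m<k. u m = (\<Sum>t<T. a t * Wh m t)"
proof (rule ccontr)
  assume not: "\<not> ?thesis"
  obtain a where a: "\<forall>t\<in>{..<T}. ip {..<k} (\<lambda>m. Wh m t) (\<lambda>m. u m - (\<Sum>t<T. a t * Wh m t)) = 0"
    using orthogonal_projection[of "{..<k}" "{..<T}" "\<lambda>t m. Wh m t" u] by auto
  define q where "q m = u m - (\<Sum>t<T. a t * Wh m t)" for m
  have qW: "(\<Sum>m<k. q m * Wh m t) = 0" if "t < T" for t
    using a that by (simp add: ip_def q_def mult.commute)
  obtain m0 where m0: "m0 < k" "q m0 \<noteq> 0" using not by (auto simp: q_def)
  define Q where "Q = (\<Sum>m<k. (q m)\<^sup>2)"
  have Q: "0 < Q" unfolding Q_def using m0 by (intro sum_pos2[of _ m0]) auto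
  define fit where "fit B W j = lin d k (x j) B (\<lambda>m. W m (fst j))" for B W j
  define res where "res j = y j - fit Bh Wh j" for j
  have normal: "(\<Sum>i<n. x (t0, i) l0 * res (t0, i)) = 0" if t0: "t0 < T" and l0: "l0 < d" for t0 l0
  proof -
    \<comment> \<open>The rank one changes \<open>g q^T\<close> of \<open>Bh\<close> and
      \<open>s q e_t0^T / Q\<close> of \<open>Wh\<close> change the product by exactly
      \<open>s\<close> in entry \<open>(l0, t0)\<close>: \<open>q\<close> annihilates the columns of
      \<open>Wh\<close>, and the second summand of \<open>g\<close> cancels the contribution of
      \<open>Bh q\<close>.\<close>
    define g where "g l = (if l = l0 then 1 else 0) - (\<Sum>m<k. Bh l m * q m) / Q" for l
    have "0 \<le> 2 * s * (- (\<Sum>i<n. x (t0, i) l0 * res (t0, i))) + s\<^sup>2 * (\<Sum>i<n. (x (t0, i) l0)\<^sup>2)" for s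
    proof -
      define B where "B l m = Bh l m + g l * q m" for l m
      define W where "W m t = Wh m t + s * q m * (if t = t0 then 1 / Q else 0)" for m t
      have BW: "mv k B (\<lambda>m. W m t) l = mv k Bh (\<lambda>m. Wh m t) l + (if t = t0 then if l = l0 then s else 0 else 0)" if t: "t < T" for t l
      proof -
        define \<tau> where "\<tau> = (if t = t0 then 1 / Q else 0)"
        have "mv k B (\<lambda>m. W m t) l = (\<Sum>m<k. Bh l m * Wh m t + g l * (q m * Wh m t) + s * \<tau> * (Bh l m * q m) + g l * s * \<tau> * (q m)\<^sup>2)"
          unfolding mv_def B_def W_def \<tau>_def[symmetric]
          by (intro sum.cong) (auto simp: power2_eq_square algebra_simps)
        also have "\<dots> = mv k Bh (\<lambda>m. Wh m t) l + g l * (\<Sum>m<k. q m * Wh m t) + s * \<tau> * (\<Sum>m<k. Bh l m * q m) + g l * s * \<tau> * Q"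
          by (simp add: sum.distrib sum_distrib_left mv_def Q_def)
        also have "\<dots> = mv k Bh (\<lambda>m. Wh m t) l + (if t = t0 then if l = l0 then s else 0 else 0)"
          using qW[OF t] Q by (simp add: \<tau>_def g_def field_simps)
        finally show ?thesis .
      qed
      have fitBW: "fit B W j = fit Bh Wh j + (if fst j = t0 then s * x j l0 else 0)" if j: "j \<in> J" for j
      proof -
        have "fst j < T" using j by (auto simp: J)
        then have "fit B W j = (\<Sum>l<d. x j l * mv k Bh (\<lambda>m. Wh m (fst j)) l + (if l = l0 then if fst j = t0 then s * x j l0 else 0 else 0))"
          unfolding fit_def lin_def by (intro sum.cong) (auto simp: BW algebra_simps)
        then show ?thesis using l0 by (simp add: sum.distrib fit_def lin_def)
      qed
      have "(\<Sum>j\<in>J. (y j - fit Bh Wh j)\<^sup>2) \<le> (\<Sum>j\<in>J. (y j - fit B W j)\<^sup>2)"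
        using opt[of B W] by (subst (asm) gain_le_iff) (auto simp: J fit_def)
      also have "\<dots> = (\<Sum>j\<in>J. (y j - fit Bh Wh j)\<^sup>2 + (if fst j = t0 then s\<^sup>2 * (x j l0)\<^sup>2 - 2 * s * (x j l0 * res j) else 0))"
        by (intro sum.cong) (auto simp: fitBW res_def power2_eq_square algebra_simps)
      finally have "0 \<le> (\<Sum>j\<in>J. if fst j = t0 then s\<^sup>2 * (x j l0)\<^sup>2 - 2 * s * (x j l0 * res j) else 0)"
        by (simp add: sum.distrib)
      also have "\<dots> = (\<Sum>t<T. \<Sum>i<n. if t = t0 then s\<^sup>2 * (x (t, i) l0)\<^sup>2 - 2 * s * (x (t, i) l0 * res (t, i)) else 0)"
        unfolding J sum.cartesian_product by (intro sum.cong) auto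
      also have "\<dots> = (\<Sum>i<n. s\<^sup>2 * (x (t0, i) l0)\<^sup>2 - 2 * s * (x (t0, i) l0 * res (t0, i)))"
        using t0 by (subst sum.swap) simp
      also have "\<dots> = 2 * s * (- (\<Sum>i<n. x (t0, i) l0 * res (t0, i))) + s\<^sup>2 * (\<Sum>i<n. (x (t0, i) l0)\<^sup>2)"
        by (simp add: sum_subtractf sum_distrib_left)
      finally show ?thesis .
    qed
    then have "- (\<Sum>i<n. x (t0, i) l0 * res (t0, i)) = 0" by (rule linear_coeff_zero)
    then show ?thesis by simp
  qed
  \<comment> \<open>The columns of \<open>Bh Wh\<close> now satisfy the normal equations of every
    task, and a relation among the first \<open>k\<close> columns of \<open>Wh\<close> passes to
    them, against \<open>indep\<close>.\<close>
  obtain \<alpha> where \<alpha>: "\<exists>t<k. \<alpha> t \<noteq> 0" "\<And>m. m < k \<Longrightarrow> (\<Sum>t<k. Wh m t * \<alpha> t) = 0"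
    using singular_kernel[of m0 k q Wh] m0 qW kT by auto
  define \<theta> where "\<theta> t = mv k Bh (\<lambda>m. Wh m t)" for t
  have dep: "(\<Sum>t<k. \<alpha> t * \<theta> t l) = 0" for l
  proof -
    have "(\<Sum>t<k. \<alpha> t * \<theta> t l) = (\<Sum>t<k. \<Sum>m<k. Bh l m * (Wh m t * \<alpha> t))"
      by (simp add: \<theta>_def mv_def sum_distrib_left mult_ac)
    also have "\<dots> = (\<Sum>m<k. Bh l m * (\<Sum>t<k. Wh m t * \<alpha> t))" by (subst sum.swap) (simp add: sum_distrib_left)
    also have "\<dots> = 0" using \<alpha>(2) by simp
    finally show ?thesis .
  qed
  have sol: "(\<Sum>i<n. x (t, i) l * (y (t, i) - (\<Sum>l'<d. \<theta> t l' * x (t, i) l'))) = 0" if "t < k" "l < d" for t l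
    using normal[of t l] that kT by (simp add: res_def fit_def lin_def \<theta>_def mult.commute)
  show False
    by (rule notE[OF indep], intro exI[of _ \<theta>] exI[of _ \<alpha>] conjI allI impI \<alpha>(1) dep sol)
qed

section \<open>Deterministic regression bounds\<close>

text \<open>Arithmetic-geometric mean inequality, weighted so that the energy \<open>v\<close>
  returns with the small factor \<open>1 / 4\<close> and can be absorbed on the left.\<close>

lemma twice_le_of_square_le:
  fixes a K v :: real
  assumes "a\<^sup>2 \<le> K * v" "0 \<le> K" "0 \<le> v"
  shows "2 * a \<le> 4 * K + v / 4"
proof -
  have *: "(2 * a)\<^sup>2 \<le> (4 * K + v / 4)\<^sup>2"
    using assms(1) zero_le_power2[of "4 * K - v / 4"] by (simp add: power2_eq_square algebra_simps)
  show ?thesis by (rule power2_le_imp_le[OF *]) (use assms in auto)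
qed

text \<open>The basic inequality of least squares against an arbitrary competitor \<open>w\<close>.
  Its noise term sees only \<open>mv k Bh (wh - w)\<close>, so a bound on the range of
  \<open>Bh\<close> suffices; absorbing the cross term gives \<open>A \<le> 3 * Bb + 8 * K\<close>
  in sample, and the covariance comparison on both sides turns this into the factors
  \<open>4\<close> and \<open>9\<close>.\<close>

lemma target_regression_bound:
  fixes x :: "nat \<Rightarrow> nat \<Rightarrow> real" and q :: "(nat \<Rightarrow> real) \<Rightarrow> real"
  assumes n: "0 < n" and K: "0 \<le> K"
    and cov: "\<And>u. \<bar>(\<Sum>i<n. (ip {..<d} (x i) (\<lambda>l. mv k Bh u l - b l))\<^sup>2) - real n * q (\<lambda>l. mv k Bh u l - b l)\<bar>
        \<le> real n / 10 * q (\<lambda>l. mv k Bh u l - b l)"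
    and noise: "\<And>u. (\<Sum>i<n. z i * ip {..<d} (x i) (mv k Bh u))\<^sup>2 \<le> K * (\<Sum>i<n. (ip {..<d} (x i) (mv k Bh u))\<^sup>2)"
    and opt: "(\<Sum>i<n. (ip {..<d} (x i) b + z i - ip {..<d} (x i) (mv k Bh wh))\<^sup>2)
        \<le> (\<Sum>i<n. (ip {..<d} (x i) b + z i - ip {..<d} (x i) (mv k Bh w))\<^sup>2)"
  shows "q (\<lambda>l. mv k Bh wh l - b l) \<le> 4 * q (\<lambda>l. mv k Bh w l - b l) + 9 * K / real n"
proof -
  define \<alpha> where "\<alpha> i = ip {..<d} (x i) (\<lambda>l. mv k Bh wh l - b l)" for i
  define \<beta> where "\<beta> i = ip {..<d} (x i) (\<lambda>l. mv k Bh w l - b l)" for i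
  define A where "A = (\<Sum>i<n. (\<alpha> i)\<^sup>2)"
  define Bb where "Bb = (\<Sum>i<n. (\<beta> i)\<^sup>2)"
  define Cr where "Cr = (\<Sum>i<n. z i * (\<alpha> i - \<beta> i))"
  define Df where "Df = (\<Sum>i<n. (\<alpha> i - \<beta> i)\<^sup>2)"
  have diff: "\<alpha> i - \<beta> i = ip {..<d} (x i) (mv k Bh (\<lambda>m. wh m - w m))" for i
    unfolding \<alpha>_def \<beta>_def ip_diff_right[symmetric] by (simp add: mv_def sum_subtractf right_diff_distrib)
  have Cr2: "Cr\<^sup>2 \<le> K * Df" unfolding Cr_def Df_def diff by (rule noise)
  have Df2: "Df \<le> 2 * A + 2 * Bb"
  proof -
    have "(\<alpha> i - \<beta> i)\<^sup>2 \<le> 2 * (\<alpha> i)\<^sup>2 + 2 * (\<beta> i)\<^sup>2" for i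
      using zero_le_power2[of "\<alpha> i + \<beta> i"] by (simp add: power2_eq_square algebra_simps)
    then show ?thesis unfolding Df_def A_def Bb_def sum_distrib_left sum.distrib[symmetric] by (intro sum_mono)
  qed
  have Df0: "0 \<le> Df" by (simp add: Df_def sum_nonneg)
  have e: "(ip {..<d} (x i) b + z i - ip {..<d} (x i) (mv k Bh wh)) = z i - \<alpha> i"
    "(ip {..<d} (x i) b + z i - ip {..<d} (x i) (mv k Bh w)) = z i - \<beta> i" for i
    by (simp_all add: \<alpha>_def \<beta>_def ip_diff_right)
  have "(\<Sum>i<n. (z i - \<alpha> i)\<^sup>2) \<le> (\<Sum>i<n. (z i - \<beta> i)\<^sup>2)" using opt by (simp add: e)
  moreover have "(\<Sum>i<n. (z i - \<alpha> i)\<^sup>2) - (\<Sum>i<n. (z i - \<beta> i)\<^sup>2) = A - Bb - 2 * Cr"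
    unfolding A_def Bb_def Cr_def sum_distrib_left sum_subtractf[symmetric]
    by (intro sum.cong) (auto simp: power2_eq_square algebra_simps)
  ultimately have "A \<le> Bb + 2 * Cr" by linarith
  also have "2 * Cr \<le> 4 * K + Df / 4" by (rule twice_le_of_square_le[OF Cr2 K Df0])
  finally have A: "A \<le> 3 * Bb + 8 * K" using Df2 by linarith
  define a where "a = real n * q (\<lambda>l. mv k Bh wh l - b l)"
  define c where "c = real n * q (\<lambda>l. mv k Bh w l - b l)"
  have "\<bar>A - a\<bar> \<le> a / 10" using cov[of wh] by (simp add: A_def \<alpha>_def a_def)
  then have "9 / 10 * a \<le> A" unfolding abs_le_iff by linarith
  have "\<bar>Bb - c\<bar> \<le> c / 10" using cov[of w] by (simp add: Bb_def \<beta>_def c_def)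
  then have "Bb \<le> 11 / 10 * c" "0 \<le> c" unfolding abs_le_iff by linarith+
  with \<open>9 / 10 * a \<le> A\<close> have "a \<le> 4 * c + 9 * K" using A K by linarith
  then show ?thesis using n by (simp add: a_def c_def field_simps)
qed

text \<open>All prediction differences \<open>\<delta> t\<close> share one orthonormal basis
  \<open>u\<close> of the span of the columns of \<open>Bh\<close> and \<open>Bs\<close>. Rounding
  that basis to a net point splits the in-sample error \<open>e\<close> into \<open>eb\<close>,
  covered by the noise event of the net point, and a remainder \<open>g\<close>, small enough to be
  paired with the entire noise by Cauchy-Schwarz.\<close>

lemma source_regression_bound:
  fixes x :: "nat \<times> nat \<Rightarrow> nat \<Rightarrow> real" and Bs Ws Bh Wh :: "nat \<Rightarrow> nat \<Rightarrow> real" and z :: "nat \<times> nat \<Rightarrow> real"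
  assumes J: "J = {..<T} \<times> {..<n}" and n: "0 < n" and k: "0 < k" and d: "0 < d"
    and L: "0 < Lm" "Lm \<le> LM" and K: "0 \<le> K3" "0 \<le> K4"
    and cov: "\<And>t v. t < T \<Longrightarrow> \<bar>(\<Sum>i<n. (ip {..<d} (x (t, i)) v)\<^sup>2) - real n * q t v\<bar> \<le> real n / 10 * q t v"
    and qL: "\<And>t v. t < T \<Longrightarrow> q t v \<le> LM * (\<Sum>l<d. (v l)\<^sup>2)" "\<And>t v. t < T \<Longrightarrow> Lm * (\<Sum>l<d. (v l)\<^sup>2) \<le> q t v"
    and net: "\<And>V :: nat \<times> nat \<Rightarrow> real. (\<forall>i\<in>{..<d} \<times> {..<2 * k}. \<bar>V i\<bar> \<le> 1)
        \<Longrightarrow> \<exists>V'\<in>N. \<forall>i\<in>{..<d} \<times> {..<2 * k}. \<bar>V i - V' i\<bar> \<le> h"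
    and h: "0 < h" "h\<^sup>2 * (2 * real k * real d * (LM / Lm * real n)) = 1"
    and noise: "\<And>V r. V \<in> N \<Longrightarrow> (\<Sum>j\<in>J. z j * (\<Sum>a<2 * k. r (fst j) a * ip {..<d} (x j) (\<lambda>l. V (l, a))))\<^sup>2
        \<le> K3 * (\<Sum>j\<in>J. (\<Sum>a<2 * k. r (fst j) a * ip {..<d} (x j) (\<lambda>l. V (l, a)))\<^sup>2)"
    and znorm: "(\<Sum>j\<in>J. (z j)\<^sup>2) \<le> K4"
    and opt: "gain J (\<lambda>j. lin d k (x j) Bs (\<lambda>m. Ws m (fst j)) + z j) (\<lambda>j. lin d k (x j) Bs (\<lambda>m. Ws m (fst j)))
        \<le> gain J (\<lambda>j. lin d k (x j) Bs (\<lambda>m. Ws m (fst j)) + z j) (\<lambda>j. lin d k (x j) Bh (\<lambda>m. Wh m (fst j)))"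
  shows "(\<Sum>t<T. q t (\<lambda>l. mv k Bh (\<lambda>m. Wh m t) l - mv k Bs (\<lambda>m. Ws m t) l)) \<le> (50 * K3 + 12 * K4 / real n) / real n"
proof -
  have finJ: "finite J" by (simp add: J)
  define \<delta> where "\<delta> t l = mv k Bh (\<lambda>m. Wh m t) l - mv k Bs (\<lambda>m. Ws m t) l" for t l
  define e where "e j = ip {..<d} (x j) (\<delta> (fst j))" for j
  define S where "S = (\<Sum>j\<in>J. (e j)\<^sup>2)"
  have sumJ: "(\<Sum>j\<in>J. f j) = (\<Sum>t<T. \<Sum>i<n. f (t, i))" for f :: "nat \<times> nat \<Rightarrow> real"
    unfolding J by (simp add: sum.cartesian_product)
  have fit: "lin d k (x j) Bh (\<lambda>m. Wh m (fst j)) = lin d k (x j) Bs (\<lambda>m. Ws m (fst j)) + e j" for j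
    by (simp add: lin_ip e_def \<delta>_def[abs_def] ip_diff_right)
  define Z where "Z = (\<Sum>j\<in>J. z j * e j)"
  have S2: "S \<le> 2 * Z"
  proof -
    have "(\<Sum>j\<in>J. (z j - e j)\<^sup>2) \<le> (\<Sum>j\<in>J. (z j)\<^sup>2)"
      using opt unfolding gain_le_iff[OF finJ] fit by simp
    moreover have "(\<Sum>j\<in>J. (z j - e j)\<^sup>2) - (\<Sum>j\<in>J. (z j)\<^sup>2) = S - 2 * Z"
      unfolding S_def Z_def sum_distrib_left sum_subtractf[symmetric]
      by (intro sum.cong) (auto simp: power2_eq_square algebra_simps)
    ultimately show ?thesis by linarith
  qed
  define v where "v a l = (if a < k then Bh l a else Bs l (a - k))" for a l
  obtain r :: nat and u c where r: "r \<le> card {..<2 * k}"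
    and on: "\<And>a b. a < r \<Longrightarrow> b < r \<Longrightarrow> ip {..<d} (u a) (u b) = (if a = b then 1 else 0)"
    and c': "\<And>j l. j \<in> {..<2 * k} \<Longrightarrow> l \<in> {..<d} \<Longrightarrow> v j l = (\<Sum>a<r. c j a * u a l)"
    by (rule orthonormal_span[of "{..<d}" "{..<2 * k}" v]) auto
  have c: "v j l = (\<Sum>a<r. c j a * u a l)" if "j < 2 * k" "l < d" for j l
    using c'[of j l] that by simp
  define \<rho> where "\<rho> t a = (\<Sum>m<k. c m a * Wh m t) - (\<Sum>m<k. c (k + m) a * Ws m t)" for t a
  have \<delta>\<rho>: "\<delta> t l = (\<Sum>a<r. \<rho> t a * u a l)" if l: "l < d" for t l
  proof -
    have 1: "mv k Bh (\<lambda>m. Wh m t) l = (\<Sum>a<r. (\<Sum>m<k. c m a * Wh m t) * u a l)"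
    proof -
      have "Bh l m = (\<Sum>a<r. c m a * u a l)" if "m < k" for m
        using c[of m l] that l by (simp add: v_def)
      then have "mv k Bh (\<lambda>m. Wh m t) l = (\<Sum>m<k. \<Sum>a<r. c m a * Wh m t * u a l)"
        unfolding mv_def by (intro sum.cong) (auto simp: sum_distrib_left mult_ac)
      also have "\<dots> = (\<Sum>a<r. (\<Sum>m<k. c m a * Wh m t) * u a l)" by (subst sum.swap) (simp add: sum_distrib_right)
      finally show ?thesis .
    qed
    have 2: "mv k Bs (\<lambda>m. Ws m t) l = (\<Sum>a<r. (\<Sum>m<k. c (k + m) a * Ws m t) * u a l)"
    proof -
      have "Bs l m = (\<Sum>a<r. c (k + m) a * u a l)" if "m < k" for m
        using c[of "k + m" l] that l by (simp add: v_def)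
      then have "mv k Bs (\<lambda>m. Ws m t) l = (\<Sum>m<k. \<Sum>a<r. c (k + m) a * Ws m t * u a l)"
        unfolding mv_def by (intro sum.cong) (auto simp: sum_distrib_left mult_ac)
      also have "\<dots> = (\<Sum>a<r. (\<Sum>m<k. c (k + m) a * Ws m t) * u a l)" by (subst sum.swap) (simp add: sum_distrib_right)
      finally show ?thesis .
    qed
    show ?thesis unfolding \<delta>_def 1 2 \<rho>_def by (simp add: left_diff_distrib sum_subtractf)
  qed
  define \<delta>n where "\<delta>n t = (\<Sum>l<d. (\<delta> t l)\<^sup>2)" for t
  have \<delta>n: "\<delta>n t = (\<Sum>a<r. (\<rho> t a)\<^sup>2)" for t
  proof -
    have "\<delta>n t = ip {..<d} (\<lambda>l. \<Sum>a<r. \<rho> t a * u a l) (\<lambda>l. \<Sum>a<r. \<rho> t a * u a l)"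
      unfolding \<delta>n_def ip_def by (intro sum.cong) (auto simp: \<delta>\<rho> power2_eq_square)
    also have "\<dots> = (\<Sum>a<r. (\<rho> t a)\<^sup>2)" by (rule ip_orthonormal_norm[OF on])
    finally show ?thesis .
  qed
  \<comment> \<open>If the span has dimension below \<open>2 * k\<close>, the missing columns are
    zero; the coefficients \<open>\<rho>'\<close> vanish there too.\<close>
  define V where "V i = (if snd i < r then u (snd i) (fst i) else 0)" for i :: "nat \<times> nat"
  have "\<bar>V i\<bar> \<le> 1" if "i \<in> {..<d} \<times> {..<2 * k}" for i
  proof (cases "snd i < r")
    case True
    have "(u (snd i) (fst i))\<^sup>2 \<le> (\<Sum>l<d. (u (snd i) l)\<^sup>2)" using that by (intro member_le_sum) auto
    also have "\<dots> = 1" using on[OF True True] by (simp add: ip_def power2_eq_square)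
    finally show ?thesis using True by (simp add: V_def abs_square_le_1)
  qed (simp add: V_def)
  then obtain V' where V': "V' \<in> N" "\<And>i. i \<in> {..<d} \<times> {..<2 * k} \<Longrightarrow> \<bar>V i - V' i\<bar> \<le> h"
    using net[of V] by blast
  define \<rho>' where "\<rho>' t a = (if a < r then \<rho> t a else 0)" for t a
  have r2: "r \<le> 2 * k" using r by simp
  have ext: "(\<Sum>a<r. f a) = (\<Sum>a<2 * k. if a < r then f a else 0)" for f :: "nat \<Rightarrow> real"
  proof -
    have "(\<Sum>a<2 * k. if a < r then f a else 0) = (\<Sum>a\<in>{..<2 * k} \<inter> {a. a < r}. f a)"
      by (simp add: sum.inter_restrict)
    moreover have "{..<2 * k} \<inter> {a. a < r} = {..<r}" using r2 by auto
    ultimately show ?thesis by simp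
  qed
  define eb where "eb j = (\<Sum>a<2 * k. \<rho>' (fst j) a * ip {..<d} (x j) (\<lambda>l. V' (l, a)))" for j
  define \<tau> where "\<tau> t l = (\<Sum>a<2 * k. \<rho>' t a * (V (l, a) - V' (l, a)))" for t l
  define g where "g j = ip {..<d} (x j) (\<tau> (fst j))" for j
  have eg: "e j = eb j + g j" for j
  proof -
    have "e j = ip {..<d} (x j) (\<lambda>l. \<Sum>a<2 * k. \<rho>' (fst j) a * V (l, a))"
      unfolding e_def
      by (intro ip_cong) (auto simp: \<delta>\<rho> ext \<rho>'_def V_def intro!: sum.cong)
    also have "\<dots> = (\<Sum>a<2 * k. \<rho>' (fst j) a * ip {..<d} (x j) (\<lambda>l. V (l, a)))" by (rule ip_sum_right)
    moreover have "g j = (\<Sum>a<2 * k. \<rho>' (fst j) a * ip {..<d} (x j) (\<lambda>l. V (l, a) - V' (l, a)))"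
      unfolding g_def \<tau>_def[abs_def] by (rule ip_sum_right)
    ultimately show ?thesis
      unfolding eb_def by (simp add: ip_diff_right sum.distrib[symmetric] algebra_simps)
  qed
  have \<tau>n: "(\<Sum>l<d. (\<tau> t l)\<^sup>2) \<le> h\<^sup>2 * (2 * real k * real d) * \<delta>n t" for t
  proof -
    have "(\<tau> t l)\<^sup>2 \<le> \<delta>n t * (2 * real k * h\<^sup>2)" if l: "l < d" for l
    proof -
      have "(\<tau> t l)\<^sup>2 \<le> (\<Sum>a<2 * k. (\<rho>' t a)\<^sup>2) * (\<Sum>a<2 * k. (V (l, a) - V' (l, a))\<^sup>2)"
        unfolding \<tau>_def by (rule Cauchy_Schwarz_ineq_sum)
      also have "(\<Sum>a<2 * k. (\<rho>' t a)\<^sup>2) = \<delta>n t"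
        unfolding \<delta>n ext by (intro sum.cong) (auto simp: \<rho>'_def)
      also have "\<delta>n t * (\<Sum>a<2 * k. (V (l, a) - V' (l, a))\<^sup>2) \<le> \<delta>n t * (\<Sum>a<2 * k. h\<^sup>2)"
      proof (intro mult_left_mono sum_mono)
        fix a assume "a \<in> {..<2 * k}"
        then have "\<bar>V (l, a) - V' (l, a)\<bar> \<le> \<bar>h\<bar>" using V'(2)[of "(l, a)"] l h(1) by simp
        then show "(V (l, a) - V' (l, a))\<^sup>2 \<le> h\<^sup>2" by (simp only: abs_le_square_iff)
      qed (simp add: \<delta>n_def sum_nonneg)
      finally show ?thesis by simp
    qed
    then have "(\<Sum>l<d. (\<tau> t l)\<^sup>2) \<le> (\<Sum>l<d. \<delta>n t * (2 * real k * h\<^sup>2))" by (intro sum_mono) auto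
    then show ?thesis by (simp add: mult_ac)
  qed
  have E9: "9 / 10 * (real n * q t v) \<le> (\<Sum>i<n. (ip {..<d} (x (t, i)) v)\<^sup>2)"
    "(\<Sum>i<n. (ip {..<d} (x (t, i)) v)\<^sup>2) \<le> 11 / 10 * (real n * q t v)" if "t < T" for t v
    using cov[OF that, of v] unfolding abs_le_iff by linarith+
  define Gs where "Gs = (\<Sum>j\<in>J. (g j)\<^sup>2)"
  \<comment> \<open>This is what the choice of \<open>h\<close> is made for: \<open>2 k d\<close>
    counts the rounded entries, \<open>LM / Lm\<close> pays for passing between the Euclidean norm
    and the task covariances, and the extra \<open>n\<close> gains the factor that offsets the total
    noise energy.\<close>
  have Gs: "real n * Gs \<le> 11 / 9 * S"
  proof -
    have "real n * (\<Sum>i<n. (g (t, i))\<^sup>2) \<le> 11 / 9 * (\<Sum>i<n. (e (t, i))\<^sup>2)" if t: "t < T" for t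
    proof -
      have "real n * (\<Sum>i<n. (g (t, i))\<^sup>2) \<le> real n * (11 / 10 * (real n * q t (\<tau> t)))"
        unfolding g_def fst_conv using E9(2)[OF t, of "\<tau> t"] by (intro mult_left_mono) auto
      also have "\<dots> \<le> real n * (11 / 10 * (real n * (LM * (h\<^sup>2 * (2 * real k * real d) * \<delta>n t))))"
        using qL(1)[OF t, of "\<tau> t"] \<tau>n[of t] L by (intro mult_left_mono order_trans[OF qL(1)[OF t]]) auto
      also have "\<dots> = (h\<^sup>2 * (2 * real k * real d * (LM / Lm * real n))) * (11 / 10 * (real n * (Lm * \<delta>n t)))"
        using L by (simp add: field_simps)
      also have "\<dots> = 11 / 10 * (real n * (Lm * \<delta>n t))" by (simp only: h(2) mult_1_left)
      also have "\<dots> \<le> 11 / 10 * (real n * q t (\<delta> t))"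
        using qL(2)[OF t, of "\<delta> t"] by (intro mult_left_mono) (auto simp: \<delta>n_def)
      also have "\<dots> \<le> 11 / 9 * (\<Sum>i<n. (e (t, i))\<^sup>2)" using E9(1)[OF t, of "\<delta> t"] by (simp add: e_def)
      finally show ?thesis .
    qed
    then have "(\<Sum>t<T. real n * (\<Sum>i<n. (g (t, i))\<^sup>2)) \<le> (\<Sum>t<T. 11 / 9 * (\<Sum>i<n. (e (t, i))\<^sup>2))"
      by (intro sum_mono) auto
    then show ?thesis unfolding Gs_def S_def sumJ by (simp add: sum_distrib_left)
  qed
  have S0: "0 \<le> S" by (simp add: S_def sum_nonneg)
  have Gs0: "0 \<le> Gs" by (simp add: Gs_def sum_nonneg)
  have n1: "1 \<le> real n" using n by simp
  have "Gs \<le> real n * Gs" using n1 Gs0 by (simp add: mult_le_cancel_right1)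
  then have GsS: "Gs \<le> 11 / 9 * S" using Gs by linarith
  define Eb where "Eb = (\<Sum>j\<in>J. (eb j)\<^sup>2)"
  have EbS: "Eb \<le> 5 * S"
  proof -
    have "(eb j)\<^sup>2 \<le> 2 * (e j)\<^sup>2 + 2 * (g j)\<^sup>2" for j
      unfolding eg[of j] using zero_le_power2[of "eb j + 2 * g j"] by (simp add: power2_eq_square algebra_simps)
    then have "Eb \<le> 2 * S + 2 * Gs" unfolding Eb_def S_def Gs_def sum_distrib_left sum.distrib[symmetric] by (intro sum_mono)
    then show ?thesis using GsS S0 by linarith
  qed
  have Eb0: "0 \<le> Eb" by (simp add: Eb_def sum_nonneg)
  define Z1 where "Z1 = (\<Sum>j\<in>J. z j * eb j)"
  define Z2 where "Z2 = (\<Sum>j\<in>J. z j * g j)"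
  have ZZ: "Z = Z1 + Z2" unfolding Z_def Z1_def Z2_def eg by (simp add: distrib_left sum.distrib)
  have "Z1\<^sup>2 \<le> K3 * Eb" unfolding Z1_def Eb_def eb_def by (rule noise[OF V'(1)])
  also have "\<dots> \<le> K3 * (5 * S)" using K EbS by (intro mult_left_mono)
  finally have "Z1\<^sup>2 \<le> (5 * K3) * S" by simp
  from twice_le_of_square_le[OF this] have 1: "2 * Z1 \<le> 20 * K3 + S / 4" using K S0 by simp
  have "Z2\<^sup>2 \<le> (\<Sum>j\<in>J. (z j)\<^sup>2) * Gs" unfolding Z2_def Gs_def by (rule Cauchy_Schwarz_ineq_sum)
  also have "\<dots> \<le> K4 * (11 / 9 * S / real n)"
    using znorm Gs Gs0 n K by (intro mult_mono) (auto simp: field_simps)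
  finally have "Z2\<^sup>2 \<le> (11 / 9 * K4 / real n) * S" by (simp add: field_simps)
  from twice_le_of_square_le[OF this] have 2: "2 * Z2 \<le> 4 * (11 / 9 * K4 / real n) + S / 4" using K S0 by simp
  \<comment> \<open>Both noise terms return \<open>S / 4\<close>, so half of \<open>S\<close>
    remains on the left.\<close>
  have SS: "S \<le> 40 * K3 + 10 * (K4 / real n)"
  proof -
    have "S \<le> 20 * K3 + S / 4 + (44 / 9 * (K4 / real n) + S / 4)" using S2 ZZ 1 2 by simp
    moreover have "0 \<le> K4 / real n" using K by simp
    ultimately show ?thesis by linarith
  qed
  have "9 / 10 * real n * (\<Sum>t<T. q t (\<delta> t)) \<le> S"
    unfolding S_def sumJ sum_distrib_left e_def fst_conv
    by (intro sum_mono) (use E9(1) in \<open>auto simp: mult.assoc\<close>)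
  moreover have "0 \<le> K4 / real n" using K by simp
  ultimately have "real n * (\<Sum>t<T. q t (\<delta> t)) \<le> 50 * K3 + 12 * (K4 / real n)" using SS K by linarith
  then show ?thesis using n by (simp add: \<delta>_def[abs_def] field_simps)
qed

section \<open>Transfer to the target distribution\<close>

text \<open>The row vector \<open>v^T R\<close>. When \<open>S = R R^T\<close> this map turns the
  form of \<open>S\<close> into the Euclidean norm.\<close>

definition tmult :: "nat \<Rightarrow> (nat \<Rightarrow> nat \<Rightarrow> real) \<Rightarrow> (nat \<Rightarrow> real) \<Rightarrow> nat \<Rightarrow> real" where
  "tmult d R v l = (\<Sum>i<d. v i * R i l)"

lemma tmult_sum: "tmult d R (\<lambda>i. \<Sum>a\<in>A. c a * w a i) l = (\<Sum>a\<in>A. c a * tmult d R (w a) l)"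
proof -
  have "tmult d R (\<lambda>i. \<Sum>a\<in>A. c a * w a i) l = (\<Sum>i<d. \<Sum>a\<in>A. c a * (w a i * R i l))"
    by (simp add: tmult_def sum_distrib_right mult.assoc)
  then show ?thesis by (subst (asm) sum.swap) (simp add: tmult_def sum_distrib_left)
qed

lemma tmult_mv: "tmult d R (mv k B w) l = (\<Sum>a<k. w a * tmult d R (\<lambda>i. B i a) l)"
  using tmult_sum[of d R w "\<lambda>a i. B i a" "{..<k}" l] by (simp add: mv_def mult.commute[of "w _"])

lemma tmult_diff: "tmult d R (\<lambda>i. v i - w i) l = tmult d R v l - tmult d R w l"
  by (simp add: tmult_def left_diff_distrib sum_subtractf)

lemma qform_gram:
  assumes S: "\<And>i j. i < d \<Longrightarrow> j < d \<Longrightarrow> S i j = (\<Sum>l<m. R i l * R j l)"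
  shows "qform d S v = ip {..<m} (tmult d R v) (tmult d R v)"
proof -
  have "qform d S v = (\<Sum>i<d. \<Sum>j<d. \<Sum>l<m. (v i * R i l) * (v j * R j l))"
    unfolding qform_def by (intro sum.cong) (auto simp: S sum_distrib_left sum_distrib_right mult_ac)
  also have "\<dots> = (\<Sum>i<d. \<Sum>l<m. \<Sum>j<d. (v i * R i l) * (v j * R j l))" by (intro sum.cong refl sum.swap)
  also have "\<dots> = (\<Sum>l<m. \<Sum>i<d. \<Sum>j<d. (v i * R i l) * (v j * R j l))" by (rule sum.swap)
  also have "\<dots> = ip {..<m} (tmult d R v) (tmult d R v)" by (simp add: ip_def tmult_def sum_product)
  finally show ?thesis .
qed

text \<open>The residual of projecting onto the range of \<open>Bh\<close> in the geometry of
  \<open>S\<close> is linear in \<open>w\<close>, here with matrix \<open>g\<close>. The best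
  attainable error is therefore a quadratic form in \<open>w\<close>, which can be averaged over the
  columns of \<open>Ws\<close> as well as over \<open>\<nu>\<close>.\<close>

lemma population_projection:
  assumes S: "\<And>i j. i < d \<Longrightarrow> j < d \<Longrightarrow> S i j = (\<Sum>l<d. R i l * R j l)"
  shows "\<exists>\<psi> g. \<forall>w. qform d S (\<lambda>l. mv k Bh (mv k \<psi> w) l - mv k Bs w l) = (\<Sum>l<d. (\<Sum>j<k. w j * g l j)\<^sup>2)
     \<and> (\<forall>u. (\<Sum>l<d. (\<Sum>j<k. w j * g l j)\<^sup>2) \<le> qform d S (\<lambda>l. mv k Bh u l - mv k Bs w l))"
proof -
  define H where "H a = tmult d R (\<lambda>i. Bh i a)" for a
  have "\<forall>j. \<exists>q. \<forall>a\<in>{..<k}. ip {..<d} (H a) (\<lambda>l. tmult d R (\<lambda>i. Bs i j) l - (\<Sum>a'<k. q a' * H a' l)) = 0"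
    using orthogonal_projection[of "{..<d}" "{..<k}" H] by auto
  from choice[OF this] obtain q where q: "\<And>j a. a < k \<Longrightarrow> ip {..<d} (H a) (\<lambda>l. tmult d R (\<lambda>i. Bs i j) l - (\<Sum>a'<k. q j a' * H a' l)) = 0"
    by auto
  define \<psi> where "\<psi> a j = q j a" for a j
  define g where "g l j = tmult d R (\<lambda>i. Bs i j) l - (\<Sum>a<k. q j a * H a l)" for l j
  have Hg: "ip {..<d} (H a) (\<lambda>l. \<Sum>j<k. w j * g l j) = 0" if "a < k" for a w
  proof -
    have "ip {..<d} (H a) (\<lambda>l. \<Sum>j<k. w j * g l j) = (\<Sum>j<k. w j * ip {..<d} (H a) (\<lambda>l. g l j))"
      using ip_sum_right[of "{..<d}" "H a" w "\<lambda>j l. g l j"] by simp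
    then show ?thesis using q[OF that] by (simp add: g_def)
  qed
  have t: "tmult d R (\<lambda>l. mv k Bh u l - mv k Bs w l) l = (\<Sum>a<k. (u a - mv k \<psi> w a) * H a l) - (\<Sum>j<k. w j * g l j)" for u w l
  proof -
    have "(\<Sum>j<k. w j * (\<Sum>a<k. q j a * H a l)) = (\<Sum>a<k. mv k \<psi> w a * H a l)"
      unfolding mv_def \<psi>_def sum_distrib_left sum_distrib_right by (subst sum.swap) (simp add: mult_ac)
    then show ?thesis
      by (simp add: tmult_diff tmult_mv g_def H_def[symmetric] right_diff_distrib left_diff_distrib sum_subtractf)
  qed
  have qg: "qform d S v = ip {..<d} (tmult d R v) (tmult d R v)" for v
    by (rule qform_gram) (rule S)
  have main: "qform d S (\<lambda>l. mv k Bh u l - mv k Bs w l)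
      = ip {..<d} (\<lambda>l. \<Sum>a<k. (u a - mv k \<psi> w a) * H a l) (\<lambda>l. \<Sum>a<k. (u a - mv k \<psi> w a) * H a l) + (\<Sum>l<d. (\<Sum>j<k. w j * g l j)\<^sup>2)" for u w
  proof -
    have z: "ip {..<d} (\<lambda>l. \<Sum>a<k. (u a - mv k \<psi> w a) * H a l) (\<lambda>l. \<Sum>j<k. w j * g l j) = 0"
      unfolding ip_sum_left using Hg by simp
    define X where "X l = (\<Sum>a<k. (u a - mv k \<psi> w a) * H a l)" for l
    define Y where "Y l = (\<Sum>j<k. w j * g l j)" for l
    have "ip {..<d} (\<lambda>l. X l - Y l) (\<lambda>l. X l - Y l) = ip {..<d} X X + (\<Sum>l<d. (Y l)\<^sup>2) - 2 * ip {..<d} X Y"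
      unfolding ip_def sum_distrib_left sum.distrib[symmetric] sum_subtractf[symmetric]
      by (intro sum.cong) (auto simp: power2_eq_square algebra_simps)
    moreover have "ip {..<d} X Y = 0" using z by (simp add: X_def[abs_def] Y_def[abs_def])
    ultimately have "ip {..<d} (\<lambda>l. X l - Y l) (\<lambda>l. X l - Y l) = ip {..<d} X X + (\<Sum>l<d. (Y l)\<^sup>2)" by simp
    then show ?thesis unfolding qg t[abs_def] X_def Y_def by simp
  qed
  have "qform d S (\<lambda>l. mv k Bh (mv k \<psi> w) l - mv k Bs w l) = (\<Sum>l<d. (\<Sum>j<k. w j * g l j)\<^sup>2)" for w
    unfolding main by (simp add: ip_def)
  moreover have "(\<Sum>l<d. (\<Sum>j<k. w j * g l j)\<^sup>2) \<le> qform d S (\<lambda>l. mv k Bh u l - mv k Bs w l)" for u w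
    unfolding main using ip_self_nonneg by simp
  ultimately show ?thesis by blast
qed

lemma gram_symm: "symm n (\<lambda>a b. \<Sum>l<m. W a l * W b l)"
  by (simp add: symm_def mult.commute)

text \<open>An eigenvector shows that the smallest eigenvalue of \<open>W W^T\<close> is
  nonnegative, so that squaring undoes the root in \<open>sing_val\<close>; the rest is the lower
  Rayleigh bound.\<close>

lemma sing_val_smallest:
  assumes k: "0 < k"
  shows "(sing_val k m W k)\<^sup>2 * (\<Sum>j<k. (g j)\<^sup>2) \<le> (\<Sum>t<m. (\<Sum>j<k. g j * W j t)\<^sup>2)"
proof -
  let ?A = "\<lambda>a b. \<Sum>l<m. W a l * W b l"
  have q: "qform k ?A v = (\<Sum>t<m. (\<Sum>j<k. v j * W j t)\<^sup>2)" for v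
    by (subst qform_gram[OF refl]) (simp add: ip_def tmult_def power2_eq_square)
  obtain x where x: "eigvec k ?A (eig_list k ?A ! (k - 1)) x" using eig_list_Rayleigh(3)[OF gram_symm[where n = k and m = m and W = W] k] by blast
  have "0 \<le> eig_list k ?A ! (k - 1) * (\<Sum>i<k. (x i)\<^sup>2)"
    unfolding qform_eigvec[OF x, symmetric] q by (intro sum_nonneg) auto
  moreover obtain i where "i < k" "x i \<noteq> 0" using x by (auto simp: eigvec_def)
  then have "0 < (\<Sum>i<k. (x i)\<^sup>2)" by (intro sum_pos2[of _ i]) auto
  ultimately have "0 \<le> eig_list k ?A ! (k - 1)" by (simp add: zero_le_mult_iff)
  then have "(sing_val k m W k)\<^sup>2 = eig_list k ?A ! (k - 1)" by (simp add: sing_val_def)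
  then show ?thesis using eig_list_Rayleigh(2)[OF gram_symm[where n = k and m = m and W = W] k, of g] by (simp add: q)
qed

text \<open>Cauchy-Schwarz applied to \<open>(g^T M) g\<close>; the squared length of
  \<open>g^T M\<close> is the form of \<open>M M^T\<close> at \<open>g\<close>, bounded by its
  largest eigenvalue.\<close>

lemma qform_le_spec_norm:
  assumes k: "0 < k"
  shows "qform k M g \<le> spec_norm k k M * (\<Sum>j<k. (g j)\<^sup>2)"
proof -
  let ?A = "\<lambda>a b. \<Sum>l<k. M a l * M b l"
  define h where "h l = (\<Sum>i<k. g i * M i l)" for l
  define N where "N = (\<Sum>j<k. (g j)\<^sup>2)"
  have N0: "0 \<le> N" by (simp add: N_def sum_nonneg)
  have hn: "(\<Sum>l<k. (h l)\<^sup>2) \<le> eig_list k ?A ! 0 * N"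
    using eig_list_Rayleigh(1)[OF gram_symm[where n = k and m = k and W = M] k, of g]
      qform_gram[OF refl, where d = k and m = k and R = M and v = g]
    by (simp add: ip_def tmult_def h_def power2_eq_square N_def)
  have "qform k M g = (\<Sum>j<k. h j * g j)"
    unfolding qform_def h_def sum_distrib_right by (rule sum.swap)
  then have "(qform k M g)\<^sup>2 \<le> (\<Sum>l<k. (h l)\<^sup>2) * N" by (simp add: Cauchy_Schwarz_ineq_sum N_def)
  also have "\<dots> \<le> (eig_list k ?A ! 0 * N) * N" using hn N0 by (intro mult_right_mono)
  finally have "qform k M g \<le> sqrt (eig_list k ?A ! 0 * N * N)" by (rule real_le_rsqrt)
  also have "\<dots> = sqrt (eig_list k ?A ! 0) * N" using N0 by (simp add: real_sqrt_mult)
  finally show ?thesis by (simp add: spec_norm_def sing_val_def N_def)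
qed

section \<open>Second moments and whitened covariates\<close>

lemma vec_space_component:
  assumes "sets M = sets (vec_space n)" "i < n"
  shows "(\<lambda>x. x i) \<in> borel_measurable M"
proof -
  have "(\<lambda>x. x i) \<in> borel_measurable (vec_space n)"
    unfolding vec_space_def using assms(2) by (intro measurable_component_singleton) auto
  then show ?thesis by (simp add: measurable_cong_sets[OF assms(1) refl])
qed

lemma second_moment_quadratic:
  assumes int: "\<And>i j. i < n \<Longrightarrow> j < n \<Longrightarrow> integrable M (\<lambda>x. x i * x j)"
  shows "integrable M (\<lambda>x. (\<Sum>i<n. v i * x i)\<^sup>2)"
    and "(\<integral>x. (\<Sum>i<n. v i * x i)\<^sup>2 \<partial>M) = qform n (second_moment M) v"
proof -
  have e: "(\<lambda>x. (\<Sum>i<n. v i * x i)\<^sup>2) = (\<lambda>x. \<Sum>i<n. \<Sum>j<n. v i * v j * (x i * x j))"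
    by (auto simp: power2_eq_square sum_product mult_ac intro!: ext sum.cong)
  show "integrable M (\<lambda>x. (\<Sum>i<n. v i * x i)\<^sup>2)"
    unfolding e by (intro Bochner_Integration.integrable_sum integrable_mult_right int) auto
  have "(\<integral>x. (\<Sum>i<n. v i * x i)\<^sup>2 \<partial>M) = (\<Sum>i<n. \<Sum>j<n. v i * v j * (\<integral>x. x i * x j \<partial>M))"
    unfolding e by (subst Bochner_Integration.integral_sum, (intro Bochner_Integration.integrable_sum integrable_mult_right int; simp),
        rule sum.cong[OF refl], subst Bochner_Integration.integral_sum, (intro integrable_mult_right int; simp), simp)
  then show "(\<integral>x. (\<Sum>i<n. v i * x i)\<^sup>2 \<partial>M) = qform n (second_moment M) v"
    by (simp add: qform_def second_moment_def mult_ac)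
qed

text \<open>The condition (A4) concerns values of integrals only; the norm bound on the target
  parameter supplies the integrability behind them.\<close>

lemma bounded_second_moment_integrable:
  assumes M: "prob_space M" "sets M = sets (vec_space n)" and b: "AE w in M. vnorm n w \<le> b"
    and ij: "i < n" "j < n"
  shows "integrable M (\<lambda>w. w i * w j)"
proof -
  interpret prob_space M by (rule M(1))
  have ab: "\<bar>w i\<bar> \<le> vnorm n w" if "i < n" for w :: "nat \<Rightarrow> real" and i
    unfolding vnorm_def using that
    by (intro real_le_rsqrt) (auto intro!: member_le_sum)
  show ?thesis
  proof (rule integrable_const_bound[of _ "b * b"])
    show "AE w in M. norm (w i * w j) \<le> b * b"
      using b
    proof eventually_elim
      case (elim w)
      have "\<bar>w i\<bar> \<le> b" "\<bar>w j\<bar> \<le> b" using ab[OF ij(1), of w] ab[OF ij(2), of w] elim by linarith+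
      then show ?case unfolding real_norm_def abs_mult by (intro mult_mono) auto
    qed
    show "(\<lambda>w. w i * w j) \<in> borel_measurable M"
      using vec_space_component[OF M(2) ij(1)] vec_space_component[OF M(2) ij(2)] by measurable
  qed
qed

lemma excess_risk_eq:
  assumes "has_cov d P S"
  shows "excess_risk d P u = 1 / 2 * qform d S u"
proof -
  have "(\<integral>x. (\<Sum>i<d. u i * x i)\<^sup>2 \<partial>P) = qform d (second_moment P) u"
    using assms by (intro second_moment_quadratic) (auto simp: has_cov_def)
  also have "\<dots> = qform d S u" using assms by (auto simp: qform_def has_cov_def intro!: sum.cong)
  finally show ?thesis by (simp add: excess_risk_def mult.commute)
qed

locale whitened =
  fixes d :: nat and \<rho> :: real and pbar p :: "(nat \<Rightarrow> real) measure" and S R :: "nat \<Rightarrow> nat \<Rightarrow> real"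
  assumes prob: "prob_space pbar" and sets_pbar: "sets pbar = sets (vec_space d)"
    and mean: "mean_zero d pbar" and cov_bar: "has_cov d pbar (\<lambda>i j. if i = j then 1 else 0)"
    and p: "p = distr pbar (vec_space d) (\<lambda>x. restrict (mv d R x) {..<d})"
    and cov: "has_cov d p S" and sub: "subgaussian d pbar (\<rho>\<^sup>2)"
begin

lemma map_measurable: "(\<lambda>x. restrict (mv d R x) {..<d}) \<in> measurable pbar (vec_space d)"
  unfolding vec_space_def
proof (rule measurable_restrict)
  fix i assume "i \<in> {..<d}"
  show "(\<lambda>x. mv d R x i) \<in> borel_measurable pbar"
    unfolding mv_def using vec_space_component[OF sets_pbar] by measurable
qed

lemma prob_p: "prob_space p"
  unfolding p by (rule prob_space.prob_space_distr[OF prob map_measurable])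

lemma sets_p: "sets p = sets (vec_space d)"
  by (simp add: p)

text \<open>In the application \<open>R\<close> is \<open>msqrt d S\<close>, a definite description.
  The factorisation is read off from the covariance of the image measure \<open>p\<close> by a
  change of variables, with \<open>pbar\<close> having covariance the identity.\<close>

lemma cov_factor:
  assumes i: "i < d" and j: "j < d"
  shows "S i j = (\<Sum>l<d. R i l * R j l)"
proof -
  have int: "integrable pbar (\<lambda>x. x a * x b)" if "a < d" "b < d" for a b
    using cov_bar that by (simp add: has_cov_def)
  have val: "(\<integral>x. x a * x b \<partial>pbar) = (if a = b then 1 else 0)" if "a < d" "b < d" for a b
    using cov_bar that by (simp add: has_cov_def second_moment_def)
  have "S i j = (\<integral>x. x i * x j \<partial>p)" using cov i j by (simp add: has_cov_def second_moment_def)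
  also have "\<dots> = (\<integral>x. mv d R x i * mv d R x j \<partial>pbar)"
    unfolding p
  proof (subst integral_distr[OF map_measurable])
    show "(\<lambda>x. x i * x j) \<in> borel_measurable (vec_space d)"
      using vec_space_component[OF refl i] vec_space_component[OF refl j] by measurable
  qed (use i j in simp)
  also have "(\<lambda>x. mv d R x i * mv d R x j) = (\<lambda>x. \<Sum>a<d. \<Sum>b<d. R i a * R j b * (x a * x b))"
    by (auto simp: mv_def sum_product mult_ac intro!: ext sum.cong)
  also have "(\<integral>x. (\<Sum>a<d. \<Sum>b<d. R i a * R j b * (x a * x b)) \<partial>pbar) = (\<Sum>a<d. \<Sum>b<d. R i a * R j b * (\<integral>x. x a * x b \<partial>pbar))"
    by (subst Bochner_Integration.integral_sum, (intro Bochner_Integration.integrable_sum integrable_mult_right int; simp),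
        rule sum.cong[OF refl], subst Bochner_Integration.integral_sum, (intro integrable_mult_right int; simp), simp)
  also have "\<dots> = (\<Sum>a<d. \<Sum>b<d. if a = b then R i a * R j b else 0)"
    by (intro sum.cong refl) (simp add: val)
  also have "\<dots> = (\<Sum>l<d. R i l * R j l)" by simp
  finally show ?thesis .
qed

lemma quadratic:
  shows "integrable p (\<lambda>x. (\<Sum>l<d. v l * x l)\<^sup>2)" and "(\<integral>x. (\<Sum>l<d. v l * x l)\<^sup>2 \<partial>p) = qform d S v"
proof -
  have int: "integrable p (\<lambda>x. x a * x b)" if "a < d" "b < d" for a b
    using cov that by (simp add: has_cov_def)
  show "integrable p (\<lambda>x. (\<Sum>l<d. v l * x l)\<^sup>2)" by (rule second_moment_quadratic(1)[OF int])
  have "(\<integral>x. (\<Sum>l<d. v l * x l)\<^sup>2 \<partial>p) = qform d (second_moment p) v" by (rule second_moment_quadratic(2)[OF int])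
  also have "\<dots> = qform d S v" using cov by (auto simp: qform_def has_cov_def intro!: sum.cong)
  finally show "(\<integral>x. (\<Sum>l<d. v l * x l)\<^sup>2 \<partial>p) = qform d S v" .
qed

text \<open>Pulling \<open>v\<close> back to \<open>u = v^T R\<close> and normalising it, the
  subgaussian condition at \<open>s = |u|\<close> applies; and \<open>|u|^2\<close> is the form of
  \<open>S\<close> at \<open>v\<close>. The direction \<open>u = 0\<close> cannot be normalised and
  is trivial.\<close>

lemma laplace:
  "(\<integral>\<^sup>+x. ennreal (exp (\<Sum>l<d. v l * x l)) \<partial>p) \<le> ennreal (exp (qform d S v * \<rho>\<^sup>2 / 2))"
proof -
  define u where "u = tmult d R v"
  define N where "N = (\<Sum>l<d. (u l)\<^sup>2)"
  have N: "qform d S v = N"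
    using qform_gram[where d = d and S = S and m = d and R = R and v = v, OF cov_factor]
    by (simp add: u_def N_def ip_def power2_eq_square)
  have mexp: "(\<lambda>x. ennreal (exp (\<Sum>l<d. v l * x l))) \<in> borel_measurable (vec_space d)"
    using vec_space_component[OF refl] by measurable
  have "(\<Sum>l<d. v l * restrict (mv d R x) {..<d} l) = (\<Sum>a<d. u a * x a)" for x
  proof -
    have "(\<Sum>l<d. v l * restrict (mv d R x) {..<d} l) = (\<Sum>l<d. \<Sum>a<d. v l * R l a * x a)"
      by (simp add: mv_def sum_distrib_left mult.assoc)
    then show ?thesis by (subst (asm) sum.swap) (simp add: u_def tmult_def sum_distrib_right)
  qed
  then have "(\<integral>\<^sup>+x. ennreal (exp (\<Sum>l<d. v l * x l)) \<partial>p) = (\<integral>\<^sup>+x. ennreal (exp (\<Sum>a<d. u a * x a)) \<partial>pbar)"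
    unfolding p by (subst nn_integral_distr[OF map_measurable]) (use mexp in simp_all)
  also have "\<dots> \<le> ennreal (exp (N * \<rho>\<^sup>2 / 2))"
  proof (cases "N = 0")
    case True
    then have "u a = 0" if "a < d" for a
      using that unfolding N_def by (subst (asm) sum_nonneg_eq_0_iff) auto
    then show ?thesis using prob_space.emeasure_space_1[OF prob] by (simp add: True)
  next
    case False
    then have N0: "0 < N" by (simp add: N_def less_le sum_nonneg)
    define y where "y a = u a / sqrt N" for a
    have "vnorm d y = 1" using N0
      by (simp add: vnorm_def y_def power_divide sum_divide_distrib[symmetric] N_def[symmetric])
    then have "(\<integral>\<^sup>+x. ennreal (exp (sqrt N * (\<Sum>i<d. y i * (x i - (\<integral>y. y i \<partial>pbar))))) \<partial>pbar)
        \<le> ennreal (exp ((sqrt N)\<^sup>2 * \<rho>\<^sup>2 / 2))"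
      using sub unfolding subgaussian_def by blast
    moreover have "(\<Sum>i<d. y i * (x i - (\<integral>y. y i \<partial>pbar))) = (\<Sum>i<d. y i * x i)" for x
      using mean by (intro sum.cong) (auto simp: mean_zero_def)
    ultimately have "(\<integral>\<^sup>+x. ennreal (exp (sqrt N * (\<Sum>i<d. y i * x i))) \<partial>pbar) \<le> ennreal (exp ((sqrt N)\<^sup>2 * \<rho>\<^sup>2 / 2))"
      by simp
    moreover have "sqrt N * (\<Sum>i<d. y i * x i) = (\<Sum>a<d. u a * x a)" for x
      using N0 by (simp add: y_def sum_distrib_left)
    ultimately show ?thesis using N0 by simp
  qed
  finally show ?thesis by (simp add: N)
qed

end

section \<open>The source and target events\<close>

lemma emeasure_compl_Int:
  assumes "A \<in> sets M" "B \<in> sets M" "emeasure M (space M - A) \<le> ennreal a" "emeasure M (space M - B) \<le> ennreal b"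
    "0 \<le> a" "0 \<le> b"
  shows "emeasure M (space M - A \<inter> B) \<le> ennreal (a + b)"
proof -
  have "space M - A \<inter> B = (space M - A) \<union> (space M - B)" by auto
  then have "emeasure M (space M - A \<inter> B) \<le> emeasure M (space M - A) + emeasure M (space M - B)"
    using assms by (simp only:) (intro emeasure_subadditive; auto)
  also have "\<dots> \<le> ennreal a + ennreal b" by (intro add_mono assms)
  finally show ?thesis using assms by simp
qed

lemma emeasure_compl_INT:
  assumes "finite I" "\<And>i. i \<in> I \<Longrightarrow> E i \<in> sets M" "\<And>i. i \<in> I \<Longrightarrow> emeasure M (space M - E i) \<le> ennreal C"
    "real (card I) \<le> D" "0 \<le> C"
  shows "emeasure M (space M - (space M - (\<Union>i\<in>I. space M - E i))) \<le> ennreal (D * C)"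
    and "space M - (\<Union>i\<in>I. space M - E i) \<in> sets M"
proof -
  have "space M - (space M - (\<Union>i\<in>I. space M - E i)) = (\<Union>i\<in>I. space M - E i)" by auto
  then show "emeasure M (space M - (space M - (\<Union>i\<in>I. space M - E i))) \<le> ennreal (D * C)"
    using assms by (simp only:) (intro emeasure_finite_union_le; auto)
  show "space M - (\<Union>i\<in>I. space M - E i) \<in> sets M" using assms by (intro sets.Diff sets.top sets.finite_UN) auto
qed

lemma emeasure_compl_fst:
  assumes Z: "prob_space Z" and E: "E \<in> sets X"
  shows "emeasure (X \<Otimes>\<^sub>M Z) (space (X \<Otimes>\<^sub>M Z) - E \<times> space Z) = emeasure X (space X - E)"
proof -
  have "space (X \<Otimes>\<^sub>M Z) - E \<times> space Z = (space X - E) \<times> space Z"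
    by (auto simp: space_pair_measure)
  then show ?thesis
    using E prob_space.emeasure_space_1[OF Z]
    by (simp add: sigma_finite_measure.emeasure_pair_measure_Times[OF prob_space_imp_sigma_finite[OF Z]])
qed

lemma limit_le_frequently:
  fixes a b :: "nat \<Rightarrow> real"
  assumes "a \<longlonglongrightarrow> A" "b \<longlonglongrightarrow> B" "\<And>m. \<exists>n\<ge>m. a n \<le> b n"
  shows "A \<le> B"
proof (rule ccontr)
  assume "\<not> A \<le> B"
  then have "0 < A - B" by simp
  moreover have "(\<lambda>n. a n - b n) \<longlonglongrightarrow> A - B" using assms by (intro tendsto_diff)
  ultimately have "eventually (\<lambda>n. 0 < a n - b n) sequentially" using order_tendstoD(1) by blast
  then obtain m where "\<And>n. n \<ge> m \<Longrightarrow> 0 < a n - b n" by (auto simp: eventually_sequentially)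
  then show False using assms(3)[of m] by force
qed

text \<open>The distributions enter only through a Laplace bound and second moments, with
  \<open>R t\<close> any factor of \<open>Sigma t\<close>. \<open>Lm\<close> and \<open>LM\<close>
  bound the spectra of the source covariances; \<open>Sigma T\<close> gets no such lower bound and
  may be singular.\<close>

locale few_shot =
  fixes d k T n1 n2 :: nat and \<rho> \<sigma> Lm LM :: real and p :: "nat \<Rightarrow> (nat \<Rightarrow> real) measure"
    and Sigma R :: "nat \<Rightarrow> nat \<Rightarrow> nat \<Rightarrow> real" and Bs Ws :: "nat \<Rightarrow> nat \<Rightarrow> real"
  assumes pos: "0 < k" "0 < T" "0 < n1" "0 < n2" "0 < \<sigma>" "0 < \<rho>" "0 < Lm" "Lm \<le> LM"
    and kd: "2 * k \<le> d" and kT: "2 * k \<le> T"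
    and prob_p: "\<And>t. t \<le> T \<Longrightarrow> prob_space (p t)"
    and sets_p: "\<And>t. t \<le> T \<Longrightarrow> sets (p t) = sets (vec_space d)"
    and factor: "\<And>t i j. t \<le> T \<Longrightarrow> i < d \<Longrightarrow> j < d \<Longrightarrow> Sigma t i j = (\<Sum>l<d. R t i l * R t j l)"
    and laplace: "\<And>t v. t \<le> T \<Longrightarrow> (\<integral>\<^sup>+x. ennreal (exp (\<Sum>l<d. v l * x l)) \<partial>p t) \<le> ennreal (exp (qform d (Sigma t) v * \<rho>\<^sup>2 / 2))"
    and quad_int: "\<And>t v. t \<le> T \<Longrightarrow> integrable (p t) (\<lambda>x. (\<Sum>l<d. v l * x l)\<^sup>2)"
    and quad_val: "\<And>t v. t \<le> T \<Longrightarrow> (\<integral>x. (\<Sum>l<d. v l * x l)\<^sup>2 \<partial>p t) = qform d (Sigma t) v"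
    and upper: "\<And>t v. t < T \<Longrightarrow> qform d (Sigma t) v \<le> LM * (\<Sum>l<d. (v l)\<^sup>2)"
    and lower: "\<And>t v. t < T \<Longrightarrow> Lm * (\<Sum>l<d. (v l)\<^sup>2) \<le> qform d (Sigma t) v"
begin

text \<open>Task numbers beyond \<open>T\<close> get the default \<open>p 0\<close>, so that every
  factor of a product is a probability space.\<close>

definition "P j = p (if fst j \<le> T then fst j else 0)" for j :: "nat \<times> nat"
definition "Src = {..<T} \<times> {..<n1}"
definition "Tgt = {T} \<times> {..<n2}"
definition "SX = PiM Src P"
definition "SZ = PiM Src (\<lambda>_. gauss \<sigma>)"
definition "TX = PiM Tgt P"
definition "TZ = PiM Tgt (\<lambda>_. gauss \<sigma>)"

lemma prob_P: "prob_space (P j)"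
  by (simp add: P_def prob_p)

lemma prob_gauss: "prob_space (gauss \<sigma>)"
  using prob_space_normal_density[OF pos(5)] .

lemma prob_spaces: "prob_space SX" "prob_space SZ" "prob_space TX" "prob_space TZ"
  unfolding SX_def SZ_def TX_def TZ_def by (intro prob_space_PiM prob_P prob_gauss)+

lemma finite_idx: "finite Src" "finite Tgt"
  by (auto simp: Src_def Tgt_def)

lemma P_component: "l < d \<Longrightarrow> (\<lambda>x. x l) \<in> borel_measurable (P j)"
  unfolding P_def by (rule vec_space_component[OF sets_p]) auto

lemma X_component:
  assumes "j \<in> I" "l < d"
  shows "(\<lambda>x. x j l) \<in> borel_measurable (PiM I P)"
  using measurable_compose[OF measurable_component_singleton[OF assms(1)] P_component[OF assms(2)]] .

definition cov_event :: "nat \<Rightarrow> nat \<Rightarrow> (nat \<times> nat \<Rightarrow> nat \<Rightarrow> real) \<Rightarrow> (nat \<Rightarrow> real) \<Rightarrow> bool" where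
  "cov_event t n x v \<longleftrightarrow> \<bar>(\<Sum>i<n. (ip {..<d} (x (t, i)) v)\<^sup>2) - real n * qform d (Sigma t) v\<bar> \<le> real n / 10 * qform d (Sigma t) v"

lemma covariance_event:
  assumes t: "t \<le> T" and I: "finite I" and sub: "{t} \<times> {..<n} \<subseteq> I" and n: "0 < n"
  shows "\<exists>E\<in>sets (PiM I P). emeasure (PiM I P) (space (PiM I P) - E)
       \<le> ennreal (exp (27 * real m) * (2 * exp (- (real n / (307200 * \<rho> ^ 4)))))
     \<and> (\<forall>x\<in>E. \<forall>b v. (\<forall>l<d. v l = (\<Sum>a<m. b a * B a l)) \<longrightarrow> cov_event t n x v)"
proof -
  let ?J = "{t} \<times> {..<n}"
  have Pj: "P j = p t" if "j \<in> ?J" for j using that t by (auto simp: P_def)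
  have J0: "?J \<noteq> {}" using n by auto
  have sumJ: "(\<Sum>j\<in>?J. f j) = (\<Sum>i<n. f (t, i))" for f :: "nat \<times> nat \<Rightarrow> real"
    by (rule sum.reindex_cong[of "\<lambda>i. (t, i)"]) (auto simp: inj_on_def)
  have ip: "(\<Sum>l<d. v l * x l) = ip {..<d} x v" for v x :: "nat \<Rightarrow> real" by (simp add: ip_def mult.commute)
  have "\<exists>E\<in>sets (PiM I P). emeasure (PiM I P) (space (PiM I P) - E)
       \<le> ennreal (exp (27 * real m) * (2 * exp (- (real (card ?J) / (307200 * \<rho> ^ 4)))))
     \<and> (\<forall>x\<in>E. \<forall>b v. (\<forall>l<d. v l = (\<Sum>a<m. b a * B a l)) \<longrightarrow>
          \<bar>(\<Sum>j\<in>?J. (\<Sum>l<d. v l * x j l)\<^sup>2) - real (card ?J) * qform d (Sigma t) v\<bar> \<le> real (card ?J) / 10 * qform d (Sigma t) v)"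
  proof (rule covariance_concentration[where X = "\<lambda>j x. x", OF prob_P I sub J0 pos(6)])
    show "Sigma t i j = (\<Sum>l<d. R t i l * R t j l)" if "i < d" "j < d" for i j using factor t that by blast
    show "(\<lambda>x. x l) \<in> borel_measurable (P j)" if "l < d" for j l using P_component[OF that] .
  qed (use laplace quad_int quad_val t in \<open>auto simp: Pj\<close>)
  moreover have "card ?J = n" by (simp add: card_cartesian_product)
  ultimately show ?thesis unfolding cov_event_def sumJ ip by simp
qed

definition "fit q x j = lin d k (x j) (fst q) (\<lambda>m. snd q m (fst j))"
  for q :: "(nat \<Rightarrow> nat \<Rightarrow> real) \<times> (nat \<Rightarrow> nat \<Rightarrow> real)" and x :: "nat \<times> nat \<Rightarrow> nat \<Rightarrow> real" and j :: "nat \<times> nat"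
definition "truth x j = lin d k (x j) Bs (\<lambda>m. Ws m (fst j))" for x :: "nat \<times> nat \<Rightarrow> nat \<Rightarrow> real" and j :: "nat \<times> nat"
definition "sgain x z q = gain Src (\<lambda>j. truth x j + z j) (fit q x)"
text \<open>Rational matrix pairs, fixed outside the relevant indices: countably many candidates
  whose fits are dense among all fits.\<close>

definition "ratpairs = (\<lambda>f. ((\<lambda>l m. fst f (l, m)), (\<lambda>m t. snd f (m, t)))) `
   (PiE ({..<d} \<times> {..<k}) (\<lambda>_. \<rat> :: real set) \<times> PiE ({..<k} \<times> {..<T}) (\<lambda>_. \<rat> :: real set))"

lemma countable_ratpairs: "countable ratpairs"
  unfolding ratpairs_def by (intro countable_image countable_SIGMA countable_PiE countable_rat) auto

lemma ratpairs_dense: "\<exists>r. (\<forall>n. r n \<in> ratpairs) \<and> (\<forall>x. \<forall>j\<in>Src. (\<lambda>n. fit (r n) x j) \<longlonglongrightarrow> fit q x j)"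
proof -
  obtain RB :: "nat \<Rightarrow> nat \<times> nat \<Rightarrow> real" where RB: "\<And>n. RB n \<in> PiE ({..<d} \<times> {..<k}) (\<lambda>_. \<rat>)"
    "\<And>a. a \<in> {..<d} \<times> {..<k} \<Longrightarrow> (\<lambda>n. RB n a) \<longlonglongrightarrow> fst q (fst a) (snd a)"
    using rational_approximation[of "{..<d} \<times> {..<k}" "\<lambda>a. fst q (fst a) (snd a)"] by blast
  obtain RW :: "nat \<Rightarrow> nat \<times> nat \<Rightarrow> real" where RW: "\<And>n. RW n \<in> PiE ({..<k} \<times> {..<T}) (\<lambda>_. \<rat>)"
    "\<And>a. a \<in> {..<k} \<times> {..<T} \<Longrightarrow> (\<lambda>n. RW n a) \<longlonglongrightarrow> snd q (fst a) (snd a)"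
    using rational_approximation[of "{..<k} \<times> {..<T}" "\<lambda>a. snd q (fst a) (snd a)"] by blast
  define r where "r n = ((\<lambda>l m. RB n (l, m)), (\<lambda>m t. RW n (m, t)))" for n
  have "r n \<in> ratpairs" for n
    unfolding ratpairs_def r_def using RB(1)[of n] RW(1)[of n] by (intro image_eqI[of _ _ "(RB n, RW n)"]) auto
  moreover have "(\<lambda>n. fit (r n) x j) \<longlonglongrightarrow> fit q x j" if "j \<in> Src" for x j
    unfolding fit_def lin_def mv_def r_def fst_conv snd_conv
  proof (intro tendsto_sum tendsto_mult tendsto_const)
    fix l m assume "l \<in> {..<d}" "m \<in> {..<k}"
    then show "(\<lambda>n. RB n (l, m)) \<longlonglongrightarrow> fst q l m" "(\<lambda>n. RW n (m, fst j)) \<longlonglongrightarrow> snd q m (fst j)"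
      using RB(2)[of "(l, m)"] RW(2)[of "(m, fst j)"] that by (auto simp: Src_def)
  qed
  ultimately show ?thesis by blast
qed

lemma ratpairs_nonempty: "ratpairs \<noteq> {}"
  using ratpairs_dense by blast

lemma fit_measurable [measurable]: "j \<in> Src \<Longrightarrow> (\<lambda>x. fit q x j) \<in> borel_measurable SX"
  unfolding fit_def lin_def SX_def
  by (intro borel_measurable_sum borel_measurable_times borel_measurable_const X_component) auto

lemma truth_measurable [measurable]: "j \<in> Src \<Longrightarrow> (\<lambda>x. truth x j) \<in> borel_measurable SX"
  unfolding truth_def lin_def SX_def
  by (intro borel_measurable_sum borel_measurable_times borel_measurable_const X_component) auto

lemma SZ_component [measurable]: "j \<in> Src \<Longrightarrow> (\<lambda>z. z j) \<in> borel_measurable SZ"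
proof -
  assume "j \<in> Src"
  then have "(\<lambda>z. z j) \<in> measurable SZ (gauss \<sigma>)"
    unfolding SZ_def by (rule measurable_component_singleton)
  then show ?thesis by (simp add: measurable_cong_sets[OF refl sets_density])
qed

definition "near n q x z \<longleftrightarrow> q \<in> ratpairs \<and> (\<forall>q'\<in>ratpairs. sgain x z q' \<le> sgain x z q + 1 / real (Suc n))" for n q x z
definition "optimal x z q \<longleftrightarrow> (\<forall>q'. sgain x z q' \<le> sgain x z q)" for x z q

definition "src_cov x \<longleftrightarrow> (\<forall>t<T. \<forall>v. cov_event t n1 x v)" for x
definition "src_noise K N x z \<longleftrightarrow> (\<forall>V\<in>N. \<forall>r. (\<Sum>j\<in>Src. z j * (\<Sum>a<2 * k. r (fst j) a * ip {..<d} (x j) (\<lambda>l. V (l, a))))\<^sup>2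
        \<le> K * (\<Sum>j\<in>Src. (\<Sum>a<2 * k. r (fst j) a * ip {..<d} (x j) (\<lambda>l. V (l, a)))\<^sup>2))"
  for K :: real and N :: "(nat \<times> nat \<Rightarrow> real) set" and x :: "nat \<times> nat \<Rightarrow> nat \<Rightarrow> real" and z
definition "src_conv x z \<longleftrightarrow> (\<forall>q qn. optimal x z q \<longrightarrow> (\<forall>n. near n (qn n) x z) \<longrightarrow> (\<forall>j\<in>Src. (\<lambda>n. fit (qn n) x j) \<longlonglongrightarrow> fit q x j))" for x z
definition "src_surj x z \<longleftrightarrow> (\<forall>q. optimal x z q \<longrightarrow> (\<forall>u. \<exists>a. \<forall>m<k. u m = (\<Sum>t<T. a t * snd q m t)))" for x z

lemma sumSrc: "(\<Sum>j\<in>Src. f j) = (\<Sum>t<T. \<Sum>i<n1. f (t, i))" for f :: "nat \<times> nat \<Rightarrow> real"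
  by (simp add: Src_def sum.cartesian_product)

text \<open>The learned subspace is arbitrary, so the comparison is made on all of the
  \<open>d\<close>-dimensional space, using the unit vectors as \<open>B\<close>, and for all
  \<open>T\<close> tasks at once. This is the source of the requirement on \<open>n1\<close> in
  terms of \<open>d\<close> and \<open>ln (T / \<delta>)\<close>.\<close>

lemma src_cov_event:
  "\<exists>E\<in>sets (SX \<Otimes>\<^sub>M SZ). emeasure (SX \<Otimes>\<^sub>M SZ) (space (SX \<Otimes>\<^sub>M SZ) - E)
       \<le> ennreal (real T * (exp (27 * real d) * (2 * exp (- (real n1 / (307200 * \<rho> ^ 4))))))
     \<and> (\<forall>(x, z)\<in>E. src_cov x)"
proof -
  let ?\<epsilon> = "exp (27 * real d) * (2 * exp (- (real n1 / (307200 * \<rho> ^ 4))))"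
  have "\<exists>E\<in>sets SX. emeasure SX (space SX - E) \<le> ennreal ?\<epsilon> \<and> (\<forall>x\<in>E. \<forall>v. cov_event t n1 x v)" if t: "t < T" for t
  proof -
    have tT: "t \<le> T" and sub: "{t} \<times> {..<n1} \<subseteq> Src" using t by (auto simp: Src_def)
    obtain E where E: "E \<in> sets SX" "emeasure SX (space SX - E) \<le> ennreal ?\<epsilon>"
      "\<And>x b v. x \<in> E \<Longrightarrow> (\<forall>l<d. v l = (\<Sum>a<d. b a * (if a = l then 1 else 0))) \<Longrightarrow> cov_event t n1 x v"
      using covariance_event[OF tT finite_idx(1) sub pos(3), where m = d and B = "\<lambda>a l. if a = l then 1 else 0"]
      unfolding SX_def[symmetric] by blast
    have "cov_event t n1 x v" if "x \<in> E" for x v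
      by (rule E(3)[OF that, where b = v]) (simp add: mult_delta_right)
    then show ?thesis using E(1,2) by blast
  qed
  then have "\<forall>t\<in>{..<T}. \<exists>E. E \<in> sets SX \<and> emeasure SX (space SX - E) \<le> ennreal ?\<epsilon> \<and> (\<forall>x\<in>E. \<forall>v. cov_event t n1 x v)" by blast
  from bchoice[OF this] obtain E where E: "\<And>t. t < T \<Longrightarrow> E t \<in> sets SX"
      "\<And>t. t < T \<Longrightarrow> emeasure SX (space SX - E t) \<le> ennreal ?\<epsilon>" "\<And>t x v. t < T \<Longrightarrow> x \<in> E t \<Longrightarrow> cov_event t n1 x v"
    by auto
  define F where "F = space SX - (\<Union>t\<in>{..<T}. space SX - E t)"
  have F: "F \<in> sets SX" "emeasure SX (space SX - F) \<le> ennreal (real T * ?\<epsilon>)"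
    unfolding F_def using emeasure_compl_INT[of "{..<T}" E SX ?\<epsilon> "real T"] E by auto
  show ?thesis
  proof (intro bexI[of _ "F \<times> space SZ"] conjI)
    show "emeasure (SX \<Otimes>\<^sub>M SZ) (space (SX \<Otimes>\<^sub>M SZ) - F \<times> space SZ) \<le> ennreal (real T * ?\<epsilon>)"
      using F by (simp only: emeasure_compl_fst[OF prob_spaces(2) F(1)])
    show "\<forall>(x, z)\<in>F \<times> space SZ. src_cov x" using E(3) by (auto simp: F_def src_cov_def)
  qed (use F(1) in auto)
qed

text \<open>For one \<open>V\<close> the coefficients of different tasks are independent of each
  other: the design vectors are indexed by task and column and supported on the samples of their
  task, which gives \<open>T * (2 * k)\<close> dimensions. A union bound over \<open>N\<close>
  follows.\<close>

lemma src_noise_event: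
  assumes K: "0 \<le> K" and N: "finite N" "real (card N) \<le> D"
  shows "\<exists>E\<in>sets (SX \<Otimes>\<^sub>M SZ). emeasure (SX \<Otimes>\<^sub>M SZ) (space (SX \<Otimes>\<^sub>M SZ) - E)
       \<le> ennreal (D * (sqrt 2 ^ (T * (2 * k)) * exp (- (K / (4 * \<sigma>\<^sup>2))))) \<and> (\<forall>(x, z)\<in>E. src_noise K N x z)"
proof -
  let ?\<epsilon> = "sqrt 2 ^ (T * (2 * k)) * exp (- (K / (4 * \<sigma>\<^sup>2)))"
  let ?A = "{..<T} \<times> {..<2 * k}"
  have "\<exists>E\<in>sets (SX \<Otimes>\<^sub>M SZ). emeasure (SX \<Otimes>\<^sub>M SZ) (space (SX \<Otimes>\<^sub>M SZ) - E) \<le> ennreal ?\<epsilon>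
      \<and> (\<forall>(x, z)\<in>E. src_noise K {V} x z)" for V
  proof -
    define \<phi> where "\<phi> a x j = (if fst j = fst a then ip {..<d} (x j) (\<lambda>l. V (l, snd a)) else 0)"
      for a :: "nat \<times> nat" and x :: "nat \<times> nat \<Rightarrow> nat \<Rightarrow> real" and j :: "nat \<times> nat"
    have meas: "(\<lambda>x. \<phi> a x j) \<in> borel_measurable SX" if "j \<in> Src" for a j
    proof (cases "fst j = fst a")
      case True
      then show ?thesis unfolding \<phi>_def ip_def SX_def using that
        by (simp, intro borel_measurable_sum borel_measurable_times borel_measurable_const X_component) auto
    qed (simp add: \<phi>_def)
    have comb: "(\<Sum>a\<in>?A. r' a * \<phi> a x j) = (\<Sum>a<2 * k. r' (fst j, a) * ip {..<d} (x j) (\<lambda>l. V (l, a)))" if j: "j \<in> Src" for r' x j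
    proof -
      have "(\<Sum>a\<in>?A. r' a * \<phi> a x j) = (\<Sum>t<T. \<Sum>a<2 * k. r' (t, a) * \<phi> (t, a) x j)"
        by (simp add: sum.cartesian_product)
      also have "\<dots> = (\<Sum>t<T. if t = fst j then \<Sum>a<2 * k. r' (t, a) * ip {..<d} (x j) (\<lambda>l. V (l, a)) else 0)"
        by (intro sum.cong refl) (auto simp: \<phi>_def)
      also have "\<dots> = (\<Sum>a<2 * k. r' (fst j, a) * ip {..<d} (x j) (\<lambda>l. V (l, a)))"
        using j by (auto simp: Src_def)
      finally show ?thesis .
    qed
    obtain E where E: "E \<in> sets (SX \<Otimes>\<^sub>M SZ)"
      "emeasure (SX \<Otimes>\<^sub>M SZ) (space (SX \<Otimes>\<^sub>M SZ) - E) \<le> ennreal (sqrt 2 ^ card ?A * exp (- (K / (4 * \<sigma>\<^sup>2))))"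
      "\<forall>(x, z)\<in>E. \<forall>r. (\<Sum>j\<in>Src. z j * (\<Sum>a\<in>?A. r a * \<phi> a x j))\<^sup>2 \<le> K * (\<Sum>j\<in>Src. (\<Sum>a\<in>?A. r a * \<phi> a x j)\<^sup>2)"
      using noise_concentration[OF prob_spaces(1) _ finite_idx(1) pos(5) K, of ?A \<phi>] meas unfolding SZ_def by auto
    have "src_noise K {V} x z" if xz: "(x, z) \<in> E" for x z
      unfolding src_noise_def
    proof (intro ballI allI)
      fix V' r assume "V' \<in> {V}"
      then have V': "V' = V" by simp
      from E(3) xz have *: "(\<Sum>j\<in>Src. z j * (\<Sum>a\<in>?A. r' a * \<phi> a x j))\<^sup>2 \<le> K * (\<Sum>j\<in>Src. (\<Sum>a\<in>?A. r' a * \<phi> a x j)\<^sup>2)" for r'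
        by blast
      show "(\<Sum>j\<in>Src. z j * (\<Sum>a<2 * k. r (fst j) a * ip {..<d} (x j) (\<lambda>l. V' (l, a))))\<^sup>2
        \<le> K * (\<Sum>j\<in>Src. (\<Sum>a<2 * k. r (fst j) a * ip {..<d} (x j) (\<lambda>l. V' (l, a)))\<^sup>2)"
        using *[of "\<lambda>a. r (fst a) (snd a)"] by (simp add: comb V' cong: sum.cong)
    qed
    then show ?thesis using E(1,2) by (intro bexI[of _ E]) (auto simp: card_cartesian_product)
  qed
  then have "\<forall>V\<in>N. \<exists>E. E \<in> sets (SX \<Otimes>\<^sub>M SZ) \<and> emeasure (SX \<Otimes>\<^sub>M SZ) (space (SX \<Otimes>\<^sub>M SZ) - E) \<le> ennreal ?\<epsilon>
      \<and> (\<forall>x z. (x, z) \<in> E \<longrightarrow> src_noise K {V} x z)" by fast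
  from bchoice[OF this] obtain E where E: "\<And>V. V \<in> N \<Longrightarrow> E V \<in> sets (SX \<Otimes>\<^sub>M SZ)"
      "\<And>V. V \<in> N \<Longrightarrow> emeasure (SX \<Otimes>\<^sub>M SZ) (space (SX \<Otimes>\<^sub>M SZ) - E V) \<le> ennreal ?\<epsilon>"
      "\<And>V x z. V \<in> N \<Longrightarrow> (x, z) \<in> E V \<Longrightarrow> src_noise K {V} x z" by blast
  define F where "F = space (SX \<Otimes>\<^sub>M SZ) - (\<Union>V\<in>N. space (SX \<Otimes>\<^sub>M SZ) - E V)"
  have "F \<in> sets (SX \<Otimes>\<^sub>M SZ)" "emeasure (SX \<Otimes>\<^sub>M SZ) (space (SX \<Otimes>\<^sub>M SZ) - F) \<le> ennreal (D * ?\<epsilon>)"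
    unfolding F_def using emeasure_compl_INT[OF N(1), of E "SX \<Otimes>\<^sub>M SZ" ?\<epsilon> D] E N(2) by auto
  moreover have "src_noise K N x z" if "(x, z) \<in> F" for x z
    using E(3) that unfolding F_def src_noise_def by blast
  ultimately show ?thesis by (intro bexI[of _ F]) auto
qed

text \<open>The general noise bound for the unit vectors as design, evaluated with the noise itself
  as coefficients: it then reads \<open>s^2 \<le> K * s\<close> for the total energy
  \<open>s\<close>.\<close>

lemma src_znorm_event:
  assumes K: "0 \<le> K"
  shows "\<exists>E\<in>sets (SX \<Otimes>\<^sub>M SZ). emeasure (SX \<Otimes>\<^sub>M SZ) (space (SX \<Otimes>\<^sub>M SZ) - E)
       \<le> ennreal (sqrt 2 ^ (T * n1) * exp (- (K / (4 * \<sigma>\<^sup>2)))) \<and> (\<forall>(x, z)\<in>E. (\<Sum>j\<in>Src. (z j)\<^sup>2) \<le> K)"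
proof -
  define \<phi> where "\<phi> a x j = (if j = a then 1 else 0 :: real)" for a :: "nat \<times> nat" and x :: "nat \<times> nat \<Rightarrow> nat \<Rightarrow> real" and j :: "nat \<times> nat"
  obtain E where E: "E \<in> sets (SX \<Otimes>\<^sub>M SZ)"
      "emeasure (SX \<Otimes>\<^sub>M SZ) (space (SX \<Otimes>\<^sub>M SZ) - E) \<le> ennreal (sqrt 2 ^ card Src * exp (- (K / (4 * \<sigma>\<^sup>2))))"
      "\<forall>(x, z)\<in>E. \<forall>r. (\<Sum>j\<in>Src. z j * (\<Sum>a\<in>Src. r a * \<phi> a x j))\<^sup>2 \<le> K * (\<Sum>j\<in>Src. (\<Sum>a\<in>Src. r a * \<phi> a x j)\<^sup>2)"
    using noise_concentration[OF prob_spaces(1) finite_idx(1) finite_idx(1) pos(5) K, of \<phi>] unfolding SZ_def by (auto simp: \<phi>_def)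
  have "(\<Sum>j\<in>Src. (z j)\<^sup>2) \<le> K" if "(x, z) \<in> E" for x z
  proof -
    have "(\<Sum>a\<in>Src. z a * \<phi> a x j) = z j" if "j \<in> Src" for j
      using that finite_idx(1) by (simp add: \<phi>_def mult_delta_right)
    moreover from E(3) that have "(\<Sum>j\<in>Src. z j * (\<Sum>a\<in>Src. z a * \<phi> a x j))\<^sup>2 \<le> K * (\<Sum>j\<in>Src. (\<Sum>a\<in>Src. z a * \<phi> a x j)\<^sup>2)" by blast
    ultimately have *: "(\<Sum>j\<in>Src. (z j)\<^sup>2)\<^sup>2 \<le> K * (\<Sum>j\<in>Src. (z j)\<^sup>2)"
      by (simp add: power2_eq_square cong: sum.cong)
    show ?thesis
    proof (cases "(\<Sum>j\<in>Src. (z j)\<^sup>2) = 0")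
      case False
      then have "0 < (\<Sum>j\<in>Src. (z j)\<^sup>2)" by (simp add: less_le sum_nonneg)
      then show ?thesis using * by (simp add: power2_eq_square)
    qed (use K in simp)
  qed
  then show ?thesis using E(1,2) by (intro bexI[of _ E]) (auto simp: Src_def card_cartesian_product)
qed

lemma src_conv_event:
  "\<exists>B\<in>null_sets (SX \<Otimes>\<^sub>M SZ). \<forall>x z. (x, z) \<in> space (SX \<Otimes>\<^sub>M SZ) - B \<longrightarrow> src_conv x z"
proof -
  note L = near_maximizers_converge[where fit = fit and \<mu> = truth, OF prob_spaces(1) finite_idx(1) pos(5) countable_ratpairs, folded SZ_def]
  obtain B where B: "B \<in> null_sets (SX \<Otimes>\<^sub>M SZ)"
    "\<And>x z u r q. (x, z) \<in> space (SX \<Otimes>\<^sub>M SZ) - B \<Longrightarrow> (\<forall>m. r m \<in> ratpairs) \<Longrightarrow> (\<forall>j\<in>Src. (\<lambda>m. fit (r m) x j) \<longlonglongrightarrow> u j)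
       \<Longrightarrow> (\<forall>p\<in>ratpairs. gain Src (\<lambda>j. truth x j + z j) (fit p x) \<le> gain Src (\<lambda>j. truth x j + z j) u)
       \<Longrightarrow> (\<forall>n. q n \<in> ratpairs \<and> (\<forall>p\<in>ratpairs. gain Src (\<lambda>j. truth x j + z j) (fit p x)
                                     \<le> gain Src (\<lambda>j. truth x j + z j) (fit (q n) x) + 1 / real (Suc n)))
       \<Longrightarrow> (\<forall>j\<in>Src. (\<lambda>n. fit (q n) x j) \<longlonglongrightarrow> u j)"
    using that by - (rule bexE[OF L], erule fit_measurable, erule truth_measurable, blast)
  have "src_conv x z" if xz: "(x, z) \<in> space (SX \<Otimes>\<^sub>M SZ) - B" for x z
    unfolding src_conv_def
  proof (intro allI impI)
    fix q qn assume q: "optimal x z q" and qn: "\<forall>n. near n (qn n) x z"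
    obtain r where r: "\<forall>n. r n \<in> ratpairs" "\<forall>x. \<forall>j\<in>Src. (\<lambda>n. fit (r n) x j) \<longlonglongrightarrow> fit q x j"
      using ratpairs_dense[of q] by blast
    show "\<forall>j\<in>Src. (\<lambda>n. fit (qn n) x j) \<longlonglongrightarrow> fit q x j"
      by (rule B(2)[OF xz r(1)]) (use r(2) q qn in \<open>auto simp: optimal_def near_def sgain_def\<close>)
  qed
  then show ?thesis using B(1) by blast
qed

lemma src_surj_event:
  "\<exists>B\<in>null_sets (SX \<Otimes>\<^sub>M SZ). \<forall>x z. (x, z) \<in> space (SX \<Otimes>\<^sub>M SZ) - B \<longrightarrow> src_cov x \<longrightarrow> src_surj x z"
proof -
  have k: "k \<le> T" "k \<le> d" using kT kd by auto
  note L = least_squares_columns_independent[where x = "\<lambda>x. x" and \<mu> = truth, OF prob_spaces(1) pos(5) Src_def k]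
  have "\<exists>B\<in>null_sets (SX \<Otimes>\<^sub>M PiM Src (\<lambda>_. gauss \<sigma>)).
     \<forall>a z. (a, z) \<in> space (SX \<Otimes>\<^sub>M PiM Src (\<lambda>_. gauss \<sigma>)) - B
       \<longrightarrow> (\<forall>t<T. \<forall>v. (\<Sum>i<n1. (\<Sum>l<d. v l * a (t, i) l)\<^sup>2) = 0 \<longrightarrow> (\<forall>l<d. v l = 0))
       \<longrightarrow> \<not> (\<exists>\<theta> \<alpha>. (\<exists>t<k. \<alpha> t \<noteq> 0) \<and> (\<forall>l<d. (\<Sum>t<k. \<alpha> t * \<theta> t l) = 0)
            \<and> (\<forall>t<k. \<forall>l<d. (\<Sum>i<n1. a (t, i) l * (truth a (t, i) + z (t, i) - (\<Sum>l'<d. \<theta> t l' * a (t, i) l'))) = 0))"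
    by (rule L) (auto simp: SX_def X_component intro!: truth_measurable[unfolded SX_def])
  then obtain B where B: "B \<in> null_sets (SX \<Otimes>\<^sub>M SZ)"
    and ind: "\<And>a z. (a, z) \<in> space (SX \<Otimes>\<^sub>M SZ) - B \<Longrightarrow>
       (\<forall>t<T. \<forall>v. (\<Sum>i<n1. (\<Sum>l<d. v l * a (t, i) l)\<^sup>2) = 0 \<longrightarrow> (\<forall>l<d. v l = 0)) \<Longrightarrow>
       \<not> (\<exists>\<theta> \<alpha>. (\<exists>t<k. \<alpha> t \<noteq> 0) \<and> (\<forall>l<d. (\<Sum>t<k. \<alpha> t * \<theta> t l) = 0)
            \<and> (\<forall>t<k. \<forall>l<d. (\<Sum>i<n1. a (t, i) l * (truth a (t, i) + z (t, i) - (\<Sum>l'<d. \<theta> t l' * a (t, i) l'))) = 0))"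
    unfolding SZ_def[symmetric] by (elim bexE) iprover
  have "src_surj x z" if xz: "(x, z) \<in> space (SX \<Otimes>\<^sub>M SZ) - B" and cov: "src_cov x" for x z
    unfolding src_surj_def
  proof (intro allI impI)
    fix q u assume q: "optimal x z q"
    \<comment> \<open>The empirical form is at least \<open>9 / 10\<close> of the population form,
      which is positive definite for source tasks; so a design with comparable covariance is
      injective.\<close>
    have inj: "\<forall>t<T. \<forall>v. (\<Sum>i<n1. (\<Sum>l<d. v l * x (t, i) l)\<^sup>2) = 0 \<longrightarrow> (\<forall>l<d. v l = 0)"
    proof (intro allI impI)
      fix t v l assume t: "t < T" and z: "(\<Sum>i<n1. (\<Sum>l<d. v l * x (t, i) l)\<^sup>2) = 0" and l: "l < d"
      have "cov_event t n1 x v" using cov t by (simp add: src_cov_def)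
      moreover have "(\<Sum>i<n1. (ip {..<d} (x (t, i)) v)\<^sup>2) = 0" using z by (simp add: ip_def mult.commute)
      ultimately have "real n1 * qform d (Sigma t) v \<le> real n1 / 10 * qform d (Sigma t) v"
        unfolding cov_event_def abs_le_iff by linarith
      then have "qform d (Sigma t) v \<le> 0" using pos(3) by (simp add: mult_le_0_iff)
      then have "Lm * (\<Sum>l<d. (v l)\<^sup>2) \<le> 0" using lower[OF t, of v] by linarith
      then have "(\<Sum>l<d. (v l)\<^sup>2) \<le> 0" using pos(7) by (simp add: mult_le_0_iff)
      then have "(\<Sum>l<d. (v l)\<^sup>2) = 0" by (simp add: antisym sum_nonneg)
      then show "v l = 0" using l by (subst (asm) sum_nonneg_eq_0_iff) auto
    qed
    show "\<exists>a. \<forall>m<k. u m = (\<Sum>t<T. a t * snd q m t)"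
    proof (rule maximizer_surjective[where x = x and Bh = "fst q", OF Src_def k(1) _ ind[OF xz inj]])
      fix B W
      have "sgain x z (B, W) \<le> sgain x z q" using q by (simp add: optimal_def)
      then show "gain Src (\<lambda>j. truth x j + z j) (\<lambda>j. lin d k (x j) B (\<lambda>m. W m (fst j)))
          \<le> gain Src (\<lambda>j. truth x j + z j) (\<lambda>j. lin d k (x j) (fst q) (\<lambda>m. snd q m (fst j)))"
        by (simp add: sgain_def fit_def[abs_def])
    qed
  qed
  then show ?thesis using B by blast
qed

end

section \<open>Target event for a random representation, and passage to the limit\<close>

lemma sum_lessThan_add: "(\<Sum>a<m + n. f a) = (\<Sum>a<m. f a) + (\<Sum>a<n. f (m + a))" for f :: "nat \<Rightarrow> real"
  by (induction n) (auto simp: add.assoc)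

lemma emeasure_compl_null:
  assumes "B \<in> null_sets M"
  shows "space M - B \<in> sets M" "emeasure M (space M - (space M - B)) \<le> ennreal 0"
proof -
  have B: "B \<in> sets M" "emeasure M B = 0" using assms by auto
  have "space M - (space M - B) = B" using sets.sets_into_space[OF B(1)] by auto
  then show "space M - B \<in> sets M" "emeasure M (space M - (space M - B)) \<le> ennreal 0" using B by auto
qed

context few_shot
begin

definition "source_good K3 K4 N x z \<longleftrightarrow> src_cov x \<and> src_noise K3 N x z \<and> (\<Sum>j\<in>Src. (z j)\<^sup>2) \<le> K4 \<and> src_conv x z \<and> src_surj x z"
  for K3 K4 :: real and N x z

lemma source_event:
  assumes K: "0 \<le> K3" "0 \<le> K4" and N: "finite N" "real (card N) \<le> D" and D: "0 \<le> D"
  shows "\<exists>G\<in>sets (SX \<Otimes>\<^sub>M SZ). emeasure (SX \<Otimes>\<^sub>M SZ) (space (SX \<Otimes>\<^sub>M SZ) - G)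
       \<le> ennreal (real T * (exp (27 * real d) * (2 * exp (- (real n1 / (307200 * \<rho> ^ 4)))))
            + D * (sqrt 2 ^ (T * (2 * k)) * exp (- (K3 / (4 * \<sigma>\<^sup>2))))
            + sqrt 2 ^ (T * n1) * exp (- (K4 / (4 * \<sigma>\<^sup>2))))
     \<and> (\<forall>x z. (x, z) \<in> G \<longrightarrow> source_good K3 K4 N x z)"
proof -
  let ?S = "SX \<Otimes>\<^sub>M SZ"
  let ?e1 = "real T * (exp (27 * real d) * (2 * exp (- (real n1 / (307200 * \<rho> ^ 4)))))"
  let ?e2 = "D * (sqrt 2 ^ (T * (2 * k)) * exp (- (K3 / (4 * \<sigma>\<^sup>2))))"
  let ?e3 = "sqrt 2 ^ (T * n1) * exp (- (K4 / (4 * \<sigma>\<^sup>2)))"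
  obtain E1 where E1: "E1 \<in> sets ?S" "emeasure ?S (space ?S - E1) \<le> ennreal ?e1" "\<forall>(x, z)\<in>E1. src_cov x"
    using src_cov_event by blast
  obtain E2 where E2: "E2 \<in> sets ?S" "emeasure ?S (space ?S - E2) \<le> ennreal ?e2" "\<forall>(x, z)\<in>E2. src_noise K3 N x z"
    using src_noise_event[OF K(1) N] by blast
  obtain E3 where E3: "E3 \<in> sets ?S" "emeasure ?S (space ?S - E3) \<le> ennreal ?e3" "\<forall>(x, z)\<in>E3. (\<Sum>j\<in>Src. (z j)\<^sup>2) \<le> K4"
    using src_znorm_event[OF K(2)] by blast
  obtain B4 where B4: "B4 \<in> null_sets ?S" "\<And>x z. (x, z) \<in> space ?S - B4 \<Longrightarrow> src_conv x z"
    using src_conv_event by blast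
  obtain B5 where B5: "B5 \<in> null_sets ?S" "\<And>x z. (x, z) \<in> space ?S - B5 \<Longrightarrow> src_cov x \<Longrightarrow> src_surj x z"
    using src_surj_event by blast
  note N4 = emeasure_compl_null[OF B4(1)] and N5 = emeasure_compl_null[OF B5(1)]
  define G where "G = E1 \<inter> E2 \<inter> E3 \<inter> (space ?S - B4) \<inter> (space ?S - B5)"
  have G: "G \<in> sets ?S" unfolding G_def using E1(1) E2(1) E3(1) N4(1) N5(1) by auto
  have nn: "0 \<le> ?e1" "0 \<le> ?e2" "0 \<le> ?e3" using D by simp_all
  have "emeasure ?S (space ?S - G) \<le> ennreal (?e1 + ?e2 + ?e3 + 0 + 0)"
    unfolding G_def
    by (intro emeasure_compl_Int sets.Int add_nonneg_nonneg E1 E2 E3 N4 N5 nn order_refl)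
  then have "emeasure ?S (space ?S - G) \<le> ennreal (?e1 + ?e2 + ?e3)" by simp
  moreover have "source_good K3 K4 N x z" if "(x, z) \<in> G" for x z
  proof -
    have "src_cov x" using E1(3) that by (auto simp: G_def)
    then show ?thesis using E2(3) E3(3) B4(2) B5(2) that unfolding source_good_def by (auto simp: G_def)
  qed
  ultimately show ?thesis using G by blast
qed

definition "tgt_good K B x z \<longleftrightarrow> (\<forall>u w. cov_event T n2 x (\<lambda>l. mv k B u l - mv k Bs w l))
   \<and> (\<forall>u. (\<Sum>i<n2. z (T, i) * ip {..<d} (x (T, i)) (mv k B u))\<^sup>2 \<le> K * (\<Sum>i<n2. (ip {..<d} (x (T, i)) (mv k B u))\<^sup>2))"
  for K :: real and B x and z :: "nat \<times> nat \<Rightarrow> real"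

text \<open>\<open>B\<close> is fixed here. Comparing predictions with the truth stays in the span
  of the columns of \<open>B\<close> and \<open>Bs\<close>, of dimension at most
  \<open>2 * k\<close>, while the noise only meets the range of \<open>B\<close>, of dimension at
  most \<open>k\<close>; both parts hold uniformly in the target parameter.\<close>

lemma target_event:
  assumes K: "0 \<le> K"
  shows "\<exists>E\<in>sets (TX \<Otimes>\<^sub>M TZ). emeasure (TX \<Otimes>\<^sub>M TZ) (space (TX \<Otimes>\<^sub>M TZ) - E)
       \<le> ennreal (exp (27 * real (2 * k)) * (2 * exp (- (real n2 / (307200 * \<rho> ^ 4)))) + sqrt 2 ^ k * exp (- (K / (4 * \<sigma>\<^sup>2))))
     \<and> (\<forall>x z. (x, z) \<in> E \<longrightarrow> tgt_good K B x z)"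
proof -
  let ?T = "TX \<Otimes>\<^sub>M TZ"
  let ?e1 = "exp (27 * real (2 * k)) * (2 * exp (- (real n2 / (307200 * \<rho> ^ 4))))"
  let ?e2 = "sqrt 2 ^ k * exp (- (K / (4 * \<sigma>\<^sup>2)))"
  define C where "C a l = (if a < k then B l a else Bs l (a - k))" for a l
  have sub: "{T} \<times> {..<n2} \<subseteq> Tgt" by (simp add: Tgt_def)
  obtain E1 where E1: "E1 \<in> sets TX" "emeasure TX (space TX - E1) \<le> ennreal ?e1"
    "\<And>x b v. x \<in> E1 \<Longrightarrow> (\<forall>l<d. v l = (\<Sum>a<2 * k. b a * C a l)) \<Longrightarrow> cov_event T n2 x v"
    using covariance_event[OF order_refl finite_idx(2) sub pos(4), where m = "2 * k" and B = C]
    unfolding TX_def[symmetric] by blast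
  have cov: "cov_event T n2 x (\<lambda>l. mv k B u l - mv k Bs w l)" if x: "x \<in> E1" for x u w
  proof (rule E1(3)[OF x, where b = "\<lambda>a. if a < k then u a else - w (a - k)"], intro allI impI)
    fix l
    show "mv k B u l - mv k Bs w l = (\<Sum>a<2 * k. (if a < k then u a else - w (a - k)) * C a l)"
      using sum_lessThan_add[of "\<lambda>a. (if a < k then u a else - w (a - k)) * C a l" k k]
      unfolding mult_2 by (simp add: C_def mv_def mult.commute sum_negf)
  qed
  have E1': "E1 \<times> space TZ \<in> sets ?T" using E1(1) by auto
  have E1'': "emeasure ?T (space ?T - E1 \<times> space TZ) \<le> ennreal ?e1"
    using E1(2) by (simp only: emeasure_compl_fst[OF prob_spaces(4) E1(1)])
  define \<phi> where "\<phi> a x j = ip {..<d} (x j) (\<lambda>l. B l a)" for a :: nat and x :: "nat \<times> nat \<Rightarrow> nat \<Rightarrow> real" and j :: "nat \<times> nat"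
  have meas: "(\<lambda>x. \<phi> a x j) \<in> borel_measurable TX" if "j \<in> Tgt" for a j
    unfolding \<phi>_def ip_def TX_def using that
    by (intro borel_measurable_sum borel_measurable_times borel_measurable_const X_component) auto
  obtain E2 where E2: "E2 \<in> sets ?T" "emeasure ?T (space ?T - E2) \<le> ennreal (sqrt 2 ^ card {..<k} * exp (- (K / (4 * \<sigma>\<^sup>2))))"
      "\<forall>(x, z)\<in>E2. \<forall>r. (\<Sum>j\<in>Tgt. z j * (\<Sum>a\<in>{..<k}. r a * \<phi> a x j))\<^sup>2 \<le> K * (\<Sum>j\<in>Tgt. (\<Sum>a\<in>{..<k}. r a * \<phi> a x j)\<^sup>2)"
    using noise_concentration[OF prob_spaces(3) _ finite_idx(2) pos(5) K, of "{..<k}" \<phi>] meas unfolding TZ_def by auto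
  have sumT: "(\<Sum>j\<in>Tgt. f j) = (\<Sum>i<n2. f (T, i))" for f :: "nat \<times> nat \<Rightarrow> real"
    unfolding Tgt_def by (rule sum.reindex_cong[of "\<lambda>i. (T, i)"]) (auto simp: inj_on_def)
  have comb: "(\<Sum>a\<in>{..<k}. r a * \<phi> a x j) = ip {..<d} (x j) (mv k B r)" for r x j
    using ip_sum_right[of "{..<d}" "x j" r "\<lambda>a l. B l a" "{..<k}"] by (simp add: \<phi>_def mv_def[abs_def] mult.commute)
  have good: "tgt_good K B x z" if xz: "(x, z) \<in> E1 \<times> space TZ \<inter> E2" for x z
  proof -
    have "\<forall>r. (\<Sum>j\<in>Tgt. z j * (\<Sum>a\<in>{..<k}. r a * \<phi> a x j))\<^sup>2 \<le> K * (\<Sum>j\<in>Tgt. (\<Sum>a\<in>{..<k}. r a * \<phi> a x j)\<^sup>2)"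
      using E2(3) xz by blast
    then show ?thesis using cov xz unfolding tgt_good_def comb sumT by blast
  qed
  have "emeasure ?T (space ?T - E1 \<times> space TZ \<inter> E2) \<le> ennreal (?e1 + ?e2)"
    by (rule emeasure_compl_Int[OF E1' E2(1) E1'']) (use E2(2) in auto)
  moreover have "E1 \<times> space TZ \<inter> E2 \<in> sets ?T" using E1' E2(1) by blast
  ultimately show ?thesis using good by blast
qed

lemma sgain_measurable [measurable]: "(\<lambda>s. sgain (fst s) (snd s) q) \<in> borel_measurable (SX \<Otimes>\<^sub>M SZ)"
  unfolding sgain_def gain_def
  by (intro borel_measurable_sum borel_measurable_times borel_measurable_add borel_measurable_diff borel_measurable_power
      borel_measurable_divide borel_measurable_const measurable_compose[OF measurable_fst] measurable_compose[OF measurable_snd]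
      fit_measurable truth_measurable SZ_component)

lemma near_measurable: "{s\<in>space (SX \<Otimes>\<^sub>M SZ). near n q (fst s) (snd s)} \<in> sets (SX \<Otimes>\<^sub>M SZ)"
  unfolding near_def
  by (intro sets.sets_Collect_conj sets.sets_Collect_const sets.sets_Collect_countable_All'[OF _ countable_ratpairs]) measurable

lemma near_exists: "\<exists>q. near n q x z"
proof -
  have ub: "sgain x z q \<le> (\<Sum>j\<in>Src. (truth x j + z j)\<^sup>2 / 2)" for q
    unfolding sgain_def gain_def
  proof (intro sum_mono)
    fix j
    show "(truth x j + z j) * fit q x j - (fit q x j)\<^sup>2 / 2 \<le> (truth x j + z j)\<^sup>2 / 2"
      using zero_le_power2[of "truth x j + z j - fit q x j"] by (simp add: power2_eq_square algebra_simps)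
  qed
  have bdd: "bdd_above (sgain x z ` ratpairs)" using ub by (auto intro!: bdd_aboveI2)
  have "(SUP q\<in>ratpairs. sgain x z q) - 1 / real (Suc n) < (SUP q\<in>ratpairs. sgain x z q)" by simp
  then obtain q where q: "q \<in> ratpairs" "(SUP q\<in>ratpairs. sgain x z q) - 1 / real (Suc n) < sgain x z q"
    using less_cSUP_iff[OF ratpairs_nonempty bdd] by blast
  have "near n q x z" unfolding near_def
  proof (intro conjI ballI q(1))
    fix q' assume "q' \<in> ratpairs"
    then have "sgain x z q' \<le> (SUP q\<in>ratpairs. sgain x z q)" by (rule cSUP_upper[OF _ bdd])
    then show "sgain x z q' \<le> sgain x z q + 1 / real (Suc n)" using q(2) by linarith
  qed
  then show ?thesis by blast
qed

text \<open>The squared Euclidean distance of two predictors of a source task is at most a constant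
  times their in-sample distance, by \<open>src_cov\<close> and the lower spectral bound; so
  convergence of fits at the samples gives convergence in all \<open>d\<close> coordinates.\<close>

lemma predictors_converge:
  assumes cov: "src_cov x" and conv: "\<And>j. j \<in> Src \<Longrightarrow> (\<lambda>n. fit (qn n) x j) \<longlonglongrightarrow> fit q x j" and t: "t < T" and l: "l < d"
  shows "(\<lambda>n. mv k (fst (qn n)) (\<lambda>m. snd (qn n) m t) l) \<longlonglongrightarrow> mv k (fst q) (\<lambda>m. snd q m t) l"
proof -
  define D where "D n l = mv k (fst (qn n)) (\<lambda>m. snd (qn n) m t) l - mv k (fst q) (\<lambda>m. snd q m t) l" for n l
  have ipD: "ip {..<d} (x (t, i)) (D n) = fit (qn n) x (t, i) - fit q x (t, i)" for i n
    unfolding D_def[abs_def] ip_diff_right by (simp add: fit_def lin_ip)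
  define a where "a n = (\<Sum>i<n1. (fit (qn n) x (t, i) - fit q x (t, i))\<^sup>2)" for n
  have "(\<lambda>n. a n) \<longlonglongrightarrow> (\<Sum>i<n1. (fit q x (t, i) - fit q x (t, i))\<^sup>2)"
    unfolding a_def using t by (intro tendsto_intros conv) (auto simp: Src_def)
  then have a0: "a \<longlonglongrightarrow> 0" by simp
  have le: "(D n l)\<^sup>2 \<le> 2 / (real n1 * Lm) * a n" for n
  proof -
    have "cov_event t n1 x (D n)" using cov t by (simp add: src_cov_def)
    moreover have "(\<Sum>i<n1. (ip {..<d} (x (t, i)) (D n))\<^sup>2) = a n" by (simp add: a_def ipD)
    ultimately have 1: "real n1 * qform d (Sigma t) (D n) \<le> a n + real n1 / 10 * qform d (Sigma t) (D n)"
      unfolding cov_event_def abs_le_iff by linarith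
    have s: "(D n l)\<^sup>2 \<le> (\<Sum>l<d. (D n l)\<^sup>2)" using l by (intro member_le_sum) auto
    have "Lm * (D n l)\<^sup>2 \<le> Lm * (\<Sum>l<d. (D n l)\<^sup>2)" using s pos(7) by (intro mult_left_mono) auto
    also have "\<dots> \<le> qform d (Sigma t) (D n)" by (rule lower[OF t])
    finally have 2: "real n1 * (Lm * (D n l)\<^sup>2) \<le> real n1 * qform d (Sigma t) (D n)" by (intro mult_left_mono) auto
    have "0 \<le> real n1 * (Lm * (D n l)\<^sup>2)" using pos(7) by simp
    with 1 2 have "real n1 * (Lm * (D n l)\<^sup>2) \<le> 2 * a n" by linarith
    then show ?thesis using pos(3,7) by (simp add: field_simps)
  qed
  have "(\<lambda>n. (D n l)\<^sup>2) \<longlonglongrightarrow> 0"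
  proof (rule real_tendsto_sandwich[where f = "\<lambda>_. 0" and h = "\<lambda>n. 2 / (real n1 * Lm) * a n"])
    show "(\<lambda>n. 2 / (real n1 * Lm) * a n) \<longlonglongrightarrow> 0" by (rule tendsto_mult_right_zero[OF a0])
    show "\<forall>\<^sub>F n in sequentially. (D n l)\<^sup>2 \<le> 2 / (real n1 * Lm) * a n" using le by simp
  qed auto
  then have "(\<lambda>n. D n l) \<longlonglongrightarrow> 0" by (subst (asm) power_tendsto_0_iff) auto
  then show ?thesis unfolding D_def by (subst (asm) LIM_zero_iff)
qed

text \<open>Both inequalities of \<open>tgt_good\<close> are closed conditions on vectors in the
  range of the representation, so holding infinitely often suffices once every vector of the
  limiting range is a limit of vectors from the approximating ranges.\<close>

lemma tgt_good_limit:
  assumes cov: "src_cov x" and conv: "\<And>j. j \<in> Src \<Longrightarrow> (\<lambda>n. fit (qn n) x j) \<longlonglongrightarrow> fit q x j"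
    and surj: "\<And>u. \<exists>a. \<forall>m<k. u m = (\<Sum>t<T. a t * snd q m t)"
    and freq: "\<And>m. \<exists>n\<ge>m. tgt_good K (fst (qn n)) x' z'"
  shows "tgt_good K (fst q) x' z'"
proof -
  \<comment> \<open>The matrices \<open>fst (qn n)\<close> need not converge; only the products with
    the coefficient columns do. Full row rank writes \<open>u\<close> as a combination of these
    columns, and the same combination for \<open>qn n\<close> converges.\<close>
  have app: "\<exists>un. \<forall>l<d. (\<lambda>n. mv k (fst (qn n)) (un n) l) \<longlonglongrightarrow> mv k (fst q) u l" for u
  proof -
    obtain a where a: "\<forall>m<k. u m = (\<Sum>t<T. a t * snd q m t)" using surj[of u] by blast
    have lin: "mv k B (\<lambda>m. \<Sum>t<T. a t * W m t) l = (\<Sum>t<T. a t * mv k B (\<lambda>m. W m t) l)" for B W l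
      unfolding mv_def sum_distrib_left by (subst sum.swap) (simp add: mult_ac)
    have "(\<lambda>n. mv k (fst (qn n)) (\<lambda>m. \<Sum>t<T. a t * snd (qn n) m t) l) \<longlonglongrightarrow> mv k (fst q) u l" if l: "l < d" for l
    proof -
      have "mv k (fst q) u l = mv k (fst q) (\<lambda>m. \<Sum>t<T. a t * snd q m t) l" using a by (simp add: mv_def)
      then show ?thesis unfolding lin
        using predictors_converge[OF cov conv _ l] by (simp add: lin) (intro tendsto_intros; simp)
    qed
    then show ?thesis by (intro exI[of _ "\<lambda>n m. \<Sum>t<T. a t * snd (qn n) m t"]) blast
  qed
  have ipl: "(\<lambda>n. ip {..<d} y (v n)) \<longlonglongrightarrow> ip {..<d} y w" if "\<forall>l<d. (\<lambda>n. v n l) \<longlonglongrightarrow> w l" for y v w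
    unfolding ip_def using that by (intro tendsto_intros) auto
  have ql: "(\<lambda>n. qform d S (v n)) \<longlonglongrightarrow> qform d S w" if "\<forall>l<d. (\<lambda>n. v n l) \<longlonglongrightarrow> w l" for S v w
    unfolding qform_def using that by (intro tendsto_intros) auto
  have "cov_event T n2 x' (\<lambda>l. mv k (fst q) u l - mv k Bs w l)" for u w
  proof -
    obtain un where un: "\<forall>l<d. (\<lambda>n. mv k (fst (qn n)) (un n) l) \<longlonglongrightarrow> mv k (fst q) u l" using app by blast
    define v where "v n l = mv k (fst (qn n)) (un n) l - mv k Bs w l" for n l
    have v: "\<forall>l<d. (\<lambda>n. v n l) \<longlonglongrightarrow> mv k (fst q) u l - mv k Bs w l"
      unfolding v_def using un by (auto intro!: tendsto_intros)
    show ?thesis unfolding cov_event_def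
    proof (rule limit_le_frequently)
      show "(\<lambda>n. \<bar>(\<Sum>i<n2. (ip {..<d} (x' (T, i)) (v n))\<^sup>2) - real n2 * qform d (Sigma T) (v n)\<bar>)
        \<longlonglongrightarrow> \<bar>(\<Sum>i<n2. (ip {..<d} (x' (T, i)) (\<lambda>l. mv k (fst q) u l - mv k Bs w l))\<^sup>2) - real n2 * qform d (Sigma T) (\<lambda>l. mv k (fst q) u l - mv k Bs w l)\<bar>"
        by (intro tendsto_intros ipl[OF v] ql[OF v])
      show "(\<lambda>n. real n2 / 10 * qform d (Sigma T) (v n)) \<longlonglongrightarrow> real n2 / 10 * qform d (Sigma T) (\<lambda>l. mv k (fst q) u l - mv k Bs w l)"
        by (intro tendsto_intros ql[OF v])
      fix m
      obtain n where "n \<ge> m" "tgt_good K (fst (qn n)) x' z'" using freq by blast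
      then show "\<exists>n\<ge>m. \<bar>(\<Sum>i<n2. (ip {..<d} (x' (T, i)) (v n))\<^sup>2) - real n2 * qform d (Sigma T) (v n)\<bar> \<le> real n2 / 10 * qform d (Sigma T) (v n)"
        unfolding tgt_good_def cov_event_def v_def[abs_def] by blast
    qed
  qed
  moreover have "(\<Sum>i<n2. z' (T, i) * ip {..<d} (x' (T, i)) (mv k (fst q) u))\<^sup>2 \<le> K * (\<Sum>i<n2. (ip {..<d} (x' (T, i)) (mv k (fst q) u))\<^sup>2)" for u
  proof -
    obtain un where un: "\<forall>l<d. (\<lambda>n. mv k (fst (qn n)) (un n) l) \<longlonglongrightarrow> mv k (fst q) u l" using app by blast
    show ?thesis
    proof (rule limit_le_frequently)
      show "(\<lambda>n. (\<Sum>i<n2. z' (T, i) * ip {..<d} (x' (T, i)) (mv k (fst (qn n)) (un n)))\<^sup>2)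
        \<longlonglongrightarrow> (\<Sum>i<n2. z' (T, i) * ip {..<d} (x' (T, i)) (mv k (fst q) u))\<^sup>2"
        by (intro tendsto_intros ipl[OF un])
      show "(\<lambda>n. K * (\<Sum>i<n2. (ip {..<d} (x' (T, i)) (mv k (fst (qn n)) (un n)))\<^sup>2))
        \<longlonglongrightarrow> K * (\<Sum>i<n2. (ip {..<d} (x' (T, i)) (mv k (fst q) u))\<^sup>2)"
        by (intro tendsto_intros ipl[OF un])
      fix m
      obtain n where "n \<ge> m" "tgt_good K (fst (qn n)) x' z'" using freq by blast
      then show "\<exists>n\<ge>m. (\<Sum>i<n2. z' (T, i) * ip {..<d} (x' (T, i)) (mv k (fst (qn n)) (un n)))\<^sup>2
          \<le> K * (\<Sum>i<n2. (ip {..<d} (x' (T, i)) (mv k (fst (qn n)) (un n)))\<^sup>2)"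
        unfolding tgt_good_def by blast
    qed
  qed
  ultimately show ?thesis unfolding tgt_good_def by blast
qed

text \<open>The representation learned from the source data is not given by a measurable function of them.
  It is approximated by countably valued near-minimisers \<open>q\<^sub>n\<close>, for which independence of the target
  sample applies; the target event for infinitely many \<open>q\<^sub>n\<close> passes to the limit.\<close>

lemma joint_event:
  assumes G: "G \<in> sets (SX \<Otimes>\<^sub>M SZ)" "emeasure (SX \<Otimes>\<^sub>M SZ) (space (SX \<Otimes>\<^sub>M SZ) - G) \<le> ennreal \<epsilon>1"
    and good: "\<And>x z. (x, z) \<in> G \<Longrightarrow> source_good K3 K4 N x z"
    and tgt: "\<And>B. \<exists>E\<in>sets (TX \<Otimes>\<^sub>M TZ). emeasure (TX \<Otimes>\<^sub>M TZ) (space (TX \<Otimes>\<^sub>M TZ) - E) \<le> ennreal \<epsilon>2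
         \<and> (\<forall>x z. (x, z) \<in> E \<longrightarrow> tgt_good K B x z)"
    and \<epsilon>: "0 \<le> \<epsilon>1" "0 \<le> \<epsilon>2"
  shows "\<exists>F\<in>sets ((SX \<Otimes>\<^sub>M SZ) \<Otimes>\<^sub>M (TX \<Otimes>\<^sub>M TZ)).
      emeasure ((SX \<Otimes>\<^sub>M SZ) \<Otimes>\<^sub>M (TX \<Otimes>\<^sub>M TZ)) (space ((SX \<Otimes>\<^sub>M SZ) \<Otimes>\<^sub>M (TX \<Otimes>\<^sub>M TZ)) - F) \<le> ennreal (\<epsilon>1 + \<epsilon>2)
     \<and> (\<forall>x z x' z'. ((x, z), (x', z')) \<in> F \<longrightarrow> source_good K3 K4 N x z \<and> (\<forall>q. optimal x z q \<longrightarrow> tgt_good K (fst q) x' z'))"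
proof -
  let ?S = "SX \<Otimes>\<^sub>M SZ" and ?T = "TX \<Otimes>\<^sub>M TZ"
  let ?M = "?S \<Otimes>\<^sub>M ?T"
  have pS: "prob_space ?S" and pT: "prob_space ?T" using prob_space_pair prob_spaces by auto
  define e where "e = from_nat_into ratpairs"
  \<comment> \<open>The least index in an enumeration of the rational pairs is a measurable
    selection of a near-maximiser.\<close>
  define idx where "idx n s = (LEAST i. near n (e i) (fst s) (snd s))" for n s
  have idx: "near n (e (idx n s)) (fst s) (snd s)" for n s
  proof -
    obtain q where q: "near n q (fst s) (snd s)" using near_exists by blast
    then have "q \<in> ratpairs" by (simp add: near_def)
    then obtain i where "q = e i" unfolding e_def using countable_ratpairs by (metis from_nat_into_to_nat_on)
    with q show ?thesis unfolding idx_def by (metis (mono_tags, lifting) LeastI)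
  qed
  have midx: "idx n \<in> measurable ?S (count_space UNIV)" for n
    unfolding idx_def[abs_def] by (intro measurable_Least) (use near_measurable in \<open>simp add: pred_def\<close>)
  have "\<forall>i. \<exists>E. E \<in> sets ?T \<and> emeasure ?T (space ?T - E) \<le> ennreal \<epsilon>2 \<and> (\<forall>x z. (x, z) \<in> E \<longrightarrow> tgt_good K (fst (e i)) x z)"
  proof
    fix i
    show "\<exists>E. E \<in> sets ?T \<and> emeasure ?T (space ?T - E) \<le> ennreal \<epsilon>2 \<and> (\<forall>x z. (x, z) \<in> E \<longrightarrow> tgt_good K (fst (e i)) x z)"
      using tgt[of "fst (e i)"] unfolding Bex_def .
  qed
  from choice[OF this] obtain E where E: "\<And>i. E i \<in> sets ?T" "\<And>i. emeasure ?T (space ?T - E i) \<le> ennreal \<epsilon>2"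
    "\<And>i x z. (x, z) \<in> E i \<Longrightarrow> tgt_good K (fst (e i)) x z" by blast
  \<comment> \<open>Failure of the target event for the selected candidate. On each piece the
    candidate is constant, so every section over the source sample has measure at most
    \<open>\<epsilon>2\<close>.\<close>
  define C where "C n = (\<Union>i. (idx n -` {i} \<inter> space ?S) \<times> (space ?T - E i))" for n
  have C: "C n \<in> sets ?M" for n
    unfolding C_def using E(1) measurable_sets[OF midx] by (intro sets.countable_UN) auto
  have sect: "Pair s -` C n = space ?T - E (idx n s)" if "s \<in> space ?S" for s n using that by (auto simp: C_def)
  have Cle: "emeasure ?M (C n) \<le> ennreal \<epsilon>2" for n
  proof -
    have "emeasure ?M (C n) = (\<integral>\<^sup>+s. emeasure ?T (Pair s -` C n) \<partial>?S)"
      by (rule sigma_finite_measure.emeasure_pair_measure_alt[OF prob_space_imp_sigma_finite[OF pT] C])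
    also have "\<dots> \<le> (\<integral>\<^sup>+s. ennreal \<epsilon>2 \<partial>?S)" using sect E(2) by (intro nn_integral_mono) simp
    also have "\<dots> = ennreal \<epsilon>2" using prob_space.emeasure_space_1[OF pS] by simp
    finally show ?thesis .
  qed
  \<comment> \<open>Failure for all candidates from \<open>m\<close> on. These sets increase, so
    their union also has measure at most \<open>\<epsilon>2\<close>; a union bound over
    \<open>n\<close> would diverge.\<close>
  define L where "L m = (\<Inter>n\<in>{m..}. C n)" for m
  have L: "L m \<in> sets ?M" for m unfolding L_def using C by (intro sets.countable_INT') auto
  have "emeasure ?M (\<Union>m. L m) = (SUP m. emeasure ?M (L m))"
    using L by (intro SUP_emeasure_incseq[symmetric]) (auto simp: L_def incseq_def)
  also have "\<dots> \<le> ennreal \<epsilon>2"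
  proof (rule SUP_least)
    fix m
    have "emeasure ?M (L m) \<le> emeasure ?M (C m)" using C by (intro emeasure_mono) (auto simp: L_def)
    then show "emeasure ?M (L m) \<le> ennreal \<epsilon>2" using Cle[of m] by simp
  qed
  finally have Lle: "emeasure ?M (\<Union>m. L m) \<le> ennreal \<epsilon>2" .
  have UL: "(\<Union>m. L m) \<in> sets ?M" using L by blast
  define H where "H = space ?M - (\<Union>m. L m)"
  have H: "H \<in> sets ?M" unfolding H_def using UL by blast
  have "space ?M - H = (\<Union>m. L m)" unfolding H_def using sets.sets_into_space[OF UL] by blast
  then have Hle: "emeasure ?M (space ?M - H) \<le> ennreal \<epsilon>2" using Lle by simp
  have G': "G \<times> space ?T \<in> sets ?M" using G(1) by auto
  have Gle: "emeasure ?M (space ?M - G \<times> space ?T) \<le> ennreal \<epsilon>1"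
    using G(2) by (simp only: emeasure_compl_fst[OF pT G(1)])
  have "emeasure ?M (space ?M - G \<times> space ?T \<inter> H) \<le> ennreal (\<epsilon>1 + \<epsilon>2)"
    by (rule emeasure_compl_Int[OF G' H Gle Hle \<epsilon>])
  moreover have "source_good K3 K4 N x z \<and> (\<forall>q. optimal x z q \<longrightarrow> tgt_good K (fst q) x' z')"
    if F: "((x, z), (x', z')) \<in> G \<times> space ?T \<inter> H" for x z x' z'
  proof (intro conjI allI impI)
    show sg: "source_good K3 K4 N x z" using good F by blast
    fix q assume q: "optimal x z q"
    define qn where "qn n = e (idx n (x, z))" for n
    have near: "near n (qn n) x z" for n using idx[of n "(x, z)"] by (simp add: qn_def)
    show "tgt_good K (fst q) x' z'"
    proof (rule tgt_good_limit)
      show "src_cov x" using sg by (simp add: source_good_def)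
      show "(\<lambda>n. fit (qn n) x j) \<longlonglongrightarrow> fit q x j" if "j \<in> Src" for j
        using sg q near that unfolding source_good_def src_conv_def by blast
      show "\<exists>a. \<forall>m<k. u m = (\<Sum>t<T. a t * snd q m t)" for u
        using sg q unfolding source_good_def src_surj_def by blast
      fix m
      have "((x, z), (x', z')) \<notin> L m" using F by (auto simp: H_def)
      then obtain n where n: "n \<ge> m" "((x, z), (x', z')) \<notin> C n" by (auto simp: L_def)
      have sp: "(x, z) \<in> space ?S" "(x', z') \<in> space ?T" using F sets.sets_into_space[OF G(1)] by auto
      then have "(x', z') \<in> E (idx n (x, z))" using n(2) sect[OF sp(1), of n] by auto
      then show "\<exists>n\<ge>m. tgt_good K (fst (qn n)) x' z'" using E(3) n(1) unfolding qn_def by blast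
    qed
  qed
  moreover have "G \<times> space ?T \<inter> H \<in> sets ?M" using G' H by blast
  ultimately show ?thesis by blast
qed

text \<open>A direction of unit variance forces \<open>1 / (4 * \<rho>^2) \<le> 1 / 2\<close>.
  Through this bound the size condition, which carries the factor \<open>\<rho>^4\<close>, yields
  \<open>n1 \<ge> d\<close> and \<open>n1 \<ge> 9\<close>.\<close>

lemma rho_lower: "1 / 4 \<le> \<rho> ^ 4"
proof -
  define e0 where "e0 l = (if l = 0 then 1 else 0 :: real)" for l :: nat
  have d: "0 < d" using kd pos(1) by simp
  have "(\<Sum>l<d. (e0 l)\<^sup>2) = 1" using d by (simp add: e0_def if_distrib[of "\<lambda>x. x\<^sup>2"] cong: if_cong)
  then have q: "0 < qform d (Sigma 0) e0" using lower[of 0 e0] pos(2,7) by simp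
  define s where "s = 1 / sqrt (qform d (Sigma 0) e0)"
  define v where "v l = s * e0 l" for l
  have qs: "qform d (Sigma 0) (\<lambda>l. h * f l) = h\<^sup>2 * qform d (Sigma 0) f" for h f
    by (simp add: qform_def sum_distrib_left power2_eq_square mult_ac)
  have qv: "qform d (Sigma 0) v = 1" using q unfolding v_def qs by (simp add: s_def power_divide)
  define Y where "Y x = (\<Sum>l<d. v l * x l)" for x :: "nat \<Rightarrow> real"
  have hY: "h * Y x = (\<Sum>l<d. (h * v l) * x l)" for h x by (simp add: Y_def sum_distrib_left mult.assoc)
  have "1 / (4 * \<rho>\<^sup>2) \<le> 1 / 2"
  proof (rule exp_centered_square_le(1)[where Y = Y and M = "p 0", OF prob_p pos(6) _ _ _ _ refl])
    show "Y \<in> borel_measurable (p 0)"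
      unfolding Y_def[abs_def] using vec_space_component[OF sets_p[of 0]]
      by (intro borel_measurable_sum borel_measurable_times borel_measurable_const) auto
    show "(\<integral>\<^sup>+x. ennreal (exp (h * Y x)) \<partial>p 0) \<le> ennreal (exp (h\<^sup>2 * \<rho>\<^sup>2 / 2))" for h
      using laplace[of 0 "\<lambda>l. h * v l"] unfolding hY qs qv by simp
    show "integrable (p 0) (\<lambda>x. (Y x)\<^sup>2)" using quad_int[of 0 v] by (simp add: Y_def)
    show "(\<integral>x. (Y x)\<^sup>2 \<partial>p 0) = 1" using quad_val[of 0 v] by (simp add: Y_def qv)
  qed simp
  then have "1 / 2 \<le> \<rho>\<^sup>2" using pos(6) by (simp add: field_simps)
  then have "(1 / 2) * (1 / 2) \<le> \<rho>\<^sup>2 * \<rho>\<^sup>2" by (intro mult_mono) auto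
  then show ?thesis by (simp add: power2_eq_square power4_eq_xxxx mult.assoc)
qed

text \<open>Deterministic once both samples are good. The estimated \<open>Wh\<close> gives
  competitors to the best approximation of the columns of \<open>Ws\<close> by the range of
  \<open>Bh\<close>, so the source risks dominate the projection residuals; the target regression is
  then compared with the projection coefficients \<open>mv k \<psi> w\<close>.\<close>

lemma risk_bound:
  fixes Bh Wh :: "nat \<Rightarrow> nat \<Rightarrow> real"
  assumes good: "source_good K3 K4 N x z" and K: "0 \<le> K3" "0 \<le> K4" "0 \<le> K5"
    and net: "\<And>V :: nat \<times> nat \<Rightarrow> real. (\<forall>i\<in>{..<d} \<times> {..<2 * k}. \<bar>V i\<bar> \<le> 1)
        \<Longrightarrow> \<exists>V'\<in>N. \<forall>i\<in>{..<d} \<times> {..<2 * k}. \<bar>V i - V' i\<bar> \<le> h"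
    and h: "0 < h" "h\<^sup>2 * (2 * real k * real d * (LM / Lm * real n1)) = 1"
    and opt: "optimal x z (Bh, Wh)" and tgt: "tgt_good K5 Bh x' z'"
    and c: "0 < c" "\<And>t v. t < T \<Longrightarrow> c * qform d (Sigma T) v \<le> qform d (Sigma t) v"
    and c0: "0 < c0" "c0 * real T / real k \<le> (sing_val k T Ws k)\<^sup>2"
    and C0: "0 < C0" "spec_norm k k (second_moment \<nu>) \<le> C0 / real k"
    and \<nu>: "prob_space \<nu>" "sets \<nu> = sets (vec_space k)" "AE w in \<nu>. vnorm k w \<le> b"
    and wh: "\<And>w u. (\<Sum>i<n2. (ip {..<d} (x' (T, i)) (mv k Bs w) + z' (T, i) - ip {..<d} (x' (T, i)) (mv k Bh (wh w)))\<^sup>2)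
        \<le> (\<Sum>i<n2. (ip {..<d} (x' (T, i)) (mv k Bs w) + z' (T, i) - ip {..<d} (x' (T, i)) (mv k Bh u))\<^sup>2)"
  shows "(\<integral>\<^sup>+w. ennreal (1 / 2 * qform d (Sigma T) (\<lambda>l. mv k Bh (wh w) l - mv k Bs w l)) \<partial>\<nu>)
     \<le> ennreal (2 * (C0 / (c0 * real T) * ((50 * K3 + 12 * K4 / real n1) / real n1 / c)) + 5 * K5 / real n2)"
proof -
  interpret nu: prob_space \<nu> by (rule \<nu>(1))
  have d: "0 < d" using kd pos(1) by simp
  define BS where "BS = (50 * K3 + 12 * K4 / real n1) / real n1"
  have sb: "(\<Sum>t<T. qform d (Sigma t) (\<lambda>l. mv k Bh (\<lambda>m. Wh m t) l - mv k Bs (\<lambda>m. Ws m t) l)) \<le> BS"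
    unfolding BS_def
  proof (rule source_regression_bound[where x = x and z = z and Lm = Lm and LM = LM and h = h and N = N and J = Src,
        OF Src_def pos(3) pos(1) d pos(7) pos(8) K(1) K(2) _ upper lower net h])
    show "\<bar>(\<Sum>i<n1. (ip {..<d} (x (t, i)) v)\<^sup>2) - real n1 * qform d (Sigma t) v\<bar> \<le> real n1 / 10 * qform d (Sigma t) v" if "t < T" for t v
      using good that unfolding source_good_def src_cov_def cov_event_def by blast
    show "(\<Sum>j\<in>Src. z j * (\<Sum>a<2 * k. r (fst j) a * ip {..<d} (x j) (\<lambda>l. V (l, a))))\<^sup>2
        \<le> K3 * (\<Sum>j\<in>Src. (\<Sum>a<2 * k. r (fst j) a * ip {..<d} (x j) (\<lambda>l. V (l, a)))\<^sup>2)" if "V \<in> N" for V r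
      using good that unfolding source_good_def src_noise_def by blast
    show "(\<Sum>j\<in>Src. (z j)\<^sup>2) \<le> K4" using good unfolding source_good_def by blast
    have "sgain x z (Bs, Ws) \<le> sgain x z (Bh, Wh)" using opt by (simp add: optimal_def)
    then show "gain Src (\<lambda>j. lin d k (x j) Bs (\<lambda>m. Ws m (fst j)) + z j) (\<lambda>j. lin d k (x j) Bs (\<lambda>m. Ws m (fst j)))
        \<le> gain Src (\<lambda>j. lin d k (x j) Bs (\<lambda>m. Ws m (fst j)) + z j) (\<lambda>j. lin d k (x j) Bh (\<lambda>m. Wh m (fst j)))"
      by (simp add: sgain_def fit_def[abs_def] truth_def)
  qed
  have "\<exists>\<psi> g. \<forall>w. qform d (Sigma T) (\<lambda>l. mv k Bh (mv k \<psi> w) l - mv k Bs w l) = (\<Sum>l<d. (\<Sum>j<k. w j * g l j)\<^sup>2)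
     \<and> (\<forall>u. (\<Sum>l<d. (\<Sum>j<k. w j * g l j)\<^sup>2) \<le> qform d (Sigma T) (\<lambda>l. mv k Bh u l - mv k Bs w l))"
    by (rule population_projection) (rule factor[OF order_refl])
  then obtain \<psi> g where pg0: "\<forall>w. qform d (Sigma T) (\<lambda>l. mv k Bh (mv k \<psi> w) l - mv k Bs w l) = (\<Sum>l<d. (\<Sum>j<k. w j * g l j)\<^sup>2)
     \<and> (\<forall>u. (\<Sum>l<d. (\<Sum>j<k. w j * g l j)\<^sup>2) \<le> qform d (Sigma T) (\<lambda>l. mv k Bh u l - mv k Bs w l))"
    by (elim exE)
  have pg: "qform d (Sigma T) (\<lambda>l. mv k Bh (mv k \<psi> w) l - mv k Bs w l) = (\<Sum>l<d. (\<Sum>j<k. w j * g l j)\<^sup>2)"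
    "(\<Sum>l<d. (\<Sum>j<k. w j * g l j)\<^sup>2) \<le> qform d (Sigma T) (\<lambda>l. mv k Bh u l - mv k Bs w l)" for w u
    using pg0 by blast+
  define G where "G w = (\<Sum>l<d. (\<Sum>j<k. w j * g l j)\<^sup>2)" for w
  \<comment> \<open>The squared Frobenius norm of the residual matrix \<open>g\<close> links source
    and target: (A3), applied to each row, bounds it by the source risks, and (A4) bounds the mean
    of \<open>G\<close> over \<open>\<nu>\<close> by it.\<close>
  define \<Gamma> where "\<Gamma> = (\<Sum>l<d. \<Sum>j<k. (g l j)\<^sup>2)"
  have \<Gamma>: "c0 * real T / real k * \<Gamma> \<le> BS / c"
  proof -
    have "c0 * real T / real k * \<Gamma> = (\<Sum>l<d. c0 * real T / real k * (\<Sum>j<k. (g l j)\<^sup>2))" by (simp add: \<Gamma>_def sum_distrib_left)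
    also have "\<dots> \<le> (\<Sum>l<d. \<Sum>t<T. (\<Sum>j<k. g l j * Ws j t)\<^sup>2)"
    proof (intro sum_mono)
      fix l
      have "c0 * real T / real k * (\<Sum>j<k. (g l j)\<^sup>2) \<le> (sing_val k T Ws k)\<^sup>2 * (\<Sum>j<k. (g l j)\<^sup>2)"
        using c0(2) by (intro mult_right_mono sum_nonneg) auto
      also have "\<dots> \<le> (\<Sum>t<T. (\<Sum>j<k. g l j * Ws j t)\<^sup>2)" by (rule sing_val_smallest[OF pos(1)])
      finally show "c0 * real T / real k * (\<Sum>j<k. (g l j)\<^sup>2) \<le> (\<Sum>t<T. (\<Sum>j<k. g l j * Ws j t)\<^sup>2)" .
    qed
    also have "\<dots> = (\<Sum>t<T. G (\<lambda>j. Ws j t))" unfolding G_def by (subst sum.swap) (simp add: mult.commute)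
    also have "\<dots> \<le> (\<Sum>t<T. qform d (Sigma t) (\<lambda>l. mv k Bh (\<lambda>m. Wh m t) l - mv k Bs (\<lambda>m. Ws m t) l) / c)"
    proof (intro sum_mono)
      fix t assume t: "t \<in> {..<T}"
      have "G (\<lambda>j. Ws j t) \<le> qform d (Sigma T) (\<lambda>l. mv k Bh (\<lambda>m. Wh m t) l - mv k Bs (\<lambda>m. Ws m t) l)"
        unfolding G_def by (rule pg(2))
      also have "\<dots> \<le> qform d (Sigma t) (\<lambda>l. mv k Bh (\<lambda>m. Wh m t) l - mv k Bs (\<lambda>m. Ws m t) l) / c"
        using c(2)[of t] t c(1) by (simp add: pos_le_divide_eq mult.commute)
      finally show "G (\<lambda>j. Ws j t) \<le> qform d (Sigma t) (\<lambda>l. mv k Bh (\<lambda>m. Wh m t) l - mv k Bs (\<lambda>m. Ws m t) l) / c" .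
    qed
    also have "\<dots> \<le> BS / c" unfolding sum_divide_distrib[symmetric] using sb c(1) by (intro divide_right_mono) auto
    finally show ?thesis .
  qed
  have sm: "integrable \<nu> (\<lambda>w. w i * w j)" if "i < k" "j < k" for i j
    by (rule bounded_second_moment_integrable[OF \<nu>(1,2,3) that])
  have G': "G w = (\<Sum>l<d. (\<Sum>j<k. g l j * w j)\<^sup>2)" for w by (simp add: G_def mult.commute)
  have intl: "integrable \<nu> (\<lambda>w. (\<Sum>j<k. g l j * w j)\<^sup>2)" for l by (rule second_moment_quadratic(1)[OF sm])
  have intG: "integrable \<nu> G" unfolding G'[abs_def] by (intro Bochner_Integration.integrable_sum intl)
  have "(\<integral>w. G w \<partial>\<nu>) = (\<Sum>l<d. \<integral>w. (\<Sum>j<k. g l j * w j)\<^sup>2 \<partial>\<nu>)"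
    unfolding G' by (rule Bochner_Integration.integral_sum) (rule intl)
  also have "\<dots> = (\<Sum>l<d. qform k (second_moment \<nu>) (g l))"
    by (intro sum.cong refl second_moment_quadratic(2)[OF sm])
  also have "\<dots> \<le> (\<Sum>l<d. C0 / real k * (\<Sum>j<k. (g l j)\<^sup>2))"
  proof (intro sum_mono)
    fix l
    have "qform k (second_moment \<nu>) (g l) \<le> spec_norm k k (second_moment \<nu>) * (\<Sum>j<k. (g l j)\<^sup>2)"
      by (rule qform_le_spec_norm[OF pos(1)])
    also have "\<dots> \<le> C0 / real k * (\<Sum>j<k. (g l j)\<^sup>2)" using C0(2) by (intro mult_right_mono sum_nonneg) auto
    finally show "qform k (second_moment \<nu>) (g l) \<le> C0 / real k * (\<Sum>j<k. (g l j)\<^sup>2)" .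
  qed
  also have "\<dots> = C0 / real k * \<Gamma>" by (simp add: \<Gamma>_def sum_distrib_left)
  also have "\<dots> = C0 / (c0 * real T) * (c0 * real T / real k * \<Gamma>)" using c0(1) pos(2) by simp
  also have "\<dots> \<le> C0 / (c0 * real T) * (BS / c)" using \<Gamma> C0(1) c0(1) by (intro mult_left_mono) auto
  finally have EG: "(\<integral>w. G w \<partial>\<nu>) \<le> C0 / (c0 * real T) * (BS / c)" .
  have G0: "0 \<le> G w" for w by (simp add: G_def sum_nonneg)
  have pt: "1 / 2 * qform d (Sigma T) (\<lambda>l. mv k Bh (wh w) l - mv k Bs w l) \<le> 2 * G w + 5 * K5 / real n2" for w
  proof -
    have "qform d (Sigma T) (\<lambda>l. mv k Bh (wh w) l - mv k Bs w l)
        \<le> 4 * qform d (Sigma T) (\<lambda>l. mv k Bh (mv k \<psi> w) l - mv k Bs w l) + 9 * K5 / real n2"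
    proof (rule target_regression_bound[where x = "\<lambda>i. x' (T, i)" and z = "\<lambda>i. z' (T, i)" and q = "qform d (Sigma T)" and b = "mv k Bs w", OF pos(4) K(3)])
      show "\<bar>(\<Sum>i<n2. (ip {..<d} (x' (T, i)) (\<lambda>l. mv k Bh u l - mv k Bs w l))\<^sup>2) - real n2 * qform d (Sigma T) (\<lambda>l. mv k Bh u l - mv k Bs w l)\<bar>
        \<le> real n2 / 10 * qform d (Sigma T) (\<lambda>l. mv k Bh u l - mv k Bs w l)" for u
        using tgt unfolding tgt_good_def cov_event_def by blast
      show "(\<Sum>i<n2. z' (T, i) * ip {..<d} (x' (T, i)) (mv k Bh u))\<^sup>2 \<le> K5 * (\<Sum>i<n2. (ip {..<d} (x' (T, i)) (mv k Bh u))\<^sup>2)" for u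
        using tgt unfolding tgt_good_def by blast
    qed (rule wh)
    moreover have "0 \<le> K5 / real n2" using K(3) by simp
    ultimately show ?thesis unfolding pg(1) G_def by simp
  qed
  \<comment> \<open>The selection \<open>wh\<close> is arbitrary, so the integrand on the left may
    fail to be measurable; monotonicity of the nonnegative integral still applies, and the majorant
    is integrable.\<close>
  have "(\<integral>\<^sup>+w. ennreal (1 / 2 * qform d (Sigma T) (\<lambda>l. mv k Bh (wh w) l - mv k Bs w l)) \<partial>\<nu>)
      \<le> (\<integral>\<^sup>+w. ennreal (2 * G w + 5 * K5 / real n2) \<partial>\<nu>)"
    by (intro nn_integral_mono ennreal_leI pt)
  also have "\<dots> = ennreal (\<integral>w. 2 * G w + 5 * K5 / real n2 \<partial>\<nu>)"
    using intG G0 K(3) by (intro nn_integral_eq_integral) auto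
  also have "(\<integral>w. 2 * G w + 5 * K5 / real n2 \<partial>\<nu>) = 2 * (\<integral>w. G w \<partial>\<nu>) + 5 * K5 / real n2"
    using intG by (simp add: nu.prob_space)
  also have "\<dots> \<le> 2 * (C0 / (c0 * real T) * (BS / c)) + 5 * K5 / real n2" using EG by simp
  finally show ?thesis unfolding BS_def by (simp add: ennreal_leI)
qed

definition "split_sample \<omega> = (((\<lambda>j\<in>Src. fst (\<omega> j)), (\<lambda>j\<in>Src. snd (\<omega> j))), ((\<lambda>j\<in>Tgt. fst (\<omega> j)), (\<lambda>j\<in>Tgt. snd (\<omega> j))))"
  for \<omega> :: "nat \<times> nat \<Rightarrow> (nat \<Rightarrow> real) \<times> real"

lemma sample_idx_eq: "sample_idx T n1 n2 = Src \<union> Tgt" "Src \<inter> Tgt = {}"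
  by (auto simp: sample_idx_def Src_def Tgt_def)

lemma sample_space_eq: "sample_space T n1 n2 p \<sigma> = PiM (Src \<union> Tgt) (\<lambda>j. P j \<Otimes>\<^sub>M gauss \<sigma>)"
  unfolding sample_space_def sample_idx_eq by (intro PiM_cong) (auto simp: P_def Src_def Tgt_def)

text \<open>\<open>split_sample\<close> inverts the composition of zipping covariates with noise and
  merging source with target, and both of these maps carry the product measure to the product
  measure. Pulling the preimage back along them returns \<open>F\<close>.\<close>

lemma split_sample_transfer:
  assumes F: "F \<in> sets ((SX \<Otimes>\<^sub>M SZ) \<Otimes>\<^sub>M (TX \<Otimes>\<^sub>M TZ))"
  shows "split_sample -` F \<inter> space (sample_space T n1 n2 p \<sigma>) \<in> sets (sample_space T n1 n2 p \<sigma>)"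
    and "emeasure (sample_space T n1 n2 p \<sigma>) (split_sample -` F \<inter> space (sample_space T n1 n2 p \<sigma>))
       = emeasure ((SX \<Otimes>\<^sub>M SZ) \<Otimes>\<^sub>M (TX \<Otimes>\<^sub>M TZ)) F"
proof -
  define PG where "PG j = P j \<Otimes>\<^sub>M gauss \<sigma>" for j
  define M where "M = PiM (Src \<union> Tgt) PG"
  have Meq: "sample_space T n1 n2 p \<sigma> = M" unfolding sample_space_eq M_def PG_def ..
  have pPG: "prob_space (PG j)" for j unfolding PG_def by (rule prob_space_pair[OF prob_P prob_gauss])
  interpret PG: product_prob_space PG by (rule product_prob_spaceI[OF pPG])
  define D where "D = PiM Src PG \<Otimes>\<^sub>M PiM Tgt PG"
  have mcomp: "(\<lambda>\<omega>. \<omega> j) \<in> measurable M (P j \<Otimes>\<^sub>M gauss \<sigma>)" if "j \<in> Src \<union> Tgt" for j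
    using measurable_component_singleton[of j "Src \<union> Tgt" PG] that by (simp add: M_def PG_def)
  have m\<Phi>: "split_sample \<in> measurable M ((SX \<Otimes>\<^sub>M SZ) \<Otimes>\<^sub>M (TX \<Otimes>\<^sub>M TZ))"
    unfolding split_sample_def SX_def SZ_def TX_def TZ_def
    by (intro measurable_Pair measurable_restrict measurable_compose[OF mcomp measurable_fst] measurable_compose[OF mcomp measurable_snd]) auto
  show A: "split_sample -` F \<inter> space (sample_space T n1 n2 p \<sigma>) \<in> sets (sample_space T n1 n2 p \<sigma>)"
    unfolding Meq by (rule measurable_sets[OF m\<Phi> F])
  have zS: "distr (SX \<Otimes>\<^sub>M SZ) (PiM Src PG) (zip_fun Src) = PiM Src PG"
    unfolding SX_def SZ_def PG_def[abs_def] by (rule distr_zip_fun[OF prob_P prob_gauss finite_idx(1)])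
  have zT: "distr (TX \<Otimes>\<^sub>M TZ) (PiM Tgt PG) (zip_fun Tgt) = PiM Tgt PG"
    unfolding TX_def TZ_def PG_def[abs_def] by (rule distr_zip_fun[OF prob_P prob_gauss finite_idx(2)])
  have mzS: "zip_fun Src \<in> measurable (SX \<Otimes>\<^sub>M SZ) (PiM Src PG)"
    unfolding SX_def SZ_def PG_def[abs_def] by (rule measurable_zip_fun)
  have mzT: "zip_fun Tgt \<in> measurable (TX \<Otimes>\<^sub>M TZ) (PiM Tgt PG)"
    unfolding TX_def TZ_def PG_def[abs_def] by (rule measurable_zip_fun)
  define zz :: "((nat \<times> nat \<Rightarrow> nat \<Rightarrow> real) \<times> (nat \<times> nat \<Rightarrow> real)) \<times> ((nat \<times> nat \<Rightarrow> nat \<Rightarrow> real) \<times> (nat \<times> nat \<Rightarrow> real)) \<Rightarrow> _"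
    where "zz = (\<lambda>(s, t). (zip_fun Src s, zip_fun Tgt t))"
  have D: "D = distr ((SX \<Otimes>\<^sub>M SZ) \<Otimes>\<^sub>M (TX \<Otimes>\<^sub>M TZ)) D zz"
  proof -
    have "sigma_finite_measure (distr (TX \<Otimes>\<^sub>M TZ) (PiM Tgt PG) (zip_fun Tgt))"
      unfolding zT by (intro prob_space_imp_sigma_finite prob_space_PiM pPG)
    from pair_measure_distr[OF mzS mzT this] show ?thesis unfolding zS zT zz_def D_def .
  qed
  have mzz: "zz \<in> measurable ((SX \<Otimes>\<^sub>M SZ) \<Otimes>\<^sub>M (TX \<Otimes>\<^sub>M TZ)) D"
    unfolding zz_def D_def split_beta
    by (intro measurable_Pair measurable_compose[OF measurable_fst mzS] measurable_compose[OF measurable_snd mzT])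
  have M: "M = distr D M (merge Src Tgt)"
    unfolding M_def D_def by (rule PG.distr_merge[symmetric, OF sample_idx_eq(2) finite_idx])
  have mm: "merge Src Tgt \<in> measurable D M" unfolding D_def M_def by (rule measurable_merge)
  have inv: "split_sample (merge Src Tgt (zz s)) = s" if "s \<in> space ((SX \<Otimes>\<^sub>M SZ) \<Otimes>\<^sub>M (TX \<Otimes>\<^sub>M TZ))" for s
  proof -
    obtain x z x' z' where s: "s = ((x, z), (x', z'))" by (metis surj_pair)
    have "x \<in> extensional Src" "z \<in> extensional Src" "x' \<in> extensional Tgt" "z' \<in> extensional Tgt"
      using that unfolding s SX_def SZ_def TX_def TZ_def by (auto simp: space_pair_measure space_PiM PiE_def)
    moreover have "merge Src Tgt (zz s) j = (x j, z j)" if "j \<in> Src" for j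
      using that by (simp add: s zz_def merge_def)
    moreover have "merge Src Tgt (zz s) j = (x' j, z' j)" if "j \<in> Tgt" for j
      using that sample_idx_eq(2) by (auto simp: s zz_def merge_def)
    ultimately show ?thesis unfolding s split_sample_def by (auto simp: fun_eq_iff extensional_def restrict_def)
  qed
  have "emeasure M (split_sample -` F \<inter> space M) = emeasure (distr D M (merge Src Tgt)) (split_sample -` F \<inter> space M)"
    using M by simp
  also have "\<dots> = emeasure D (merge Src Tgt -` (split_sample -` F \<inter> space M) \<inter> space D)"
    using A unfolding Meq by (rule emeasure_distr[OF mm])
  also have "\<dots> = emeasure (distr ((SX \<Otimes>\<^sub>M SZ) \<Otimes>\<^sub>M (TX \<Otimes>\<^sub>M TZ)) D zz) (merge Src Tgt -` (split_sample -` F \<inter> space M) \<inter> space D)"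
    using D by simp
  also have "\<dots> = emeasure ((SX \<Otimes>\<^sub>M SZ) \<Otimes>\<^sub>M (TX \<Otimes>\<^sub>M TZ))
      (zz -` (merge Src Tgt -` (split_sample -` F \<inter> space M) \<inter> space D) \<inter> space ((SX \<Otimes>\<^sub>M SZ) \<Otimes>\<^sub>M (TX \<Otimes>\<^sub>M TZ)))"
    using A unfolding Meq by (intro emeasure_distr[OF mzz] measurable_sets[OF mm])
  also have "zz -` (merge Src Tgt -` (split_sample -` F \<inter> space M) \<inter> space D) \<inter> space ((SX \<Otimes>\<^sub>M SZ) \<Otimes>\<^sub>M (TX \<Otimes>\<^sub>M TZ)) = F"
  proof -
    have sp: "zz s \<in> space D" "merge Src Tgt (zz s) \<in> space M" if "s \<in> space ((SX \<Otimes>\<^sub>M SZ) \<Otimes>\<^sub>M (TX \<Otimes>\<^sub>M TZ))" for s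
      using measurable_space[OF mzz that] measurable_space[OF mm] by auto
    show ?thesis
    proof (intro equalityI subsetI)
      fix s assume "s \<in> F"
      moreover from this have "s \<in> space ((SX \<Otimes>\<^sub>M SZ) \<Otimes>\<^sub>M (TX \<Otimes>\<^sub>M TZ))" using sets.sets_into_space[OF F] by blast
      ultimately show "s \<in> zz -` (merge Src Tgt -` (split_sample -` F \<inter> space M) \<inter> space D) \<inter> space ((SX \<Otimes>\<^sub>M SZ) \<Otimes>\<^sub>M (TX \<Otimes>\<^sub>M TZ))"
        using sp inv by simp
    next
      fix s assume s: "s \<in> zz -` (merge Src Tgt -` (split_sample -` F \<inter> space M) \<inter> space D) \<inter> space ((SX \<Otimes>\<^sub>M SZ) \<Otimes>\<^sub>M (TX \<Otimes>\<^sub>M TZ))"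
      then have "split_sample (merge Src Tgt (zz s)) \<in> F" by simp
      then show "s \<in> F" using inv s by simp
    qed
  qed
  finally show "emeasure (sample_space T n1 n2 p \<sigma>) (split_sample -` F \<inter> space (sample_space T n1 n2 p \<sigma>))
       = emeasure ((SX \<Otimes>\<^sub>M SZ) \<Otimes>\<^sub>M (TX \<Otimes>\<^sub>M TZ)) F" unfolding Meq .
qed

end

section \<open>The generalization bound\<close>

text \<open>Since \<open>sqrt 2 \<le> exp 1\<close>, the power costs at most \<open>m\<close> in the
  exponent; the additional \<open>3\<close> buys \<open>exp 3 \<ge> 8\<close>.\<close>

lemma sqrt2_power_exp_le:
  fixes x L \<delta> :: real
  assumes "0 < \<delta>" "L = ln (1 / \<delta>)" "real m + 3 \<le> x"
  shows "sqrt 2 ^ m * exp (- (x + L)) \<le> \<delta> / 8"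
proof -
  have e2: "2 \<le> exp (1::real)" using exp_ge_add_one_self[of "1::real"] by simp
  have "(2::real) ^ 3 \<le> exp 1 ^ 3" by (intro power_mono e2) auto
  then have e8: "8 \<le> exp (3::real)" by (simp flip: exp_of_nat_mult)
  have "sqrt 2 \<le> exp (1::real)" using e2 sqrt_le_D[of 2 2] real_le_lsqrt[of 2 2] by (simp add: power2_eq_square)
  then have "sqrt 2 ^ m \<le> exp 1 ^ m" by (intro power_mono) auto
  then have "sqrt 2 ^ m \<le> exp (real m)" by (simp flip: exp_of_nat_mult)
  then have "sqrt 2 ^ m * exp (- (x + L)) \<le> exp (real m) * exp (- (x + L))" by (intro mult_right_mono) auto
  also have "\<dots> = exp (real m - x) * exp (- L)" by (simp flip: exp_add)
  also have "\<dots> \<le> exp (- 3) * exp (- L)" using assms(3) by (intro mult_right_mono) auto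
  also have "exp (- L) = \<delta>" using assms(1,2) by (simp add: ln_div)
  also have "exp (- 3) * \<delta> \<le> \<delta> / 8" using e8 assms(1) by (simp add: exp_minus field_simps)
  finally show ?thesis .
qed

text \<open>As \<open>30720000 = 100 * 307200\<close>, the exponent \<open>n / (307200 * r)\<close>
  is at least \<open>100 * (m + ln (T / \<delta>))\<close>. This pays for the net, up to
  \<open>54 * m\<close>, for the union over tasks and for a remaining \<open>exp 4 \<ge> 16\<close>.
  Sources use \<open>m = d\<close> and the number of tasks, the target \<open>m = k\<close> and
  \<open>T = 1\<close>, where \<open>54 k = 27 * (2 k)\<close>.\<close>

lemma covariance_failure_le:
  fixes r n \<delta> :: real
  assumes \<delta>: "0 < \<delta>" "\<delta> \<le> T" and r: "0 < r" and m: "1 \<le> m"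
    and n: "30720000 * r * (m + ln (T / \<delta>)) \<le> n" and l: "l \<le> 54 * m"
  shows "T * (exp l * (2 * exp (- (n / (307200 * r))))) \<le> \<delta> / 8"
proof -
  have T: "0 < T" using \<delta> by linarith
  have ln0: "0 \<le> ln (T / \<delta>)" using \<delta> by simp
  have e2: "2 \<le> exp (1::real)" using exp_ge_add_one_self[of "1::real"] by simp
  have "(2::real) ^ 4 \<le> exp 1 ^ 4" by (intro power_mono e2) auto
  then have e16: "16 \<le> exp (4::real)" by (simp flip: exp_of_nat_mult)
  define X where "X = n / (307200 * r)"
  define q where "q = ln (T / \<delta>)"
  have "100 * (m + q) * (307200 * r) \<le> n" using n by (simp add: q_def mult_ac)
  then have "100 * (m + q) \<le> X" using r unfolding X_def by (subst pos_le_divide_eq) auto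
  then have "100 * m + 100 * q \<le> X" by simp
  moreover have "0 \<le> q" using ln0 unfolding q_def .
  ultimately have "l - X \<le> - 4 - q" using l m by linarith
  then have "l - n / (307200 * r) \<le> - 4 - ln (T / \<delta>)" unfolding X_def q_def .
  then have "exp l * exp (- (n / (307200 * r))) \<le> exp (- 4) * exp (- ln (T / \<delta>))" by (simp flip: exp_add)
  also have "exp (- ln (T / \<delta>)) = \<delta> / T" using \<delta> T by (simp add: exp_minus)
  finally have "2 * T * (exp l * exp (- (n / (307200 * r)))) \<le> 2 * T * (exp (- 4) * (\<delta> / T))"
    using T by (intro mult_left_mono) auto
  then have "T * (exp l * (2 * exp (- (n / (307200 * r))))) \<le> T * (2 * (exp (- 4) * (\<delta> / T)))" by (simp add: mult_ac)
  also have "\<dots> = 2 * exp (- 4) * \<delta>" using T by simp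
  also have "\<dots> \<le> \<delta> / 8" using e16 \<delta> by (simp add: exp_minus field_simps)
  finally show ?thesis .
qed

text \<open>With \<open>y = \<kappa> * n\<close>, the choice of \<open>h\<close> gives
  \<open>(3 / h)^2 = 9 * (2 k d) * y\<close>. The bounds \<open>9 \<le> y\<close> and
  \<open>2 k d \<le> y^2\<close>, the latter from \<open>2 k \<le> d \<le> n\<close>, make this at
  most \<open>y^4\<close>.\<close>

lemma log_net_le:
  fixes \<kappa> n h :: real
  assumes \<kappa>: "1 \<le> \<kappa>" and kd: "1 \<le> k" "2 * k \<le> d" "d \<le> n" "9 \<le> n" and h: "0 < h" "h\<^sup>2 * (2 * k * d * (\<kappa> * n)) = 1"
  shows "ln (3 / h) \<le> 2 * ln (\<kappa> * n)" and "0 \<le> ln (\<kappa> * n)"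
proof -
  define y where "y = \<kappa> * n"
  have yn: "n \<le> y" using \<kappa> kd by (simp add: y_def mult_le_cancel_right1)
  then have y: "1 \<le> y" using kd by linarith
  show "0 \<le> ln (\<kappa> * n)" using y by (simp add: y_def)
  have "2 * k * d \<le> y * y" using kd yn by (intro mult_mono) auto
  then have "9 * (2 * k * d) \<le> y * (y * y)" using kd yn by (intro mult_mono) auto
  then have "9 * (2 * k * d) * y \<le> (y * (y * y)) * y" using y by (intro mult_right_mono) auto
  also have "\<dots> = y ^ 4" by (simp add: power4_eq_xxxx)
  finally have le: "9 * (2 * k * d * y) \<le> y ^ 4" by (simp add: mult.assoc)
  have "(3 / h)\<^sup>2 = 9 / h\<^sup>2 * (h\<^sup>2 * (2 * k * d * y))" using h(2) by (simp add: y_def power_divide)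
  also have "\<dots> = 9 * (2 * k * d * y)" using h(1) by simp
  finally have "(3 / h)\<^sup>2 \<le> (y\<^sup>2)\<^sup>2" using le by simp
  then have "3 / h \<le> y\<^sup>2" by (rule power2_le_imp_le) simp
  then have "ln (3 / h) \<le> ln (y\<^sup>2)" using h(1) y by (intro ln_mono) auto
  also have "\<dots> = 2 * ln y" using y by (simp add: ln_realpow)
  finally show "ln (3 / h) \<le> 2 * ln (\<kappa> * n)" by (simp add: y_def)
qed

text \<open>In \<open>50 * K3 + 12 * K4 / n1\<close> the terms in \<open>k d l\<close>,
  \<open>k T\<close>, \<open>T\<close> and \<open>L\<close> have coefficients \<open>800\<close>,
  \<open>1000\<close>, \<open>192\<close> and \<open>248\<close> times \<open>\<sigma>^2\<close>;
  with \<open>T \<le> k T\<close> they are all covered by \<open>1200\<close>. The target noise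
  contributes \<open>80\<close>.\<close>

lemma risk_constants:
  fixes k d T n1 n2 c \<sigma> l L a3 c0 C0 :: real
  assumes p: "1 \<le> k" "1 \<le> d" "1 \<le> T" "1 \<le> n1" "0 < n2" "0 < c" "0 \<le> l" "0 \<le> L" "0 < c0" "0 < C0"
    and n: "n2 \<le> c * n1" and a3: "a3 \<le> 4 * (k * d * l) + 5 * (k * T) + L"
  shows "2 * (C0 / (c0 * T) * ((50 * (4 * \<sigma>\<^sup>2 * a3) + 12 * (4 * \<sigma>\<^sup>2 * (4 * (T * n1) + L)) / n1) / n1 / c))
        + 5 * (4 * \<sigma>\<^sup>2 * (4 * k + L)) / n2
     \<le> (2400 * C0 / c0 + 80) * \<sigma>\<^sup>2 * (k * d * l / (c * n1 * T) + (k + L) / n2)"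
proof -
  define X where "X = k * d * l"
  define Y where "Y = k * T"
  have X0: "0 \<le> X" using p by (simp add: X_def)
  have TY: "T \<le> Y" using p by (simp add: Y_def mult_le_cancel_right1)
  have "L / n1 \<le> L / 1" using p by (intro divide_left_mono) auto
  then have 1: "12 * (4 * \<sigma>\<^sup>2 * (4 * (T * n1) + L)) / n1 \<le> 48 * \<sigma>\<^sup>2 * (4 * T + L)"
  proof -
    have "12 * (4 * \<sigma>\<^sup>2 * (4 * (T * n1) + L)) / n1 = 48 * \<sigma>\<^sup>2 * (4 * T + L / n1)"
      using p by (simp add: field_simps)
    also have "\<dots> \<le> 48 * \<sigma>\<^sup>2 * (4 * T + L)" using \<open>L / n1 \<le> L / 1\<close> by (intro mult_left_mono) auto
    finally show ?thesis .
  qed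
  have "50 * (4 * \<sigma>\<^sup>2 * a3) \<le> 50 * (4 * \<sigma>\<^sup>2 * (4 * X + 5 * Y + L))"
    using a3 by (intro mult_left_mono) (auto simp: X_def Y_def)
  then have "50 * (4 * \<sigma>\<^sup>2 * a3) + 12 * (4 * \<sigma>\<^sup>2 * (4 * (T * n1) + L)) / n1
      \<le> 50 * (4 * \<sigma>\<^sup>2 * (4 * X + 5 * Y + L)) + 48 * \<sigma>\<^sup>2 * (4 * T + L)" using 1 by linarith
  also have "\<dots> = \<sigma>\<^sup>2 * (800 * X + 1000 * Y + 192 * T + 248 * L)" by (simp add: algebra_simps)
  also have "\<dots> \<le> \<sigma>\<^sup>2 * (1200 * (X + Y + L))" using X0 TY p by (intro mult_left_mono) auto
  finally have 2: "50 * (4 * \<sigma>\<^sup>2 * a3) + 12 * (4 * \<sigma>\<^sup>2 * (4 * (T * n1) + L)) / n1 \<le> \<sigma>\<^sup>2 * (1200 * (X + Y + L))" .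
  define W where "W = (50 * (4 * \<sigma>\<^sup>2 * a3) + 12 * (4 * \<sigma>\<^sup>2 * (4 * (T * n1) + L)) / n1) / n1 / c"
  have W: "W \<le> \<sigma>\<^sup>2 * (1200 * (X + Y + L)) / n1 / c" unfolding W_def using 2 p by (intro divide_right_mono) auto
  have "2 * (C0 / (c0 * T) * W) \<le> 2 * (C0 / (c0 * T) * (\<sigma>\<^sup>2 * (1200 * (X + Y + L)) / n1 / c))"
    using W p by (intro mult_left_mono) auto
  also have "\<dots> = 2400 * C0 / c0 * \<sigma>\<^sup>2 * (X / (c * n1 * T) + (Y + L) / (c * n1 * T))"
    using p by (simp add: field_simps)
  \<comment> \<open>The only use of \<open>n2 \<le> c * n1\<close>: the \<open>k T\<close> degrees
    of freedom and \<open>L\<close>, divided by \<open>c * n1 * T\<close>, cost at most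
    \<open>(k + L) / n2\<close>.\<close>
  also have "\<dots> \<le> 2400 * C0 / c0 * \<sigma>\<^sup>2 * (X / (c * n1 * T) + (k + L) / n2)"
  proof (intro mult_left_mono add_left_mono)
    have "L \<le> L * T" using p by (simp add: mult_le_cancel_left1)
    then have "(Y + L) / (c * n1 * T) \<le> ((k + L) * T) / (c * n1 * T)"
      using p by (intro divide_right_mono) (auto simp: Y_def distrib_right)
    also have "\<dots> = (k + L) / (c * n1)" using p by simp
    also have "\<dots> \<le> (k + L) / n2" using p n by (intro divide_left_mono) auto
    finally show "(Y + L) / (c * n1 * T) \<le> (k + L) / n2" .
  qed (use p in auto)
  finally have 3: "2 * (C0 / (c0 * T) * W) \<le> 2400 * C0 / c0 * \<sigma>\<^sup>2 * (X / (c * n1 * T) + (k + L) / n2)" .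
  have "5 * (4 * \<sigma>\<^sup>2 * (4 * k + L)) / n2 \<le> 80 * \<sigma>\<^sup>2 * ((k + L) / n2)"
  proof -
    have "5 * (4 * \<sigma>\<^sup>2 * (4 * k + L)) = \<sigma>\<^sup>2 * (80 * k + 20 * L)" by (simp add: algebra_simps)
    also have "\<dots> \<le> \<sigma>\<^sup>2 * (80 * (k + L))" using p by (intro mult_left_mono) auto
    finally have "5 * (4 * \<sigma>\<^sup>2 * (4 * k + L)) / n2 \<le> \<sigma>\<^sup>2 * (80 * (k + L)) / n2" using p by (intro divide_right_mono) auto
    then show ?thesis by (simp add: mult_ac)
  qed
  moreover have "0 \<le> 80 * \<sigma>\<^sup>2 * (X / (c * n1 * T))" using X0 p by simp
  ultimately have "2 * (C0 / (c0 * T) * W) + 5 * (4 * \<sigma>\<^sup>2 * (4 * k + L)) / n2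
     \<le> 2400 * C0 / c0 * \<sigma>\<^sup>2 * (X / (c * n1 * T) + (k + L) / n2) + 80 * \<sigma>\<^sup>2 * (X / (c * n1 * T) + (k + L) / n2)"
    using 3 unfolding distrib_left[of "80 * \<sigma>\<^sup>2"] by linarith
  then show ?thesis unfolding W_def X_def by (simp add: distrib_right)
qed

context few_shot
begin

lemma generalization:
  fixes c c0 C0 \<delta> b :: real and \<nu> :: "(nat \<Rightarrow> real) measure"
  assumes \<delta>: "0 < \<delta>" "\<delta> < 1"
    and c: "0 < c" "\<And>t v. t < T \<Longrightarrow> c * qform d (Sigma T) v \<le> qform d (Sigma t) v"
    and c0: "0 < c0" "c0 * real T / real k \<le> (sing_val k T Ws k)\<^sup>2"
    and C0: "0 < C0" "spec_norm k k (second_moment \<nu>) \<le> C0 / real k"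
    and \<nu>: "prob_space \<nu>" "sets \<nu> = sets (vec_space k)" "AE w in \<nu>. vnorm k w \<le> b"
    and has_cov: "has_cov d (p T) (Sigma T)"
    and size: "30720000 * \<rho> ^ 4 * (real d + ln (real T / \<delta>)) \<le> real n1"
      "30720000 * \<rho> ^ 4 * (real k + ln (1 / \<delta>)) \<le> real n2" "real n2 \<le> c * real n1"
  shows "\<exists>A\<in>sets (sample_space T n1 n2 p \<sigma>). measure (sample_space T n1 n2 p \<sigma>) A \<ge> 1 - \<delta> \<and>
        (\<forall>\<omega>\<in>A. \<forall>Bh Wh.
           (\<forall>B W. source_loss d k T n1 Bs Ws \<omega> Bh Wh \<le> source_loss d k T n1 Bs Ws \<omega> B W) \<longrightarrow>
           (\<forall>wh :: (nat \<Rightarrow> real) \<Rightarrow> (nat \<Rightarrow> real).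
              (\<forall>wT w. target_loss d k T n2 Bs wT \<omega> Bh (wh wT) \<le> target_loss d k T n2 Bs wT \<omega> Bh w) \<longrightarrow>
              (\<integral>\<^sup>+wT. ennreal (excess_risk d (p T) (\<lambda>i. mv k Bh (wh wT) i - mv k Bs wT i)) \<partial>\<nu>)
                \<le> ennreal ((2400 * C0 / c0 + 80) * \<sigma>\<^sup>2 * (real k * real d * ln (LM / Lm * real n1) / (c * real n1 * real T)
                                       + (real k + ln (1 / \<delta>)) / real n2))))"
proof -
  define L where "L = ln (1 / \<delta>)"
  have L0: "0 \<le> L" using \<delta> by (simp add: L_def)
  define \<kappa> where "\<kappa> = LM / Lm"
  have \<kappa>: "1 \<le> \<kappa>" using pos(7,8) by (simp add: \<kappa>_def)
  have k1: "1 \<le> real k" "1 \<le> real T" "1 \<le> real n1" using pos by simp_all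
  have d1: "1 \<le> real d" "2 * real k \<le> real d" using kd pos(1) by linarith+
  have lnT: "0 \<le> ln (real T / \<delta>)" using \<delta> k1(2) by simp
  have n1: "real d \<le> real n1" "9 \<le> real n1"
  proof -
    have "30720000 * (1 / 4) * (real d + 0) \<le> 30720000 * \<rho> ^ 4 * (real d + ln (real T / \<delta>))"
      using rho_lower lnT d1 by (intro mult_mono add_mono) auto
    from this size(1) have "30720000 * (1 / 4) * (real d + 0) \<le> real n1" by (rule order_trans)
    then have le: "7680000 * real d \<le> real n1" by simp
    show "real d \<le> real n1" using le d1 by linarith
    show "9 \<le> real n1" using le d1 by linarith
  qed
  define Y where "Y = 2 * real k * real d * (\<kappa> * real n1)"
  have Y1: "1 \<le> Y"
  proof -
    have "1 * 1 \<le> \<kappa> * real n1" using \<kappa> k1 by (intro mult_mono) auto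
    moreover have "1 * 1 \<le> (2 * real k) * real d" using k1 d1 by (intro mult_mono) auto
    ultimately have "1 * 1 \<le> ((2 * real k) * real d) * (\<kappa> * real n1)" by (intro mult_mono) auto
    then show ?thesis by (simp add: Y_def)
  qed
  \<comment> \<open>The resolution at which rounding costs a fraction of order \<open>1 / n1\<close>
    of the prediction energy; \<open>Y \<ge> 1\<close> keeps it at most \<open>1\<close>, as the
    cube net requires.\<close>
  define h where "h = 1 / sqrt Y"
  have h: "0 < h" "h\<^sup>2 * Y = 1" "h \<le> 1" using Y1 by (auto simp: h_def power_divide)
  note ln_le = log_net_le[OF \<kappa> k1(1) d1(2) n1 h(1) h(2)[unfolded Y_def]]
  define l where "l = ln (\<kappa> * real n1)"
  have l: "0 \<le> l" "ln (3 / h) \<le> 2 * l" using ln_le by (simp_all add: l_def)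
  obtain N :: "(nat \<times> nat \<Rightarrow> real) set" where N: "finite N" "real (card N) \<le> (3 / h) ^ card ({..<d} \<times> {..<2 * k})"
     and net: "\<And>V. (\<forall>i\<in>{..<d} \<times> {..<2 * k}. \<bar>V i\<bar> \<le> 1) \<Longrightarrow> \<exists>V'\<in>N. \<forall>i\<in>{..<d} \<times> {..<2 * k}. \<bar>V i - V' i\<bar> \<le> h"
    using cube_net[OF h(1,3), of "{..<d} \<times> {..<2 * k}"] by auto
  define D where "D = exp (real (d * (2 * k)) * ln (3 / h))"
  have "(3 / h) ^ card ({..<d} \<times> {..<2 * k}) = D"
    using h(1) by (simp add: D_def card_cartesian_product exp_of_nat_mult del: of_nat_mult)
  then have ND: "real (card N) \<le> D" using N(2) by simp
  have D0: "0 \<le> D" by (simp add: D_def)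
  \<comment> \<open>Each threshold is \<open>4 \<sigma>^2\<close> times the exponent it must
    produce. The summand with \<open>ln (3 / h)\<close> cancels the cardinality bound
    \<open>D\<close>; the coefficients \<open>5\<close>, \<open>4\<close> and \<open>4\<close>
    exceed the dimension counts \<open>2 k T\<close>, \<open>T n1\<close> and \<open>k\<close> by at
    least \<open>3\<close>; and \<open>L\<close> contributes the factor
    \<open>\<delta>\<close>.\<close>
  define a3 where "a3 = real (d * (2 * k)) * ln (3 / h) + 5 * (real k * real T) + L"
  define K3 where "K3 = 4 * \<sigma>\<^sup>2 * a3"
  define K4 where "K4 = 4 * \<sigma>\<^sup>2 * (4 * (real T * real n1) + L)"
  define K5 where "K5 = 4 * \<sigma>\<^sup>2 * (4 * real k + L)"
  have ln3: "0 \<le> ln (3 / h)" using h by simp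
  have K: "0 \<le> K3" "0 \<le> K4" "0 \<le> K5" using L0 ln3 by (simp_all add: K3_def K4_def K5_def a3_def)
  have \<sigma>2: "4 * \<sigma>\<^sup>2 * a / (4 * \<sigma>\<^sup>2) = a" for a using pos(5) by simp
  have \<rho>4: "0 < \<rho> ^ 4" using pos(6) by simp
  define \<epsilon>1 where "\<epsilon>1 = real T * (exp (27 * real d) * (2 * exp (- (real n1 / (307200 * \<rho> ^ 4)))))
            + D * (sqrt 2 ^ (T * (2 * k)) * exp (- (K3 / (4 * \<sigma>\<^sup>2))))
            + sqrt 2 ^ (T * n1) * exp (- (K4 / (4 * \<sigma>\<^sup>2)))"
  define \<epsilon>2 where "\<epsilon>2 = exp (27 * real (2 * k)) * (2 * exp (- (real n2 / (307200 * \<rho> ^ 4)))) + sqrt 2 ^ k * exp (- (K5 / (4 * \<sigma>\<^sup>2)))"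
  have \<epsilon>0: "0 \<le> \<epsilon>1" "0 \<le> \<epsilon>2" using D0 by (simp_all add: \<epsilon>1_def \<epsilon>2_def)
  have e1: "real T * (exp (27 * real d) * (2 * exp (- (real n1 / (307200 * \<rho> ^ 4))))) \<le> \<delta> / 8"
    by (rule covariance_failure_le[OF \<delta>(1) _ \<rho>4 d1(1) size(1)]) (use \<delta> k1 d1 in auto)
  have e2: "D * (sqrt 2 ^ (T * (2 * k)) * exp (- (K3 / (4 * \<sigma>\<^sup>2)))) \<le> \<delta> / 8"
  proof -
    have kT1: "1 \<le> real k * real T" using k1 mult_mono[of 1 "real k" 1 "real T"] by simp
    have "exp (- (K3 / (4 * \<sigma>\<^sup>2))) = exp (- (real (d * (2 * k)) * ln (3 / h))) * exp (- (5 * (real k * real T) + L))"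
      unfolding K3_def \<sigma>2 a3_def by (simp flip: exp_add)
    then have "D * (sqrt 2 ^ (T * (2 * k)) * exp (- (K3 / (4 * \<sigma>\<^sup>2)))) = sqrt 2 ^ (T * (2 * k)) * exp (- (5 * (real k * real T) + L))"
      by (simp add: D_def exp_minus)
    also have "\<dots> \<le> \<delta> / 8"
      by (rule sqrt2_power_exp_le[OF \<delta>(1) L_def]) (use kT1 in \<open>simp add: mult.commute\<close>)
    finally show ?thesis .
  qed
  have e3: "sqrt 2 ^ (T * n1) * exp (- (K4 / (4 * \<sigma>\<^sup>2))) \<le> \<delta> / 8"
    unfolding K4_def \<sigma>2
  proof (rule sqrt2_power_exp_le[OF \<delta>(1) L_def])
    have "1 \<le> real T * real n1" using k1 mult_mono[of 1 "real T" 1 "real n1"] by simp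
    then show "real (T * n1) + 3 \<le> 4 * (real T * real n1)" by simp
  qed
  have e4: "exp (27 * real (2 * k)) * (2 * exp (- (real n2 / (307200 * \<rho> ^ 4)))) \<le> \<delta> / 8"
    using covariance_failure_le[of \<delta> 1 "\<rho> ^ 4" "real k" "real n2" "27 * real (2 * k)"] \<delta> \<rho>4 k1(1) size(2) by simp
  have e5: "sqrt 2 ^ k * exp (- (K5 / (4 * \<sigma>\<^sup>2))) \<le> \<delta> / 8"
    unfolding K5_def \<sigma>2 by (rule sqrt2_power_exp_le[OF \<delta>(1) L_def]) (use k1 in simp)
  \<comment> \<open>Five failure events of probability at most \<open>\<delta> / 8\<close> each; the
    almost sure events add nothing.\<close>
  have \<epsilon>: "\<epsilon>1 + \<epsilon>2 \<le> \<delta>" unfolding \<epsilon>1_def \<epsilon>2_def using e1 e2 e3 e4 e5 \<delta> by linarith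
  obtain G where G: "G \<in> sets (SX \<Otimes>\<^sub>M SZ)" "emeasure (SX \<Otimes>\<^sub>M SZ) (space (SX \<Otimes>\<^sub>M SZ) - G) \<le> ennreal \<epsilon>1"
    "\<And>x z. (x, z) \<in> G \<Longrightarrow> source_good K3 K4 N x z"
    using source_event[OF K(1,2) N(1) ND D0] unfolding \<epsilon>1_def by blast
  let ?M = "(SX \<Otimes>\<^sub>M SZ) \<Otimes>\<^sub>M (TX \<Otimes>\<^sub>M TZ)"
  have "\<exists>F\<in>sets ?M. emeasure ?M (space ?M - F) \<le> ennreal (\<epsilon>1 + \<epsilon>2)
     \<and> (\<forall>x z x' z'. ((x, z), (x', z')) \<in> F \<longrightarrow> source_good K3 K4 N x z \<and> (\<forall>q. optimal x z q \<longrightarrow> tgt_good K5 (fst q) x' z'))"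
    by (rule joint_event[OF G(1,2) _ target_event[OF K(3), folded \<epsilon>2_def] \<epsilon>0]) (rule G(3))
  then obtain F where F: "F \<in> sets ?M" "emeasure ?M (space ?M - F) \<le> ennreal (\<epsilon>1 + \<epsilon>2)"
    and FG: "\<forall>x z x' z'. ((x, z), (x', z')) \<in> F \<longrightarrow> source_good K3 K4 N x z \<and> (\<forall>q. optimal x z q \<longrightarrow> tgt_good K5 (fst q) x' z')"
    by (elim bexE conjE)
  let ?S = "sample_space T n1 n2 p \<sigma>"
  define A where "A = split_sample -` F \<inter> space ?S"
  have A: "A \<in> sets ?S" "emeasure ?S A = emeasure ?M F" unfolding A_def by (rule split_sample_transfer[OF F(1)])+
  have pM: "prob_space ?M" by (intro prob_space_pair prob_spaces)
  interpret M: prob_space ?M by (rule pM)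
  have "ennreal (measure ?M (space ?M - F)) \<le> ennreal \<delta>"
    using F(2) \<epsilon> by (simp add: M.emeasure_eq_measure) (meson ennreal_leI order_trans)
  then have "measure ?M (space ?M - F) \<le> \<delta>" using \<delta> by (simp add: ennreal_le_iff)
  then have "1 - \<delta> \<le> measure ?M F" using M.prob_compl[OF F(1)] by linarith
  then have PA: "1 - \<delta> \<le> measure ?S A" using A(2) by (simp add: measure_def)
  have main: "(\<integral>\<^sup>+wT. ennreal (excess_risk d (p T) (\<lambda>i. mv k Bh (wh wT) i - mv k Bs wT i)) \<partial>\<nu>)
                \<le> ennreal ((2400 * C0 / c0 + 80) * \<sigma>\<^sup>2 * (real k * real d * l / (c * real n1 * real T) + (real k + L) / real n2))"
    if \<omega>: "\<omega> \<in> A" and src: "\<forall>B W. source_loss d k T n1 Bs Ws \<omega> Bh Wh \<le> source_loss d k T n1 Bs Ws \<omega> B W"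
      and tgt: "\<forall>wT w. target_loss d k T n2 Bs wT \<omega> Bh (wh wT) \<le> target_loss d k T n2 Bs wT \<omega> Bh w"
    for \<omega> Bh Wh and wh :: "(nat \<Rightarrow> real) \<Rightarrow> (nat \<Rightarrow> real)"
  proof -
    define x z x' z' where "x = (\<lambda>j\<in>Src. fst (\<omega> j))" and "z = (\<lambda>j\<in>Src. snd (\<omega> j))"
      and "x' = (\<lambda>j\<in>Tgt. fst (\<omega> j))" and "z' = (\<lambda>j\<in>Tgt. snd (\<omega> j))"
    have "((x, z), (x', z')) \<in> F"
      using \<omega> by (simp add: A_def split_sample_def x_def z_def x'_def z'_def)
    then have good: "source_good K3 K4 N x z" and tg: "\<And>q. optimal x z q \<Longrightarrow> tgt_good K5 (fst q) x' z'"
      using FG by blast+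
    have loss: "source_loss d k T n1 Bs Ws \<omega> B W = 1 / (2 * real n1 * real T) * (\<Sum>j\<in>Src. (truth x j + z j - fit (B, W) x j)\<^sup>2)" for B W
      unfolding source_loss_def sumSrc
      by (intro arg_cong2[where f = "(*)"] refl sum.cong) (auto simp: resp_def truth_def fit_def x_def z_def Src_def)
    have opt: "optimal x z (Bh, Wh)" unfolding optimal_def
    proof
      fix q
      have "(\<Sum>j\<in>Src. (truth x j + z j - fit (Bh, Wh) x j)\<^sup>2) \<le> (\<Sum>j\<in>Src. (truth x j + z j - fit q x j)\<^sup>2)"
        using src[rule_format, of "fst q" "snd q"] k1 unfolding loss by (simp add: divide_le_cancel)
      then show "sgain x z q \<le> sgain x z (Bh, Wh)" unfolding sgain_def by (subst gain_le_iff[OF finite_idx(1)])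
    qed
    have wh: "(\<Sum>i<n2. (ip {..<d} (x' (T, i)) (mv k Bs w) + z' (T, i) - ip {..<d} (x' (T, i)) (mv k Bh (wh w)))\<^sup>2)
        \<le> (\<Sum>i<n2. (ip {..<d} (x' (T, i)) (mv k Bs w) + z' (T, i) - ip {..<d} (x' (T, i)) (mv k Bh u))\<^sup>2)" for w u
    proof -
      have "target_loss d k T n2 Bs w \<omega> Bh v = 1 / (2 * real n2)
          * (\<Sum>i<n2. (ip {..<d} (x' (T, i)) (mv k Bs w) + z' (T, i) - ip {..<d} (x' (T, i)) (mv k Bh v))\<^sup>2)" for v
        unfolding target_loss_def
        by (intro arg_cong2[where f = "(*)"] refl sum.cong) (auto simp: resp_def lin_ip x'_def z'_def Tgt_def)
      then show ?thesis using tgt[rule_format, of w u] pos(4) by (simp add: divide_le_cancel)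
    qed
    have "(\<integral>\<^sup>+w. ennreal (1 / 2 * qform d (Sigma T) (\<lambda>l. mv k Bh (wh w) l - mv k Bs w l)) \<partial>\<nu>)
     \<le> ennreal (2 * (C0 / (c0 * real T) * ((50 * K3 + 12 * K4 / real n1) / real n1 / c)) + 5 * K5 / real n2)"
      by (rule risk_bound[OF good K net h(1) _ opt _ c c0 C0 \<nu> wh])
         (use h(2) tg[OF opt] in \<open>auto simp: Y_def \<kappa>_def\<close>)
    also have "\<dots> \<le> ennreal ((2400 * C0 / c0 + 80) * \<sigma>\<^sup>2 * (real k * real d * l / (c * real n1 * real T) + (real k + L) / real n2))"
    proof (rule ennreal_leI)
      have "real (d * (2 * k)) * ln (3 / h) \<le> real (d * (2 * k)) * (2 * l)" using l by (intro mult_left_mono) auto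
      then have a3: "a3 \<le> 4 * (real k * real d * l) + 5 * (real k * real T) + L" by (simp add: a3_def mult_ac)
      show "2 * (C0 / (c0 * real T) * ((50 * K3 + 12 * K4 / real n1) / real n1 / c)) + 5 * K5 / real n2
        \<le> (2400 * C0 / c0 + 80) * \<sigma>\<^sup>2 * (real k * real d * l / (c * real n1 * real T) + (real k + L) / real n2)"
        unfolding K3_def K4_def K5_def
        using risk_constants[OF k1(1) d1(1) k1(2,3) _ c(1) l(1) L0 c0(1) C0(1) size(3) a3, of \<sigma>] pos(4) by simp
    qed
    finally show ?thesis unfolding excess_risk_eq[OF has_cov] .
  qed
  show ?thesis
  proof (intro bexI[of _ A] conjI ballI allI impI)
    show "A \<in> sets ?S" "1 - \<delta> \<le> measure ?S A" by (rule A(1), rule PA)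
  qed (rule main[unfolded l_def \<kappa>_def L_def])
qed

end

theorem mainTheorem1:
  fixes wlo whi c0 C0 :: real
  assumes "0 < wlo" and "wlo \<le> whi" and "0 < c0" and "0 < C0"
  shows "\<exists>Cn>0. \<exists>C>0. \<forall>(d::nat) (k::nat) (T::nat) (n1::nat) (n2::nat) (\<delta>::real) (\<rho>::real) (c::real) (\<sigma>::real)
      (pbar :: nat \<Rightarrow> (nat \<Rightarrow> real) measure) (p :: nat \<Rightarrow> (nat \<Rightarrow> real) measure)
      (Sigma :: nat \<Rightarrow> nat \<Rightarrow> nat \<Rightarrow> real) (Bs :: nat \<Rightarrow> nat \<Rightarrow> real) (Ws :: nat \<Rightarrow> nat \<Rightarrow> real)
      (\<nu> :: (nat \<Rightarrow> real) measure).
    0 < d \<and> 0 < k \<and> 0 < T \<and> 0 < n1 \<and> 0 < n2 \<and> 0 < \<delta> \<and> \<delta> < 1 \<and> 0 < \<sigma>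
    \<and> (\<forall>t\<le>T. prob_space (pbar t) \<and> sets (pbar t) = sets (vec_space d)
          \<and> mean_zero d (pbar t) \<and> has_cov d (pbar t) (\<lambda>i j. if i = j then 1 else 0)
          \<and> psd d (Sigma t)
          \<and> p t = distr (pbar t) (vec_space d) (\<lambda>x. restrict (mv d (msqrt d (Sigma t)) x) {..<d})
          \<and> mean_zero d (p t) \<and> has_cov d (p t) (Sigma t))
    \<and> (\<forall>t<T. pd d (Sigma t))
    \<and> (\<forall>t<T. wlo \<le> vnorm k (\<lambda>j. Ws j t) \<and> vnorm k (\<lambda>j. Ws j t) \<le> whi)
    \<comment> \<open>(A1)\<close>
    \<and> 0 < \<rho> \<and> (\<forall>t\<le>T. subgaussian d (pbar t) (\<rho>\<^sup>2))
    \<comment> \<open>(A2)\<close>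
    \<and> 0 < c \<and> (\<forall>t<T. loewner_ge d (Sigma t) (\<lambda>i j. c * Sigma T i j))
    \<comment> \<open>(A3)\<close>
    \<and> (sing_val k T Ws k)\<^sup>2 \<ge> c0 * real T / real k
    \<comment> \<open>(A4) and the norm bounds for the target parameter\<close>
    \<and> prob_space \<nu> \<and> sets \<nu> = sets (vec_space k)
    \<and> (AE w in \<nu>. wlo \<le> vnorm k w \<and> vnorm k w \<le> whi)
    \<and> spec_norm k k (second_moment \<nu>) \<le> C0 / real k
    \<comment> \<open>size conditions\<close>
    \<and> 2 * k \<le> min d T
    \<and> real n1 \<ge> Cn * \<rho> ^ 4 * (real d + ln (real T / \<delta>))
    \<and> real n2 \<ge> Cn * \<rho> ^ 4 * (real k + ln (1 / \<delta>))
    \<and> c * real n1 \<ge> real n2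
    \<longrightarrow>
    (let \<kappa> = Max ((\<lambda>t. lam_max d (Sigma t)) ` {..<T}) / Min ((\<lambda>t. lam_min d (Sigma t)) ` {..<T});
         M = sample_space T n1 n2 p \<sigma>
     in \<exists>A\<in>sets M. measure M A \<ge> 1 - \<delta> \<and>
        (\<forall>\<omega>\<in>A. \<forall>Bh Wh.
           (\<forall>B W. source_loss d k T n1 Bs Ws \<omega> Bh Wh \<le> source_loss d k T n1 Bs Ws \<omega> B W) \<longrightarrow>
           (\<forall>wh :: (nat \<Rightarrow> real) \<Rightarrow> (nat \<Rightarrow> real).
              (\<forall>wT w. target_loss d k T n2 Bs wT \<omega> Bh (wh wT) \<le> target_loss d k T n2 Bs wT \<omega> Bh w) \<longrightarrow>
              (\<integral>\<^sup>+wT. ennreal (excess_risk d (p T) (\<lambda>i. mv k Bh (wh wT) i - mv k Bs wT i)) \<partial>\<nu>)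
                \<le> ennreal (C * \<sigma>\<^sup>2 * (real k * real d * ln (\<kappa> * real n1) / (c * real n1 * real T)
                                       + (real k + ln (1 / \<delta>)) / real n2)))))"
proof -
  have body: "let \<kappa> = Max ((\<lambda>t. lam_max d (Sigma t)) ` {..<T}) / Min ((\<lambda>t. lam_min d (Sigma t)) ` {..<T});
         M = sample_space T n1 n2 p \<sigma>
     in \<exists>A\<in>sets M. measure M A \<ge> 1 - \<delta> \<and>
        (\<forall>\<omega>\<in>A. \<forall>Bh Wh.
           (\<forall>B W. source_loss d k T n1 Bs Ws \<omega> Bh Wh \<le> source_loss d k T n1 Bs Ws \<omega> B W) \<longrightarrow>
           (\<forall>wh :: (nat \<Rightarrow> real) \<Rightarrow> (nat \<Rightarrow> real).
              (\<forall>wT w. target_loss d k T n2 Bs wT \<omega> Bh (wh wT) \<le> target_loss d k T n2 Bs wT \<omega> Bh w) \<longrightarrow>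
              (\<integral>\<^sup>+wT. ennreal (excess_risk d (p T) (\<lambda>i. mv k Bh (wh wT) i - mv k Bs wT i)) \<partial>\<nu>)
                \<le> ennreal ((2400 * C0 / c0 + 80) * \<sigma>\<^sup>2 * (real k * real d * ln (\<kappa> * real n1) / (c * real n1 * real T)
                                       + (real k + ln (1 / \<delta>)) / real n2))))"
    if pos: "0 < d" "0 < k" "0 < T" "0 < n1" "0 < n2" "0 < \<delta>" "\<delta> < 1" "0 < \<sigma>"
      and dist: "\<forall>t\<le>T. prob_space (pbar t) \<and> sets (pbar t) = sets (vec_space d)
          \<and> mean_zero d (pbar t) \<and> has_cov d (pbar t) (\<lambda>i j. if i = j then 1 else 0)
          \<and> psd d (Sigma t)
          \<and> p t = distr (pbar t) (vec_space d) (\<lambda>x. restrict (mv d (msqrt d (Sigma t)) x) {..<d})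
          \<and> mean_zero d (p t) \<and> has_cov d (p t) (Sigma t)"
      and pd: "\<forall>t<T. pd d (Sigma t)"
      and \<rho>: "\<forall>t\<le>T. subgaussian d (pbar t) (\<rho>\<^sup>2)" "0 < \<rho>"
      and c: "0 < c" "\<forall>t<T. loewner_ge d (Sigma t) (\<lambda>i j. c * Sigma T i j)"
      and sv: "(sing_val k T Ws k)\<^sup>2 \<ge> c0 * real T / real k"
      and \<nu>: "prob_space \<nu>" "sets \<nu> = sets (vec_space k)" "AE w in \<nu>. wlo \<le> vnorm k w \<and> vnorm k w \<le> whi"
        "spec_norm k k (second_moment \<nu>) \<le> C0 / real k"
      and size: "2 * k \<le> min d T" "real n1 \<ge> 30720000 * \<rho> ^ 4 * (real d + ln (real T / \<delta>))"
        "real n2 \<ge> 30720000 * \<rho> ^ 4 * (real k + ln (1 / \<delta>))" "c * real n1 \<ge> real n2"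
    for d k T n1 n2 :: nat and \<delta> \<rho> c \<sigma> :: real and pbar p :: "nat \<Rightarrow> (nat \<Rightarrow> real) measure"
      and Sigma :: "nat \<Rightarrow> nat \<Rightarrow> nat \<Rightarrow> real" and Bs Ws :: "nat \<Rightarrow> nat \<Rightarrow> real" and \<nu> :: "(nat \<Rightarrow> real) measure"
  proof -
    define LM where "LM = Max ((\<lambda>t. lam_max d (Sigma t)) ` {..<T})"
    define Lm where "Lm = Min ((\<lambda>t. lam_min d (Sigma t)) ` {..<T})"
    note \<delta>01 = pos(6,7)
    have ne: "{..<T} \<noteq> {}" using pos(3) by auto
    have symm: "symm d (Sigma t)" if "t < T" for t using pd that by (simp add: pd_def)
    have upper: "qform d (Sigma t) v \<le> LM * (\<Sum>l<d. (v l)\<^sup>2)" if t: "t < T" for t v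
    proof -
      have "qform d (Sigma t) v \<le> lam_max d (Sigma t) * (\<Sum>l<d. (v l)\<^sup>2)"
        unfolding lam_max_def by (rule eig_list_Rayleigh(1)[OF symm[OF t] pos(1)])
      also have "\<dots> \<le> LM * (\<Sum>l<d. (v l)\<^sup>2)" unfolding LM_def using t by (intro mult_right_mono sum_nonneg) auto
      finally show ?thesis .
    qed
    have lower: "Lm * (\<Sum>l<d. (v l)\<^sup>2) \<le> qform d (Sigma t) v" if t: "t < T" for t v
    proof -
      have "Lm * (\<Sum>l<d. (v l)\<^sup>2) \<le> lam_min d (Sigma t) * (\<Sum>l<d. (v l)\<^sup>2)"
        unfolding Lm_def using t by (intro mult_right_mono sum_nonneg) auto
      also have "\<dots> \<le> qform d (Sigma t) v"
        unfolding lam_min_def by (rule eig_list_Rayleigh(2)[OF symm[OF t] pos(1)])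
      finally show ?thesis .
    qed
    have "Lm \<in> (\<lambda>t. lam_min d (Sigma t)) ` {..<T}" unfolding Lm_def using ne by (intro Min_in) auto
    then have Lm0: "0 < Lm" using lam_min_pos[OF _ pos(1)] pd by auto
    have LmM: "Lm \<le> LM"
    proof -
      \<comment> \<open>One unit vector, inserted in both spectral bounds of task \<open>0\<close>,
        compares the smallest with the largest eigenvalue.\<close>
      define e0 where "e0 l = (if l = 0 then 1 else 0 :: real)" for l :: nat
      have "(\<Sum>l<d. (e0 l)\<^sup>2) = 1" using pos(1) by (simp add: e0_def if_distrib[of "\<lambda>x. x\<^sup>2"] cong: if_cong)
      then show ?thesis using upper[OF pos(3), of e0] lower[OF pos(3), of e0] by simp
    qed
    have W: "whitened d \<rho> (pbar t) (p t) (Sigma t) (msqrt d (Sigma t))" if "t \<le> T" for t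
    proof -
      note dt = dist[rule_format, OF that]
      show ?thesis by (rule whitened.intro) (use dt \<rho>(1) that in blast)+
    qed
    interpret few_shot d k T n1 n2 \<rho> \<sigma> Lm LM p Sigma "\<lambda>t. msqrt d (Sigma t)" Bs Ws
    proof (rule few_shot.intro)
      show "2 * k \<le> d" "2 * k \<le> T" using size(1) by auto
      show "prob_space (p t)" if "t \<le> T" for t by (rule whitened.prob_p[OF W[OF that]])
      show "sets (p t) = sets (vec_space d)" if "t \<le> T" for t by (rule whitened.sets_p[OF W[OF that]])
      show "(\<integral>\<^sup>+x. ennreal (exp (\<Sum>l<d. v l * x l)) \<partial>p t) \<le> ennreal (exp (qform d (Sigma t) v * \<rho>\<^sup>2 / 2))"
        if "t \<le> T" for t v by (rule whitened.laplace[OF W[OF that]])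
      show "integrable (p t) (\<lambda>x. (\<Sum>l<d. v l * x l)\<^sup>2)" if "t \<le> T" for t v
        by (rule whitened.quadratic(1)[OF W[OF that]])
      show "(\<integral>x. (\<Sum>l<d. v l * x l)\<^sup>2 \<partial>p t) = qform d (Sigma t) v" if "t \<le> T" for t v
        by (rule whitened.quadratic(2)[OF W[OF that]])
      show "Sigma t i j = (\<Sum>l<d. msqrt d (Sigma t) i l * msqrt d (Sigma t) j l)"
        if "t \<le> T" "i < d" "j < d" for t i j by (rule whitened.cov_factor[OF W[OF that(1)] that(2,3)])
    qed (rule pos(2,3,4,5,8) \<rho>(2) Lm0 LmM upper lower | assumption)+
    have cq: "c * qform d (Sigma T) v \<le> qform d (Sigma t) v" if "t < T" for t v
    proof -
      have "0 \<le> (\<Sum>i<d. \<Sum>j<d. v i * (Sigma t i j - c * Sigma T i j) * v j)"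
        using c(2) that by (auto simp: loewner_ge_def psd_def)
      also have "\<dots> = qform d (Sigma t) v - c * qform d (Sigma T) v"
        by (simp add: qform_def sum_distrib_left sum_subtractf[symmetric] algebra_simps)
      finally show ?thesis by simp
    qed
    have bound: "AE w in \<nu>. vnorm k w \<le> whi" using \<nu>(3) by eventually_elim simp
    have cov: "has_cov d (p T) (Sigma T)" using dist by blast
    show ?thesis
      unfolding Let_def LM_def[symmetric] Lm_def[symmetric]
      by (rule generalization[OF \<delta>01 c(1) _ assms(3) sv assms(4) \<nu>(4) \<nu>(1) \<nu>(2) bound cov size(2,3,4)]) (rule cq)
  qed
  have C: "0 < 2400 * C0 / c0 + 80" using assms by (simp add: add_pos_pos)
  show ?thesis
    by (rule exI[of _ 30720000], rule conjI, simp, rule exI[of _ "2400 * C0 / c0 + 80"], rule conjI, rule C,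
        intro allI impI, elim conjE, rule body; assumption)
qed

end
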